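(* Let $d\ge2$ be an integer, $k\in\mathbb N_0$, and $0\le s<r<k+\frac12$. There is a constant $C>0$ such that for every $n\ge2$, every $\Theta_n=\{\theta_{j,n}^*\}_{j=1}^n\subset\mathbb S^d$ with antipodal separation distance $\underline h>0$, and every $f_n\in L_n^k(\Theta_n)$, $$\|f_n\|_{\mathcal H^r(\mathbb S^d)}\le C\,\underline h^{-(r-s)}\|f_n\|_{\mathcal H^s(\mathbb S^d)} .$$ In particular, if $\{\Theta_n\}_{n\ge1}$ is an antipodally quasi-uniform sequence, then for all $n\ge 2$ and $f_n\in L_n^k(\Theta_n)$ $$\|f_n\|_{\mathcal H^r(\mathbb S^d)}\le C'\,n^{\frac{r-s}{d}}\|f_n\|_{\mathcal H^s(\mathbb S^d)},$$ where the constant is independent of $n$, $\Theta_n$ and $f_n$. Moreover, let $\beta\ge0$ and let $\mathfrak L_\beta$ be an elliptic spectral multiplier of order $\beta$ on $\mathbb S^d$ (see context). If $0\le s<r<k+\frac12-\beta$, then there is a constant $C''$, independent of $n$, $\Theta_n$, $v_n$, such that for every $n\ge2$, every $\Theta_n$ with $\underline h>0$, and every $v_n\in\mathfrak L_\beta L_n^k(\Theta_n)=\{\mathfrak L_\beta g:g\in L_n^k(\Theta_n)\}$, $$\|v_n\|_{\mathcal H^r(\mathbb S^d)}\le C''\,\underline h^{-(r-s)}\|v_n\|_{\mathcal H^s(\mathbb S^d)} .$$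
   Context: Notation. $\mathbb S^d=\{x\in\mathbb R^{d+1}:|x|=1\}$ carries the normalized rotation-invariant surface measure, and $\rho$ is the geodesic distance. $\Pi_m$ is the $\mathcal L^2(\mathbb S^d)$-orthogonal projection onto spherical harmonics of degree $m$; $\{Y_{m,\ell}\}_{\ell=1}^{N(m)}$ is an orthonormal basis of that space and $\widehat f(m,\ell)=\langle f,Y_{m,\ell}\rangle_{\mathcal L^2(\mathbb S^d)}$. $\|f\|_{\mathcal H^r}^2=\sum_{m,\ell}(1+m^{2r})\widehat f(m,\ell)^2$ for $r>0$, and $\mathcal H^0=\mathcal L^2$. Network space. $\sigma_k(t)=(\max\{0,t\})^k$ for $k\ge1$, and $\sigma_0$ is the Heaviside function ($1$ for $t>0$, $0$ for $t<0$). $L_n^k(\Theta_n)=\{g\in\mathcal L^2(\mathbb S^d):g(\eta)=\sum_{j=1}^n a_j\sigma_k(\theta_{j,n}^*\cdot\eta),\ a_j\in\mathbb R\}$. Geometry. $h_n=\max_{\eta\in\mathbb S^d}\min_j\rho(\eta,\theta_{j,n}^* )$; the antipodal separation distance is $\underline h=\underline h_n=\min\{\min_{i\ne j}\rho(\theta_{i,n}^*,\theta_{j,n}^* ),\min_{i\ne j}\rho(-\theta_{i,n}^*,\theta_{j,n}^* )\}$. A sequence $\{\Theta_n\}_{n\ge1}$, $\#\Theta_n=n$, is antipodally quasi-uniform if $h_n\le\kappa\underline h_n$ with $\kappa$ independent of $n$. Elliptic spectral multiplier of order $\beta\ge0$: $\mathfrak L_\beta v=\sum_{m\ge0}\ell_\beta(m)\Pi_m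 v$ for $v\in\mathcal H^\beta(\mathbb S^d)$, where for constants $0<c_{\mathfrak L}\le C_{\mathfrak L}<\infty$ one has $c_{\mathfrak L}(1+m)^\beta\le\ell_\beta(m)\le C_{\mathfrak L}(1+m)^\beta$ for all $m\ge0$, and $\ell_0(m)=1$ (so $\mathfrak L_0=I$). Constants may depend on $d,k,r,s$, on the quasi-uniformity constant in the second estimate, and on $\beta,c_{\mathfrak L},C_{\mathfrak L}$ in the third. *)

theory Defs
  imports "HOL-Analysis.Analysis"
begin

subsection \<open>The unit sphere and its normalized surface measure\<close>

text \<open>
  The normalized surface measure is realised as the cone measure: the image of the uniform
  distribution on the unit ball under the radial projection \<open>x \<mapsto> x / |x|\<close>. Its total mass and
  its rotation invariance, which characterise it, are proved below.
\<close>

definition sphere_measure :: "'a::euclidean_space measure" where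
  "sphere_measure =
     restrict_space (distr (uniform_measure lborel (ball 0 1)) borel sgn) (sphere 0 1)"

lemma space_sphere_measure [simp]: "space sphere_measure = sphere 0 1"
  by (simp add: sphere_measure_def space_restrict_space)

lemma sets_sphere_measure: "sets sphere_measure = sets (restrict_space borel (sphere 0 1))"
  by (simp add: sphere_measure_def sets_restrict_space)

lemma sgn_borel_measurable [measurable]: "(sgn :: 'a::euclidean_space \<Rightarrow> 'a) \<in> borel_measurable borel"
  unfolding sgn_div_norm[abs_def] by measurable

lemma emeasure_sphere_measure:
  fixes A :: "'a::euclidean_space set"
  assumes "A \<in> sets borel" "A \<subseteq> sphere 0 1"
  shows "emeasure sphere_measure A =
    emeasure lborel (ball 0 1 \<inter> sgn -` A) / emeasure lborel (ball 0 (1::real) :: 'a set)"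
proof -
  have "emeasure sphere_measure A
      = emeasure (distr (uniform_measure lborel (ball 0 1)) borel (sgn :: 'a \<Rightarrow> 'a)) A"
    unfolding sphere_measure_def using assms by (intro emeasure_restrict_space) auto
  also have "\<dots> = emeasure (uniform_measure lborel (ball 0 1)) (sgn -` A)"
    using assms by (subst emeasure_distr) auto
  also have "\<dots> = emeasure lborel (ball 0 1 \<inter> sgn -` A) / emeasure lborel (ball 0 (1::real) :: 'a set)"
    using assms measurable_sets[OF sgn_borel_measurable, of A]
    by (intro emeasure_uniform_measure) auto
  finally show ?thesis .
qed

lemma emeasure_sphere_measure_space:
  "emeasure (sphere_measure :: 'a::euclidean_space measure) (sphere 0 1) = 1"
proof -
  have eq: "ball 0 1 \<inter> sgn -` sphere 0 1 = (ball 0 1 - {0} :: 'a set)"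
    by (auto simp: norm_sgn split: if_splits)
  have "emeasure lborel (ball 0 1 - {0} :: 'a set) = emeasure lborel (ball 0 1 :: 'a set)"
    by (subst emeasure_Diff) auto
  moreover have "emeasure lborel (ball 0 1 :: 'a set) \<noteq> 0"
    using emeasure_lborel_ball_finite[of "0::'a" 1] content_ball_pos[of 1 "0::'a"]
    by (auto simp: measure_def)
  moreover have "emeasure lborel (ball 0 1 :: 'a set) \<noteq> \<infinity>"
    using emeasure_lborel_ball_finite[of "0::'a" 1] by auto
  ultimately show ?thesis
    by (simp add: emeasure_sphere_measure eq ennreal_divide_self top.not_eq_extremum)
qed

lemma lborel_orthogonal_invariant:
  fixes T :: "'a::euclidean_space \<Rightarrow> 'a"
  assumes T: "orthogonal_transformation T"
  shows "distr lborel borel T = lborel"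
proof (rule measure_eqI)
  let ?\<nu> = "distr lborel borel T"
  let ?B = "ball (0::'a) 1"
  have lin: "linear T" using T by (simp add: orthogonal_transformation_linear)
  have mT [measurable]: "T \<in> borel_measurable borel"
    using lin by (simp add: borel_measurable_continuous_onI linear_continuous_on linear_conv_bounded_linear)
  obtain T' where T': "\<And>x. T (T' x) = x"
    using orthogonal_transformation_surj[OF T] by (metis surjD)
  have nrm: "norm (T x) = norm x" for x
    using T by (simp add: orthogonal_transformation_norm)
  have shift: "(\<integral>\<^sup>+x. f x \<partial>lborel) = (\<integral>\<^sup>+x. f (x + a) \<partial>lborel)"
    if "f \<in> borel_measurable borel" for f :: "'a \<Rightarrow> ennreal" and a
    using that lborel_distr_plus[of a]
      nn_integral_distr[of "(+) a" "lborel :: 'a measure" borel f] by (simp add: add.commute)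
  have shiftT: "(\<integral>\<^sup>+x. f x \<partial>?\<nu>) = (\<integral>\<^sup>+x. f (x + a) \<partial>?\<nu>)"
    if [measurable]: "f \<in> borel_measurable borel" for f :: "'a \<Rightarrow> ennreal" and a
  proof -
    have "(\<integral>\<^sup>+x. f x \<partial>?\<nu>) = (\<integral>\<^sup>+x. f (T x) \<partial>lborel)"
      by (simp add: nn_integral_distr)
    also have "\<dots> = (\<integral>\<^sup>+x. f (T (x + T' a)) \<partial>lborel)"
      by (rule shift) measurable
    also have "\<dots> = (\<integral>\<^sup>+x. f (x + a) \<partial>?\<nu>)"
      by (simp add: nn_integral_distr linear_add[OF lin] T')
    finally show ?thesis .
  qed
  have fin: "emeasure lborel ?B \<noteq> \<infinity>" and pos: "emeasure lborel ?B \<noteq> 0"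
    using emeasure_lborel_ball_finite[of "0::'a" 1] content_ball_pos[of 1 "0::'a"]
    by (auto simp: measure_def)
  have "T -` cball 0 r = cball 0 r" for r
    by (auto simp: nrm)
  then have cb: "emeasure ?\<nu> (cball 0 r) = emeasure lborel (cball (0::'a) r)" for r
    by (simp add: emeasure_distr)
  interpret \<nu>: sigma_finite_measure ?\<nu>
  proof
    show "\<exists>A. countable A \<and> A \<subseteq> sets ?\<nu> \<and> \<Union> A = space ?\<nu> \<and> (\<forall>a\<in>A. emeasure ?\<nu> a \<noteq> \<infinity>)"
    proof (intro exI[of _ "range (\<lambda>n. cball 0 (real n))"] conjI ballI)
      show "\<Union> (range (\<lambda>n. cball (0::'a) (real n))) = space ?\<nu>"
        by (auto simp: real_arch_simple)
    qed (use emeasure_lborel_cball_finite[where 'a='a] in \<open>auto simp: cb less_top\<close>)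
  qed
  interpret P: pair_sigma_finite ?\<nu> "lborel :: 'a measure" ..
  show "sets ?\<nu> = sets lborel" by simp
  fix A assume "A \<in> sets ?\<nu>"
  then have [measurable]: "A \<in> sets borel" by simp
  have [measurable]: "?B \<in> sets borel" by simp
  have "T -` ?B = ?B" by (auto simp: nrm)
  then have \<nu>B: "emeasure ?\<nu> ?B = emeasure lborel ?B" by (simp add: emeasure_distr)
  have "emeasure ?\<nu> A * emeasure lborel ?B
      = (\<integral>\<^sup>+x. indicator A x * (\<integral>\<^sup>+y. indicator ?B y \<partial>lborel) \<partial>?\<nu>)"
    by (simp add: nn_integral_multc)
  also have "\<dots> = (\<integral>\<^sup>+x. (\<integral>\<^sup>+y. indicator A x * indicator ?B (y - x) \<partial>lborel) \<partial>?\<nu>)"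
  proof (intro nn_integral_cong)
    fix x :: 'a
    have "(\<integral>\<^sup>+y. indicator ?B y \<partial>lborel) = (\<integral>\<^sup>+y. indicator ?B (y + - x) \<partial>lborel)"
      by (rule shift) measurable
    then show "indicator A x * (\<integral>\<^sup>+y. indicator ?B y \<partial>lborel)
        = (\<integral>\<^sup>+y. indicator A x * indicator ?B (y - x) \<partial>lborel)"
      by (subst nn_integral_cmult) auto
  qed
  also have "\<dots> = (\<integral>\<^sup>+y. (\<integral>\<^sup>+x. indicator A x * indicator ?B (y - x) \<partial>?\<nu>) \<partial>lborel)"
    by (rule P.Fubini'[symmetric]) measurable
  also have "\<dots> = (\<integral>\<^sup>+y. (\<integral>\<^sup>+x. indicator A (x + y) * indicator ?B (y - (x + y)) \<partial>?\<nu>) \<partial>lborel)"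
    by (intro nn_integral_cong shiftT) measurable
  also have "\<dots> = (\<integral>\<^sup>+y. (\<integral>\<^sup>+x. indicator A (y + x) * indicator ?B x \<partial>?\<nu>) \<partial>lborel)"
    by (intro nn_integral_cong) (auto simp: indicator_def add.commute)
  also have "\<dots> = (\<integral>\<^sup>+x. (\<integral>\<^sup>+y. indicator A (y + x) * indicator ?B x \<partial>lborel) \<partial>?\<nu>)"
    by (rule P.Fubini') measurable
  also have "\<dots> = (\<integral>\<^sup>+x. emeasure lborel A * indicator ?B x \<partial>?\<nu>)"
  proof (intro nn_integral_cong)
    fix x :: 'a
    have "emeasure lborel A = (\<integral>\<^sup>+y. indicator A y \<partial>lborel)" by simp
    also have "\<dots> = (\<integral>\<^sup>+y. indicator A (y + x) \<partial>lborel)"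
      by (rule shift) measurable
    finally show "(\<integral>\<^sup>+y. indicator A (y + x) * indicator ?B x \<partial>lborel)
        = emeasure lborel A * indicator ?B x"
      by (subst nn_integral_multc) auto
  qed
  also have "\<dots> = emeasure lborel A * emeasure lborel ?B"
    by (subst nn_integral_cmult) (auto simp: \<nu>B)
  finally show "emeasure ?\<nu> A = emeasure lborel A"
    using fin pos by (metis ennreal_mult_divide_eq infinity_ennreal_def)
qed

lemma sphere_measure_rotation_invariant:
  fixes T :: "'a::euclidean_space \<Rightarrow> 'a"
  assumes T: "orthogonal_transformation T" and A: "A \<in> sets sphere_measure"
  shows "emeasure sphere_measure (T -` A) = emeasure sphere_measure A"
proof -
  have A': "A \<in> sets borel" "A \<subseteq> sphere 0 1"
    using A by (auto simp: sets_sphere_measure sets_restrict_space)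
  have lin: "linear T" using T by (simp add: orthogonal_transformation_linear)
  have mT: "T \<in> borel_measurable borel"
    using lin by (simp add: borel_measurable_continuous_onI linear_continuous_on linear_conv_bounded_linear)
  have nrm: "norm (T x) = norm x" for x
    using T by (simp add: orthogonal_transformation_norm)
  have sgnT: "sgn (T x) = T (sgn x)" for x
    by (simp add: sgn_div_norm nrm linear_cmul[OF lin])
  have TA: "T -` A \<in> sets borel" "T -` A \<subseteq> sphere 0 1"
    using A' measurable_sets[OF mT, of A] nrm by (auto simp: subset_iff)
  have B: "ball 0 1 \<inter> sgn -` A \<in> sets borel"
    using A' measurable_sets[OF sgn_borel_measurable, of A] by auto
  have "ball 0 1 \<inter> sgn -` T -` A = T -` (ball 0 1 \<inter> sgn -` A)"
    by (auto simp: nrm sgnT)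
  also have "emeasure lborel \<dots> = emeasure (distr lborel borel T) (ball 0 1 \<inter> sgn -` A)"
    using B mT by (simp add: emeasure_distr)
  also have "\<dots> = emeasure lborel (ball 0 1 \<inter> sgn -` A)"
    by (simp add: lborel_orthogonal_invariant[OF T])
  finally show ?thesis
    using emeasure_sphere_measure[OF A'] emeasure_sphere_measure[OF TA] by simp
qed

text \<open>
  Elements of \<open>L\<^sup>2\<close> are represented by functions on the ambient space of which only the values
  almost everywhere on the sphere matter.
\<close>

definition sphere_L2 :: "('a::euclidean_space \<Rightarrow> real) set" where
  "sphere_L2 = {f \<in> borel_measurable sphere_measure. integrable sphere_measure (\<lambda>x. (f x)\<^sup>2)}"

definition sphere_inner :: "('a::euclidean_space \<Rightarrow> real) \<Rightarrow> ('a \<Rightarrow> real) \<Rightarrow> real" where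
  "sphere_inner f g = (LINT x|sphere_measure. f x * g x)"

definition L2_norm :: "('a::euclidean_space \<Rightarrow> real) \<Rightarrow> real" where
  "L2_norm f = sqrt (sphere_inner f f)"


subsection \<open>Spherical harmonics\<close>

definition laplacian :: "('a::euclidean_space \<Rightarrow> real) \<Rightarrow> 'a \<Rightarrow> real" where
  "laplacian p x = (\<Sum>b\<in>Basis. (deriv ^^ 2) (\<lambda>t. p (x + t *\<^sub>R b)) 0)"

definition spherical_harmonics :: "nat \<Rightarrow> ('a::euclidean_space \<Rightarrow> real) set" where
  "spherical_harmonics m =
     {y. \<exists>p. real_polynomial_function p \<and> (\<forall>c x. p (c *\<^sub>R x) = c ^ m * p x) \<and>
             (\<forall>x. laplacian p x = 0) \<and> (\<forall>\<eta>\<in>sphere 0 1. y \<eta> = p \<eta>)}"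

text \<open>The orthogonal projection \<open>\<Pi>\<^sub>m f\<close>; its values on the sphere are uniquely determined.\<close>

definition harmonic_proj :: "nat \<Rightarrow> ('a::euclidean_space \<Rightarrow> real) \<Rightarrow> 'a \<Rightarrow> real" where
  "harmonic_proj m f =
     (SOME y. y \<in> spherical_harmonics m \<and>
              (\<forall>z\<in>spherical_harmonics m. sphere_inner (\<lambda>x. f x - y x) z = 0))"

definition harmonic_onb :: "(nat \<Rightarrow> nat \<Rightarrow> 'a::euclidean_space \<Rightarrow> real) \<Rightarrow> (nat \<Rightarrow> nat) \<Rightarrow> bool" where
  "harmonic_onb Y N \<longleftrightarrow>
     (\<forall>m. (\<forall>l\<in>{1..N m}. Y m l \<in> spherical_harmonics m) \<and>
          (\<forall>l\<in>{1..N m}. \<forall>l'\<in>{1..N m}. sphere_inner (Y m l) (Y m l') = (if l = l' then 1 else 0)) \<and>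
          (\<forall>y\<in>spherical_harmonics m. \<exists>c. \<forall>\<eta>\<in>sphere 0 1. y \<eta> = (\<Sum>l=1..N m. c l * Y m l \<eta>)))"


subsection \<open>Sobolev spaces\<close>

context
  fixes Y :: "nat \<Rightarrow> nat \<Rightarrow> 'a::euclidean_space \<Rightarrow> real" and N :: "nat \<Rightarrow> nat"
begin

definition sobolev_term :: "real \<Rightarrow> ('a \<Rightarrow> real) \<Rightarrow> nat \<Rightarrow> real" where
  "sobolev_term r f m = (\<Sum>l=1..N m. (1 + real m powr (2 * r)) * (sphere_inner f (Y m l))\<^sup>2)"

definition sobolev :: "real \<Rightarrow> ('a \<Rightarrow> real) set" where
  "sobolev r = (if r = 0 then sphere_L2 else {f \<in> sphere_L2. summable (sobolev_term r f)})"

definition sobolev_norm :: "real \<Rightarrow> ('a \<Rightarrow> real) \<Rightarrow> real" where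
  "sobolev_norm r f = (if r = 0 then L2_norm f else sqrt (\<Sum>m. sobolev_term r f m))"

end


subsection \<open>Networks\<close>

text \<open>The case distinction matters: \<open>(max 0 t) ^ 0 = 1\<close> for all \<open>t\<close>.\<close>

definition relu_pow :: "nat \<Rightarrow> real \<Rightarrow> real" where
  "relu_pow k t = (if k = 0 then (if t > 0 then 1 else 0) else (max 0 t) ^ k)"

text \<open>
  \<open>\<Theta>\<^sub>n\<close> is given by its enumeration \<open>\<theta> 1, \<dots>, \<theta> n\<close>. Equality almost everywhere makes the space
  independent of the value of the Heaviside function at \<open>0\<close>.
\<close>

definition network :: "nat \<Rightarrow> nat \<Rightarrow> (nat \<Rightarrow> 'a::euclidean_space) \<Rightarrow> ('a \<Rightarrow> real) set" where
  "network k n \<theta> =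
     {g \<in> sphere_L2. \<exists>a. AE \<eta> in sphere_measure. g \<eta> = (\<Sum>j=1..n. a j * relu_pow k (\<theta> j \<bullet> \<eta>))}"


subsection \<open>Geometry of the parameter sets\<close>

definition geod_dist :: "'a::euclidean_space \<Rightarrow> 'a \<Rightarrow> real" where
  "geod_dist x y = arccos (x \<bullet> y)"

definition mesh_norm :: "nat \<Rightarrow> (nat \<Rightarrow> 'a::euclidean_space) \<Rightarrow> real" where
  "mesh_norm n \<theta> = (SUP \<eta>\<in>sphere 0 1. Min ((\<lambda>j. geod_dist \<eta> (\<theta> j)) ` {1..n}))"

text \<open>Meaningful for \<open>n \<ge> 2\<close> only.\<close>

definition antipodal_sep :: "nat \<Rightarrow> (nat \<Rightarrow> 'a::euclidean_space) \<Rightarrow> real" where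
  "antipodal_sep n \<theta> =
     min (Min {geod_dist (\<theta> i) (\<theta> j) | i j. i \<in> {1..n} \<and> j \<in> {1..n} \<and> i \<noteq> j})
         (Min {geod_dist (- \<theta> i) (\<theta> j) | i j. i \<in> {1..n} \<and> j \<in> {1..n} \<and> i \<noteq> j})"

text \<open>
  For \<open>n = 1\<close> the separation distance is a minimum over the empty set, i.e. infinite, so that the
  inequality is required for \<open>n \<ge> 2\<close> only.
\<close>

definition antipodally_quasi_uniform ::
    "real \<Rightarrow> (nat \<Rightarrow> nat \<Rightarrow> 'a::euclidean_space) \<Rightarrow> bool" where
  "antipodally_quasi_uniform \<kappa> \<Theta> \<longleftrightarrow>
     (\<forall>n\<ge>1. \<Theta> n ` {1..n} \<subseteq> sphere 0 1 \<and> inj_on (\<Theta> n) {1..n}) \<and>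
     (\<forall>n\<ge>2. mesh_norm n (\<Theta> n) \<le> \<kappa> * antipodal_sep n (\<Theta> n))"


subsection \<open>Elliptic spectral multipliers\<close>

definition elliptic_symbol :: "real \<Rightarrow> real \<Rightarrow> real \<Rightarrow> (nat \<Rightarrow> real) \<Rightarrow> bool" where
  "elliptic_symbol \<beta> c C ell \<longleftrightarrow>
     (\<forall>m. c * (1 + real m) powr \<beta> \<le> ell m \<and> ell m \<le> C * (1 + real m) powr \<beta>) \<and>
     (\<beta> = 0 \<longrightarrow> (\<forall>m. ell m = 1))"

text \<open>
  \<open>is_multiplier_value ell g v\<close> says that the series \<open>\<Sum>m. ell m * \<Pi>\<^sub>m g\<close> converges in \<open>L\<^sup>2\<close>, with
  sum (represented by) \<open>v\<close>.
\<close>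

definition is_multiplier_value ::
    "(nat \<Rightarrow> real) \<Rightarrow> ('a::euclidean_space \<Rightarrow> real) \<Rightarrow> ('a \<Rightarrow> real) \<Rightarrow> bool" where
  "is_multiplier_value ell g v \<longleftrightarrow> v \<in> sphere_L2 \<and>
     (\<lambda>M. L2_norm (\<lambda>x. v x - (\<Sum>m<M. ell m * harmonic_proj m g x))) \<longlonglongrightarrow> 0"

definition multiplier_image ::
    "(nat \<Rightarrow> real) \<Rightarrow> ('a::euclidean_space \<Rightarrow> real) set \<Rightarrow> ('a \<Rightarrow> real) set" where
  "multiplier_image ell G = {v. \<exists>g\<in>G. is_multiplier_value ell g v}"

end

theory Submission
  imports Defs
begin

text \<open>
  Write \<open>N = d + 1\<close> for the ambient dimension and \<open>f = (\<Sum>j. a j * \<sigma>\<^sub>k (\<theta> j \<bullet> x))\<close>. By the Funk-Hecke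
  formula the coefficient of \<open>f\<close> at a spherical harmonic \<open>Y\<close> of degree \<open>m\<close> is
  \<open>\<lambda> m * (\<Sum>j. a j * Y (\<theta> j))\<close>, so the energy of \<open>f\<close> in degree \<open>m\<close> is \<open>(\<lambda> m)\<^sup>2 * Q m\<close>, where
  \<open>Q m = (\<Sum>l. (\<Sum>j. a j * Y m l (\<theta> j))\<^sup>2)\<close> no longer depends on the activation function. The
  inverse inequality is trivial for the part of \<open>f\<close> of degree at most \<open>M\<close>, where \<open>M\<close> is a large
  multiple of \<open>1 / h\<close>, because there \<open>m powr (2 * r) \<le> M powr (2 * (r - s)) * m powr (2 * s)\<close>. So it
  remains to dominate the degrees above \<open>M\<close> by those below, and this needs three facts.

  \<^item> The multipliers: \<open>\<bar>\<lambda> m\<bar>\<close> is at most a constant times \<open>m powr (- (k + N / 2))\<close> for large \<open>m\<close>, and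
    at least such a constant times it if \<open>m + k\<close> is odd and \<open>m > k\<close> (\<open>relu_coef_upper\<close>,
    \<open>relu_coef_lower\<close>). For even \<open>m + k\<close> and \<open>m > k\<close> the multiplier vanishes, and therefore the
    points \<open>- \<theta> j\<close> have to be separated from the points \<open>\<theta> i\<close> as well.
  \<^item> The upper estimate \<open>(\<Sum>m\<le>K. Q m) \<le> C * K ^ d * (\<Sum>j. (a j)\<^sup>2)\<close> for all \<open>K \<ge> M\<close> (\<open>energy_upper\<close>).
  \<^item> The lower estimate \<open>M ^ d * (\<Sum>j. (a j)\<^sup>2) \<le> C * (\<Sum>m. Q m)\<close>, the sum being over the degrees
    \<open>m\<close> in \<open>{k<..M}\<close> with \<open>m + k\<close> odd (\<open>energy_lower\<close>).

  A dyadic decomposition of the degrees above \<open>M\<close> then yields the result, since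
  \<open>2 * r < 2 * k + 1\<close> makes the dyadic sums geometric (\<open>inverse_inequality_sequences\<close>). A spectral
  multiplier only changes the exponent in the bounds for the multipliers by \<open>\<beta>\<close>.

  Both estimates for \<open>Q\<close> come from test functions \<open>(\<Sum>j. a j * G (\<theta> j \<bullet> x))\<close> whose profile \<open>G\<close> is
  supported in a cap so small that the summands have disjoint supports; then the norm of the test
  function is known exactly, and so are its coefficients, up to the Funk-Hecke multipliers \<open>\<mu> m\<close> of
  \<open>G\<close>. For the upper estimate Bessel's inequality suffices, together with a lower bound for \<open>\<mu> m\<close>
  that follows from a gradient bound for the reproducing kernel (\<open>zonal_kernel_near_diagonal\<close>). For
  the lower estimate Parseval's identity is applied to a symmetrised test function. Its high degrees
  are controlled by applying Bessel's inequality to its Laplacian; its degrees up to \<open>k\<close> are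
  negligible because the profile is itself a Laplacian.

  All integrations by parts, in particular the recursions for the multipliers \<open>\<lambda> m\<close>, rest on one
  divergence theorem on the sphere, which is obtained by differentiating the invariance of the
  measure under rotations (\<open>sphere_divergence\<close>).
\<close>

section \<open>Directional derivatives of polynomial functions\<close>

lemmas poly_const = real_polynomial_function.intros(2)
  and poly_add = real_polynomial_function.intros(3)
  and poly_mult = real_polynomial_function.intros(4)

lemmas poly_intros = poly_const poly_add poly_mult real_polynomial_function_diff
  real_polynomial_function_sum real_polynomial_function_power real_polynomial_function_minus

definition dir_deriv :: "'a::real_normed_vector \<Rightarrow> ('a \<Rightarrow> real) \<Rightarrow> 'a \<Rightarrow> real" where
  "dir_deriv v p x = frechet_derivative p (at x) v"

lemma dir_deriv_eqI: "(p has_derivative D) (at x) \<Longrightarrow> dir_deriv v p x = D v"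
  using frechet_derivative_at[of p D x] by (simp add: dir_deriv_def)

lemma polynomial_has_derivative_ex:
  fixes p :: "'a::euclidean_space \<Rightarrow> real"
  assumes "real_polynomial_function p"
  shows "\<exists>D. (\<forall>x. (p has_derivative D x) (at x)) \<and> (\<forall>v. real_polynomial_function (\<lambda>x. D x v))"
  using assms
proof (induction rule: real_polynomial_function.induct)
  case (linear f)
  then show ?case
    by (intro exI[of _ "\<lambda>x. f"]) (auto intro: bounded_linear_imp_has_derivative)
next
  case (const c)
  show ?case by (intro exI[of _ "\<lambda>x h. 0"]) auto
next
  case (add f g)
  then obtain D E where "\<forall>x. (f has_derivative D x) (at x)" "\<forall>v. real_polynomial_function (\<lambda>x. D x v)"
    "\<forall>x. (g has_derivative E x) (at x)" "\<forall>v. real_polynomial_function (\<lambda>x. E x v)" by blast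
  then show ?case
    by (intro exI[of _ "\<lambda>x h. D x h + E x h"]) (auto intro!: has_derivative_add poly_add)
next
  case (mult f g)
  then obtain D E where "\<forall>x. (f has_derivative D x) (at x)" "\<forall>v. real_polynomial_function (\<lambda>x. D x v)"
    "\<forall>x. (g has_derivative E x) (at x)" "\<forall>v. real_polynomial_function (\<lambda>x. E x v)" by blast
  then show ?case using mult.hyps
    by (intro exI[of _ "\<lambda>x h. f x * E x h + D x h * g x"]) (auto intro!: has_derivative_mult poly_add poly_mult)
qed

lemma dir_deriv_has_derivative:
  fixes p :: "'a::euclidean_space \<Rightarrow> real"
  assumes "real_polynomial_function p"
  shows "(p has_derivative (\<lambda>h. dir_deriv h p x)) (at x)"
proof -
  have "p differentiable (at x)"
    using polynomial_has_derivative_ex[OF assms] differentiableI by blast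
  then show ?thesis unfolding dir_deriv_def by (simp add: frechet_derivative_works)
qed

lemma dir_deriv_polynomial [intro]:
  fixes p :: "'a::euclidean_space \<Rightarrow> real"
  assumes "real_polynomial_function p"
  shows "real_polynomial_function (dir_deriv v p)"
proof -
  obtain D where D: "\<And>x. (p has_derivative D x) (at x)" "\<And>v. real_polynomial_function (\<lambda>x. D x v)"
    using polynomial_has_derivative_ex[OF assms] by blast
  have "dir_deriv v p = (\<lambda>x. D x v)" using dir_deriv_eqI[OF D(1)] by auto
  with D(2) show ?thesis by simp
qed

lemma dir_deriv_linear:
  fixes p :: "'a::euclidean_space \<Rightarrow> real"
  assumes "real_polynomial_function p"
  shows "linear (\<lambda>v. dir_deriv v p x)"
  using dir_deriv_has_derivative[OF assms, of x] has_derivative_linear by blast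

lemma dir_deriv_basis_sum:
  fixes p :: "'a::euclidean_space \<Rightarrow> real"
  assumes "real_polynomial_function p"
  shows "dir_deriv v p x = (\<Sum>b\<in>Basis. (v \<bullet> b) * dir_deriv b p x)"
proof -
  have "dir_deriv v p x = dir_deriv (\<Sum>b\<in>Basis. (v \<bullet> b) *\<^sub>R b) p x" by (simp add: euclidean_representation)
  also have "\<dots> = (\<Sum>b\<in>Basis. (v \<bullet> b) * dir_deriv b p x)"
    using linear_sum[OF dir_deriv_linear[OF assms, of x], of "\<lambda>b. (v \<bullet> b) *\<^sub>R b" Basis]
    by (simp add: linear_cmul[OF dir_deriv_linear[OF assms]] o_def)
  finally show ?thesis .
qed

lemma dir_deriv_const [simp]: "dir_deriv v (\<lambda>x. c) x = 0"
  by (rule dir_deriv_eqI) auto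

lemma dir_deriv_bounded_linear: "bounded_linear f \<Longrightarrow> dir_deriv v f x = f v"
  by (rule dir_deriv_eqI) (rule bounded_linear_imp_has_derivative)

context
  fixes p q :: "'a::euclidean_space \<Rightarrow> real"
  assumes p: "real_polynomial_function p" and q: "real_polynomial_function q"
begin

lemma dir_deriv_add: "dir_deriv v (\<lambda>x. p x + q x) x = dir_deriv v p x + dir_deriv v q x"
  by (rule dir_deriv_eqI[OF has_derivative_add[OF dir_deriv_has_derivative[OF p] dir_deriv_has_derivative[OF q]]])

lemma dir_deriv_diff: "dir_deriv v (\<lambda>x. p x - q x) x = dir_deriv v p x - dir_deriv v q x"
  by (rule dir_deriv_eqI[OF has_derivative_diff[OF dir_deriv_has_derivative[OF p] dir_deriv_has_derivative[OF q]]])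

lemma dir_deriv_mult: "dir_deriv v (\<lambda>x. p x * q x) x = p x * dir_deriv v q x + dir_deriv v p x * q x"
  by (rule dir_deriv_eqI[OF has_derivative_mult[OF dir_deriv_has_derivative[OF p] dir_deriv_has_derivative[OF q]]])

end

lemma dir_deriv_cmult:
  fixes p :: "'a::euclidean_space \<Rightarrow> real"
  assumes "real_polynomial_function p"
  shows "dir_deriv v (\<lambda>x. c * p x) x = c * dir_deriv v p x"
  using dir_deriv_mult[OF poly_const[of c] assms] by simp

lemma dir_deriv_sum:
  fixes p :: "'i \<Rightarrow> 'a::euclidean_space \<Rightarrow> real"
  assumes "\<And>i. i \<in> I \<Longrightarrow> real_polynomial_function (p i)"
  shows "dir_deriv v (\<lambda>x. \<Sum>i\<in>I. p i x) x = (\<Sum>i\<in>I. dir_deriv v (p i) x)"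
  by (rule dir_deriv_eqI) (intro has_derivative_sum dir_deriv_has_derivative assms)

lemma dir_deriv_inner [simp]: "dir_deriv v (\<lambda>x. x \<bullet> a) x = v \<bullet> a" "dir_deriv v (\<lambda>x. a \<bullet> x) x = a \<bullet> v"
  by (simp_all add: dir_deriv_bounded_linear bounded_linear_inner_left bounded_linear_inner_right)

lemma polynomial_inner [intro, simp]:
  "real_polynomial_function (\<lambda>x. x \<bullet> a)" "real_polynomial_function (\<lambda>x. a \<bullet> x)"
  by (auto simp: bounded_linear_inner_left bounded_linear_inner_right)

lemma polynomial_inner_self [intro, simp]:
  "real_polynomial_function (\<lambda>x::'a::euclidean_space. x \<bullet> x)"
  unfolding euclidean_inner[of x x for x] by (intro poly_intros) auto

lemma dir_deriv_inner_self [simp]: "dir_deriv v (\<lambda>x::'a::euclidean_space. x \<bullet> x) x = 2 * (v \<bullet> x)"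
  by (subst dir_deriv_eqI[where D="\<lambda>h. x \<bullet> h + h \<bullet> x"]) (auto intro!: derivative_eq_intros simp: inner_commute)

lemma dir_deriv_commute:
  fixes p :: "'a::euclidean_space \<Rightarrow> real"
  assumes "real_polynomial_function p"
  shows "dir_deriv u (dir_deriv v p) x = dir_deriv v (dir_deriv u p) x"
  using assms
proof (induction arbitrary: x rule: real_polynomial_function.induct)
  case (linear f)
  then have "dir_deriv w f = (\<lambda>x. f w)" for w by (auto simp: dir_deriv_bounded_linear)
  then show ?case by simp
next
  case (const c)
  have "dir_deriv w (\<lambda>x::'a. c) = (\<lambda>x. 0)" for w by auto
  then show ?case by simp
next
  case (add f g)
  then have "dir_deriv w (\<lambda>x. f x + g x) = (\<lambda>x. dir_deriv w f x + dir_deriv w g x)" for w by (auto simp: dir_deriv_add)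
  with add show ?case by (simp add: dir_deriv_add dir_deriv_polynomial)
next
  case (mult f g)
  then have *: "dir_deriv w (\<lambda>x. f x * g x) = (\<lambda>x. f x * dir_deriv w g x + dir_deriv w f x * g x)" for w by (auto simp: dir_deriv_mult)
  have **: "dir_deriv u (\<lambda>x. f x * dir_deriv v g x + dir_deriv v f x * g x) x
     = (f x * dir_deriv u (dir_deriv v g) x + dir_deriv u f x * dir_deriv v g x) + (dir_deriv v f x * dir_deriv u g x + dir_deriv u (dir_deriv v f) x * g x)" for u v
    using mult by (subst dir_deriv_add) (auto simp: dir_deriv_mult dir_deriv_polynomial poly_mult)
  show ?case unfolding * ** using mult.IH by simp
qed

lemma deriv_line:
  fixes p :: "'a::euclidean_space \<Rightarrow> real"
  assumes "real_polynomial_function p"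
  shows "((\<lambda>t. p (x + t *\<^sub>R v)) has_real_derivative dir_deriv v p (x + t *\<^sub>R v)) (at t)"
proof -
  have "((\<lambda>t. x + t *\<^sub>R v) has_derivative (\<lambda>h. h *\<^sub>R v)) (at t)"
    by (auto intro!: derivative_eq_intros)
  then have "((\<lambda>t. p (x + t *\<^sub>R v)) has_derivative (\<lambda>h. dir_deriv (h *\<^sub>R v) p (x + t *\<^sub>R v))) (at t)"
    by (rule has_derivative_compose[OF _ dir_deriv_has_derivative[OF assms]])
  then show ?thesis
    by (simp add: has_field_derivative_def linear_cmul[OF dir_deriv_linear[OF assms]] mult.commute[of _ "dir_deriv v p (x + t *\<^sub>R v)"])
qed

lemma laplacian_eq:
  fixes p :: "'a::euclidean_space \<Rightarrow> real"
  assumes "real_polynomial_function p"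
  shows "laplacian p x = (\<Sum>b\<in>Basis. dir_deriv b (dir_deriv b p) x)"
proof -
  have 1: "deriv (\<lambda>t. p (x + t *\<^sub>R b)) = (\<lambda>t. dir_deriv b p (x + t *\<^sub>R b))" for b
    using deriv_line[OF assms] by (intro ext DERIV_imp_deriv)
  have 2: "deriv (\<lambda>t. dir_deriv b p (x + t *\<^sub>R b)) 0 = dir_deriv b (dir_deriv b p) x" for b
    using deriv_line[OF dir_deriv_polynomial[OF assms], where x=x and v=b and t=0] by (intro DERIV_imp_deriv) simp
  show ?thesis unfolding laplacian_def by (simp add: numeral_2_eq_2 1 2)
qed

section \<open>Homogeneous harmonic polynomials\<close>

text \<open>
  The homogeneous harmonic polynomials, whose restrictions to the unit sphere are the spherical
  harmonics. Working with the polynomials on the whole space gives access to their derivatives.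
\<close>

definition solid_harmonics :: "nat \<Rightarrow> ('a::euclidean_space \<Rightarrow> real) set" where
  "solid_harmonics m = {p. real_polynomial_function p \<and> (\<forall>c x. p (c *\<^sub>R x) = c ^ m * p x) \<and>
     (\<forall>x. (\<Sum>b\<in>Basis. dir_deriv b (dir_deriv b p) x) = 0)}"

lemma solid_harmonicsD:
  assumes "p \<in> solid_harmonics m"
  shows "real_polynomial_function p" "p (c *\<^sub>R x) = c ^ m * p x" "(\<Sum>b\<in>Basis. dir_deriv b (dir_deriv b p) x) = 0"
  using assms by (auto simp: solid_harmonics_def)

lemma spherical_harmonics_iff:
  "y \<in> spherical_harmonics m \<longleftrightarrow> (\<exists>p\<in>solid_harmonics m. \<forall>\<eta>\<in>sphere 0 1. y \<eta> = p \<eta>)"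
proof -
  have "(real_polynomial_function p \<and> (\<forall>c x. p (c *\<^sub>R x) = c ^ m * p x) \<and>
      (\<forall>x. laplacian p x = 0) \<and> (\<forall>\<eta>\<in>sphere 0 1. y \<eta> = p \<eta>))
    \<longleftrightarrow> p \<in> solid_harmonics m \<and> (\<forall>\<eta>\<in>sphere 0 1. y \<eta> = p \<eta>)" for p :: "'a \<Rightarrow> real"
  proof (cases "real_polynomial_function p")
    case True
    show ?thesis by (simp only: solid_harmonics_def laplacian_eq[OF True] mem_Collect_eq conj_assoc)
  next
    case False
    then show ?thesis unfolding solid_harmonics_def by blast
  qed
  then show ?thesis by (simp only: spherical_harmonics_def Bex_def mem_Collect_eq)
qed

text \<open>
  Differentiating the homogeneity relation gives a factor \<open>c\<close> too much, which can be cancelled unless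
  \<open>c = 0\<close>; that case follows by continuity.
\<close>

lemma dir_deriv_homogeneous:
  fixes p :: "'a::euclidean_space \<Rightarrow> real"
  assumes p: "real_polynomial_function p" and hom: "\<And>c x. p (c *\<^sub>R x) = c ^ m * p x"
  shows "dir_deriv v p (c *\<^sub>R x) = c ^ (m - 1) * dir_deriv v p x"
proof (cases "m = 0")
  case True
  then have "p x = p 0" for x using hom[of 0 x] by simp
  then have "p = (\<lambda>x. p 0)" by auto
  then have "dir_deriv v p y = 0" for y by (metis dir_deriv_const)
  then show ?thesis by simp
next
  case m: False
  have nz: "dir_deriv v p (c *\<^sub>R x) = c ^ (m - 1) * dir_deriv v p x" if "c \<noteq> 0" for c x
  proof -
    have eq: "p (c *\<^sub>R x + t *\<^sub>R (c *\<^sub>R v)) = c ^ m * p (x + t *\<^sub>R v)" for t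
      using hom[of c "x + t *\<^sub>R v"] by (simp add: algebra_simps)
    have "((\<lambda>t. c ^ m * p (x + t *\<^sub>R v)) has_real_derivative dir_deriv (c *\<^sub>R v) p (c *\<^sub>R x)) (at 0)"
      using deriv_line[OF p, of "c *\<^sub>R x" "c *\<^sub>R v" 0] by (simp only: eq) simp
    moreover have "((\<lambda>t. c ^ m * p (x + t *\<^sub>R v)) has_real_derivative c ^ m * dir_deriv v p x) (at 0)"
      using deriv_line[OF p, of x v 0] by (auto intro!: DERIV_cmult)
    ultimately have "dir_deriv (c *\<^sub>R v) p (c *\<^sub>R x) = c ^ m * dir_deriv v p x" by (rule DERIV_unique)
    then have "c * dir_deriv v p (c *\<^sub>R x) = c * (c ^ (m - 1) * dir_deriv v p x)"
      using m by (cases m) (simp_all add: linear_cmul[OF dir_deriv_linear[OF p]])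
    then show ?thesis using that by simp
  qed
  show ?thesis
  proof (cases "c = 0")
    case True
    have cont: "continuous_on UNIV (dir_deriv v p)"
      by (intro continuous_on_polymonial_function) (use dir_deriv_polynomial[OF p] real_polynomial_function_eq in blast)
    have "((\<lambda>c. dir_deriv v p (c *\<^sub>R x)) \<longlongrightarrow> dir_deriv v p (0 *\<^sub>R x)) (at (0::real))"
      by (rule isCont_tendsto_compose[of _ "dir_deriv v p"])
        (use cont in \<open>auto intro!: tendsto_eq_intros simp: continuous_on_eq_continuous_at\<close>)
    moreover have "((\<lambda>c. c ^ (m - 1) * dir_deriv v p x) \<longlongrightarrow> 0 ^ (m - 1) * dir_deriv v p x) (at (0::real))"
      by (auto intro!: tendsto_intros)
    moreover have "\<forall>\<^sub>F c in at (0::real). dir_deriv v p (c *\<^sub>R x) = c ^ (m - 1) * dir_deriv v p x"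
      using nz by (auto simp: eventually_at_filter)
    ultimately have "dir_deriv v p (0 *\<^sub>R x) = 0 ^ (m - 1) * dir_deriv v p x"
      by (intro tendsto_unique[OF trivial_limit_at]) (auto simp: tendsto_cong)
    with True show ?thesis by simp
  qed (use nz in auto)
qed

lemma euler_homogeneous:
  fixes p :: "'a::euclidean_space \<Rightarrow> real"
  assumes p: "real_polynomial_function p" and hom: "\<And>c x. p (c *\<^sub>R x) = c ^ m * p x"
  shows "dir_deriv x p x = real m * p x"
proof -
  have eq: "p (x + t *\<^sub>R x) = (1 + t) ^ m * p x" for t
    using hom[of "1 + t" x] by (simp add: algebra_simps)
  have "((\<lambda>t. (1 + t) ^ m * p x) has_real_derivative dir_deriv x p x) (at 0)"
    using deriv_line[OF p, of x x 0] by (simp only: eq) simp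
  moreover have "((\<lambda>t. (1 + t) ^ m * p x) has_real_derivative real m * p x) (at 0)"
    by (auto intro!: derivative_eq_intros)
  ultimately show ?thesis by (rule DERIV_unique)
qed

lemma solid_harmonics_euler: "p \<in> solid_harmonics m \<Longrightarrow> dir_deriv x p x = real m * p x"
  by (intro euler_homogeneous) (auto simp: solid_harmonics_def)

lemma solid_harmonics_pd:
  assumes "p \<in> solid_harmonics m"
  shows "dir_deriv v p \<in> solid_harmonics (m - 1)"
proof -
  note p = solid_harmonicsD[OF assms]
  have e: "dir_deriv b (dir_deriv v p) = dir_deriv v (dir_deriv b p)" for b using dir_deriv_commute[OF p(1)] by blast
  have "(\<Sum>b\<in>Basis. dir_deriv b (dir_deriv b (dir_deriv v p)) x) = 0" for x
  proof -
    have "(\<Sum>b\<in>Basis. dir_deriv b (dir_deriv b (dir_deriv v p)) x) = (\<Sum>b\<in>Basis. dir_deriv v (dir_deriv b (dir_deriv b p)) x)"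
      unfolding e using dir_deriv_commute[OF dir_deriv_polynomial[OF p(1)]] by simp
    also have "\<dots> = dir_deriv v (\<lambda>x. \<Sum>b\<in>Basis. dir_deriv b (dir_deriv b p) x) x"
      using p(1) by (intro dir_deriv_sum[symmetric]) (auto intro!: dir_deriv_polynomial)
    finally show ?thesis by (simp add: p(3))
  qed
  then show ?thesis unfolding solid_harmonics_def using dir_deriv_polynomial p(1) dir_deriv_homogeneous p(2) by blast
qed

lemma solid_harmonics_0_const: "p \<in> solid_harmonics 0 \<Longrightarrow> p x = p y"
  using solid_harmonicsD(2)[of p 0 0] by (metis power_0 mult_1 scaleR_zero_left)

lemma solid_harmonics_const [simp, intro]: "(\<lambda>x. c) \<in> solid_harmonics 0"
proof -
  have "dir_deriv b (\<lambda>x::'a. c) = (\<lambda>x. 0)" for b by auto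
  then show ?thesis by (auto simp: solid_harmonics_def)
qed

lemma solid_harmonics_inner [simp, intro]: "(\<lambda>x. a \<bullet> x) \<in> solid_harmonics 1"
proof -
  have "dir_deriv b (\<lambda>x. a \<bullet> x) = (\<lambda>x. a \<bullet> b)" for b by auto
  then show ?thesis by (auto simp: solid_harmonics_def)
qed

lemma solid_harmonics_lincomb:
  assumes "\<And>i. i \<in> I \<Longrightarrow> p i \<in> solid_harmonics m"
  shows "(\<lambda>x. \<Sum>i\<in>I. c i * p i x) \<in> solid_harmonics m"
proof -
  note p = solid_harmonicsD[OF assms]
  have p2: "real_polynomial_function (\<lambda>x. c i * p i x)" if "i \<in> I" for i using p(1)[OF that] by auto
  have "dir_deriv b (\<lambda>x. \<Sum>i\<in>I. c i * p i x) = (\<lambda>x. \<Sum>i\<in>I. c i * dir_deriv b (p i) x)" for b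
    using p(1) by (intro ext) (auto simp: dir_deriv_sum[OF p2] dir_deriv_cmult intro!: sum.cong)
  then have "dir_deriv b (dir_deriv b (\<lambda>x. \<Sum>i\<in>I. c i * p i x)) x = (\<Sum>i\<in>I. c i * dir_deriv b (dir_deriv b (p i)) x)" for b x
    using p(1) by (simp add: dir_deriv_sum dir_deriv_cmult dir_deriv_polynomial poly_mult poly_const)
  then have "(\<Sum>b\<in>Basis. dir_deriv b (dir_deriv b (\<lambda>x. \<Sum>i\<in>I. c i * p i x)) x) = 0" for x
    using p(3) by (simp add: sum.swap[of _ I] sum_distrib_left[symmetric])
  moreover have "real_polynomial_function (\<lambda>x. \<Sum>i\<in>I. c i * p i x)"
    by (cases "finite I") (use p2 in \<open>auto intro!: real_polynomial_function_sum\<close>)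
  ultimately show ?thesis unfolding solid_harmonics_def using p(2) by (auto simp: sum_distrib_left mult_ac intro!: sum.cong)
qed

lemma solid_harmonics_odd_even: "p \<in> solid_harmonics m \<Longrightarrow> p (- x) = (-1) ^ m * p x"
  using solid_harmonicsD(2)[of p m "-1" x] by simp

section \<open>Integration on the sphere\<close>

interpretation sphere_measure: finite_measure "sphere_measure :: 'a::euclidean_space measure"
  by (rule finite_measureI) (simp add: emeasure_sphere_measure_space)

lemma sphere_integral_const [simp]: "(LINT x|(sphere_measure :: 'a::euclidean_space measure). c) = (c::real)"
  by (simp add: measure_def emeasure_sphere_measure_space)

lemma borel_measurable_sphere_continuous:
  fixes f :: "'a::euclidean_space \<Rightarrow> real"
  assumes "continuous_on (sphere 0 1) f"
  shows "f \<in> borel_measurable sphere_measure"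
  using borel_measurable_continuous_on_restrict[OF assms]
    measurable_cong_sets[OF sets_sphere_measure refl] by blast

lemma borel_measurable_sphere_borel:
  fixes f :: "'a::euclidean_space \<Rightarrow> 'b::topological_space"
  assumes "f \<in> borel_measurable borel"
  shows "f \<in> borel_measurable sphere_measure"
  using measurable_restrict_space1[OF assms, of "sphere 0 1"]
    measurable_cong_sets[OF sets_sphere_measure refl] by blast

lemma continuous_on_polynomial:
  fixes p :: "'a::euclidean_space \<Rightarrow> real"
  assumes "real_polynomial_function p"
  shows "continuous_on S p"
  using assms continuous_on_polymonial_function real_polynomial_function_eq by blast

lemma borel_measurable_polynomial:
  fixes p :: "'a::euclidean_space \<Rightarrow> real"
  shows "real_polynomial_function p \<Longrightarrow> p \<in> borel_measurable sphere_measure"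
  by (intro borel_measurable_sphere_continuous continuous_on_polynomial)

lemma integrable_sphere_bounded:
  fixes f :: "'a::euclidean_space \<Rightarrow> real"
  assumes "f \<in> borel_measurable sphere_measure" "\<And>x. x \<in> sphere 0 1 \<Longrightarrow> \<bar>f x\<bar> \<le> B"
  shows "integrable sphere_measure f"
  using assms by (intro sphere_measure.integrable_const_bound[of _ B]) auto

lemma continuous_sphere_bounded:
  fixes f :: "'a::euclidean_space \<Rightarrow> real"
  assumes "continuous_on (sphere 0 1) f"
  obtains B where "B > 0" "\<And>x. x \<in> sphere 0 1 \<Longrightarrow> \<bar>f x\<bar> \<le> B"
proof -
  have "bounded (f ` sphere 0 1)"
    using assms by (intro compact_imp_bounded compact_continuous_image) auto
  then show ?thesis using that by (auto simp: bounded_pos)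
qed

lemma integrable_sphere_continuous:
  fixes f :: "'a::euclidean_space \<Rightarrow> real"
  assumes "continuous_on (sphere 0 1) f"
  shows "integrable sphere_measure f"
  using continuous_sphere_bounded[OF assms] integrable_sphere_bounded borel_measurable_sphere_continuous[OF assms]
  by metis

lemma integrable_sphere_mult_continuous:
  fixes f g :: "'a::euclidean_space \<Rightarrow> real"
  assumes f: "integrable sphere_measure f" and g: "continuous_on (sphere 0 1) g"
  shows "integrable sphere_measure (\<lambda>x. f x * g x)"
proof -
  obtain B where B: "\<And>x. x \<in> sphere 0 1 \<Longrightarrow> \<bar>g x\<bar> \<le> B" using continuous_sphere_bounded[OF g] by metis
  have [measurable]: "f \<in> borel_measurable sphere_measure" "g \<in> borel_measurable sphere_measure"
    using f borel_measurable_sphere_continuous[OF g] by auto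
  have "\<bar>f x\<bar> * \<bar>g x\<bar> \<le> \<bar>B\<bar> * \<bar>f x\<bar>" if "x \<in> sphere 0 1" for x
    using mult_left_mono[OF order_trans[OF B[OF that] abs_ge_self], of "\<bar>f x\<bar>"] by (simp add: mult.commute)
  then show ?thesis
    by (intro Bochner_Integration.integrable_bound[OF integrable_mult_right[OF f, of "\<bar>B\<bar>"]])
      (auto simp: abs_mult)
qed

lemma sphere_integral_mono:
  fixes f g :: "'a::euclidean_space \<Rightarrow> real"
  assumes "integrable sphere_measure f" "integrable sphere_measure g"
    "\<And>x. x \<in> sphere 0 1 \<Longrightarrow> f x \<le> g x"
  shows "(LINT x|sphere_measure. f x) \<le> (LINT x|sphere_measure. g x)"
  using assms by (intro integral_mono) auto

lemma orthogonal_transformation_distr: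
  fixes T :: "'a::euclidean_space \<Rightarrow> 'a"
  assumes T: "orthogonal_transformation T"
  shows "T \<in> measurable sphere_measure sphere_measure"
    "distr sphere_measure sphere_measure T = (sphere_measure :: 'a measure)"
proof -
  have nrm: "norm (T x) = norm x" for x using T by (simp add: orthogonal_transformation_norm)
  have "T \<in> borel_measurable borel"
    using orthogonal_transformation_linear[OF T]
    by (simp add: borel_measurable_continuous_onI linear_continuous_on linear_conv_bounded_linear)
  then have "T \<in> measurable (restrict_space borel (sphere 0 1)) (restrict_space borel (sphere 0 1))"
    by (auto intro!: measurable_restrict_space3 simp: nrm)
  then show m: "T \<in> measurable sphere_measure (sphere_measure :: 'a measure)"
    using measurable_cong_sets[OF sets_sphere_measure sets_sphere_measure] by blast
  show "distr sphere_measure sphere_measure T = (sphere_measure :: 'a measure)"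
  proof (rule measure_eqI)
    fix A assume "A \<in> sets (distr sphere_measure sphere_measure T)"
    then have A: "A \<in> sets sphere_measure" by simp
    then have "T -` A \<subseteq> space sphere_measure" using sets.sets_into_space[OF A] nrm by auto
    then have "T -` A \<inter> space sphere_measure = T -` A" by blast
    then show "emeasure (distr sphere_measure sphere_measure T) A = emeasure sphere_measure A"
      by (simp only: emeasure_distr[OF m A] sphere_measure_rotation_invariant[OF T A])
  qed simp
qed

lemma sphere_integral_rotate:
  fixes f :: "'a::euclidean_space \<Rightarrow> real" and T :: "'a \<Rightarrow> 'a"
  assumes T: "orthogonal_transformation T" and f: "f \<in> borel_measurable sphere_measure"
  shows "(LINT x|sphere_measure. f (T x)) = (LINT x|sphere_measure. f x)"
  using integral_distr[OF orthogonal_transformation_distr(1)[OF T] f] orthogonal_transformation_distr(2)[OF T] by simp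

text \<open>
  The reflection at the hyperplane orthogonal to \<open>a - b\<close> is a rotation of the sphere that exchanges
  \<open>a\<close> and \<open>b\<close>.
\<close>

lemma reflection_exists:
  fixes a b :: "'a::euclidean_space"
  assumes "norm a = norm b"
  obtains T where "orthogonal_transformation T" "\<And>x. a \<bullet> T x = b \<bullet> x"
proof (cases "a = b")
  case True
  then show ?thesis using that[of "\<lambda>x. x"] by (simp add: orthogonal_transformation_def linear_id[unfolded id_def])
next
  case False
  define w where "w = a - b"
  define T where "T x = x - (2 * (x \<bullet> w) / (w \<bullet> w)) *\<^sub>R w" for x
  have w: "w \<bullet> w \<noteq> 0" using False by (simp add: w_def)
  have ab: "a \<bullet> a = b \<bullet> b" using assms by (simp add: dot_square_norm)
  have lin: "linear T"
    by (rule linearI) (simp_all add: T_def algebra_simps inner_add_left add_divide_distrib)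
  have "T x \<bullet> T y = x \<bullet> y" for x y
  proof -
    define c e where "c = 2 * (x \<bullet> w) / (w \<bullet> w)" and "e = 2 * (y \<bullet> w) / (w \<bullet> w)"
    have ce: "c * (w \<bullet> w) = 2 * (x \<bullet> w)" "e * (x \<bullet> w) = c * (y \<bullet> w)" using w by (auto simp: c_def e_def)
    have Txy: "T x = x - c *\<^sub>R w" "T y = y - e *\<^sub>R w" by (simp_all add: T_def c_def e_def)
    have "T x \<bullet> T y = x \<bullet> y - e * (x \<bullet> w) - c * (y \<bullet> w) + e * (c * (w \<bullet> w))"
      unfolding Txy inner_diff_left inner_diff_right inner_scaleR_left inner_scaleR_right
      by (simp only: inner_commute[of w y]) (simp only: algebra_simps)
    then show ?thesis by (simp add: ce)
  qed
  then have "orthogonal_transformation T" using lin by (simp add: orthogonal_transformation_def)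
  moreover have "a \<bullet> T x = b \<bullet> x" for x
  proof -
    have "2 * (a \<bullet> w) = w \<bullet> w"
      using ab by (simp add: w_def inner_diff_left inner_diff_right inner_commute)
    then have "a \<bullet> T x = a \<bullet> x - (x \<bullet> w)"
      using w by (simp add: T_def inner_diff_right) (simp add: field_simps)
    then show ?thesis by (simp add: w_def inner_diff_right inner_commute)
  qed
  ultimately show ?thesis using that by blast
qed

lemma zonal_integral_indep:
  fixes a b :: "'a::euclidean_space"
  assumes "a \<in> sphere 0 1" "b \<in> sphere 0 1" and f: "f \<in> borel_measurable borel"
  shows "(LINT x|sphere_measure. f (a \<bullet> x)) = (LINT x|sphere_measure. (f (b \<bullet> x) :: real))"
proof -
  obtain T where T: "orthogonal_transformation T" "\<And>x. a \<bullet> T x = b \<bullet> x"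
    using reflection_exists[of a b] assms by auto
  have "(\<lambda>x. f (a \<bullet> x)) \<in> borel_measurable sphere_measure"
    by (rule borel_measurable_sphere_borel) (use f in measurable)
  from sphere_integral_rotate[OF T(1) this] show ?thesis by (simp add: T(2))
qed

text \<open>
  The cone over the slice lies in the frontier of the convex cone \<open>{x. \<tau> * norm x \<le> \<theta> \<bullet> x}\<close>. This
  allows profiles with a kink at \<open>\<tau>\<close>: they are differentiable almost everywhere on the sphere.
\<close>

lemma sphere_slice_null:
  fixes \<theta> :: "'a::euclidean_space"
  assumes \<theta>: "\<theta> \<in> sphere 0 1" and \<tau>: "0 \<le> \<tau>" "\<tau> < 1"
  shows "AE x in sphere_measure. \<theta> \<bullet> x \<noteq> \<tau>"
proof -
  define A where "A = {x \<in> sphere 0 1. \<theta> \<bullet> x = \<tau>}"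
  define C where "C = {x. \<tau> * norm x \<le> \<theta> \<bullet> x}"
  have "A = sphere 0 1 \<inter> {x. \<theta> \<bullet> x = \<tau>}" by (auto simp: A_def)
  then have A: "A \<in> sets borel" by (auto simp: closed_hyperplane borel_closed)
  have "convex C"
    unfolding C_def
  proof (rule convexI, simp)
    fix x y :: 'a and u v :: real
    assume *: "\<tau> * norm x \<le> \<theta> \<bullet> x" "\<tau> * norm y \<le> \<theta> \<bullet> y" "0 \<le> u" "0 \<le> v" "u + v = 1"
    have "\<tau> * norm (u *\<^sub>R x + v *\<^sub>R y) \<le> \<tau> * (u * norm x + v * norm y)"
      using norm_triangle_ineq[of "u *\<^sub>R x" "v *\<^sub>R y"] * \<tau> by (intro mult_left_mono) auto
    also have "\<dots> = u * (\<tau> * norm x) + v * (\<tau> * norm y)" by (simp add: algebra_simps)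
    also have "\<dots> \<le> u * (\<theta> \<bullet> x) + v * (\<theta> \<bullet> y)" using * by (intro add_mono mult_left_mono) auto
    finally show "\<tau> * norm (u *\<^sub>R x + v *\<^sub>R y) \<le> \<theta> \<bullet> (u *\<^sub>R x + v *\<^sub>R y)"
      by (simp add: inner_add_right)
  qed
  have "ball 0 1 \<inter> sgn -` A \<subseteq> frontier C"
  proof
    fix x assume "x \<in> ball 0 1 \<inter> sgn -` A"
    then have x: "x \<noteq> 0" "\<theta> \<bullet> sgn x = \<tau>" by (auto simp: A_def)
    then have eq: "\<theta> \<bullet> x = \<tau> * norm x" by (auto simp: sgn_div_norm field_simps)
    then have "x \<in> closure C" using closure_subset[of C] by (auto simp: C_def)
    moreover have "x \<notin> interior C"
    proof
      assume "x \<in> interior C"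
      then obtain e where e: "e > 0" "ball x e \<subseteq> C" by (auto simp: mem_interior)
      define y where "y = x - (e/2) *\<^sub>R \<theta>"
      have "y \<in> ball x e" using e \<theta> by (auto simp: y_def dist_norm)
      then have "\<tau> * norm y \<le> \<theta> \<bullet> y" using e by (auto simp: C_def)
      also have "\<theta> \<bullet> y = \<tau> * norm x - e/2"
        using \<theta> eq by (simp add: y_def inner_diff_right dot_square_norm)
      finally have *: "\<tau> * norm y \<le> \<tau> * norm x - e/2" .
      have "norm x \<le> norm y + e/2" using norm_triangle_ineq[of y "(e/2) *\<^sub>R \<theta>"] \<theta> e by (simp add: y_def)
      then have "\<tau> * norm x \<le> \<tau> * norm y + \<tau> * (e/2)"
        using \<tau> mult_left_mono[of "norm x" "norm y + e/2" \<tau>] by (simp add: algebra_simps)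
      moreover have "\<tau> * (e/2) < e/2" using \<tau> e by simp
      ultimately show False using * by linarith
    qed
    ultimately show "x \<in> frontier C" by (simp add: frontier_def)
  qed
  then have "negligible (ball 0 1 \<inter> sgn -` A)"
    using negligible_convex_frontier[OF \<open>convex C\<close>] negligible_subset by blast
  moreover have "ball 0 1 \<inter> sgn -` A \<in> sets borel"
    using A measurable_sets[OF sgn_borel_measurable, of A] by auto
  ultimately have "emeasure lborel (ball 0 1 \<inter> sgn -` A) = 0"
    by (simp add: negligible_iff_null_sets null_sets_def)
  then have "emeasure sphere_measure A = 0"
    using A by (subst emeasure_sphere_measure) (auto simp: A_def)
  then show ?thesis
    by (intro AE_I[of _ _ A]) (use A in \<open>auto simp: A_def sets_sphere_measure sets_restrict_space\<close>)
qed

section \<open>The divergence theorem on the sphere\<close>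

definition plane_rotation :: "'a::euclidean_space \<Rightarrow> 'a \<Rightarrow> real \<Rightarrow> 'a \<Rightarrow> 'a" where
  "plane_rotation i j t x = x + ((cos t - 1) * (x \<bullet> i) - sin t * (x \<bullet> j)) *\<^sub>R i
     + (sin t * (x \<bullet> i) + (cos t - 1) * (x \<bullet> j)) *\<^sub>R j"

lemma plane_rotation_orthogonal:
  assumes "i \<in> Basis" "j \<in> Basis" "i \<noteq> j"
  shows "orthogonal_transformation (plane_rotation i j t :: 'a::euclidean_space \<Rightarrow> 'a)"
proof -
  have ij: "i \<bullet> i = 1" "j \<bullet> j = 1" "i \<bullet> j = 0" "j \<bullet> i = 0" using assms by (auto simp: inner_Basis)
  have "linear (plane_rotation i j t)"
    by (rule linearI) (simp_all add: plane_rotation_def algebra_simps inner_add_left)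
  moreover have "plane_rotation i j t x \<bullet> plane_rotation i j t x = x \<bullet> x" for x
  proof -
    let ?u = "(cos t - 1) * (x \<bullet> i) - sin t * (x \<bullet> j)" and ?w = "sin t * (x \<bullet> i) + (cos t - 1) * (x \<bullet> j)"
    have "plane_rotation i j t x \<bullet> plane_rotation i j t x
        = x \<bullet> x + 2 * (?u * (x \<bullet> i) + ?w * (x \<bullet> j)) + ?u\<^sup>2 + ?w\<^sup>2"
      by (simp add: plane_rotation_def inner_add_left inner_add_right ij inner_commute[of i x] inner_commute[of j x]
          power2_eq_square algebra_simps)
    also have "\<dots> = x \<bullet> x + ((sin t)\<^sup>2 + (cos t)\<^sup>2 - 1) * ((x \<bullet> i)\<^sup>2 + (x \<bullet> j)\<^sup>2)"
      by algebra
    finally show ?thesis by simp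
  qed
  ultimately show ?thesis by (simp add: orthogonal_transformation norm_eq_sqrt_inner)
qed

lemma plane_rotation_derivative:
  "((\<lambda>t. plane_rotation i j t x) has_vector_derivative ((x \<bullet> i) *\<^sub>R j - (x \<bullet> j) *\<^sub>R i)) (at 0)"
  unfolding plane_rotation_def
  by (auto intro!: derivative_eq_intros simp: has_vector_derivative_def fun_eq_iff algebra_simps)

lemma plane_rotation_dist:
  assumes "i \<in> Basis" "j \<in> Basis" "norm x = 1"
  shows "norm (plane_rotation i j t x - x) \<le> 4 * \<bar>t\<bar>"
proof -
  have c: "\<bar>cos t - 1\<bar> \<le> \<bar>t\<bar>"
  proof -
    have "\<bar>cos t - 1\<bar> = 2 * (\<bar>sin (t/2)\<bar> * \<bar>sin (t/2)\<bar>)"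
      using cos_double_sin[of "t/2"] by (simp add: abs_mult power2_eq_square)
    also have "\<dots> \<le> 2 * (\<bar>t/2\<bar> * 1)"
      using abs_sin_x_le_abs_x[of "t/2"] by (intro mult_left_mono mult_mono) auto
    finally show ?thesis by simp
  qed
  have s: "\<bar>sin t\<bar> \<le> \<bar>t\<bar>" by (rule abs_sin_x_le_abs_x)
  have x: "\<bar>x \<bullet> i\<bar> \<le> 1" "\<bar>x \<bullet> j\<bar> \<le> 1" using Basis_le_norm assms by metis+
  have b: "\<bar>p * q\<bar> \<le> \<bar>t\<bar>" if "\<bar>p\<bar> \<le> \<bar>t\<bar>" "\<bar>q\<bar> \<le> 1" for p q :: real
    using mult_mono[OF that] by (simp add: abs_mult)
  have "norm (plane_rotation i j t x - x) \<le>
     norm (((cos t - 1) * (x \<bullet> i) - sin t * (x \<bullet> j)) *\<^sub>R i) + norm ((sin t * (x \<bullet> i) + (cos t - 1) * (x \<bullet> j)) *\<^sub>R j)"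
    unfolding plane_rotation_def by (rule order_trans[OF _ norm_triangle_ineq]) simp
  also have "\<dots> = \<bar>(cos t - 1) * (x \<bullet> i) - sin t * (x \<bullet> j)\<bar> + \<bar>sin t * (x \<bullet> i) + (cos t - 1) * (x \<bullet> j)\<bar>"
    using assms by simp
  finally show ?thesis using b[OF c x(1)] b[OF c x(2)] b[OF s x(1)] b[OF s x(2)] by linarith
qed

text \<open>
  The integral of \<open>F\<close> over the rotated sphere does not depend on the angle, and its derivative at angle
  \<open>0\<close> is the integral below. Dominated convergence, with the Lipschitz constant of \<open>F\<close> as the bound for
  the difference quotients, only needs the derivative of \<open>F\<close> almost everywhere.
\<close>

lemma rotation_derivative_integral:
  fixes F :: "'a::euclidean_space \<Rightarrow> real"
  assumes ij: "i \<in> Basis" "j \<in> Basis" "i \<noteq> j"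
    and lip: "L-lipschitz_on (sphere 0 1) F"
    and lin: "\<And>x. linear (D x)"
    and meas: "\<And>b. b \<in> Basis \<Longrightarrow> (\<lambda>x. D x b) \<in> borel_measurable sphere_measure"
    and der: "AE x in sphere_measure. (F has_derivative D x) (at x)"
  shows "(LINT x|sphere_measure. (x \<bullet> i) * D x j - (x \<bullet> j) * D x i) = 0"
proof -
  define t where "t n = inverse (real (Suc n))" for n
  define R where "R n = plane_rotation i j (t n)" for n
  have t: "t n > 0" "t \<longlonglongrightarrow> 0" for n unfolding t_def by (simp, rule LIMSEQ_inverse_real_of_nat)
  have Fm: "F \<in> borel_measurable sphere_measure"
    using lipschitz_on_continuous_on[OF lip] by (rule borel_measurable_sphere_continuous)
  have R: "orthogonal_transformation (R n)" for n
    unfolding R_def by (rule plane_rotation_orthogonal[OF ij])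
  have Rm: "R n \<in> measurable sphere_measure sphere_measure" for n
    by (rule orthogonal_transformation_distr(1)[OF R])
  have FRm: "(\<lambda>x. F (R n x)) \<in> borel_measurable sphere_measure" for n
    using measurable_comp[OF Rm Fm] by (simp add: o_def)
  have Fi: "integrable sphere_measure F"
    by (intro integrable_sphere_continuous lipschitz_on_continuous_on[OF lip])
  have nR: "norm (R n x) = norm x" for n x
    using R orthogonal_transformation_norm by blast
  have FRi: "integrable sphere_measure (\<lambda>x. F (R n x))" for n
  proof -
    obtain B where "\<And>x. x \<in> sphere 0 1 \<Longrightarrow> \<bar>F x\<bar> \<le> B"
      using continuous_sphere_bounded[OF lipschitz_on_continuous_on[OF lip]] by metis
    then show ?thesis by (intro integrable_sphere_bounded[OF FRm, of n B]) (auto simp: nR)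
  qed
  let ?q = "\<lambda>n x. (F (R n x) - F x) / t n"
  have zero: "(LINT x|sphere_measure. ?q n x) = 0" for n
    using sphere_integral_rotate[OF R[of n] Fm] FRi[of n] Fi by simp
  have lim: "AE x in sphere_measure. (\<lambda>n. ?q n x) \<longlonglongrightarrow> (x \<bullet> i) * D x j - (x \<bullet> j) * D x i"
    using der
  proof eventually_elim
    case (elim x)
    have "((\<lambda>s. F (plane_rotation i j s x)) has_derivative
        (\<lambda>h. D x (h *\<^sub>R ((x \<bullet> i) *\<^sub>R j - (x \<bullet> j) *\<^sub>R i)))) (at 0)"
      by (rule has_derivative_compose[OF plane_rotation_derivative[unfolded has_vector_derivative_def]])
        (use elim in \<open>simp add: plane_rotation_def\<close>)
    then have "((\<lambda>s. F (plane_rotation i j s x)) has_real_derivative (x \<bullet> i) * D x j - (x \<bullet> j) * D x i) (at 0)"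
      by (simp add: has_field_derivative_def linear_cmul[OF lin] linear_diff[OF lin] mult_commute_abs)
    then have "((\<lambda>s. (F (plane_rotation i j s x) - F x) / s) \<longlongrightarrow> (x \<bullet> i) * D x j - (x \<bullet> j) * D x i) (at 0)"
      by (simp add: DERIV_def plane_rotation_def)
    moreover have "filterlim t (at 0) sequentially"
      using t by (auto simp: filterlim_at intro!: always_eventually) (metis less_irrefl)
    ultimately show ?case unfolding R_def by (rule filterlim_compose)
  qed
  have bd: "norm (?q n x) \<le> L * 4" if x: "x \<in> sphere 0 1" for n x
  proof -
    have "\<bar>F (R n x) - F x\<bar> \<le> L * norm (R n x - x)"
      using lipschitz_onD[OF lip, of "R n x" x] x by (auto simp: dist_norm nR)
    also have "\<dots> \<le> L * (4 * t n)"
      using plane_rotation_dist[OF ij(1,2), of x "t n"] x lipschitz_on_nonneg[OF lip] t(1)[of n]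
      by (intro mult_left_mono) (auto simp: R_def)
    finally show ?thesis using t(1)[of n] by (simp add: field_simps)
  qed
  have "(\<lambda>n. LINT x|sphere_measure. ?q n x) \<longlonglongrightarrow> (LINT x|sphere_measure. (x \<bullet> i) * D x j - (x \<bullet> j) * D x i)"
  proof (rule integral_dominated_convergence[where w="\<lambda>x. L * 4"])
    show "(\<lambda>x. (x \<bullet> i) * D x j - (x \<bullet> j) * D x i) \<in> borel_measurable sphere_measure"
      using ij by (intro borel_measurable_diff borel_measurable_times meas borel_measurable_polynomial) auto
    show "?q n \<in> borel_measurable sphere_measure" for n
      using FRm[of n] Fm by measurable
    show "AE x in sphere_measure. norm (?q n x) \<le> L * 4" for n using bd by (intro AE_I2) auto
  qed (use lim in auto)
  then show ?thesis unfolding zero by (rule LIMSEQ_unique[OF _ tendsto_const])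
qed

lemma integrable_derivative_term:
  fixes D :: "'a::euclidean_space \<Rightarrow> 'a \<Rightarrow> real"
  assumes meas: "\<And>b. b \<in> Basis \<Longrightarrow> (\<lambda>x. D x b) \<in> borel_measurable sphere_measure"
    and bd: "\<And>b x. b \<in> Basis \<Longrightarrow> x \<in> sphere 0 1 \<Longrightarrow> \<bar>D x b\<bar> \<le> B"
    and b: "b \<in> Basis" and g: "continuous_on (sphere 0 1) g"
  shows "integrable sphere_measure (\<lambda>x. g x * D x b)"
proof -
  have *: "integrable sphere_measure (\<lambda>x. D x b)" if "b \<in> Basis" for b
    using that by (intro integrable_sphere_bounded[OF meas bd])
  show ?thesis
    using integrable_sphere_mult_continuous[OF *[OF b] g] by (simp add: mult.commute)
qed

text \<open>
  The sum of the preceding identity over all coordinate planes that contain \<open>v\<close>, applied to the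
  functions \<open>(x \<bullet> i) * F x\<close>. If \<open>F\<close> is homogeneous of degree \<open>q\<close>, it says that the mean of \<open>\<partial>\<^sub>v F\<close> is
  \<open>N - 1 + q\<close> times the mean of \<open>(x \<bullet> v) * F x\<close>.
\<close>

lemma sphere_divergence:
  fixes F :: "'a::euclidean_space \<Rightarrow> real"
  assumes lip: "L-lipschitz_on (sphere 0 1) F"
    and lin: "\<And>x. linear (D x)"
    and meas: "\<And>b. b \<in> Basis \<Longrightarrow> (\<lambda>x. D x b) \<in> borel_measurable sphere_measure"
    and bd: "\<And>b x. b \<in> Basis \<Longrightarrow> x \<in> sphere 0 1 \<Longrightarrow> \<bar>D x b\<bar> \<le> B"
    and der: "AE x in sphere_measure. (F has_derivative D x) (at x)"
    and v: "v \<in> Basis"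
  shows "(LINT x|sphere_measure. D x v) - (LINT x|sphere_measure. (x \<bullet> v) * D x x)
       = (real DIM('a) - 1) * (LINT x|sphere_measure. (x \<bullet> v) * F x)"
proof -
  have int: "integrable sphere_measure (\<lambda>x. g x * D x b)" if "b \<in> Basis" "continuous_on (sphere 0 1) g" for g b
    by (rule integrable_derivative_term[where B=B]) (use meas bd that in auto)
  have cF: "continuous_on (sphere 0 1) F" by (rule lipschitz_on_continuous_on[OF lip])
  obtain BF where BF: "\<And>x. x \<in> sphere 0 1 \<Longrightarrow> \<bar>F x\<bar> \<le> BF" using continuous_sphere_bounded[OF cF] by metis
  have rot: "(LINT x|sphere_measure. (x \<bullet> v) * ((x \<bullet> i) * D x i + F x) - (x \<bullet> i) * ((x \<bullet> i) * D x v)) = 0"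
    if i: "i \<in> Basis" "i \<noteq> v" for i
  proof -
    let ?D = "\<lambda>x h. (x \<bullet> i) * D x h + (h \<bullet> i) * F x"
    have l1: "1-lipschitz_on (sphere 0 1) (\<lambda>x. x \<bullet> i)"
      using i by (intro lipschitz_onI) (auto simp: dist_norm inner_diff_left[symmetric] Basis_le_norm)
    have lip': "(1 * BF + L * 1)-lipschitz_on (sphere 0 1) (\<lambda>x. (x \<bullet> i) * F x)"
    proof (rule lipschitz_onI)
      fix x y :: 'a assume xy: "x \<in> sphere 0 1" "y \<in> sphere 0 1"
      have "(x \<bullet> i) * F x - (y \<bullet> i) * F y = ((x - y) \<bullet> i) * F x + (y \<bullet> i) * (F x - F y)"
        by (simp add: algebra_simps inner_diff_left)
      also have "\<bar>\<dots>\<bar> \<le> \<bar>(x - y) \<bullet> i\<bar> * \<bar>F x\<bar> + \<bar>y \<bullet> i\<bar> * \<bar>F x - F y\<bar>"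
        by (rule order_trans[OF abs_triangle_ineq]) (simp add: abs_mult)
      also have "\<dots> \<le> norm (x - y) * BF + 1 * (L * norm (x - y))"
        using Basis_le_norm[OF i(1)] BF[OF xy(1)] lipschitz_onD[OF lip xy] xy Basis_le_norm[OF i(1), of y]
        by (intro add_mono mult_mono) (auto simp: dist_norm)
      finally show "dist ((x \<bullet> i) * F x) ((y \<bullet> i) * F y) \<le> (1 * BF + L * 1) * dist x y"
        by (simp add: dist_norm algebra_simps)
    next
      show "0 \<le> 1 * BF + L * 1"
        using lipschitz_on_nonneg[OF lip] BF[of i] i by (auto simp: order_trans[OF abs_ge_zero])
    qed
    have "(LINT x|sphere_measure. (x \<bullet> v) * ?D x i - (x \<bullet> i) * ?D x v) = 0"
    proof (rule rotation_derivative_integral[OF v i(1) i(2)[symmetric] lip'])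
      show "linear (?D x)" for x
        by (rule linearI) (simp_all add: linear_add[OF lin] linear_cmul[OF lin] algebra_simps inner_add_left)
      show "(\<lambda>x. ?D x b) \<in> borel_measurable sphere_measure" if "b \<in> Basis" for b
        using that by (intro borel_measurable_add borel_measurable_times meas borel_measurable_polynomial
            borel_measurable_sphere_continuous[OF cF]) (auto intro: poly_const)
      show "AE x in sphere_measure. ((\<lambda>x. (x \<bullet> i) * F x) has_derivative ?D x) (at x)"
        using der by eventually_elim (auto intro!: derivative_eq_intros)
    qed
    then show ?thesis using i v by (simp add: inner_Basis)
  qed
  let ?B = "Basis - {v}"
  have cont: "continuous_on (sphere 0 1) (\<lambda>x::'a. x \<bullet> c)" for c by (intro continuous_intros)
  have I1: "integrable sphere_measure (\<lambda>x. (x \<bullet> v) * ((x \<bullet> i) * D x i))" if "i \<in> Basis" for i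
    using int[OF that, of "\<lambda>x. (x \<bullet> v) * (x \<bullet> i)"]
    by (simp add: mult.assoc continuous_on_mult cont)
  have I2: "integrable sphere_measure (\<lambda>x. (x \<bullet> i) * ((x \<bullet> i) * D x v))" if "i \<in> Basis" for i
    using int[OF v, of "\<lambda>x. (x \<bullet> i) * (x \<bullet> i)"]
    by (simp add: mult.assoc continuous_on_mult cont)
  have I3: "integrable sphere_measure (\<lambda>x. (x \<bullet> v) * F x)"
    by (intro integrable_sphere_continuous continuous_on_mult cont cF)
  have "0 = (\<Sum>i\<in>?B. LINT x|sphere_measure. (x \<bullet> v) * ((x \<bullet> i) * D x i + F x) - (x \<bullet> i) * ((x \<bullet> i) * D x v))"
    using rot by simp
  also have "\<dots> = (\<Sum>i\<in>?B. (LINT x|sphere_measure. (x \<bullet> v) * ((x \<bullet> i) * D x i)) + (LINT x|sphere_measure. (x \<bullet> v) * F x)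
      - (LINT x|sphere_measure. (x \<bullet> i) * ((x \<bullet> i) * D x v)))"
    using I1 I2 I3 by (intro sum.cong) (auto simp: distrib_left)
  also have "\<dots> = (\<Sum>i\<in>Basis. (LINT x|sphere_measure. (x \<bullet> v) * ((x \<bullet> i) * D x i)) + (LINT x|sphere_measure. (x \<bullet> v) * F x)
      - (LINT x|sphere_measure. (x \<bullet> i) * ((x \<bullet> i) * D x v))) - (LINT x|sphere_measure. (x \<bullet> v) * F x)"
    using v by (simp add: sum_diff1)
  also have "\<dots> = (LINT x|sphere_measure. (\<Sum>i\<in>Basis. (x \<bullet> v) * ((x \<bullet> i) * D x i)))
      + (real DIM('a) - 1) * (LINT x|sphere_measure. (x \<bullet> v) * F x)
      - (LINT x|sphere_measure. (\<Sum>i\<in>Basis. (x \<bullet> i) * ((x \<bullet> i) * D x v)))"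
    using I1 I2 by (simp add: sum.distrib sum_subtractf integral_sum algebra_simps)
  also have "(LINT x|sphere_measure. (\<Sum>i\<in>Basis. (x \<bullet> v) * ((x \<bullet> i) * D x i))) = (LINT x|sphere_measure. (x \<bullet> v) * D x x)"
  proof (rule Bochner_Integration.integral_cong[OF refl])
    fix x :: 'a
    have "D x x = D x (\<Sum>i\<in>Basis. (x \<bullet> i) *\<^sub>R i)" by (simp add: euclidean_representation)
    also have "\<dots> = (\<Sum>i\<in>Basis. (x \<bullet> i) * D x i)"
      using linear_sum[OF lin[of x], of "\<lambda>i. (x \<bullet> i) *\<^sub>R i" Basis] by (simp add: linear_cmul[OF lin])
    finally show "(\<Sum>i\<in>Basis. (x \<bullet> v) * ((x \<bullet> i) * D x i)) = (x \<bullet> v) * D x x"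
      by (simp add: sum_distrib_left)
  qed
  also have "(LINT x|sphere_measure. (\<Sum>i\<in>Basis. (x \<bullet> i) * ((x \<bullet> i) * D x v))) = (LINT x|sphere_measure. D x v)"
  proof (rule Bochner_Integration.integral_cong[OF refl])
    fix x :: 'a assume "x \<in> space sphere_measure"
    then have "(\<Sum>i\<in>Basis. (x \<bullet> i) * (x \<bullet> i)) = 1"
      by (simp add: euclidean_inner[symmetric] dot_square_norm)
    then show "(\<Sum>i\<in>Basis. (x \<bullet> i) * ((x \<bullet> i) * D x v)) = D x v"
      by (simp add: mult.assoc[symmetric] sum_distrib_right[symmetric])
  qed
  finally show ?thesis by simp
qed

section \<open>Integrals of zonal functions against harmonic polynomials\<close>

lemma lipschitz_on_mult_bounded:
  fixes f g :: "'a::metric_space \<Rightarrow> real"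
  assumes f: "L-lipschitz_on S f" "\<And>x. x \<in> S \<Longrightarrow> \<bar>f x\<bar> \<le> A" and g: "M-lipschitz_on S g" "\<And>x. x \<in> S \<Longrightarrow> \<bar>g x\<bar> \<le> B"
    and AB: "0 \<le> A" "0 \<le> B"
  shows "(A * M + B * L)-lipschitz_on S (\<lambda>x. f x * g x)"
proof (rule lipschitz_onI)
  fix x y assume xy: "x \<in> S" "y \<in> S"
  have "f x * g x - f y * g y = f x * (g x - g y) + g y * (f x - f y)" by (simp add: algebra_simps)
  also have "\<bar>\<dots>\<bar> \<le> \<bar>f x\<bar> * \<bar>g x - g y\<bar> + \<bar>g y\<bar> * \<bar>f x - f y\<bar>"
    by (rule order_trans[OF abs_triangle_ineq]) (simp add: abs_mult)
  also have "\<dots> \<le> A * (M * dist x y) + B * (L * dist x y)"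
    using lipschitz_onD[OF f(1) xy] lipschitz_onD[OF g(1) xy] f(2)[OF xy(1)] g(2)[OF xy(2)] AB
    by (intro add_mono mult_mono) (auto simp: dist_norm)
  finally show "dist (f x * g x) (f y * g y) \<le> (A * M + B * L) * dist x y"
    by (simp add: dist_norm algebra_simps)
qed (use AB lipschitz_on_nonneg[OF f(1)] lipschitz_on_nonneg[OF g(1)] in auto)

lemma polynomial_lipschitz:
  fixes p :: "'a::euclidean_space \<Rightarrow> real"
  assumes "real_polynomial_function p"
  shows "\<exists>L. L-lipschitz_on (sphere 0 1) p"
  using assms
proof (induction rule: real_polynomial_function.induct)
  case (linear f)
  show ?case
  proof (intro exI[of _ "onorm f"] lipschitz_onI)
    fix x y :: 'a
    show "dist (f x) (f y) \<le> onorm f * dist x y"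
      using onorm[OF linear, of "x - y"] by (simp add: dist_norm linear_diff[OF bounded_linear.linear[OF linear]])
  qed (rule onorm_pos_le[OF linear])
next
  case (const c)
  show ?case by (intro exI[of _ 0] lipschitz_onI) auto
next
  case (add f g)
  then show ?case using lipschitz_on_add by blast
next
  case (mult f g)
  then obtain L M where LM: "L-lipschitz_on (sphere 0 1) f" "M-lipschitz_on (sphere 0 1) g" by blast
  obtain A B where AB: "A > 0" "\<And>x. x \<in> sphere 0 1 \<Longrightarrow> \<bar>f x\<bar> \<le> A" "B > 0" "\<And>x. x \<in> sphere 0 1 \<Longrightarrow> \<bar>g x\<bar> \<le> B"
    using continuous_sphere_bounded continuous_on_polynomial mult.hyps by metis
  show ?case
    by (intro exI[of _ "A * M + B * L"] lipschitz_on_mult_bounded LM AB less_imp_le)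
qed

text \<open>
  Profiles are composed with \<open>\<theta> \<bullet> x\<close>, which stays in \<open>{-1..1}\<close> on the sphere.
\<close>

definition bounded_profile :: "(real \<Rightarrow> real) set" where
  "bounded_profile = {g. g \<in> borel_measurable borel \<and> (\<exists>B. \<forall>t\<in>{-1..1}. \<bar>g t\<bar> \<le> B)}"

lemma bounded_profileE:
  assumes "g \<in> bounded_profile"
  obtains B where "B > 0" "\<And>t. t \<in> {-1..1} \<Longrightarrow> \<bar>g t\<bar> \<le> B"
proof -
  obtain B where "\<forall>t\<in>{-1..1}. \<bar>g t\<bar> \<le> B" using assms by (auto simp: bounded_profile_def)
  then show ?thesis by (intro that[of "max B 1"]) (auto simp: le_max_iff_disj)
qed

lemma bounded_profile_measurable: "g \<in> bounded_profile \<Longrightarrow> g \<in> borel_measurable borel"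
  by (simp add: bounded_profile_def)

lemma bounded_profileI: "g \<in> borel_measurable borel \<Longrightarrow> (\<And>t. t \<in> {-1..1} \<Longrightarrow> \<bar>g t\<bar> \<le> B) \<Longrightarrow> g \<in> bounded_profile"
  unfolding bounded_profile_def by blast

lemma bounded_profile_continuous:
  assumes "continuous_on UNIV g"
  shows "g \<in> bounded_profile"
proof -
  have "compact (g ` {-1..1})"
    using continuous_on_subset[OF assms] by (intro compact_continuous_image) auto
  then have "bounded (g ` {-1..1})" by (rule compact_imp_bounded)
  then obtain B where "\<forall>t\<in>{-1..1}. \<bar>g t\<bar> \<le> B" by (auto simp: bounded_iff)
  then show ?thesis
    using borel_measurable_continuous_onI[OF assms] by (auto simp: bounded_profile_def)
qed

lemma bounded_profile_add [intro]:
  assumes "f \<in> bounded_profile" "g \<in> bounded_profile"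
  shows "(\<lambda>t. f t + g t) \<in> bounded_profile"
proof -
  obtain A B where "\<And>t. t \<in> {-1..1} \<Longrightarrow> \<bar>f t\<bar> \<le> A" "\<And>t. t \<in> {-1..1} \<Longrightarrow> \<bar>g t\<bar> \<le> B"
    using assms bounded_profileE by metis
  then have "\<bar>f t + g t\<bar> \<le> A + B" if "t \<in> {-1..1}" for t using that by fastforce
  then show ?thesis using assms[THEN bounded_profile_measurable] by (intro bounded_profileI) auto
qed

lemma bounded_profile_mult [intro]:
  assumes "f \<in> bounded_profile" "g \<in> bounded_profile"
  shows "(\<lambda>t. f t * g t) \<in> bounded_profile"
proof -
  obtain A B where AB: "A > 0" "\<And>t. t \<in> {-1..1} \<Longrightarrow> \<bar>f t\<bar> \<le> A" "\<And>t. t \<in> {-1..1} \<Longrightarrow> \<bar>g t\<bar> \<le> B"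
    using assms bounded_profileE by metis
  then have "\<bar>f t * g t\<bar> \<le> A * B" if "t \<in> {-1..1}" for t using that by (auto simp: abs_mult intro!: mult_mono)
  then show ?thesis using assms[THEN bounded_profile_measurable] by (intro bounded_profileI) auto
qed

lemma bounded_profile_const [intro, simp]: "(\<lambda>t. c) \<in> bounded_profile"
  by (rule bounded_profile_continuous) auto

lemma bounded_profile_id [intro, simp]: "(\<lambda>t. t) \<in> bounded_profile"
  by (rule bounded_profile_continuous) auto

lemma bounded_profile_power [intro]: "g \<in> bounded_profile \<Longrightarrow> (\<lambda>t. g t ^ n) \<in> bounded_profile"
  by (induction n) auto

lemma bounded_profile_diff [intro]:
  assumes "f \<in> bounded_profile" "g \<in> bounded_profile"
  shows "(\<lambda>t. f t - g t) \<in> bounded_profile"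
  using bounded_profile_add[OF assms(1) bounded_profile_mult[OF bounded_profile_const[of "-1"] assms(2)]] by simp

lemma bounded_profile_abs [intro]:
  assumes "f \<in> bounded_profile"
  shows "(\<lambda>t. \<bar>f t\<bar>) \<in> bounded_profile"
  using assms by (auto simp: bounded_profile_def)

definition zonal_pairing :: "'a::euclidean_space \<Rightarrow> (real \<Rightarrow> real) \<Rightarrow> ('a \<Rightarrow> real) \<Rightarrow> real" where
  "zonal_pairing \<theta> G p = (LINT x|sphere_measure. G (\<theta> \<bullet> x) * p x)"

lemma inner_sphere_range:
  fixes \<theta> x :: "'a::euclidean_space"
  assumes "\<theta> \<in> sphere 0 1" "x \<in> sphere 0 1"
  shows "\<theta> \<bullet> x \<in> {-1..1}"
  using Cauchy_Schwarz_ineq2[of \<theta> x] assms by (auto simp: abs_le_iff)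

lemma zonal_measurable:
  assumes "g \<in> borel_measurable borel"
  shows "(\<lambda>x. g ((\<theta>::'a::euclidean_space) \<bullet> x) :: real) \<in> borel_measurable sphere_measure"
  by (rule borel_measurable_sphere_borel) (use assms in measurable)

lemma zonal_integrable:
  fixes \<theta> :: "'a::euclidean_space"
  assumes g: "g \<in> bounded_profile" and \<theta>: "\<theta> \<in> sphere 0 1"
  shows "integrable sphere_measure (\<lambda>x. g (\<theta> \<bullet> x))"
proof -
  obtain B where B: "\<And>t. t \<in> {-1..1} \<Longrightarrow> \<bar>g t\<bar> \<le> B" using bounded_profileE[OF g] by metis
  show ?thesis
    using B inner_sphere_range[OF \<theta>]
    by (intro integrable_sphere_bounded[of _ B] zonal_measurable bounded_profile_measurable[OF g]) blast
qed

lemma zonal_pairing_integrable: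
  fixes \<theta> :: "'a::euclidean_space"
  assumes "g \<in> bounded_profile" "\<theta> \<in> sphere 0 1" "real_polynomial_function p"
  shows "integrable sphere_measure (\<lambda>x. g (\<theta> \<bullet> x) * p x)"
  by (intro integrable_sphere_mult_continuous zonal_integrable continuous_on_polynomial assms)

lemma zonal_pairing_add:
  assumes "f \<in> bounded_profile" "g \<in> bounded_profile" "\<theta> \<in> sphere 0 1" "real_polynomial_function p"
  shows "zonal_pairing \<theta> (\<lambda>t. f t + g t) p = zonal_pairing \<theta> f p + zonal_pairing \<theta> g p"
  using zonal_pairing_integrable[OF assms(1,3,4)] zonal_pairing_integrable[OF assms(2,3,4)] by (simp add: zonal_pairing_def distrib_right)

lemma zonal_pairing_diff:
  assumes "f \<in> bounded_profile" "g \<in> bounded_profile" "\<theta> \<in> sphere 0 1" "real_polynomial_function p"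
  shows "zonal_pairing \<theta> (\<lambda>t. f t - g t) p = zonal_pairing \<theta> f p - zonal_pairing \<theta> g p"
  using zonal_pairing_integrable[OF assms(1,3,4)] zonal_pairing_integrable[OF assms(2,3,4)] by (simp add: zonal_pairing_def left_diff_distrib)

lemma zonal_pairing_cmult: "zonal_pairing \<theta> (\<lambda>t. c * f t) p = c * zonal_pairing \<theta> f p"
  by (simp add: zonal_pairing_def mult.assoc)

text \<open>
  At the kink \<open>\<tau>\<close> the value \<open>G' \<tau>\<close> is arbitrary; the Lipschitz condition excludes a jump there.
\<close>

definition kinked :: "real \<Rightarrow> (real \<Rightarrow> real) \<Rightarrow> (real \<Rightarrow> real) \<Rightarrow> bool" where
  "kinked \<tau> G G' \<longleftrightarrow> (\<exists>L. L-lipschitz_on {-1..1} G) \<and> G \<in> bounded_profile \<and> G' \<in> bounded_profile \<and>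
     (\<forall>t. t \<noteq> \<tau> \<longrightarrow> (G has_real_derivative G' t) (at t))"

lemma zonal_divergence:
  fixes \<theta> :: "'a::euclidean_space"
  assumes G: "kinked \<tau> G G'" and \<tau>: "0 \<le> \<tau>" "\<tau> < 1" and \<theta>: "\<theta> \<in> sphere 0 1"
    and p: "real_polynomial_function p" and v: "v \<in> Basis"
  shows "(LINT x|sphere_measure. G' (\<theta> \<bullet> x) * ((\<theta> \<bullet> v) * p x) + G (\<theta> \<bullet> x) * dir_deriv v p x)
     - (LINT x|sphere_measure. (x \<bullet> v) * (G' (\<theta> \<bullet> x) * ((\<theta> \<bullet> x) * p x) + G (\<theta> \<bullet> x) * dir_deriv x p x))
     = (real DIM('a) - 1) * (LINT x|sphere_measure. (x \<bullet> v) * (G (\<theta> \<bullet> x) * p x))"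
proof -
  obtain L where L: "L-lipschitz_on {-1..1} G" and Gb: "G \<in> bounded_profile" "G' \<in> bounded_profile"
    and der: "\<And>t. t \<noteq> \<tau> \<Longrightarrow> (G has_real_derivative G' t) (at t)"
    using G by (auto simp: kinked_def)
  obtain A where A: "A > 0" "\<And>t. t \<in> {-1..1} \<Longrightarrow> \<bar>G t\<bar> \<le> A" using bounded_profileE[OF Gb(1)] by metis
  obtain A' where A': "A' > 0" "\<And>t. t \<in> {-1..1} \<Longrightarrow> \<bar>G' t\<bar> \<le> A'" using bounded_profileE[OF Gb(2)] by metis
  obtain M where M: "M-lipschitz_on (sphere 0 1) p" using polynomial_lipschitz[OF p] by blast
  obtain B where B: "B > 0" "\<And>x. x \<in> sphere 0 1 \<Longrightarrow> \<bar>p x\<bar> \<le> B"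
    using continuous_sphere_bounded[OF continuous_on_polynomial[OF p]] by metis
  have "\<exists>Bv. \<forall>b\<in>Basis. \<forall>x\<in>sphere 0 1. \<bar>dir_deriv b p x\<bar> \<le> Bv"
  proof -
    have "\<forall>b\<in>Basis. \<exists>Bv. Bv > 0 \<and> (\<forall>x\<in>sphere 0 1. \<bar>dir_deriv b p x\<bar> \<le> Bv)"
      using continuous_sphere_bounded[OF continuous_on_polynomial[OF dir_deriv_polynomial[OF p]]] by metis
    then obtain f where f: "\<And>b. b \<in> Basis \<Longrightarrow> f b > 0 \<and> (\<forall>x\<in>sphere 0 1. \<bar>dir_deriv b p x\<bar> \<le> f b)" by metis
    have "\<bar>dir_deriv b p x\<bar> \<le> sum f Basis" if "b \<in> Basis" "x \<in> sphere 0 1" for b x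
    proof -
      have "f b \<le> sum f Basis" using f that by (intro member_le_sum) (auto intro: less_imp_le)
      then show ?thesis using f that by force
    qed
    then show ?thesis by blast
  qed
  then obtain Bv where Bv: "\<And>b x. b \<in> Basis \<Longrightarrow> x \<in> sphere 0 1 \<Longrightarrow> \<bar>dir_deriv b p x\<bar> \<le> Bv" by blast
  have Gx: "L-lipschitz_on (sphere 0 1) (\<lambda>x. G (\<theta> \<bullet> x))"
  proof (rule lipschitz_onI)
    fix x y :: 'a assume xy: "x \<in> sphere 0 1" "y \<in> sphere 0 1"
    have "dist (G (\<theta> \<bullet> x)) (G (\<theta> \<bullet> y)) \<le> L * dist (\<theta> \<bullet> x) (\<theta> \<bullet> y)"
      using xy \<theta> by (intro lipschitz_onD[OF L] inner_sphere_range)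
    also have "dist (\<theta> \<bullet> x) (\<theta> \<bullet> y) \<le> dist x y"
      using Cauchy_Schwarz_ineq2[of \<theta> "x - y"] \<theta> by (simp add: dist_norm inner_diff_right)
    finally show "dist (G (\<theta> \<bullet> x)) (G (\<theta> \<bullet> y)) \<le> L * dist x y"
      using lipschitz_on_nonneg[OF L] by (simp add: mult_left_mono)
  qed (rule lipschitz_on_nonneg[OF L])
  let ?D = "\<lambda>x h. G' (\<theta> \<bullet> x) * ((\<theta> \<bullet> h) * p x) + G (\<theta> \<bullet> x) * dir_deriv h p x"
  show ?thesis
  proof (rule sphere_divergence[of "A * M + B * L" _ ?D "A' * B + A * Bv"])
    show "(A * M + B * L)-lipschitz_on (sphere 0 1) (\<lambda>x. G (\<theta> \<bullet> x) * p x)"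
      using A B inner_sphere_range[OF \<theta>] by (intro lipschitz_on_mult_bounded Gx M) auto
    show "linear (?D x)" for x
      by (rule linearI) (simp_all add: linear_add[OF dir_deriv_linear[OF p]] linear_cmul[OF dir_deriv_linear[OF p]]
          algebra_simps inner_add_right)
    show "(\<lambda>x. ?D x b) \<in> borel_measurable sphere_measure" for b
      by (intro borel_measurable_add borel_measurable_times zonal_measurable bounded_profile_measurable Gb
          borel_measurable_polynomial dir_deriv_polynomial p) auto
    show "\<bar>?D x b\<bar> \<le> A' * B + A * Bv" if b: "b \<in> Basis" and x: "x \<in> sphere 0 1" for b x
    proof -
      have "\<bar>?D x b\<bar> \<le> \<bar>G' (\<theta> \<bullet> x)\<bar> * (\<bar>\<theta> \<bullet> b\<bar> * \<bar>p x\<bar>) + \<bar>G (\<theta> \<bullet> x)\<bar> * \<bar>dir_deriv b p x\<bar>"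
        by (rule order_trans[OF abs_triangle_ineq]) (simp add: abs_mult)
      also have "\<dots> \<le> A' * (1 * B) + A * Bv"
        using A A' B Bv b x Basis_le_norm[OF b, of \<theta>] \<theta> inner_sphere_range[OF \<theta> x]
        by (intro add_mono mult_mono) auto
      finally show ?thesis by simp
    qed
    show "AE x in sphere_measure. ((\<lambda>x. G (\<theta> \<bullet> x) * p x) has_derivative ?D x) (at x)"
      using sphere_slice_null[OF \<theta> \<tau>]
    proof eventually_elim
      case (elim x)
      have "((\<lambda>x. G (\<theta> \<bullet> x)) has_derivative (\<lambda>h. G' (\<theta> \<bullet> x) * (\<theta> \<bullet> h))) (at x)"
        using has_derivative_compose[of "\<lambda>x. \<theta> \<bullet> x" "\<lambda>h. \<theta> \<bullet> h" x UNIV G "\<lambda>h. G' (\<theta> \<bullet> x) * h"]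
          der[OF elim] bounded_linear_imp_has_derivative[OF bounded_linear_inner_right[of \<theta>], of "at x"]
        by (simp add: has_field_derivative_def)
      from has_derivative_mult[OF this dir_deriv_has_derivative[OF p]] show ?case
        by (simp add: algebra_simps)
    qed
  qed (rule v)
qed

text \<open>
  The divergence theorem for the vector field \<open>G (\<theta> \<bullet> x) * \<nabla>p x\<close>. Its divergence is
  \<open>G' (\<theta> \<bullet> x) * \<partial>\<^sub>\<theta> p x\<close> because \<open>p\<close> is harmonic, and its radial component is \<open>m * G (\<theta> \<bullet> x) * p x\<close> by
  Euler's relation.
\<close>

lemma zonal_gradient_identity:
  fixes \<theta> :: "'a::euclidean_space"
  assumes G: "kinked \<tau> G G'" and \<tau>: "0 \<le> \<tau>" "\<tau> < 1" and \<theta>: "\<theta> \<in> sphere 0 1" and p: "p \<in> solid_harmonics m"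
  shows "zonal_pairing \<theta> G' (dir_deriv \<theta> p) = real m * zonal_pairing \<theta> (\<lambda>t. t * G' t) p
     + real m * (real m + real DIM('a) - 2) * zonal_pairing \<theta> G p"
proof -
  have pp: "real_polynomial_function p" using p by (rule solid_harmonicsD)
  have pb: "dir_deriv b p \<in> solid_harmonics (m - 1)" for b using p by (rule solid_harmonics_pd)
  note P = solid_harmonicsD(1)[OF pb]
  have Gb: "G \<in> bounded_profile" "G' \<in> bounded_profile" using G by (auto simp: kinked_def)
  note I = zonal_pairing_integrable[OF _ \<theta>]
  have sp: "(\<Sum>b\<in>Basis. (x \<bullet> b) * dir_deriv b p x) = real m * p x" for x
    using dir_deriv_basis_sum[OF pp, of x x] solid_harmonics_euler[OF p] by simp
  let ?A = "\<lambda>b x. G' (\<theta> \<bullet> x) * ((\<theta> \<bullet> b) * dir_deriv b p x) + G (\<theta> \<bullet> x) * dir_deriv b (dir_deriv b p) x"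
  let ?E = "\<lambda>b x. (x \<bullet> b) * (G' (\<theta> \<bullet> x) * ((\<theta> \<bullet> x) * dir_deriv b p x) + G (\<theta> \<bullet> x) * dir_deriv x (dir_deriv b p) x)"
  let ?C = "\<lambda>b x. (x \<bullet> b) * (G (\<theta> \<bullet> x) * dir_deriv b p x)"
  have iA: "integrable sphere_measure (?A b)" for b
    by (intro Bochner_Integration.integrable_add I Gb dir_deriv_polynomial P poly_mult poly_const)
  have iE: "integrable sphere_measure (?E b)" for b
  proof -
    have "integrable sphere_measure (\<lambda>x. (G' (\<theta> \<bullet> x) * (\<theta> \<bullet> x) + G (\<theta> \<bullet> x) * real (m - 1)) * ((x \<bullet> b) * dir_deriv b p x))"
      by (intro I[where g="\<lambda>t. G' t * t + G t * real (m - 1)"] bounded_profile_add bounded_profile_mult Gb P poly_mult) auto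
    then show ?thesis using solid_harmonics_euler[OF pb] by (simp add: algebra_simps)
  qed
  have iC: "integrable sphere_measure (?C b)" for b
  proof -
    have "integrable sphere_measure (\<lambda>x. G (\<theta> \<bullet> x) * ((x \<bullet> b) * dir_deriv b p x))"
      by (intro I Gb P poly_mult) auto
    then show ?thesis by (simp add: algebra_simps)
  qed
  have "(\<Sum>b\<in>Basis. (LINT x|sphere_measure. ?A b x) - (LINT x|sphere_measure. ?E b x))
      = (\<Sum>b\<in>Basis. (real DIM('a) - 1) * (LINT x|sphere_measure. ?C b x))"
    by (intro sum.cong refl zonal_divergence[OF G \<tau> \<theta> P])
  then have "(LINT x|sphere_measure. (\<Sum>b\<in>Basis. ?A b x)) - (LINT x|sphere_measure. (\<Sum>b\<in>Basis. ?E b x))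
      = (real DIM('a) - 1) * (LINT x|sphere_measure. (\<Sum>b\<in>Basis. ?C b x))"
    using iA iE iC by (simp add: sum_subtractf sum_distrib_left)
  moreover have "(\<Sum>b\<in>Basis. ?A b x) = G' (\<theta> \<bullet> x) * dir_deriv \<theta> p x" for x
    using solid_harmonicsD(3)[OF p] by (simp add: sum.distrib sum_distrib_left[symmetric] dir_deriv_basis_sum[OF pp, of \<theta>])
  moreover have "(\<Sum>b\<in>Basis. ?E b x) = (G' (\<theta> \<bullet> x) * (\<theta> \<bullet> x) + real (m - 1) * G (\<theta> \<bullet> x)) * (real m * p x)" for x
  proof -
    have "(\<Sum>b\<in>Basis. ?E b x) = (\<Sum>b\<in>Basis. (G' (\<theta> \<bullet> x) * (\<theta> \<bullet> x) + real (m - 1) * G (\<theta> \<bullet> x)) * ((x \<bullet> b) * dir_deriv b p x))"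
      using solid_harmonics_euler[OF pb] by (intro sum.cong) (simp_all add: algebra_simps)
    then show ?thesis by (simp add: sum_distrib_left[symmetric] sp)
  qed
  moreover have "(\<Sum>b\<in>Basis. ?C b x) = G (\<theta> \<bullet> x) * (real m * p x)" for x
    unfolding sp[symmetric] by (simp add: sum_distrib_left mult_ac)
  ultimately have *: "zonal_pairing \<theta> G' (dir_deriv \<theta> p)
      - (LINT x|sphere_measure. (G' (\<theta> \<bullet> x) * (\<theta> \<bullet> x) + real (m - 1) * G (\<theta> \<bullet> x)) * (real m * p x))
      = (real DIM('a) - 1) * (real m * zonal_pairing \<theta> G p)"
    by (simp add: zonal_pairing_def mult.left_commute)
  have "(LINT x|sphere_measure. (G' (\<theta> \<bullet> x) * (\<theta> \<bullet> x) + real (m - 1) * G (\<theta> \<bullet> x)) * (real m * p x))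
      = real m * zonal_pairing \<theta> (\<lambda>t. t * G' t + real (m - 1) * G t) p"
    unfolding zonal_pairing_def integral_mult_right_zero[symmetric]
    by (intro Bochner_Integration.integral_cong) (simp_all add: algebra_simps)
  also have "zonal_pairing \<theta> (\<lambda>t. t * G' t + real (m - 1) * G t) p = zonal_pairing \<theta> (\<lambda>t. t * G' t) p + real (m - 1) * zonal_pairing \<theta> G p"
    by (subst zonal_pairing_add) (use Gb \<theta> pp in \<open>auto simp: zonal_pairing_cmult intro!: bounded_profile_mult bounded_profile_power\<close>)
  finally show ?thesis using * by (cases m) (simp_all add: algebra_simps)
qed

text \<open>
  The divergence theorem for the vector field \<open>(G (\<theta> \<bullet> x) * p x) *\<^sub>R \<theta>\<close>.
\<close>

lemma zonal_axis_identity: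
  fixes \<theta> :: "'a::euclidean_space"
  assumes G: "kinked \<tau> G G'" and \<tau>: "0 \<le> \<tau>" "\<tau> < 1" and \<theta>: "\<theta> \<in> sphere 0 1" and p: "p \<in> solid_harmonics m"
  shows "zonal_pairing \<theta> (\<lambda>t. (1 - t\<^sup>2) * G' t) p + zonal_pairing \<theta> G (dir_deriv \<theta> p)
     = (real m + real DIM('a) - 1) * zonal_pairing \<theta> (\<lambda>t. t * G t) p"
proof -
  have pp: "real_polynomial_function p" using p by (rule solid_harmonicsD)
  have Gb: "G \<in> bounded_profile" "G' \<in> bounded_profile" using G by (auto simp: kinked_def)
  note I = zonal_pairing_integrable[OF _ \<theta>]
  let ?A = "\<lambda>b x. G' (\<theta> \<bullet> x) * ((\<theta> \<bullet> b) * p x) + G (\<theta> \<bullet> x) * dir_deriv b p x"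
  let ?E = "\<lambda>b x. (x \<bullet> b) * (G' (\<theta> \<bullet> x) * ((\<theta> \<bullet> x) * p x) + G (\<theta> \<bullet> x) * dir_deriv x p x)"
  let ?C = "\<lambda>b x. (x \<bullet> b) * (G (\<theta> \<bullet> x) * p x)"
  have iA: "integrable sphere_measure (?A b)" for b
    by (intro Bochner_Integration.integrable_add I Gb dir_deriv_polynomial pp poly_mult poly_const)
  have iE: "integrable sphere_measure (?E b)" for b
  proof -
    have "integrable sphere_measure (\<lambda>x. (G' (\<theta> \<bullet> x) * (\<theta> \<bullet> x) + G (\<theta> \<bullet> x) * real m) * ((x \<bullet> b) * p x))"
      by (intro I[where g="\<lambda>t. G' t * t + G t * real m"] bounded_profile_add bounded_profile_mult Gb pp poly_mult) auto
    then show ?thesis using solid_harmonics_euler[OF p] by (simp add: algebra_simps)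
  qed
  have iC: "integrable sphere_measure (?C b)" for b
  proof -
    have "integrable sphere_measure (\<lambda>x. G (\<theta> \<bullet> x) * ((x \<bullet> b) * p x))"
      by (intro I Gb pp poly_mult) auto
    then show ?thesis by (simp add: algebra_simps)
  qed
  have "(\<Sum>b\<in>Basis. (\<theta> \<bullet> b) * ((LINT x|sphere_measure. ?A b x) - (LINT x|sphere_measure. ?E b x)))
      = (\<Sum>b\<in>Basis. (\<theta> \<bullet> b) * ((real DIM('a) - 1) * (LINT x|sphere_measure. ?C b x)))"
    by (intro sum.cong refl arg_cong2[where f="(*)"] zonal_divergence[OF G \<tau> \<theta> pp])
  then have "(LINT x|sphere_measure. (\<Sum>b\<in>Basis. (\<theta> \<bullet> b) * ?A b x)) - (LINT x|sphere_measure. (\<Sum>b\<in>Basis. (\<theta> \<bullet> b) * ?E b x))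
      = (real DIM('a) - 1) * (LINT x|sphere_measure. (\<Sum>b\<in>Basis. (\<theta> \<bullet> b) * ?C b x))"
    using iA iE iC
    by (simp only: sum_subtractf sum_distrib_left right_diff_distrib mult.left_commute[of "_ \<bullet> _" "real DIM('a) - 1"]
        Bochner_Integration.integral_sum integrable_mult_right simp_thms integral_mult_right_zero)
  moreover have "(\<Sum>b\<in>Basis. (\<theta> \<bullet> b) * ?A b x) = G' (\<theta> \<bullet> x) * p x + G (\<theta> \<bullet> x) * dir_deriv \<theta> p x" for x
  proof -
    have "(\<Sum>b\<in>Basis. (\<theta> \<bullet> b) * ?A b x) = G' (\<theta> \<bullet> x) * p x * (\<Sum>b\<in>Basis. (\<theta> \<bullet> b) * (\<theta> \<bullet> b)) + G (\<theta> \<bullet> x) * dir_deriv \<theta> p x"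
      by (simp add: dir_deriv_basis_sum[OF pp, of \<theta>] sum_distrib_left sum.distrib algebra_simps)
    also have "(\<Sum>b\<in>Basis. (\<theta> \<bullet> b) * (\<theta> \<bullet> b)) = 1"
      using \<theta> by (simp add: euclidean_inner[symmetric] dot_square_norm)
    finally show ?thesis by simp
  qed
  moreover have sp: "(\<Sum>b\<in>Basis. (\<theta> \<bullet> b) * ((x \<bullet> b) * c)) = (\<theta> \<bullet> x) * c" for c x
    by (simp add: euclidean_inner[of \<theta> x] sum_distrib_right mult.assoc)
  ultimately have *: "(LINT x|sphere_measure. G' (\<theta> \<bullet> x) * p x + G (\<theta> \<bullet> x) * dir_deriv \<theta> p x)
     - (LINT x|sphere_measure. (\<theta> \<bullet> x) * (G' (\<theta> \<bullet> x) * ((\<theta> \<bullet> x) * p x) + G (\<theta> \<bullet> x) * (real m * p x)))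
     = (real DIM('a) - 1) * (LINT x|sphere_measure. (\<theta> \<bullet> x) * (G (\<theta> \<bullet> x) * p x))"
    by (simp add: solid_harmonics_euler[OF p])
  have 1: "(LINT x|sphere_measure. G' (\<theta> \<bullet> x) * p x + G (\<theta> \<bullet> x) * dir_deriv \<theta> p x) = zonal_pairing \<theta> G' p + zonal_pairing \<theta> G (dir_deriv \<theta> p)"
    using I[OF Gb(2) pp] I[OF Gb(1) dir_deriv_polynomial[OF pp]] by (simp add: zonal_pairing_def)
  have 2: "(LINT x|sphere_measure. (\<theta> \<bullet> x) * (G' (\<theta> \<bullet> x) * ((\<theta> \<bullet> x) * p x) + G (\<theta> \<bullet> x) * (real m * p x)))
     = zonal_pairing \<theta> (\<lambda>t. t\<^sup>2 * G' t + real m * (t * G t)) p"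
    by (simp add: zonal_pairing_def algebra_simps power2_eq_square)
  have 3: "zonal_pairing \<theta> (\<lambda>t. t\<^sup>2 * G' t + real m * (t * G t)) p = zonal_pairing \<theta> (\<lambda>t. t\<^sup>2 * G' t) p + real m * zonal_pairing \<theta> (\<lambda>t. t * G t) p"
    by (subst zonal_pairing_add) (use Gb \<theta> pp in \<open>auto simp: zonal_pairing_cmult intro!: bounded_profile_mult bounded_profile_power\<close>)
  have 4: "zonal_pairing \<theta> (\<lambda>t. (1 - t\<^sup>2) * G' t) p = zonal_pairing \<theta> G' p - zonal_pairing \<theta> (\<lambda>t. t\<^sup>2 * G' t) p"
    unfolding left_diff_distrib mult_1 by (subst zonal_pairing_diff) (use Gb \<theta> pp in \<open>auto intro!: bounded_profile_mult bounded_profile_power\<close>)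
  have 5: "(LINT x|sphere_measure. (\<theta> \<bullet> x) * (G (\<theta> \<bullet> x) * p x)) = zonal_pairing \<theta> (\<lambda>t. t * G t) p"
    by (simp add: zonal_pairing_def mult.assoc)
  show ?thesis using *[unfolded 1 2 3 5] 4 by (simp add: algebra_simps)
qed

text \<open>
  On functions of \<open>\<theta> \<bullet> x\<close> the Laplace-Beltrami operator is \<open>(1 - t\<^sup>2) * G'' - (N - 1) * t * G'\<close>, and
  \<open>- m * (m + N - 2)\<close> is its eigenvalue on harmonics of degree \<open>m\<close>. When the second identity is applied
  to \<open>G1\<close> and the first one to \<open>G\<close>, the terms with \<open>\<partial>\<^sub>\<theta> p\<close> cancel.
\<close>

lemma zonal_laplacian_eigenvalue:
  fixes \<theta> :: "'a::euclidean_space"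
  assumes G: "kinked \<tau> G G1" "kinked \<tau> G1 G2" and \<tau>: "0 \<le> \<tau>" "\<tau> < 1" and \<theta>: "\<theta> \<in> sphere 0 1" and p: "p \<in> solid_harmonics m"
  shows "zonal_pairing \<theta> (\<lambda>t. (1 - t\<^sup>2) * G2 t - (real DIM('a) - 1) * (t * G1 t)) p
     = - (real m * (real m + real DIM('a) - 2)) * zonal_pairing \<theta> G p"
proof -
  have "zonal_pairing \<theta> (\<lambda>t. (1 - t\<^sup>2) * G2 t - (real DIM('a) - 1) * (t * G1 t)) p
     = zonal_pairing \<theta> (\<lambda>t. (1 - t\<^sup>2) * G2 t) p - (real DIM('a) - 1) * zonal_pairing \<theta> (\<lambda>t. t * G1 t) p"
    using G \<theta> solid_harmonicsD(1)[OF p]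
    by (subst zonal_pairing_diff)
      (auto simp: kinked_def zonal_pairing_cmult intro!: bounded_profile_mult bounded_profile_diff bounded_profile_power)
  then show ?thesis
    using zonal_gradient_identity[OF G(1) \<tau> \<theta> p] zonal_axis_identity[OF G(2) \<tau> \<theta> p] by (simp add: algebra_simps)
qed

lemma kinked_const: "kinked \<tau> (\<lambda>t. c) (\<lambda>t. 0)"
  unfolding kinked_def by (auto intro!: exI[of _ 0] lipschitz_onI)

text \<open>
  The divergence theorem for \<open>p x * \<nabla>q x - q x * \<nabla>p x\<close>, which is free of divergence and has the radial
  component \<open>(l - m) * p x * q x\<close>.
\<close>

lemma harmonic_orthogonal:
  fixes p q :: "'a::euclidean_space \<Rightarrow> real"
  assumes p: "p \<in> solid_harmonics m" and q: "q \<in> solid_harmonics l" and ml: "m \<noteq> l" and N: "DIM('a) \<ge> 2"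
  shows "(LINT x|sphere_measure. p x * q x) = 0"
proof -
  have pp: "real_polynomial_function p" and qq: "real_polynomial_function q" using p q by (auto dest: solid_harmonicsD)
  define P where "P b = (\<lambda>x. p x * dir_deriv b q x - dir_deriv b p x * q x)" for b
  have P: "real_polynomial_function (P b)" for b
    unfolding P_def by (intro poly_mult real_polynomial_function_diff pp qq dir_deriv_polynomial)
  have pdP: "dir_deriv v (P b) x = p x * dir_deriv v (dir_deriv b q) x + dir_deriv v p x * dir_deriv b q x - (dir_deriv b p x * dir_deriv v q x + dir_deriv v (dir_deriv b p) x * q x)" for v b x
    unfolding P_def by (simp add: dir_deriv_diff dir_deriv_mult poly_mult pp qq dir_deriv_polynomial)
  obtain \<theta> :: 'a where \<theta>: "\<theta> \<in> sphere 0 1" using SOME_Basis[where 'a='a] norm_Basis by (metis dist_0_norm mem_sphere)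
  have div: "(LINT x|sphere_measure. dir_deriv b (P b) x) - (LINT x|sphere_measure. (x \<bullet> b) * dir_deriv x (P b) x)
     = (real DIM('a) - 1) * (LINT x|sphere_measure. (x \<bullet> b) * P b x)" if "b \<in> Basis" for b
    using zonal_divergence[OF kinked_const[of 0 1] _ _ \<theta> P that] by simp
  have sp: "(\<Sum>b\<in>Basis. (x \<bullet> b) * dir_deriv b p x) = real m * p x" "(\<Sum>b\<in>Basis. (x \<bullet> b) * dir_deriv b q x) = real l * q x" for x
    using dir_deriv_basis_sum[OF pp, of x x] solid_harmonics_euler[OF p] dir_deriv_basis_sum[OF qq, of x x] solid_harmonics_euler[OF q] by auto
  have pdx: "dir_deriv x (P b) x = (real (l - 1) + real m) * (p x * dir_deriv b q x) - (real l + real (m - 1)) * (dir_deriv b p x * q x)" for x b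
    unfolding pdP solid_harmonics_euler[OF p] solid_harmonics_euler[OF q] solid_harmonics_euler[OF solid_harmonics_pd[OF p]] solid_harmonics_euler[OF solid_harmonics_pd[OF q]]
    by (simp add: algebra_simps)
  have s1: "(\<Sum>b\<in>Basis. dir_deriv b (P b) x) = 0" for x
  proof -
    have "(\<Sum>b\<in>Basis. dir_deriv b (P b) x) = p x * (\<Sum>b\<in>Basis. dir_deriv b (dir_deriv b q) x) - (\<Sum>b\<in>Basis. dir_deriv b (dir_deriv b p) x) * q x"
      unfolding pdP by (simp add: sum.distrib sum_subtractf sum_distrib_left sum_distrib_right)
    then show ?thesis using solid_harmonicsD(3)[OF p] solid_harmonicsD(3)[OF q] by simp
  qed
  have s3: "(\<Sum>b\<in>Basis. (x \<bullet> b) * P b x) = (real l - real m) * (p x * q x)" for x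
  proof -
    have "(\<Sum>b\<in>Basis. (x \<bullet> b) * P b x) = p x * (\<Sum>b\<in>Basis. (x \<bullet> b) * dir_deriv b q x) - (\<Sum>b\<in>Basis. (x \<bullet> b) * dir_deriv b p x) * q x"
      by (simp add: P_def sum_distrib_left sum_distrib_right sum_subtractf algebra_simps)
    then show ?thesis by (simp add: sp algebra_simps)
  qed
  have s2: "(\<Sum>b\<in>Basis. (x \<bullet> b) * dir_deriv x (P b) x) = (real l - real m) * (real m + real l - 1) * (p x * q x)" for x
  proof -
    have "(\<Sum>b\<in>Basis. (x \<bullet> b) * dir_deriv x (P b) x) = (real (l - 1) + real m) * (p x * (\<Sum>b\<in>Basis. (x \<bullet> b) * dir_deriv b q x))
       - (real l + real (m - 1)) * ((\<Sum>b\<in>Basis. (x \<bullet> b) * dir_deriv b p x) * q x)"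
      unfolding pdx by (simp add: sum_distrib_left sum_distrib_right sum_subtractf algebra_simps)
    also have "\<dots> = ((real (l - 1) + real m) * real l - (real l + real (m - 1)) * real m) * (p x * q x)"
      by (simp add: sp algebra_simps)
    also have "(real (l - 1) + real m) * real l - (real l + real (m - 1)) * real m = (real l - real m) * (real m + real l - 1)"
      by (cases l; cases m) (simp_all add: algebra_simps)
    finally show ?thesis .
  qed
  have i1: "integrable sphere_measure (dir_deriv b (P b))" for b
    by (intro integrable_sphere_continuous continuous_on_polynomial dir_deriv_polynomial P)
  have i3: "integrable sphere_measure (\<lambda>x. (x \<bullet> b) * P b x)" for b
    by (intro integrable_sphere_continuous continuous_on_polynomial poly_mult P) auto
  have i2: "integrable sphere_measure (\<lambda>x. (x \<bullet> b) * dir_deriv x (P b) x)" for b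
    unfolding pdx by (intro integrable_sphere_continuous continuous_on_polynomial poly_mult real_polynomial_function_diff poly_const pp qq dir_deriv_polynomial) auto
  have "(\<Sum>b\<in>Basis. (LINT x|sphere_measure. dir_deriv b (P b) x) - (LINT x|sphere_measure. (x \<bullet> b) * dir_deriv x (P b) x))
     = (\<Sum>b\<in>Basis. (real DIM('a) - 1) * (LINT x|sphere_measure. (x \<bullet> b) * P b x))"
    using div by (intro sum.cong) auto
  then have "(LINT x|sphere_measure. (\<Sum>b\<in>Basis. dir_deriv b (P b) x)) - (LINT x|sphere_measure. (\<Sum>b\<in>Basis. (x \<bullet> b) * dir_deriv x (P b) x))
     = (real DIM('a) - 1) * (LINT x|sphere_measure. (\<Sum>b\<in>Basis. (x \<bullet> b) * P b x))"
    using i1 i2 i3 by (simp add: sum_subtractf sum_distrib_left)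
  then have "(real l - real m) * (real m + real l + real DIM('a) - 2) * (LINT x|sphere_measure. p x * q x) = 0"
    unfolding s1 s2 s3 integral_mult_right_zero by (simp add: algebra_simps)
  moreover have "real m + real l + real DIM('a) - 2 \<noteq> 0" using ml N by linarith
  ultimately show ?thesis using ml by simp
qed

lemma measure_sphere_measure [simp]:
  "measure (sphere_measure :: 'a::euclidean_space measure) (sphere 0 1) = 1"
  by (simp add: measure_def emeasure_sphere_measure_space)

section \<open>Completeness of the spherical harmonics\<close>

text \<open>
  The finite sums of spherical harmonics, as functions on the sphere.
\<close>

definition harmonic_sums :: "('a::euclidean_space \<Rightarrow> real) set" where
  "harmonic_sums = {f. \<exists>M p. (\<forall>m<M. p m \<in> solid_harmonics m) \<and> (\<forall>x\<in>sphere 0 1. f x = (\<Sum>m<M. p m x))}"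

lemma solid_harmonics_cmult: "p \<in> solid_harmonics m \<Longrightarrow> (\<lambda>x. c * p x) \<in> solid_harmonics m"
  using solid_harmonics_lincomb[of "{()}" "\<lambda>_. p" m "\<lambda>_. c"] by simp

lemma solid_harmonics_add: "p \<in> solid_harmonics m \<Longrightarrow> q \<in> solid_harmonics m \<Longrightarrow> (\<lambda>x. p x + q x) \<in> solid_harmonics m"
  using solid_harmonics_lincomb[of "{True, False}" "\<lambda>b. if b then p else q" m "\<lambda>_. 1"] by simp

lemma solid_harmonics_zero: "(\<lambda>x. 0) \<in> solid_harmonics m"
  using solid_harmonics_lincomb[of "{}" "undefined :: unit \<Rightarrow> _" m] by simp

lemma harmonic_sums_cong: "f \<in> harmonic_sums \<Longrightarrow> (\<And>x. x \<in> sphere 0 1 \<Longrightarrow> g x = f x) \<Longrightarrow> g \<in> harmonic_sums"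
  unfolding harmonic_sums_def mem_Collect_eq by (elim exE conjE) (intro exI conjI, assumption, simp)

lemma harmonic_sums_extend:
  assumes "\<forall>m<M. p m \<in> solid_harmonics m" "M \<le> K"
  shows "\<exists>q. (\<forall>m<K. q m \<in> solid_harmonics m) \<and> (\<forall>x. (\<Sum>m<M. p m x) = (\<Sum>m<K. q m x))"
proof (intro exI[of _ "\<lambda>m. if m < M then p m else (\<lambda>x. 0)"] conjI allI impI)
  fix x
  show "(\<Sum>m<M. p m x) = (\<Sum>m<K. (if m < M then p m else (\<lambda>x. 0)) x)"
    using assms(2) by (intro sum.mono_neutral_cong_left) auto
qed (use assms solid_harmonics_zero in auto)

lemma harmonic_sums_add:
  assumes "f \<in> harmonic_sums" "g \<in> harmonic_sums"
  shows "(\<lambda>x. f x + g x) \<in> harmonic_sums"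
proof -
  obtain M p where p: "\<forall>m<M. p m \<in> solid_harmonics m" "\<forall>x\<in>sphere 0 1. f x = (\<Sum>m<M. p m x)" using assms(1) by (auto simp: harmonic_sums_def)
  obtain K q where q: "\<forall>m<K. q m \<in> solid_harmonics m" "\<forall>x\<in>sphere 0 1. g x = (\<Sum>m<K. q m x)" using assms(2) by (auto simp: harmonic_sums_def)
  obtain p' where p': "\<forall>m<max M K. p' m \<in> solid_harmonics m" "\<forall>x. (\<Sum>m<M. p m x) = (\<Sum>m<max M K. p' m x)"
    using harmonic_sums_extend[OF p(1), of "max M K"] by auto
  obtain q' where q': "\<forall>m<max M K. q' m \<in> solid_harmonics m" "\<forall>x. (\<Sum>m<K. q m x) = (\<Sum>m<max M K. q' m x)"
    using harmonic_sums_extend[OF q(1), of "max M K"] by auto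
  show ?thesis unfolding harmonic_sums_def mem_Collect_eq
    by (intro exI[of _ "max M K"] exI[of _ "\<lambda>m x. p' m x + q' m x"])
      (use p(2) q(2) p' q' in \<open>auto simp: sum.distrib intro!: solid_harmonics_add\<close>)
qed

lemma harmonic_sums_cmult:
  assumes "f \<in> harmonic_sums"
  shows "(\<lambda>x. c * f x) \<in> harmonic_sums"
proof -
  obtain M p where p: "\<forall>m<M. p m \<in> solid_harmonics m" "\<forall>x\<in>sphere 0 1. f x = (\<Sum>m<M. p m x)" using assms(1) by (auto simp: harmonic_sums_def)
  show ?thesis unfolding harmonic_sums_def mem_Collect_eq
    by (intro exI[of _ M] exI[of _ "\<lambda>m x. c * p m x"]) (use p in \<open>auto simp: sum_distrib_left intro!: solid_harmonics_cmult\<close>)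
qed

lemma harmonic_sums_sum: "finite I \<Longrightarrow> (\<And>i. i \<in> I \<Longrightarrow> f i \<in> harmonic_sums) \<Longrightarrow> (\<lambda>x. \<Sum>i\<in>I. f i x) \<in> harmonic_sums"
proof (induction I rule: finite_induct)
  case empty
  show ?case by (auto simp: harmonic_sums_def intro!: exI[of _ 0])
next
  case (insert i I)
  then show ?case using harmonic_sums_add[of "f i" "\<lambda>x. \<Sum>i\<in>I. f i x"] by simp
qed

lemma solid_harmonics_subset: "p \<in> solid_harmonics m \<Longrightarrow> p \<in> harmonic_sums"
  unfolding harmonic_sums_def mem_Collect_eq
  by (intro exI[of _ "Suc m"] exI[of _ "\<lambda>k. if k = m then p else (\<lambda>x. 0)"])
    (auto simp: solid_harmonics_zero if_distrib[of "\<lambda>f. f x" for x] cong: if_cong)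

text \<open>
  The Laplacian of \<open>(x \<bullet> v) * H x\<close> is \<open>2 * \<partial>\<^sub>v H x\<close>, and that of \<open>(x \<bullet> x) * \<partial>\<^sub>v H x\<close> is
  \<open>2 * (N + 2 * m - 2) * \<partial>\<^sub>v H x\<close>. On the sphere, where \<open>x \<bullet> x = 1\<close>, it follows that a coordinate
  times a harmonic is a sum of harmonics of degrees \<open>m + 1\<close> and \<open>m - 1\<close>.
\<close>

lemma solid_harmonics_coordinate_mult:
  fixes H :: "'a::euclidean_space \<Rightarrow> real"
  assumes H: "H \<in> solid_harmonics m" and v: "v \<in> Basis" and N: "real DIM('a) + 2 * real m - 2 \<noteq> 0"
  shows "(\<lambda>x. (x \<bullet> v) * H x - (x \<bullet> x) * dir_deriv v H x / (real DIM('a) + 2 * real m - 2)) \<in> solid_harmonics (m + 1)"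
proof -
  define K where "K = real DIM('a) + 2 * real m - 2"
  define c where "c = 1 / K"
  have K: "K \<noteq> 0" using N by (simp add: K_def)
  define D where "D = dir_deriv v H"
  have D: "D \<in> solid_harmonics (m - 1)" unfolding D_def by (rule solid_harmonics_pd[OF H])
  note Hp = solid_harmonicsD(1)[OF H] and Dp = solid_harmonicsD(1)[OF D]
  have D0: "D x = 0" if "m = 0" for x
    using H that solid_harmonicsD(2)[of H 0 0] by (metis D_def solid_harmonics_0_const dir_deriv_const ext)
  let ?K = "\<lambda>x. (x \<bullet> v) * H x - c * ((x \<bullet> x) * D x)"
  have pK: "real_polynomial_function ?K"
    by (intro poly_intros Hp Dp) auto
  have pdK: "dir_deriv b ?K = (\<lambda>x. ((x \<bullet> v) * dir_deriv b H x + (b \<bullet> v) * H x) - c * ((x \<bullet> x) * dir_deriv b D x + 2 * (b \<bullet> x) * D x))" for b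
    by (rule ext) (simp add: dir_deriv_diff dir_deriv_mult dir_deriv_cmult poly_intros Hp Dp)
  have pp: "dir_deriv b (dir_deriv b ?K) x = ((x \<bullet> v) * dir_deriv b (dir_deriv b H) x + 2 * (b \<bullet> v) * dir_deriv b H x)
     - c * ((x \<bullet> x) * dir_deriv b (dir_deriv b D) x + 4 * (b \<bullet> x) * dir_deriv b D x + 2 * (b \<bullet> b) * D x)" for b x
  proof -
    have q: "real_polynomial_function (\<lambda>x. (x \<bullet> v) * dir_deriv b H x)" "real_polynomial_function (\<lambda>x. (b \<bullet> v) * H x)"
      "real_polynomial_function (\<lambda>x. (x \<bullet> x) * dir_deriv b D x)" "real_polynomial_function (\<lambda>x. 2 * (b \<bullet> x) * D x)"
      "real_polynomial_function (\<lambda>x. 2 * (b \<bullet> x))"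
      by (intro poly_intros Hp Dp dir_deriv_polynomial; auto)+
    show ?thesis unfolding pdK
      using Hp Dp q by (simp add: dir_deriv_diff dir_deriv_add dir_deriv_cmult dir_deriv_mult poly_intros dir_deriv_polynomial algebra_simps)
  qed
  have "(\<Sum>b\<in>Basis. dir_deriv b (dir_deriv b ?K) x) = 0" for x
  proof -
    have "(\<Sum>b\<in>Basis. dir_deriv b (dir_deriv b ?K) x) =
       (x \<bullet> v) * (\<Sum>b\<in>Basis. dir_deriv b (dir_deriv b H) x) + 2 * (\<Sum>b\<in>Basis. (v \<bullet> b) * dir_deriv b H x)
       - c * ((x \<bullet> x) * (\<Sum>b\<in>Basis. dir_deriv b (dir_deriv b D) x) + 4 * (\<Sum>b\<in>Basis. (x \<bullet> b) * dir_deriv b D x) + 2 * (\<Sum>b\<in>(Basis::'a set). (b \<bullet> b) * D x))"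
      unfolding pp by (simp add: sum_subtractf sum.distrib sum_distrib_left inner_commute mult_ac distrib_left)
    also have "\<dots> = 2 * D x - c * (4 * (real (m - 1) * D x) + 2 * real DIM('a) * D x)"
      using solid_harmonicsD(3)[OF H] solid_harmonicsD(3)[OF D] dir_deriv_basis_sum[OF Hp, of v x] dir_deriv_basis_sum[OF Dp, of x x] solid_harmonics_euler[OF D]
      by (simp add: D_def)
    also have "\<dots> = 0"
    proof (cases "m = 0")
      case True then show ?thesis using D0 by simp
    next
      case False
      then have "4 * (real (m - 1) * D x) + 2 * real DIM('a) * D x = 2 * K * D x"
        by (simp add: K_def of_nat_diff algebra_simps)
      then show ?thesis using K by (simp add: c_def)
    qed
    finally show ?thesis .
  qed
  moreover have "?K (a *\<^sub>R x) = a ^ (m + 1) * ?K x" for a x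
    using solid_harmonicsD(2)[OF H, of a x] solid_harmonicsD(2)[OF D, of a x] D0 by (cases m) (simp_all add: algebra_simps)
  ultimately have "?K \<in> solid_harmonics (m + 1)" using pK by (simp add: solid_harmonics_def)
  then show ?thesis by (simp add: c_def D_def K_def)
qed

lemma harmonic_sums_coordinate_mult:
  fixes f :: "'a::euclidean_space \<Rightarrow> real"
  assumes f: "f \<in> harmonic_sums" and v: "v \<in> Basis" and N: "DIM('a) \<ge> 3"
  shows "(\<lambda>x. (x \<bullet> v) * f x) \<in> harmonic_sums"
proof -
  obtain M p where p: "\<forall>m<M. p m \<in> solid_harmonics m" "\<forall>x\<in>sphere 0 1. f x = (\<Sum>m<M. p m x)" using f by (auto simp: harmonic_sums_def)
  have "(\<lambda>x. (x \<bullet> v) * H x) \<in> harmonic_sums" if H: "H \<in> solid_harmonics m" for m H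
  proof -
    let ?c = "1 / (real DIM('a) + 2 * real m - 2)"
    have "(\<lambda>x. (x \<bullet> v) * H x - (x \<bullet> x) * dir_deriv v H x / (real DIM('a) + 2 * real m - 2)) \<in> harmonic_sums"
      using N by (intro solid_harmonics_subset[where m="m + 1"] solid_harmonics_coordinate_mult H v) auto
    moreover have "(\<lambda>x. ?c * dir_deriv v H x) \<in> harmonic_sums"
      by (intro harmonic_sums_cmult solid_harmonics_subset[OF solid_harmonics_pd[OF H]])
    ultimately have "(\<lambda>x. ((x \<bullet> v) * H x - (x \<bullet> x) * dir_deriv v H x / (real DIM('a) + 2 * real m - 2)) + ?c * dir_deriv v H x) \<in> harmonic_sums"
      by (rule harmonic_sums_add)
    then show ?thesis by (rule harmonic_sums_cong) (simp add: dot_square_norm)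
  qed
  then have "(\<lambda>x. \<Sum>m<M. (x \<bullet> v) * p m x) \<in> harmonic_sums"
    using p(1) by (intro harmonic_sums_sum) auto
  then show ?thesis by (rule harmonic_sums_cong) (simp add: p(2) sum_distrib_left)
qed

text \<open>
  The sums of harmonics contain the constants and are closed under multiplication by coordinates, hence
  by polynomials.
\<close>

lemma polynomial_in_harmonic_sums:
  fixes p :: "'a::euclidean_space \<Rightarrow> real"
  assumes p: "real_polynomial_function p" and N: "DIM('a) \<ge> 3"
  shows "p \<in> harmonic_sums"
proof -
  have "\<forall>h\<in>harmonic_sums. (\<lambda>x. p x * h x) \<in> harmonic_sums" using p
  proof (induction rule: real_polynomial_function.induct)
    case (linear f)
    have fx: "f x = (\<Sum>b\<in>Basis. f b * (x \<bullet> b))" for x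
      using linear_sum[OF bounded_linear.linear[OF linear], of "\<lambda>b. (x \<bullet> b) *\<^sub>R b" Basis]
        linear_cmul[OF bounded_linear.linear[OF linear]]
      by (simp add: euclidean_representation mult.commute)
    show ?case
    proof
      fix h assume h: "h \<in> (harmonic_sums :: ('a \<Rightarrow> real) set)"
      have "(\<lambda>x. \<Sum>b\<in>Basis. f b * ((x \<bullet> b) * h x)) \<in> harmonic_sums"
        by (intro harmonic_sums_sum harmonic_sums_cmult harmonic_sums_coordinate_mult h N) auto
      moreover have "f x * h x = (\<Sum>b\<in>Basis. f b * ((x \<bullet> b) * h x))" for x
        by (subst fx) (simp add: sum_distrib_right mult.assoc)
      ultimately show "(\<lambda>x. f x * h x) \<in> harmonic_sums" by simp
    qed
  next
    case (const c)
    then show ?case using harmonic_sums_cmult by blast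
  next
    case (add f g)
    show ?case
    proof
      fix h :: "'a \<Rightarrow> real" assume "h \<in> harmonic_sums"
      then show "(\<lambda>x. (f x + g x) * h x) \<in> harmonic_sums"
        using harmonic_sums_add[of "\<lambda>x. f x * h x" "\<lambda>x. g x * h x"] add.IH by (simp add: distrib_right)
    qed
  next
    case (mult f g)
    then show ?case by (simp add: mult.assoc)
  qed
  then show ?thesis using solid_harmonics_subset[OF solid_harmonics_const[of 1]] by fastforce
qed

section \<open>Bessel and Parseval\<close>

lemma sphere_L2_integrable:
  assumes "f \<in> sphere_L2"
  shows "integrable sphere_measure (f :: 'a::euclidean_space \<Rightarrow> real)" "integrable sphere_measure (\<lambda>x. (f x)\<^sup>2)"
proof -
  show 2: "integrable sphere_measure (\<lambda>x. (f x)\<^sup>2)" using assms by (simp add: sphere_L2_def)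
  have m: "f \<in> borel_measurable sphere_measure" using assms by (simp add: sphere_L2_def)
  have "\<bar>f x\<bar> \<le> 1 + (f x)\<^sup>2" for x
    using zero_le_power2[of "\<bar>f x\<bar> - 1"] by (simp add: power2_diff)
  then show "integrable sphere_measure f"
    by (intro Bochner_Integration.integrable_bound[OF Bochner_Integration.integrable_add[OF sphere_measure.integrable_const[of 1] 2] m])
      auto
qed

lemma continuous_sphere_L2: "continuous_on (sphere 0 1) f \<Longrightarrow> f \<in> sphere_L2"
  unfolding sphere_L2_def
  by (auto intro!: borel_measurable_sphere_continuous integrable_sphere_continuous continuous_intros)

locale spherical_basis =
  fixes Y :: "nat \<Rightarrow> nat \<Rightarrow> 'a::euclidean_space \<Rightarrow> real" and N :: "nat \<Rightarrow> nat"
  assumes onb: "harmonic_onb Y N" and dim3: "DIM('a) \<ge> 3"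
begin

definition Ypoly :: "nat \<Rightarrow> nat \<Rightarrow> 'a \<Rightarrow> real" where
  "Ypoly m l = (SOME p. p \<in> solid_harmonics m \<and> (\<forall>\<eta>\<in>sphere 0 1. Y m l \<eta> = p \<eta>))"

lemma Ypoly: assumes "l \<in> {1..N m}" shows "Ypoly m l \<in> solid_harmonics m" "\<eta> \<in> sphere 0 1 \<Longrightarrow> Y m l \<eta> = Ypoly m l \<eta>"
proof -
  have "\<exists>p. p \<in> solid_harmonics m \<and> (\<forall>\<eta>\<in>sphere 0 1. Y m l \<eta> = p \<eta>)"
    using onb assms unfolding harmonic_onb_def spherical_harmonics_iff by blast
  from someI_ex[OF this] show "Ypoly m l \<in> solid_harmonics m" "\<eta> \<in> sphere 0 1 \<Longrightarrow> Y m l \<eta> = Ypoly m l \<eta>"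
    unfolding Ypoly_def by blast+
qed

lemma Ypoly_polynomial: "l \<in> {1..N m} \<Longrightarrow> real_polynomial_function (Ypoly m l)"
  using Ypoly(1) solid_harmonicsD(1) by blast

lemma sphere_inner_Y:
  assumes "l \<in> {1..N m}"
  shows "sphere_inner f (Y m l) = (LINT x|sphere_measure. f x * Ypoly m l x)"
  unfolding sphere_inner_def by (intro Bochner_Integration.integral_cong) (use Ypoly(2)[OF assms] in auto)

definition degree_index :: "nat \<Rightarrow> (nat \<times> nat) set" where
  "degree_index M = (SIGMA m:{..<M}. {1..N m})"

definition Yfun :: "nat \<times> nat \<Rightarrow> 'a \<Rightarrow> real" where "Yfun i = Ypoly (fst i) (snd i)"

definition fourier_coeff :: "('a \<Rightarrow> real) \<Rightarrow> nat \<times> nat \<Rightarrow> real" where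
  "fourier_coeff f i = (LINT x|sphere_measure. f x * Yfun i x)"

lemma fourier_coeff_sphere_inner: "l \<in> {1..N m} \<Longrightarrow> sphere_inner f (Y m l) = fourier_coeff f (m, l)"
  by (simp add: sphere_inner_Y fourier_coeff_def Yfun_def)

lemma finite_degree_index [simp]: "finite (degree_index M)" by (simp add: degree_index_def)

lemma sum_degree_index: "(\<Sum>i\<in>degree_index M. g i) = (\<Sum>m<M. \<Sum>l=1..N m. g (m, l))"
  by (simp add: degree_index_def sum.Sigma)

lemma Yfun_poly: "i \<in> degree_index M \<Longrightarrow> real_polynomial_function (Yfun i)"
  using Ypoly_polynomial by (auto simp: degree_index_def Yfun_def)

lemma Yfun_cont: "i \<in> degree_index M \<Longrightarrow> continuous_on (sphere 0 1) (Yfun i)"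
  by (intro continuous_on_polynomial Yfun_poly)

lemma Yfun_orthonormal:
  assumes "i \<in> degree_index M" "j \<in> degree_index M"
  shows "(LINT x|sphere_measure. Yfun i x * Yfun j x) = (if i = j then 1 else 0)"
proof -
  obtain m l m' l' where ij: "i = (m, l)" "j = (m', l')" by (cases i, cases j)
  then have l: "l \<in> {1..N m}" "l' \<in> {1..N m'}" using assms by (auto simp: degree_index_def)
  show ?thesis
  proof (cases "m = m'")
    case True
    have "sphere_inner (Y m l) (Y m l') = (if l = l' then 1 else 0)"
      using onb l True unfolding harmonic_onb_def by blast
    moreover have "sphere_inner (Y m l) (Y m l') = (LINT x|sphere_measure. Ypoly m l x * Ypoly m l' x)"
      unfolding sphere_inner_def
      by (intro Bochner_Integration.integral_cong) (use Ypoly(2)[OF l(1)] Ypoly(2)[OF l(2)] True in auto)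
    ultimately show ?thesis using True ij by (simp add: Yfun_def)
  next
    case False
    then show ?thesis using harmonic_orthogonal[OF Ypoly(1)[OF l(1)] Ypoly(1)[OF l(2)]] ij dim3 by (simp add: Yfun_def)
  qed
qed

text \<open>
  Pythagoras: among the sums over \<open>degree_index M\<close>, the one with the Fourier coefficients of \<open>f\<close> is closest
  to \<open>f\<close>.
\<close>

lemma square_distance:
  assumes f: "f \<in> sphere_L2"
  shows "(LINT x|sphere_measure. (f x - (\<Sum>i\<in>degree_index M. d i * Yfun i x))\<^sup>2)
    = (LINT x|sphere_measure. (f x)\<^sup>2) - (\<Sum>i\<in>degree_index M. (fourier_coeff f i)\<^sup>2) + (\<Sum>i\<in>degree_index M. (fourier_coeff f i - d i)\<^sup>2)"
proof -
  let ?g = "\<lambda>x. \<Sum>i\<in>degree_index M. d i * Yfun i x"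
  have cg: "continuous_on (sphere 0 1) ?g" by (intro continuous_intros Yfun_cont)
  have ife: "integrable sphere_measure (\<lambda>x. f x * Yfun i x)" if "i \<in> degree_index M" for i
    by (intro integrable_sphere_mult_continuous sphere_L2_integrable f Yfun_cont[OF that])
  have iee: "integrable sphere_measure (\<lambda>x. Yfun i x * Yfun j x)" if "i \<in> degree_index M" "j \<in> degree_index M" for i j
    using that by (intro integrable_sphere_continuous continuous_intros Yfun_cont)
  have fg: "(LINT x|sphere_measure. f x * ?g x) = (\<Sum>i\<in>degree_index M. d i * fourier_coeff f i)"
  proof -
    have "(LINT x|sphere_measure. f x * ?g x) = (LINT x|sphere_measure. (\<Sum>i\<in>degree_index M. d i * (f x * Yfun i x)))"
      by (simp add: sum_distrib_left mult_ac)
    also have "\<dots> = (\<Sum>i\<in>degree_index M. LINT x|sphere_measure. d i * (f x * Yfun i x))"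
      using ife by (intro Bochner_Integration.integral_sum) auto
    finally show ?thesis by (simp add: fourier_coeff_def)
  qed
  have gg: "(LINT x|sphere_measure. (?g x)\<^sup>2) = (\<Sum>i\<in>degree_index M. (d i)\<^sup>2)"
  proof -
    have "(LINT x|sphere_measure. (?g x)\<^sup>2) = (LINT x|sphere_measure. (\<Sum>i\<in>degree_index M. \<Sum>j\<in>degree_index M. d i * d j * (Yfun i x * Yfun j x)))"
      by (simp add: power2_eq_square sum_product mult_ac)
    also have "\<dots> = (\<Sum>i\<in>degree_index M. LINT x|sphere_measure. (\<Sum>j\<in>degree_index M. d i * d j * (Yfun i x * Yfun j x)))"
      using iee by (intro Bochner_Integration.integral_sum Bochner_Integration.integrable_sum integrable_mult_right) auto
    also have "\<dots> = (\<Sum>i\<in>degree_index M. \<Sum>j\<in>degree_index M. LINT x|sphere_measure. d i * d j * (Yfun i x * Yfun j x))"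
      using iee by (intro sum.cong refl Bochner_Integration.integral_sum integrable_mult_right) auto
    also have "\<dots> = (\<Sum>i\<in>degree_index M. \<Sum>j\<in>degree_index M. d i * d j * (if i = j then 1 else 0))"
      by (intro sum.cong refl) (simp add: Yfun_orthonormal)
    also have "\<dots> = (\<Sum>i\<in>degree_index M. d i * d i)" by (simp add: if_distrib cong: if_cong)
    finally show ?thesis by (simp add: power2_eq_square)
  qed
  have "(LINT x|sphere_measure. (f x - ?g x)\<^sup>2) = (LINT x|sphere_measure. (f x)\<^sup>2 - 2 * (f x * ?g x) + (?g x)\<^sup>2)"
    by (intro Bochner_Integration.integral_cong) (auto simp: power2_diff)
  also have "\<dots> = (LINT x|sphere_measure. (f x)\<^sup>2) - 2 * (LINT x|sphere_measure. f x * ?g x) + (LINT x|sphere_measure. (?g x)\<^sup>2)"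
  proof -
    have "integrable sphere_measure (\<lambda>x. (f x)\<^sup>2)" "integrable sphere_measure (\<lambda>x. f x * ?g x)" "integrable sphere_measure (\<lambda>x. (?g x)\<^sup>2)"
      by (rule sphere_L2_integrable[OF f] integrable_sphere_mult_continuous[OF sphere_L2_integrable(1)[OF f] cg]
          integrable_sphere_continuous[OF continuous_on_power[OF cg]])+
    then show ?thesis by simp
  qed
  also have "\<dots> = (LINT x|sphere_measure. (f x)\<^sup>2) + (\<Sum>i\<in>degree_index M. (d i)\<^sup>2 - 2 * (d i * fourier_coeff f i))"
    unfolding fg gg sum_subtractf sum_distrib_left[symmetric] by simp
  also have "(\<Sum>i\<in>degree_index M. (d i)\<^sup>2 - 2 * (d i * fourier_coeff f i)) = (\<Sum>i\<in>degree_index M. (fourier_coeff f i - d i)\<^sup>2 - (fourier_coeff f i)\<^sup>2)"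
    by (intro sum.cong) (auto simp: power2_diff)
  finally show ?thesis by (simp add: sum_subtractf)
qed

lemma bessel:
  assumes f: "f \<in> sphere_L2"
  shows "(\<Sum>i\<in>degree_index M. (fourier_coeff f i)\<^sup>2) \<le> (LINT x|sphere_measure. (f x)\<^sup>2)"
proof -
  have "0 \<le> (LINT x|sphere_measure. (f x - (\<Sum>i\<in>degree_index M. fourier_coeff f i * Yfun i x))\<^sup>2)" by (intro integral_nonneg_AE) auto
  then show ?thesis by (simp add: square_distance[OF f])
qed

lemma harmonic_sums_expand:
  assumes "f \<in> harmonic_sums"
  shows "\<exists>M d. \<forall>x\<in>sphere 0 1. f x = (\<Sum>i\<in>degree_index M. d i * Yfun i x)"
proof -
  obtain M p where p: "\<forall>m<M. p m \<in> solid_harmonics m" "\<forall>x\<in>sphere 0 1. f x = (\<Sum>m<M. p m x)" using assms by (auto simp: harmonic_sums_def)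
  have "\<exists>c. \<forall>x\<in>sphere 0 1. p m x = (\<Sum>l=1..N m. c l * Y m l x)" if "m < M" for m
  proof -
    have "p m \<in> spherical_harmonics m" using p(1) that by (auto simp: spherical_harmonics_iff)
    then show ?thesis using onb unfolding harmonic_onb_def by blast
  qed
  then obtain c where c: "\<And>m x. m < M \<Longrightarrow> x \<in> sphere 0 1 \<Longrightarrow> p m x = (\<Sum>l=1..N m. c m l * Y m l x)"
    by metis
  have "f x = (\<Sum>i\<in>degree_index M. c (fst i) (snd i) * Yfun i x)" if x: "x \<in> sphere 0 1" for x
    unfolding sum_degree_index using p(2) c x Ypoly(2) by (auto simp: Yfun_def intro!: sum.cong)
  then show ?thesis by (intro exI ballI)
qed

lemma degree_index_mono: "M \<le> K \<Longrightarrow> degree_index M \<subseteq> degree_index K" by (auto simp: degree_index_def)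

text \<open>
  By the Stone-Weierstrass theorem \<open>f\<close> is a uniform limit of polynomials, which are finite sums of
  harmonics; the truncated Fourier series does at least as well in the mean square.
\<close>

lemma parseval:
  assumes f: "continuous_on (sphere 0 1) f"
  shows "(\<lambda>m. \<Sum>l=1..N m. (fourier_coeff f (m, l))\<^sup>2) sums (LINT x|sphere_measure. (f x)\<^sup>2)"
proof -
  have fL: "f \<in> sphere_L2" by (rule continuous_sphere_L2[OF f])
  let ?I = "LINT x|sphere_measure. (f x)\<^sup>2"
  have "(\<lambda>M. \<Sum>i\<in>degree_index M. (fourier_coeff f i)\<^sup>2) \<longlonglongrightarrow> ?I"
  proof (rule LIMSEQ_I)
    fix r :: real assume r: "r > 0"
    define \<epsilon> where "\<epsilon> = min 1 (r / 2)"
    have \<epsilon>: "\<epsilon> > 0" "\<epsilon>\<^sup>2 < r"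
    proof -
      show "\<epsilon> > 0" using r by (simp add: \<epsilon>_def)
      then have "\<epsilon> * \<epsilon> \<le> 1 * (r/2)" unfolding \<epsilon>_def using r by (intro mult_mono) auto
      then show "\<epsilon>\<^sup>2 < r" using r by (simp add: power2_eq_square)
    qed
    obtain g where g: "real_polynomial_function g" "\<And>x. x \<in> sphere 0 1 \<Longrightarrow> \<bar>f x - g x\<bar> < \<epsilon>"
      using Stone_Weierstrass_real_polynomial_function[OF compact_sphere f \<epsilon>(1)] by metis
    obtain M0 d where d: "\<And>x. x \<in> sphere 0 1 \<Longrightarrow> g x = (\<Sum>i\<in>degree_index M0. d i * Yfun i x)"
      using harmonic_sums_expand[OF polynomial_in_harmonic_sums[OF g(1) dim3]] by blast
    have "?I - (\<Sum>i\<in>degree_index M0. (fourier_coeff f i)\<^sup>2) \<le> (LINT x|sphere_measure. (f x - (\<Sum>i\<in>degree_index M0. d i * Yfun i x))\<^sup>2)"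
      unfolding square_distance[OF fL] by (simp add: sum_nonneg)
    also have "\<dots> \<le> (LINT x|(sphere_measure :: 'a measure). \<epsilon>\<^sup>2)"
    proof (rule sphere_integral_mono)
      show "integrable sphere_measure (\<lambda>x. (f x - (\<Sum>i\<in>degree_index M0. d i * Yfun i x))\<^sup>2)"
        by (intro integrable_sphere_continuous continuous_intros f Yfun_cont)
      fix x :: 'a assume x: "x \<in> sphere 0 1"
      then have "\<bar>f x - (\<Sum>i\<in>degree_index M0. d i * Yfun i x)\<bar> \<le> \<epsilon>" using g(2)[OF x] d[OF x] by simp
      then show "(f x - (\<Sum>i\<in>degree_index M0. d i * Yfun i x))\<^sup>2 \<le> \<epsilon>\<^sup>2" by (rule power2_le_iff_abs_le[THEN iffD2, rotated]) (use \<epsilon> in simp)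
    qed auto
    finally have M0: "?I - (\<Sum>i\<in>degree_index M0. (fourier_coeff f i)\<^sup>2) < r" using \<epsilon> by simp
    show "\<exists>no. \<forall>n\<ge>no. norm ((\<Sum>i\<in>degree_index n. (fourier_coeff f i)\<^sup>2) - ?I) < r"
    proof (intro exI[of _ M0] allI impI)
      fix n assume "n \<ge> M0"
      then have "(\<Sum>i\<in>degree_index M0. (fourier_coeff f i)\<^sup>2) \<le> (\<Sum>i\<in>degree_index n. (fourier_coeff f i)\<^sup>2)"
        by (intro sum_mono2 degree_index_mono) auto
      then show "norm ((\<Sum>i\<in>degree_index n. (fourier_coeff f i)\<^sup>2) - ?I) < r" using M0 bessel[OF fL, of n] by simp
    qed
  qed
  then show ?thesis by (simp add: sums_def sum_degree_index)
qed

lemma sphere_L2_sub: 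
  assumes "f \<in> sphere_L2" "continuous_on (sphere 0 1) g"
  shows "(\<lambda>x. f x - g x) \<in> sphere_L2"
proof -
  have m: "f \<in> borel_measurable sphere_measure" using assms by (simp add: sphere_L2_def)
  have "integrable sphere_measure (\<lambda>x. (f x)\<^sup>2 - 2 * (f x * g x) + (g x)\<^sup>2)"
    by (intro Bochner_Integration.integrable_add Bochner_Integration.integrable_diff integrable_mult_right
        sphere_L2_integrable[OF assms(1)] integrable_sphere_mult_continuous[OF sphere_L2_integrable(1)[OF assms(1)] assms(2)]
        integrable_sphere_continuous[OF continuous_on_power[OF assms(2)]])
  moreover have "(f x - g x)\<^sup>2 = (f x)\<^sup>2 - 2 * (f x * g x) + (g x)\<^sup>2" for x by (simp add: power2_diff)
  ultimately show ?thesis using m borel_measurable_sphere_continuous[OF assms(2)] by (simp add: sphere_L2_def)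
qed

text \<open>
  The truncated Fourier series satisfies the condition in the definition of the projection, so the
  choice made there has a witness; and the condition determines the Fourier coefficients.
\<close>

lemma harmonic_proj:
  assumes f: "f \<in> sphere_L2"
  obtains p where "p \<in> solid_harmonics m" "\<And>x. x \<in> sphere 0 1 \<Longrightarrow> harmonic_proj m f x = p x"
    "\<And>l. l \<in> {1..N m} \<Longrightarrow> fourier_coeff p (m, l) = fourier_coeff f (m, l)"
proof -
  let ?Q = "\<lambda>y. y \<in> spherical_harmonics m \<and> (\<forall>z\<in>spherical_harmonics m. sphere_inner (\<lambda>x. f x - y x) z = 0)"
  define y where "y x = (\<Sum>l=1..N m. fourier_coeff f (m, l) * Ypoly m l x)" for x
  have y: "y \<in> solid_harmonics m" unfolding y_def using Ypoly(1) by (intro solid_harmonics_lincomb) auto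
  have diff: "sphere_inner (\<lambda>x. f x - p x) (Y m l) = fourier_coeff f (m, l) - fourier_coeff p (m, l)" if "p \<in> solid_harmonics m" "l \<in> {1..N m}" for p l
  proof -
    have "integrable sphere_measure (\<lambda>x. f x * Ypoly m l x)" "integrable sphere_measure (\<lambda>x. p x * Ypoly m l x)"
      by (intro integrable_sphere_mult_continuous sphere_L2_integrable[OF f] Ypoly_polynomial that
          integrable_sphere_continuous continuous_on_polynomial solid_harmonicsD(1)[OF that(1)])+
    then show ?thesis using that by (simp add: sphere_inner_Y fourier_coeff_def Yfun_def left_diff_distrib)
  qed
  have cy: "fourier_coeff y (m, l) = fourier_coeff f (m, l)" if l: "l \<in> {1..N m}" for l
  proof -
    have i: "integrable sphere_measure (\<lambda>x. Ypoly m l' x * Ypoly m l x)" if "l' \<in> {1..N m}" for l'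
      using that l Ypoly_polynomial by (intro integrable_sphere_continuous continuous_on_polynomial poly_mult) auto
    have "fourier_coeff y (m, l) = (LINT x|sphere_measure. (\<Sum>l'=1..N m. fourier_coeff f (m, l') * (Ypoly m l' x * Ypoly m l x)))"
      by (simp add: fourier_coeff_def y_def Yfun_def sum_distrib_right mult.assoc)
    also have "\<dots> = (\<Sum>l'=1..N m. fourier_coeff f (m, l') * (LINT x|sphere_measure. Ypoly m l' x * Ypoly m l x))"
      using i by (subst Bochner_Integration.integral_sum) auto
    also have "\<dots> = (\<Sum>l'=1..N m. fourier_coeff f (m, l') * (if l' = l then 1 else 0))"
    proof (intro sum.cong refl)
      fix l' assume l': "l' \<in> {1..N m}"
      show "fourier_coeff f (m, l') * (LINT x|sphere_measure. Ypoly m l' x * Ypoly m l x) = fourier_coeff f (m, l') * (if l' = l then 1 else 0)"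
        using Yfun_orthonormal[of "(m, l')" "Suc m" "(m, l)"] l l' by (simp add: degree_index_def Yfun_def)
    qed
    also have "\<dots> = fourier_coeff f (m, l)" using l by (simp add: if_distrib cong: if_cong)
    finally show ?thesis .
  qed
  have "?Q y"
  proof (intro conjI ballI)
    show "y \<in> spherical_harmonics m" using y by (auto simp: spherical_harmonics_iff)
    fix z :: "'a \<Rightarrow> real" assume "z \<in> spherical_harmonics m"
    then obtain c where c: "\<And>x. x \<in> sphere 0 1 \<Longrightarrow> z x = (\<Sum>l=1..N m. c l * Y m l x)"
      using onb unfolding harmonic_onb_def by blast
    have i: "integrable sphere_measure (\<lambda>x. (f x - y x) * Ypoly m l x)" if "l \<in> {1..N m}" for l
      using that sphere_L2_integrable[OF sphere_L2_sub[OF f continuous_on_polynomial[OF solid_harmonicsD(1)[OF y]]]] Ypoly_polynomial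
      by (intro integrable_sphere_mult_continuous continuous_on_polynomial) auto
    have "sphere_inner (\<lambda>x. f x - y x) z = (LINT x|sphere_measure. (\<Sum>l=1..N m. c l * ((f x - y x) * Ypoly m l x)))"
      unfolding sphere_inner_def
    proof (intro Bochner_Integration.integral_cong refl)
      fix x :: 'a assume "x \<in> space sphere_measure"
      then have x: "x \<in> sphere 0 1" by simp
      show "(f x - y x) * z x = (\<Sum>l=1..N m. c l * ((f x - y x) * Ypoly m l x))"
        unfolding c[OF x] sum_distrib_left by (intro sum.cong refl) (simp add: Ypoly(2)[OF _ x])
    qed
    also have "\<dots> = (\<Sum>l=1..N m. c l * (LINT x|sphere_measure. (f x - y x) * Ypoly m l x))"
      using i by (subst Bochner_Integration.integral_sum) auto
    also have "\<dots> = 0" using diff[OF y] cy by (intro sum.neutral) (simp add: sphere_inner_Y)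
    finally show "sphere_inner (\<lambda>x. f x - y x) z = 0" .
  qed
  then have Q: "?Q (harmonic_proj m f)" unfolding harmonic_proj_def by (rule someI[of ?Q])
  then obtain p where p: "p \<in> solid_harmonics m" "\<And>x. x \<in> sphere 0 1 \<Longrightarrow> harmonic_proj m f x = p x"
    by (auto simp: spherical_harmonics_iff)
  show ?thesis
  proof (rule that[OF p])
    fix l assume l: "l \<in> {1..N m}"
    have "Y m l \<in> spherical_harmonics m" using onb l by (auto simp: harmonic_onb_def)
    then have "0 = sphere_inner (\<lambda>x. f x - harmonic_proj m f x) (Y m l)" using Q by simp
    also have "\<dots> = sphere_inner (\<lambda>x. f x - p x) (Y m l)"
      unfolding sphere_inner_def by (intro Bochner_Integration.integral_cong) (auto simp: p(2))
    finally show "fourier_coeff p (m, l) = fourier_coeff f (m, l)" using diff[OF p(1) l] by simp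
  qed
qed

text \<open>
  The partial sums with more than \<open>m\<close> terms all have the coefficient \<open>ell m * fourier_coeff g (m, l)\<close>, and
  coefficients depend continuously on the function by Bessel's inequality.
\<close>

lemma multiplier_coefficient:
  assumes g: "g \<in> sphere_L2" and v: "is_multiplier_value ell g v" and l: "l \<in> {1..N m}"
  shows "fourier_coeff v (m, l) = ell m * fourier_coeff g (m, l)"
proof -
  have vL: "v \<in> sphere_L2" and lim: "(\<lambda>M. L2_norm (\<lambda>x. v x - (\<Sum>m<M. ell m * harmonic_proj m g x))) \<longlonglongrightarrow> 0"
    using v by (auto simp: is_multiplier_value_def)
  obtain p where p: "\<And>m. p m \<in> solid_harmonics m" "\<And>m x. x \<in> sphere 0 1 \<Longrightarrow> harmonic_proj m g x = p m x"
    "\<And>m l. l \<in> {1..N m} \<Longrightarrow> fourier_coeff (p m) (m, l) = fourier_coeff g (m, l)"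
  proof -
    have "\<forall>m. \<exists>p. p \<in> solid_harmonics m \<and> (\<forall>x\<in>sphere 0 1. harmonic_proj m g x = p x) \<and> (\<forall>l\<in>{1..N m}. fourier_coeff p (m, l) = fourier_coeff g (m, l))"
      using harmonic_proj[OF g] by metis
    from choice[OF this] show ?thesis using that by blast
  qed
  let ?s = "\<lambda>M x. \<Sum>m<M. ell m * p m x"
  have sp: "real_polynomial_function (?s M)" for M
    using p(1) solid_harmonicsD(1) by (intro poly_intros) auto
  have Pm: "real_polynomial_function (Ypoly m l)" by (rule Ypoly_polynomial[OF l])
  have cs: "fourier_coeff (?s M) (m, l) = ell m * fourier_coeff g (m, l)" if M: "M > m" for M
  proof -
    have i: "integrable sphere_measure (\<lambda>x. p k x * Ypoly m l x)" for k
      by (intro integrable_sphere_continuous continuous_on_polynomial poly_mult Pm solid_harmonicsD(1)[OF p(1)])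
    have "fourier_coeff (?s M) (m, l) = (LINT x|sphere_measure. (\<Sum>k<M. ell k * (p k x * Ypoly m l x)))"
      by (simp add: fourier_coeff_def Yfun_def sum_distrib_right mult.assoc)
    also have "\<dots> = (\<Sum>k<M. ell k * (LINT x|sphere_measure. p k x * Ypoly m l x))"
      using i by (subst Bochner_Integration.integral_sum) auto
    also have "\<dots> = (\<Sum>k<M. if k = m then ell m * fourier_coeff g (m, l) else 0)"
    proof (intro sum.cong refl)
      fix k
      show "ell k * (LINT x|sphere_measure. p k x * Ypoly m l x) = (if k = m then ell m * fourier_coeff g (m, l) else 0)"
        using harmonic_orthogonal[OF p(1)[of k] Ypoly(1)[OF l]] dim3 p(3)[OF l] by (simp add: fourier_coeff_def Yfun_def)
    qed
    finally show ?thesis using M by simp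
  qed
  have bound: "\<bar>fourier_coeff v (m, l) - ell m * fourier_coeff g (m, l)\<bar> \<le> L2_norm (\<lambda>x. v x - (\<Sum>m<M. ell m * harmonic_proj m g x))" if M: "M > m" for M
  proof -
    have d: "(\<lambda>x. v x - ?s M x) \<in> sphere_L2" by (intro sphere_L2_sub vL continuous_on_polynomial sp)
    have "integrable sphere_measure (\<lambda>x. v x * Ypoly m l x)" "integrable sphere_measure (\<lambda>x. ?s M x * Ypoly m l x)"
      by (intro integrable_sphere_mult_continuous sphere_L2_integrable[OF vL] continuous_on_polynomial Pm
          integrable_sphere_continuous[OF continuous_on_polynomial] sp)+
    then have "fourier_coeff (\<lambda>x. v x - ?s M x) (m, l) = fourier_coeff v (m, l) - fourier_coeff (?s M) (m, l)"
      by (simp add: fourier_coeff_def Yfun_def left_diff_distrib)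
    then have "(fourier_coeff v (m, l) - ell m * fourier_coeff g (m, l))\<^sup>2 = (fourier_coeff (\<lambda>x. v x - ?s M x) (m, l))\<^sup>2" by (simp add: cs[OF M])
    also have "\<dots> \<le> (\<Sum>i\<in>degree_index (Suc m). (fourier_coeff (\<lambda>x. v x - ?s M x) i)\<^sup>2)"
      using l by (intro member_le_sum) (auto simp: degree_index_def)
    also have "\<dots> \<le> (LINT x|sphere_measure. (v x - ?s M x)\<^sup>2)" by (rule bessel[OF d])
    also have "\<dots> = sphere_inner (\<lambda>x. v x - (\<Sum>m<M. ell m * harmonic_proj m g x)) (\<lambda>x. v x - (\<Sum>m<M. ell m * harmonic_proj m g x))"
      unfolding sphere_inner_def by (intro Bochner_Integration.integral_cong) (auto simp: p(2) power2_eq_square)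
    finally show ?thesis unfolding L2_norm_def by (rule real_le_rsqrt[OF power2_abs[THEN ord_eq_le_trans]])
  qed
  have "\<bar>fourier_coeff v (m, l) - ell m * fourier_coeff g (m, l)\<bar> \<le> 0"
    by (rule tendsto_lowerbound[OF lim]) (use bound in \<open>auto simp: eventually_sequentially intro!: exI[of _ "Suc m"]\<close>)
  then show ?thesis by simp
qed

end

section \<open>Powers of the rectifier as profiles\<close>

lemma relu_pow_Suc: "relu_pow (Suc j) t = (max 0 t) ^ Suc j"
  by (simp add: relu_pow_def)

lemma relu_pow_0: "relu_pow 0 t = (if t > 0 then 1 else 0)"
  by (simp add: relu_pow_def)

lemma relu_pow_pos: "t > 0 \<Longrightarrow> relu_pow j t = t ^ j"
  by (simp add: relu_pow_def)

lemma relu_pow_nonpos: "t \<le> 0 \<Longrightarrow> relu_pow j t = 0"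
  by (simp add: relu_pow_def)

lemma relu_pow_nonneg: "0 \<le> relu_pow j t"
  by (simp add: relu_pow_def)

lemma relu_pow_add: "relu_pow (i + j) t = relu_pow i t * relu_pow j t"
  by (cases "t > 0") (simp_all add: relu_pow_pos relu_pow_nonpos power_add)

lemma relu_pow_mult_t: "t * relu_pow j t = relu_pow (Suc j) t"
  by (cases "t > 0") (simp_all add: relu_pow_pos relu_pow_nonpos)

lemma relu_pow_le:
  assumes "t \<le> v" "0 \<le> v"
  shows "relu_pow (i + j) t \<le> v ^ i * relu_pow j t"
proof (cases "t > 0")
  case True
  then show ?thesis using assms by (simp add: relu_pow_pos power_add power_mono mult_right_mono)
qed (simp add: relu_pow_nonpos)

lemma relu_pow_measurable [measurable]: "relu_pow j \<in> borel_measurable borel"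
  unfolding relu_pow_def[abs_def] by (cases "j = 0") simp_all

lemma relu_pow_continuous: "continuous_on UNIV (\<lambda>t. relu_pow (Suc j) (t - \<tau>))"
  unfolding relu_pow_Suc by (intro continuous_intros)

lemma bounded_profile_relu_pow:
  assumes "0 \<le> \<tau>"
  shows "(\<lambda>t. relu_pow j (t - \<tau>)) \<in> bounded_profile"
proof (rule bounded_profileI[of _ 1])
  show "(\<lambda>t. relu_pow j (t - \<tau>)) \<in> borel_measurable borel" by measurable
  fix t :: real assume "t \<in> {-1..1}"
  then have "t - \<tau> \<le> 1" using assms by simp
  then have "relu_pow (j + 0) (t - \<tau>) \<le> 1 ^ j * relu_pow 0 (t - \<tau>)" by (rule relu_pow_le) simp
  also have "\<dots> \<le> 1" by (simp add: relu_pow_0)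
  finally show "\<bar>relu_pow j (t - \<tau>)\<bar> \<le> 1" using relu_pow_nonneg by simp
qed

lemma kinked_relu_pow:
  assumes "0 \<le> \<tau>"
  shows "kinked \<tau> (\<lambda>t. relu_pow (Suc j) (t - \<tau>)) (\<lambda>t. real (Suc j) * relu_pow j (t - \<tau>))"
  unfolding kinked_def
proof (intro conjI allI impI)
  have 1: "1-lipschitz_on {-1..1} (\<lambda>t. max 0 (t - \<tau>))"
    by (rule lipschitz_onI) (auto simp: dist_real_def)
  have b: "\<bar>max 0 (t - \<tau>)\<bar> \<le> 1" if "t \<in> {-1..1}" for t using that assms by auto
  show "\<exists>L. L-lipschitz_on {-1..1} (\<lambda>t. relu_pow (Suc j) (t - \<tau>))"
  proof (induction j)
    case 0
    show ?case using 1 by (auto simp: relu_pow_Suc)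
  next
    case (Suc j)
    then obtain L where L: "L-lipschitz_on {-1..1} (\<lambda>t. (max 0 (t - \<tau>)) ^ Suc j)" by (auto simp: relu_pow_Suc)
    have b': "\<bar>(max 0 (t - \<tau>)) ^ Suc j\<bar> \<le> 1" if "t \<in> {-1..1}" for t
      using power_le_one[of "max 0 (t - \<tau>)" "Suc j"] b[OF that] by auto
    have "(1 * L + 1 * 1)-lipschitz_on {-1..1} (\<lambda>t. max 0 (t - \<tau>) * (max 0 (t - \<tau>)) ^ Suc j)"
      by (intro lipschitz_on_mult_bounded 1 L b b') auto
    then show ?case by (auto simp: relu_pow_Suc)
  qed
  fix t assume t: "t \<noteq> \<tau>"
  show "((\<lambda>t. relu_pow (Suc j) (t - \<tau>)) has_real_derivative real (Suc j) * relu_pow j (t - \<tau>)) (at t)"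
  proof (cases "t > \<tau>")
    case True
    have "((\<lambda>t. t - \<tau>) has_real_derivative 1) (at t)" by (auto intro!: derivative_eq_intros)
    from DERIV_power[OF this, of "Suc j"]
    have "((\<lambda>t. (t - \<tau>) ^ Suc j) has_real_derivative real (Suc j) * relu_pow j (t - \<tau>)) (at t)"
      using True by (simp add: relu_pow_pos)
    moreover have "\<forall>\<^sub>F t in nhds t. (t - \<tau>) ^ Suc j = relu_pow (Suc j) (t - \<tau>)"
      using eventually_nhds_in_open[of "{\<tau><..}" t] True by (auto simp: relu_pow_pos elim: eventually_mono)
    ultimately show ?thesis by (subst (asm) DERIV_cong_ev[OF refl _ refl])
  next
    case False
    have "((\<lambda>t. 0) has_real_derivative real (Suc j) * relu_pow j (t - \<tau>)) (at t)"
      using False by (simp add: relu_pow_nonpos)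
    moreover have "\<forall>\<^sub>F t in nhds t. 0 = relu_pow (Suc j) (t - \<tau>)"
      using eventually_nhds_in_open[of "{..<\<tau>}" t] False t by (auto simp: relu_pow_nonpos elim: eventually_mono)
    ultimately show ?thesis by (subst (asm) DERIV_cong_ev[OF refl _ refl])
  qed
qed (use assms in \<open>auto intro!: bounded_profile_relu_pow bounded_profile_mult\<close>)

lemma kinked_cmult:
  assumes "kinked \<tau> G G'"
  shows "kinked \<tau> (\<lambda>t. c * G t) (\<lambda>t. c * G' t)"
proof -
  obtain L where L: "L-lipschitz_on {-1..1} G" using assms by (auto simp: kinked_def)
  have "(\<bar>c\<bar> * L)-lipschitz_on {-1..1} (\<lambda>t. c * G t)"
    using lipschitz_on_cmult_real[OF L, of c] by simp
  then show ?thesis using assms by (auto simp: kinked_def intro!: bounded_profile_mult DERIV_cmult)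
qed

lemma kinked_power: "kinked \<tau> (\<lambda>t. t ^ j) (\<lambda>t. real j * t ^ (j - 1))"
  unfolding kinked_def
proof (intro conjI allI impI)
  show "\<exists>L. L-lipschitz_on {-1..1} (\<lambda>t::real. t ^ j)"
  proof (induction j)
    case 0
    show ?case by (auto intro!: exI[of _ 0] lipschitz_onI)
  next
    case (Suc j)
    then obtain L where L: "L-lipschitz_on {-1..1} (\<lambda>t::real. t ^ j)" by blast
    have "1-lipschitz_on {-1..1} (\<lambda>t::real. t)" by (rule lipschitz_onI) auto
    moreover have "\<bar>t ^ j\<bar> \<le> 1" if "t \<in> {-1..1}" for t :: real
      using that by (auto simp: power_abs intro!: power_le_one)
    ultimately have "(1 * L + 1 * 1)-lipschitz_on {-1..1} (\<lambda>t::real. t * t ^ j)"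
      by (intro lipschitz_on_mult_bounded L) auto
    then show ?case by auto
  qed
qed (auto intro!: bounded_profile_power bounded_profile_mult derivative_eq_intros)

section \<open>The Funk-Hecke formula\<close>

lemma zonal_pairing_const:
  assumes p: "p \<in> solid_harmonics 0"
  shows "zonal_pairing \<theta> G p = (LINT x|sphere_measure. G (\<theta> \<bullet> x)) * p y"
proof -
  have "p x = p y" for x using solid_harmonics_0_const[OF p] by blast
  then have "zonal_pairing \<theta> G p = (LINT x|sphere_measure. G (\<theta> \<bullet> x) * p y)" unfolding zonal_pairing_def by metis
  then show ?thesis by simp
qed

text \<open>
  The Funk-Hecke multiplier of \<open>t ^ j\<close> in degree \<open>m\<close> and dimension \<open>N\<close>, where \<open>c j\<close> is the mean of
  \<open>(\<theta> \<bullet> x) ^ j\<close>. The gradient identity lowers \<open>j\<close> and \<open>m\<close> at the same time.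
\<close>

primrec monomial_coef :: "real \<Rightarrow> (nat \<Rightarrow> real) \<Rightarrow> nat \<Rightarrow> nat \<Rightarrow> real" where
  "monomial_coef N c 0 j = c j"
| "monomial_coef N c (Suc m) j = real j * monomial_coef N c m (j - 1) / (real j + real m + N - 1)"

lemma monomial_coef_eq_0: "j < m \<Longrightarrow> monomial_coef N c m j = 0"
  by (induction m arbitrary: j) (auto simp: less_Suc_eq_0_disj)

lemma monomial_coef_neq_0: "c 0 \<noteq> 0 \<Longrightarrow> N \<ge> 1 \<Longrightarrow> monomial_coef N c m m \<noteq> 0"
  by (induction m) auto

lemma zonal_pairing_monomial:
  fixes \<theta> b :: "'a::euclidean_space"
  assumes "\<theta> \<in> sphere 0 1" "p \<in> solid_harmonics m" and b: "b \<in> sphere 0 1" and N: "DIM('a) \<ge> 2"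
  shows "zonal_pairing \<theta> (\<lambda>t. t ^ j) p = monomial_coef (real DIM('a)) (\<lambda>j. LINT x|sphere_measure. (b \<bullet> x) ^ j) m j * p \<theta>"
  using assms(1,2)
proof (induction m arbitrary: p j)
  case 0
  have "(LINT x|sphere_measure. (\<theta> \<bullet> x) ^ j) = (LINT x|sphere_measure. (b \<bullet> x) ^ j)"
    using zonal_integral_indep[OF 0(1) b, of "\<lambda>t. t ^ j"] by simp
  then show ?case using zonal_pairing_const[OF 0(2), of \<theta> "\<lambda>t. t ^ j" \<theta>] by simp
next
  case (Suc m)
  let ?c = "monomial_coef (real DIM('a)) (\<lambda>j. LINT x|sphere_measure. (b \<bullet> x) ^ j)"
  have t: "t * (real j * t ^ (j - 1)) = real j * t ^ j" for t :: real by (cases j) auto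
  have dir_deriv: "dir_deriv \<theta> p \<in> solid_harmonics m" using solid_harmonics_pd[OF Suc.prems(2), of \<theta>] by simp
  have "real j * zonal_pairing \<theta> (\<lambda>t. t ^ (j - 1)) (dir_deriv \<theta> p)
      = real (Suc m) * (real j * zonal_pairing \<theta> (\<lambda>t. t ^ j) p) + real (Suc m) * (real (Suc m) + real DIM('a) - 2) * zonal_pairing \<theta> (\<lambda>t. t ^ j) p"
    using zonal_gradient_identity[OF kinked_power _ _ Suc.prems, of 0 j] by (simp only: t zonal_pairing_cmult order_refl zero_less_one)
  moreover have "zonal_pairing \<theta> (\<lambda>t. t ^ (j - 1)) (dir_deriv \<theta> p) = ?c m (j - 1) * (real (Suc m) * p \<theta>)"
    using Suc.IH[OF Suc.prems(1) dir_deriv] solid_harmonics_euler[OF Suc.prems(2)] by simp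
  ultimately have "real (Suc m) * ((real j + real m + real DIM('a) - 1) * zonal_pairing \<theta> (\<lambda>t. t ^ j) p)
      = real (Suc m) * (real j * ?c m (j - 1) * p \<theta>)" by (simp add: algebra_simps)
  then have *: "(real j + real m + real DIM('a) - 1) * zonal_pairing \<theta> (\<lambda>t. t ^ j) p = real j * ?c m (j - 1) * p \<theta>"
    by (simp only: mult_cancel_left of_nat_eq_0_iff mult_eq_0_iff nat.distinct simp_thms)
  have "real j + real m + real DIM('a) - 1 \<noteq> 0" using N by linarith
  then show ?case using * by (simp add: field_simps)
qed

lemma zonal_pairing_uniform_diff:
  fixes \<theta> :: "'a::euclidean_space"
  assumes G: "continuous_on UNIV G" "continuous_on UNIV H" and \<theta>: "\<theta> \<in> sphere 0 1" and p: "real_polynomial_function p"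
    and d: "\<And>t. t \<in> {-1..1} \<Longrightarrow> \<bar>G t - H t\<bar> \<le> \<epsilon>" and B: "\<And>x. x \<in> sphere 0 1 \<Longrightarrow> \<bar>p x\<bar> \<le> B"
  shows "\<bar>zonal_pairing \<theta> G p - zonal_pairing \<theta> H p\<bar> \<le> \<epsilon> * B"
proof -
  have i: "integrable sphere_measure (\<lambda>x. \<bar>(G (\<theta> \<bullet> x) - H (\<theta> \<bullet> x)) * p x\<bar>)"
    by (intro integrable_abs zonal_pairing_integrable[of "\<lambda>t. G t - H t"] bounded_profile_diff bounded_profile_continuous G \<theta> p)
  have "zonal_pairing \<theta> G p - zonal_pairing \<theta> H p = (LINT x|sphere_measure. (G (\<theta> \<bullet> x) - H (\<theta> \<bullet> x)) * p x)"
    using zonal_pairing_diff[OF bounded_profile_continuous[OF G(1)] bounded_profile_continuous[OF G(2)] \<theta> p] by (simp add: zonal_pairing_def)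
  also have "\<bar>\<dots>\<bar> \<le> (LINT x|sphere_measure. \<bar>(G (\<theta> \<bullet> x) - H (\<theta> \<bullet> x)) * p x\<bar>)"
    by (rule integral_abs_bound)
  also have "\<dots> \<le> (LINT x|(sphere_measure :: 'a measure). \<epsilon> * B)"
    using d[OF inner_sphere_range[OF \<theta>]] B
    by (intro sphere_integral_mono[OF i]) (auto simp: abs_mult intro!: mult_mono order_trans[OF abs_ge_zero])
  finally show ?thesis by simp
qed

lemma zonal_pairing_polynomial_profile:
  fixes \<theta> b :: "'a::euclidean_space"
  assumes N: "DIM('a) \<ge> 2" and g: "real_polynomial_function (g :: real \<Rightarrow> real)"
  shows "\<exists>\<mu>. \<forall>\<theta>\<in>sphere (0::'a) 1. \<forall>p\<in>solid_harmonics m. zonal_pairing \<theta> g p = \<mu> * p \<theta>"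
proof -
  obtain b :: 'a where b: "b \<in> sphere 0 1" using SOME_Basis[where 'a='a] norm_Basis by (metis dist_0_norm mem_sphere)
  let ?c = "monomial_coef (real DIM('a)) (\<lambda>j. LINT x|sphere_measure. (b \<bullet> x) ^ j) m"
  obtain a n where g: "g = (\<lambda>t. \<Sum>i\<le>n. a i * t ^ i)" using g real_polynomial_function_iff_sum by metis
  have "zonal_pairing \<theta> g p = (\<Sum>i\<le>n. a i * ?c i) * p \<theta>" if \<theta>: "\<theta> \<in> sphere 0 1" and p: "p \<in> solid_harmonics m" for \<theta> :: 'a and p
  proof -
    have i: "integrable sphere_measure (\<lambda>x. (\<theta> \<bullet> x) ^ i * p x)" for i
      by (intro zonal_pairing_integrable[of "\<lambda>t. t ^ i"] \<theta> solid_harmonicsD(1)[OF p] bounded_profile_power) auto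
    have "zonal_pairing \<theta> g p = (LINT x|sphere_measure. (\<Sum>i\<le>n. a i * ((\<theta> \<bullet> x) ^ i * p x)))"
      by (simp add: zonal_pairing_def g sum_distrib_right mult.assoc)
    also have "\<dots> = (\<Sum>i\<le>n. a i * zonal_pairing \<theta> (\<lambda>t. t ^ i) p)"
      using i by (subst Bochner_Integration.integral_sum) (auto simp: zonal_pairing_def)
    also have "\<dots> = (\<Sum>i\<le>n. a i * (?c i * p \<theta>))"
      by (intro sum.cong refl) (simp add: zonal_pairing_monomial[OF \<theta> p b N])
    finally show ?thesis by (simp add: sum_distrib_right mult.assoc)
  qed
  then show ?thesis by blast
qed

text \<open>
  For polynomial profiles the multiplier was computed above. In general fix a harmonic \<open>q\<close> of degree \<open>m\<close>
  and a point \<open>\<theta>0\<close> where \<open>\<bar>q\<bar>\<close> is maximal. The relation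
  \<open>zonal_pairing \<theta> G p * q \<theta>0 = zonal_pairing \<theta>0 G q * p \<theta>\<close> passes to uniform limits of profiles and
  determines the multiplier; its bound comes from the choice of \<open>\<theta>0\<close>. If all harmonics of degree \<open>m\<close>
  vanish on the sphere, the multiplier \<open>0\<close> will do.
\<close>

lemma funk_hecke:
  assumes N: "DIM('a::euclidean_space) \<ge> 2" and G: "continuous_on UNIV (G :: real \<Rightarrow> real)"
  shows "\<exists>\<mu>. (\<forall>\<theta>\<in>sphere (0::'a) 1. \<forall>p\<in>solid_harmonics m. zonal_pairing \<theta> G p = \<mu> * p \<theta>)
    \<and> (\<forall>\<theta>\<in>sphere (0::'a) 1. \<bar>\<mu>\<bar> \<le> (LINT x|sphere_measure. \<bar>G (\<theta> \<bullet> x)\<bar>))"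
proof (cases "\<exists>p\<in>solid_harmonics m. \<exists>\<theta>\<in>sphere (0::'a) 1. p \<theta> \<noteq> 0")
  case False
  have "zonal_pairing \<theta> G p = 0" if "p \<in> solid_harmonics m" for \<theta> :: 'a and p
  proof -
    have "zonal_pairing \<theta> G p = (LINT x|(sphere_measure :: 'a measure). 0)"
      unfolding zonal_pairing_def using False that by (intro Bochner_Integration.integral_cong) auto
    then show ?thesis by simp
  qed
  with False show ?thesis by (intro exI[of _ 0]) auto
next
  case True
  then obtain q \<theta>1 where q: "q \<in> solid_harmonics m" "\<theta>1 \<in> sphere (0::'a) 1" "q \<theta>1 \<noteq> 0" by blast
  note qp = solid_harmonicsD(1)[OF q(1)]
  obtain \<theta>0 where \<theta>0: "\<theta>0 \<in> sphere (0::'a) 1" "\<And>x. x \<in> sphere 0 1 \<Longrightarrow> \<bar>q x\<bar> \<le> \<bar>q \<theta>0\<bar>"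
    using continuous_attains_sup[of "sphere (0::'a) 1" "\<lambda>x. \<bar>q x\<bar>"] q(2)
      continuous_on_rabs[OF continuous_on_polynomial[OF qp]] by auto
  have q0: "q \<theta>0 \<noteq> 0" using \<theta>0(2)[OF q(2)] q(3) by auto
  have cross: "zonal_pairing \<theta> G p * q \<theta>0 = zonal_pairing \<theta>0 G q * p \<theta>" if \<theta>: "\<theta> \<in> sphere 0 1" and p: "p \<in> solid_harmonics m" for \<theta> :: 'a and p
  proof -
    note pp = solid_harmonicsD(1)[OF p]
    obtain B where B: "B > 0" "\<And>x. x \<in> sphere 0 1 \<Longrightarrow> \<bar>p x\<bar> \<le> B"
      using continuous_sphere_bounded[OF continuous_on_polynomial[OF pp]] by metis
    have "\<bar>zonal_pairing \<theta> G p * q \<theta>0 - zonal_pairing \<theta>0 G q * p \<theta>\<bar> \<le> 0 + \<epsilon>" if e: "\<epsilon> > 0" for \<epsilon>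
    proof -
      define \<delta> where "\<delta> = \<epsilon> / (2 * B * \<bar>q \<theta>0\<bar>)"
      have \<delta>: "\<delta> > 0" using e B q0 by (simp add: \<delta>_def)
      obtain g where g: "real_polynomial_function g" "\<And>t. t \<in> {-1..1} \<Longrightarrow> \<bar>G t - g t\<bar> < \<delta>"
        using Stone_Weierstrass_real_polynomial_function[of "{-1..1::real}" G \<delta>] \<delta> continuous_on_subset[OF G] by auto
      note gc = continuous_on_polynomial[OF g(1), of UNIV]
      obtain \<mu> where \<mu>: "\<And>\<theta> p. \<theta> \<in> sphere (0::'a) 1 \<Longrightarrow> p \<in> solid_harmonics m \<Longrightarrow> zonal_pairing \<theta> g p = \<mu> * p \<theta>"
        using zonal_pairing_polynomial_profile[OF N g(1)] by blast
      have a: "\<bar>zonal_pairing \<theta> G p - zonal_pairing \<theta> g p\<bar> \<le> \<delta> * B"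
        using zonal_pairing_uniform_diff[OF G gc \<theta> pp less_imp_le[OF g(2)] B(2)] by blast
      have b: "\<bar>zonal_pairing \<theta>0 G q - zonal_pairing \<theta>0 g q\<bar> \<le> \<delta> * \<bar>q \<theta>0\<bar>"
        using zonal_pairing_uniform_diff[OF G gc \<theta>0(1) qp less_imp_le[OF g(2)] \<theta>0(2)] by blast
      have eq: "zonal_pairing \<theta> G p * q \<theta>0 - zonal_pairing \<theta>0 G q * p \<theta>
        = (zonal_pairing \<theta> G p - zonal_pairing \<theta> g p) * q \<theta>0 - (zonal_pairing \<theta>0 G q - zonal_pairing \<theta>0 g q) * p \<theta>"
        using \<mu>[OF \<theta> p] \<mu>[OF \<theta>0(1) q(1)] by (simp add: algebra_simps)
      have "\<bar>zonal_pairing \<theta> G p * q \<theta>0 - zonal_pairing \<theta>0 G q * p \<theta>\<bar> \<le> \<bar>zonal_pairing \<theta> G p - zonal_pairing \<theta> g p\<bar> * \<bar>q \<theta>0\<bar> + \<bar>zonal_pairing \<theta>0 G q - zonal_pairing \<theta>0 g q\<bar> * \<bar>p \<theta>\<bar>"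
        unfolding eq abs_mult[symmetric] by (rule abs_triangle_ineq4)
      also have "\<dots> \<le> (\<delta> * B) * \<bar>q \<theta>0\<bar> + (\<delta> * \<bar>q \<theta>0\<bar>) * B"
        using a b B(2)[OF \<theta>] \<delta> by (intro add_mono mult_mono) auto
      also have "\<dots> = \<epsilon>" using B q0 by (simp add: \<delta>_def field_simps)
      finally show ?thesis by simp
    qed
    then have "\<bar>zonal_pairing \<theta> G p * q \<theta>0 - zonal_pairing \<theta>0 G q * p \<theta>\<bar> \<le> 0" by (rule field_le_epsilon)
    then show ?thesis by simp
  qed
  define \<mu> where "\<mu> = zonal_pairing \<theta>0 G q / q \<theta>0"
  have "\<bar>\<mu>\<bar> \<le> (LINT x|sphere_measure. \<bar>G (\<theta> \<bullet> x)\<bar>)" if \<theta>: "\<theta> \<in> sphere 0 1" for \<theta> :: 'a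
  proof -
    have bG: "(\<lambda>t. \<bar>G t\<bar>) \<in> bounded_profile" by (rule bounded_profile_abs[OF bounded_profile_continuous[OF G]])
    have "\<bar>zonal_pairing \<theta>0 G q\<bar> \<le> (LINT x|sphere_measure. \<bar>G (\<theta>0 \<bullet> x) * q x\<bar>)"
      unfolding zonal_pairing_def by (rule integral_abs_bound)
    also have "\<dots> \<le> (LINT x|sphere_measure. \<bar>G (\<theta>0 \<bullet> x)\<bar> * \<bar>q \<theta>0\<bar>)"
      using zonal_integrable[OF bG \<theta>0(1)] \<theta>0(2)
      by (intro sphere_integral_mono integrable_abs zonal_pairing_integrable[OF bounded_profile_continuous[OF G] \<theta>0(1) qp])
        (auto simp: abs_mult intro!: mult_left_mono)
    also have "\<dots> = (LINT x|sphere_measure. \<bar>G (\<theta> \<bullet> x)\<bar>) * \<bar>q \<theta>0\<bar>"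
      using zonal_integral_indep[OF \<theta>0(1) \<theta> bounded_profile_measurable[OF bG]] by simp
    finally show ?thesis using q0 by (simp add: \<mu>_def field_simps)
  qed
  moreover have "zonal_pairing \<theta> G p = \<mu> * p \<theta>" if "\<theta> \<in> sphere 0 1" "p \<in> solid_harmonics m" for \<theta> :: 'a and p
    using cross[OF that] q0 by (simp add: \<mu>_def field_simps)
  ultimately show ?thesis by blast
qed

section \<open>The multipliers of the activation function\<close>

text \<open>
  The Funk-Hecke multiplier of \<open>\<sigma>\<^sub>k\<close> in degree \<open>m\<close> and dimension \<open>N\<close>, where \<open>c0\<close> and \<open>c1\<close> are the means of
  \<open>\<sigma>\<^sub>k (\<theta> \<bullet> x)\<close> and \<open>\<sigma>\<^sub>k\<^sub>+\<^sub>1 (\<theta> \<bullet> x)\<close>. The factor \<open>k - m\<close> kills all degrees \<open>m > k\<close> of the parity of \<open>k\<close>.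
\<close>

fun relu_coef :: "real \<Rightarrow> nat \<Rightarrow> real \<Rightarrow> real \<Rightarrow> nat \<Rightarrow> real" where
  "relu_coef N k c0 c1 0 = c0"
| "relu_coef N k c0 c1 (Suc 0) = c1"
| "relu_coef N k c0 c1 (Suc (Suc m)) = (real k - real m) / (real k + real m + N) * relu_coef N k c0 c1 m"

text \<open>
  The mean of \<open>\<sigma>\<^sub>k (\<theta> \<bullet> x)\<close> is the same for all unit vectors \<open>\<theta>\<close>; one of them is chosen to make it a
  constant.
\<close>

definition relu_moment :: "'a::euclidean_space itself \<Rightarrow> nat \<Rightarrow> real" where
  "relu_moment _ k = (LINT x|sphere_measure. relu_pow k ((SOME b::'a. b \<in> sphere 0 1) \<bullet> x))"

lemma relu_moment:
  fixes \<theta> :: "'a::euclidean_space"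
  assumes \<theta>: "\<theta> \<in> sphere 0 1"
  shows "(LINT x|sphere_measure. relu_pow k (\<theta> \<bullet> x)) = relu_moment TYPE('a) k"
  unfolding relu_moment_def
  by (rule zonal_integral_indep[OF \<theta>]) (rule someI[of "\<lambda>b. b \<in> sphere 0 1", OF \<theta>], measurable)

text \<open>
  Otherwise both \<open>\<sigma>\<^sub>k (b \<bullet> x)\<close> and \<open>\<sigma>\<^sub>k (- b \<bullet> x)\<close> vanish almost everywhere, hence \<open>b \<bullet> x = 0\<close> almost
  everywhere; but the equator is a null set.
\<close>

lemma relu_moment_pos: "relu_moment TYPE('a::euclidean_space) k > 0"
proof -
  obtain b :: 'a where b: "b \<in> sphere 0 1" using SOME_Basis[where 'a='a] norm_Basis by (metis dist_0_norm mem_sphere)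
  then have nb: "- b \<in> sphere 0 1" by simp
  have bp: "relu_pow k \<in> bounded_profile" using bounded_profile_relu_pow[of 0 k] by simp
  have "relu_moment TYPE('a) k \<ge> 0"
    unfolding relu_moment[OF b, symmetric] by (intro integral_nonneg_AE AE_I2 relu_pow_nonneg)
  moreover have "relu_moment TYPE('a) k \<noteq> 0"
  proof
    assume 0: "relu_moment TYPE('a) k = 0"
    have "AE x in sphere_measure. relu_pow k (c \<bullet> x) = 0" if "c \<in> sphere 0 1" for c :: 'a
      using integral_nonneg_eq_0_iff_AE[OF zonal_integrable[OF bp that]] relu_moment[OF that, of k] 0
      by (simp add: relu_pow_nonneg)
    from this[OF b] this[OF nb] sphere_slice_null[OF b order_refl zero_less_one]
    have "AE x in (sphere_measure :: 'a measure). False"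
    proof eventually_elim
      case (elim x)
      then show ?case using relu_pow_pos[of "b \<bullet> x" k] relu_pow_pos[of "- b \<bullet> x" k]
        by (cases "b \<bullet> x > 0") auto
    qed
    then obtain M where "sphere 0 1 \<subseteq> M" "emeasure (sphere_measure :: 'a measure) M = 0" "M \<in> sets sphere_measure"
      by (rule AE_E) (simp add: sphere_def)
    then have "emeasure (sphere_measure :: 'a measure) (sphere 0 1) = 0"
      using emeasure_mono[of "sphere 0 1" M sphere_measure] by simp
    then show False by (simp add: emeasure_sphere_measure_space)
  qed
  ultimately show ?thesis by simp
qed

text \<open>
  The gradient and axis identities for \<open>\<sigma>\<^sub>k\<^sub>+\<^sub>1\<close>, simplified by \<open>t * \<sigma>\<^sub>k t = \<sigma>\<^sub>k\<^sub>+\<^sub>1 t\<close>. They need only one derivative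
  of \<open>\<sigma>\<^sub>k\<^sub>+\<^sub>1\<close>, so that the Heaviside function is covered.
\<close>

lemma relu_identities:
  fixes \<theta> :: "'a::euclidean_space"
  assumes \<theta>: "\<theta> \<in> sphere 0 1" and p: "p \<in> solid_harmonics m"
  shows relu_gradient: "real m * (real k + real m + real DIM('a) - 1) * zonal_pairing \<theta> (relu_pow (Suc k)) p
      = real (Suc k) * zonal_pairing \<theta> (relu_pow k) (dir_deriv \<theta> p)"
    and relu_axis: "real m * real (Suc k) * zonal_pairing \<theta> (relu_pow k) p
      = (real k + 2 - real m) * zonal_pairing \<theta> (relu_pow (Suc k)) (dir_deriv \<theta> p)"
proof -
  have kk: "kinked 0 (relu_pow (Suc k)) (\<lambda>t. real (Suc k) * relu_pow k t)" for k
    using kinked_relu_pow[of 0 k] by simp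
  have t: "t * (real (Suc k) * relu_pow k t) = real (Suc k) * relu_pow (Suc k) t" for t k
    by (metis mult.left_commute relu_pow_mult_t)
  have g: "real m * (real k + real m + real DIM('a) - 1) * zonal_pairing \<theta> (relu_pow (Suc k)) p
      = real (Suc k) * zonal_pairing \<theta> (relu_pow k) (dir_deriv \<theta> p)" for k
    using zonal_gradient_identity[OF kk _ _ \<theta> p, of k] unfolding t zonal_pairing_cmult by (simp add: algebra_simps)
  show "real m * (real k + real m + real DIM('a) - 1) * zonal_pairing \<theta> (relu_pow (Suc k)) p
      = real (Suc k) * zonal_pairing \<theta> (relu_pow k) (dir_deriv \<theta> p)" by (rule g)
  have bp: "relu_pow k \<in> bounded_profile" for k using bounded_profile_relu_pow[of 0 k] by simp
  have "(1 - t\<^sup>2) * (real (Suc k) * relu_pow k t) = real (Suc k) * relu_pow k t - real (Suc k) * relu_pow (Suc (Suc k)) t" for t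
    by (simp add: relu_pow_mult_t[symmetric] power2_eq_square algebra_simps)
  then have "zonal_pairing \<theta> (\<lambda>t. (1 - t\<^sup>2) * (real (Suc k) * relu_pow k t)) p
     = real (Suc k) * zonal_pairing \<theta> (relu_pow k) p - real (Suc k) * zonal_pairing \<theta> (relu_pow (Suc (Suc k))) p"
    using zonal_pairing_diff[OF bounded_profile_mult[OF bounded_profile_const bp] bounded_profile_mult[OF bounded_profile_const bp] \<theta> solid_harmonicsD(1)[OF p], of "real (Suc k)" k "real (Suc k)" "Suc (Suc k)"]
    by (simp add: zonal_pairing_cmult)
  then have a: "real (Suc k) * zonal_pairing \<theta> (relu_pow k) p - real (Suc k) * zonal_pairing \<theta> (relu_pow (Suc (Suc k))) p + zonal_pairing \<theta> (relu_pow (Suc k)) (dir_deriv \<theta> p)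
     = (real m + real DIM('a) - 1) * zonal_pairing \<theta> (relu_pow (Suc (Suc k))) p"
    using zonal_axis_identity[OF kk _ _ \<theta> p, of k] unfolding relu_pow_mult_t by simp
  have "real m * (real (Suc k) * zonal_pairing \<theta> (relu_pow k) p)
     = real m * (real (Suc k) + real m + real DIM('a) - 1) * zonal_pairing \<theta> (relu_pow (Suc (Suc k))) p - real m * zonal_pairing \<theta> (relu_pow (Suc k)) (dir_deriv \<theta> p)"
    using arg_cong[OF a, of "\<lambda>z. real m * z"] by (simp add: algebra_simps)
  then show "real m * real (Suc k) * zonal_pairing \<theta> (relu_pow k) p
      = (real k + 2 - real m) * zonal_pairing \<theta> (relu_pow (Suc k)) (dir_deriv \<theta> p)"
    unfolding g[of "Suc k"] by (simp add: algebra_simps)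
qed

text \<open>
  The two relations together lower the degree by two and leave \<open>k\<close> unchanged. The recursion ends with
  a constant or with a linear form.
\<close>

lemma zonal_pairing_relu:
  fixes \<theta> :: "'a::euclidean_space"
  assumes \<theta>: "\<theta> \<in> sphere 0 1" and p: "p \<in> solid_harmonics m" and N: "DIM('a) \<ge> 2"
  shows "zonal_pairing \<theta> (relu_pow k) p
    = relu_coef (real DIM('a)) k (relu_moment TYPE('a) k) (relu_moment TYPE('a) (Suc k)) m * p \<theta>"
  using p
proof (induction "real DIM('a)" k "relu_moment TYPE('a) k" "relu_moment TYPE('a) (Suc k)" m arbitrary: p rule: relu_coef.induct)
  case (1 k)
  then show ?case using zonal_pairing_const[of p \<theta> "relu_pow k" \<theta>] relu_moment[OF \<theta>] by simp
next
  case (2 k)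
  have dir_deriv: "dir_deriv \<theta> p \<in> solid_harmonics 0" using solid_harmonics_pd[OF 2, of \<theta>] by simp
  have z: "zonal_pairing \<theta> (relu_pow (Suc k)) (dir_deriv \<theta> p) = relu_moment TYPE('a) (Suc k) * p \<theta>"
    using zonal_pairing_const[OF dir_deriv, of \<theta> "relu_pow (Suc k)" \<theta>] relu_moment[OF \<theta>, of "Suc k"] solid_harmonics_euler[OF 2, of \<theta>] by simp
  have "real (Suc k) * zonal_pairing \<theta> (relu_pow k) p = real (Suc k) * zonal_pairing \<theta> (relu_pow (Suc k)) (dir_deriv \<theta> p)"
    using relu_axis[OF \<theta> 2, of k] by simp
  then have "zonal_pairing \<theta> (relu_pow k) p = zonal_pairing \<theta> (relu_pow (Suc k)) (dir_deriv \<theta> p)"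
    by (simp only: mult_cancel_left of_nat_eq_0_iff nat.distinct simp_thms)
  then show ?case by (simp add: z)
next
  case (3 k m)
  note p = 3(2)
  have dir_deriv: "dir_deriv \<theta> p \<in> solid_harmonics (Suc m)" using solid_harmonics_pd[OF p, of \<theta>] by simp
  have pdd: "dir_deriv \<theta> (dir_deriv \<theta> p) \<in> solid_harmonics m" using solid_harmonics_pd[OF dir_deriv, of \<theta>] by simp
  let ?r = "relu_coef (real DIM('a)) k (relu_moment TYPE('a) k) (relu_moment TYPE('a) (Suc k)) m"
  have "zonal_pairing \<theta> (relu_pow k) (dir_deriv \<theta> (dir_deriv \<theta> p)) = ?r * (real (Suc m) * (real (Suc (Suc m)) * p \<theta>))"
    using 3(1)[OF pdd] solid_harmonics_euler[OF dir_deriv, of \<theta>] solid_harmonics_euler[OF p, of \<theta>] by simp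
  then have 1: "real (Suc m) * ((real k + real m + real DIM('a)) * zonal_pairing \<theta> (relu_pow (Suc k)) (dir_deriv \<theta> p))
      = real (Suc m) * (real (Suc k) * (?r * (real (Suc (Suc m)) * p \<theta>)))"
    using relu_gradient[OF \<theta> dir_deriv, of k] by (simp add: algebra_simps)
  then have 1: "(real k + real m + real DIM('a)) * zonal_pairing \<theta> (relu_pow (Suc k)) (dir_deriv \<theta> p)
      = real (Suc k) * (?r * (real (Suc (Suc m)) * p \<theta>))"
    by (simp only: mult_cancel_left of_nat_eq_0_iff mult_eq_0_iff nat.distinct simp_thms)
  have D: "real k + real m + real DIM('a) \<noteq> 0" using N by linarith
  have 2: "real (Suc (Suc m)) * real (Suc k) * zonal_pairing \<theta> (relu_pow k) p = (real k - real m) * zonal_pairing \<theta> (relu_pow (Suc k)) (dir_deriv \<theta> p)"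
    using relu_axis[OF \<theta> p, of k] by simp
  have "(real (Suc (Suc m)) * real (Suc k)) * ((real k + real m + real DIM('a)) * zonal_pairing \<theta> (relu_pow k) p)
     = (real (Suc (Suc m)) * real (Suc k)) * ((real k - real m) * ?r * p \<theta>)"
    using arg_cong[OF 1, of "\<lambda>z. (real k - real m) * z"] arg_cong[OF 2, of "\<lambda>z. (real k + real m + real DIM('a)) * z"]
    by (simp only: mult_ac)
  then have "(real k + real m + real DIM('a)) * zonal_pairing \<theta> (relu_pow k) p = (real k - real m) * ?r * p \<theta>"
    by (simp only: mult_cancel_left of_nat_eq_0_iff mult_eq_0_iff nat.distinct simp_thms)
  then show ?case using D by (simp add: field_simps)
qed

text \<open>
  The weighted inequality of arithmetic and geometric means for \<open>1 + \<alpha> * y\<close> and \<open>1\<close>.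
\<close>

lemma Bernoulli_powr:
  fixes \<alpha> y :: real
  assumes "\<alpha> \<ge> 1" "1 + y > 0"
  shows "1 + \<alpha> * y \<le> (1 + y) powr \<alpha>"
proof (cases "1 + \<alpha> * y > 0")
  case True
  have "(1 + \<alpha> * y) powr (1/\<alpha>) * 1 powr (1 - 1/\<alpha>) \<le> (1/\<alpha>) * (1 + \<alpha> * y) + (1 - 1/\<alpha>) * 1"
    using assms True by (intro Youngs_inequality_0) auto
  also have "\<dots> = 1 + y" using assms by (simp add: field_simps)
  finally have "((1 + \<alpha> * y) powr (1/\<alpha>)) powr \<alpha> \<le> (1 + y) powr \<alpha>"
    using assms by (intro powr_mono2) auto
  then show ?thesis using assms True by (simp add: powr_powr)
qed (use powr_ge_zero[of "1 + y" \<alpha>] in linarith)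

lemma relu_coef_nonzero:
  assumes "c0 \<noteq> 0" "c1 \<noteq> 0" "N \<ge> 1" "odd (m + k)"
  shows "relu_coef N k c0 c1 m \<noteq> 0"
  using assms
proof (induction N k c0 c1 m rule: relu_coef.induct)
  case (3 N k c0 c1 m)
  then have "real k \<noteq> real m" by auto
  then show ?case using 3 by (simp add: add_nonneg_eq_0_iff)
qed auto

text \<open>
  Two degrees further the multiplier has changed by the factor \<open>1 - 2 * \<alpha> / x\<close> with \<open>x = m + k + N\<close>, up to
  sign. By Bernoulli this is at most \<open>((x - 2) / x) powr \<alpha>\<close>, and so
  \<open>\<bar>relu_coef N k c0 c1 m\<bar> * (m + k + N - 2) powr \<alpha>\<close> does not increase.
\<close>

lemma relu_coef_upper:
  fixes N :: real
  assumes N: "N \<ge> 2" and \<alpha>: "\<alpha> = real k + N / 2"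
  shows "\<exists>C>0. \<forall>m\<ge>k. m \<ge> 1 \<longrightarrow> \<bar>relu_coef N k c0 c1 m\<bar> \<le> C * real m powr (- \<alpha>)"
proof -
  have \<alpha>1: "\<alpha> \<ge> 1" using assms by simp
  let ?a = "\<lambda>m. \<bar>relu_coef N k c0 c1 m\<bar> * (real m + real k + N - 2) powr \<alpha>"
  have step: "?a (Suc (Suc m)) \<le> ?a m" if "m \<ge> k" for m
  proof -
    define x where "x = real m + real k + N"
    have x: "x \<ge> 2" using N by (simp add: x_def)
    show ?thesis
    proof (cases "x = 2")
      case True
      then have "m = 0" "k = 0" using N x_def by linarith+
      then show ?thesis by simp
    next
      case False
      then have x2: "x > 2" using x by simp
      have "(real m - real k) / x = 1 + \<alpha> * (- 2 / x)" using x \<alpha> by (simp add: field_simps x_def)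
      also have "\<dots> \<le> (1 + - 2 / x) powr \<alpha>" using x2 by (intro Bernoulli_powr \<alpha>1) (simp add: field_simps)
      also have "1 + - 2 / x = (x - 2) / x" using x by (simp add: field_simps)
      also have "((x - 2) / x) powr \<alpha> = (x - 2) powr \<alpha> / x powr \<alpha>" using x by (simp add: powr_divide)
      finally have *: "(real m - real k) / x * x powr \<alpha> \<le> (x - 2) powr \<alpha>" using x by (simp add: field_simps)
      have "?a (Suc (Suc m)) = \<bar>relu_coef N k c0 c1 m\<bar> * ((real m - real k) / x * x powr \<alpha>)"
        using that x by (simp add: x_def abs_mult abs_divide add_ac)
      also have "\<dots> \<le> \<bar>relu_coef N k c0 c1 m\<bar> * (x - 2) powr \<alpha>" by (intro mult_left_mono *) auto
      finally show ?thesis by (simp add: x_def)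
    qed
  qed
  define C where "C = max 1 (max (?a k) (?a (Suc k)))"
  have C: "?a k \<le> C" "?a (Suc k) \<le> C" "C > 0" by (auto simp: C_def)
  have aC: "?a (k + i) \<le> C" for i
  proof (induction i rule: nat_less_induct)
    case (1 i)
    consider "i = 0" | "i = 1" | j where "i = Suc (Suc j)" by (metis One_nat_def not0_implies_Suc)
    then show ?case
    proof cases
      case 3
      then have "?a (k + i) \<le> ?a (k + j)" using step[of "k + j"] by simp
      also have "\<dots> \<le> C" using 1 3 by simp
      finally show ?thesis .
    qed (use C in auto)
  qed
  have "\<bar>relu_coef N k c0 c1 m\<bar> \<le> C * real m powr (- \<alpha>)" if "m \<ge> k" "m \<ge> 1" for m
  proof -
    have "\<bar>relu_coef N k c0 c1 m\<bar> * real m powr \<alpha> \<le> ?a m"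
      using N \<alpha>1 by (intro mult_left_mono powr_mono2) auto
    also have "\<dots> \<le> C" using aC[of "m - k"] that by simp
    finally show ?thesis using that by (simp add: powr_minus field_simps)
  qed
  then show ?thesis using C by blast
qed

text \<open>
  The inverse of the factor is \<open>1 + 2 * \<alpha> / y\<close> with \<open>y = m - k\<close>. By Bernoulli this is at most
  \<open>((y + 2) / y) powr \<alpha>\<close>, and so \<open>\<bar>relu_coef N k c0 c1 m\<bar> * (m - k) powr \<alpha>\<close> does not decrease.
\<close>

lemma relu_coef_lower:
  fixes N :: real
  assumes N: "N \<ge> 2" and \<alpha>: "\<alpha> = real k + N / 2" and c: "c0 \<noteq> 0" "c1 \<noteq> 0"
  shows "\<exists>C>0. \<forall>m>k. odd (m + k) \<longrightarrow> C * real m powr (- \<alpha>) \<le> \<bar>relu_coef N k c0 c1 m\<bar>"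
proof -
  have \<alpha>1: "\<alpha> \<ge> 1" using assms by simp
  let ?a = "\<lambda>m. \<bar>relu_coef N k c0 c1 m\<bar> * (real m - real k) powr \<alpha>"
  have step: "?a m \<le> ?a (Suc (Suc m))" if "m > k" for m
  proof -
    define y where "y = real m - real k"
    have y: "y \<ge> 1" using that by (simp add: y_def)
    have D: "real k + real m + N > 0" using N by linarith
    have "(real k + real m + N) / y = 1 + \<alpha> * (2 / y)" using y \<alpha> by (simp add: field_simps y_def)
    also have "\<dots> \<le> (1 + 2 / y) powr \<alpha>" using y by (intro Bernoulli_powr \<alpha>1) (auto simp: field_simps)
    also have "1 + 2 / y = (y + 2) / y" using y by (simp add: field_simps)
    also have "((y + 2) / y) powr \<alpha> = (y + 2) powr \<alpha> / y powr \<alpha>" using y by (simp add: powr_divide)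
    finally have *: "y powr \<alpha> \<le> y / (real k + real m + N) * (y + 2) powr \<alpha>" using y D by (simp add: field_simps)
    have "?a m \<le> \<bar>relu_coef N k c0 c1 m\<bar> * (y / (real k + real m + N) * (y + 2) powr \<alpha>)"
      unfolding y_def[symmetric] by (intro mult_left_mono *) auto
    also have "\<dots> = ?a (Suc (Suc m))"
    proof -
      have "\<bar>real k - real m\<bar> = y" "y + 2 = 2 + real m - real k" using that by (auto simp: y_def)
      then show ?thesis using D by (simp add: abs_mult add.commute[of _ 2] add_diff_eq)
    qed
    finally show ?thesis .
  qed
  define C where "C = \<bar>relu_coef N k c0 c1 (Suc k)\<bar>"
  have C: "C > 0" using relu_coef_nonzero[OF c, of N "Suc k" k] N by (simp add: C_def)
  have aC: "C \<le> ?a (Suc k + 2 * i)" for i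
  proof (induction i)
    case (Suc i)
    then show ?case using step[of "Suc k + 2 * i"] by (simp del: relu_coef.simps)
  qed (simp add: C_def del: relu_coef.simps)
  have "C * real m powr (- \<alpha>) \<le> \<bar>relu_coef N k c0 c1 m\<bar>" if "m > k" "odd (m + k)" for m
  proof -
    have "\<exists>i. m = Suc k + 2 * i" using that by presburger
    then obtain i where "m = Suc k + 2 * i" ..
    then have "C \<le> ?a m" using aC[of i] by simp
    also have "\<dots> \<le> \<bar>relu_coef N k c0 c1 m\<bar> * real m powr \<alpha>"
      using that \<alpha>1 by (intro mult_left_mono powr_mono2) auto
    finally show ?thesis using that by (simp add: powr_minus field_simps)
  qed
  then show ?thesis using C by blast
qed

section \<open>The addition theorem\<close>

lemma dir_deriv_inner_power:
  "dir_deriv v (\<lambda>x::'a::euclidean_space. (x \<bullet> x) ^ n) x = real n * (2 * (v \<bullet> x)) * (x \<bullet> x) ^ (n - 1)"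
  by (rule dir_deriv_eqI) (auto intro!: derivative_eq_intros simp: inner_commute)

lemma laplacian_inner_power:
  "(\<Sum>b\<in>Basis. dir_deriv b (dir_deriv b (\<lambda>x::'a::euclidean_space. (x \<bullet> x) ^ Suc n)) x)
    = 2 * real (Suc n) * (real DIM('a) + 2 * real n) * (x \<bullet> x) ^ n"
proof -
  let ?q = "\<lambda>x::'a. (x \<bullet> x) ^ n"
  have q: "real_polynomial_function ?q" by (intro poly_intros) auto
  have pdq: "dir_deriv b (\<lambda>x::'a. (x \<bullet> x) ^ Suc n) = (\<lambda>x. (2 * real (Suc n)) * ((b \<bullet> x) * ?q x))" for b
    by (rule ext, subst dir_deriv_inner_power) simp
  have "dir_deriv b (dir_deriv b (\<lambda>x::'a. (x \<bullet> x) ^ Suc n)) x = (2 * real (Suc n)) * ((b \<bullet> x) * dir_deriv b ?q x + (b \<bullet> b) * ?q x)" for b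
    unfolding pdq by (subst dir_deriv_cmult, intro poly_mult polynomial_inner q) (subst dir_deriv_mult, auto intro: q)
  then have "(\<Sum>b\<in>Basis. dir_deriv b (dir_deriv b (\<lambda>x::'a. (x \<bullet> x) ^ Suc n)) x)
     = (2 * real (Suc n)) * ((\<Sum>b\<in>Basis. (x \<bullet> b) * dir_deriv b ?q x) + (\<Sum>b\<in>(Basis::'a set). (b \<bullet> b) * ?q x))"
    by (simp add: sum_distrib_left sum.distrib inner_commute distrib_left del: of_nat_Suc)
  also have "(\<Sum>b\<in>Basis. (x \<bullet> b) * dir_deriv b ?q x) = 2 * real n * ?q x"
    using dir_deriv_basis_sum[OF q, of x x] dir_deriv_inner_power[of x n x] by (cases n) (auto simp: algebra_simps)
  finally show ?thesis by (simp add: algebra_simps)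
qed

context spherical_basis
begin

definition zonal_kernel :: "nat \<Rightarrow> 'a \<Rightarrow> 'a \<Rightarrow> real" where
  "zonal_kernel m x y = (\<Sum>l=1..N m. Ypoly m l x * Ypoly m l y)"

lemma fourier_coeff_zonal: "l \<in> {1..N m} \<Longrightarrow> fourier_coeff (\<lambda>x. G (\<theta> \<bullet> x)) (m, l) = zonal_pairing \<theta> G (Ypoly m l)"
  by (simp add: fourier_coeff_def Yfun_def zonal_pairing_def)

text \<open>
  Parseval for \<open>(\<theta> \<bullet> x) ^ j\<close> says that the sum of \<open>(c m j)\<^sup>2 * zonal_kernel m \<theta> \<theta>\<close> over all \<open>m \<le> j\<close> is the
  mean of \<open>(\<theta> \<bullet> x) ^ (2 * j)\<close>, which does not depend on \<open>\<theta>\<close>. As \<open>c j j \<noteq> 0\<close>, the last summand can be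
  solved for.
\<close>

lemma zonal_kernel_diagonal_const:
  assumes "\<theta> \<in> sphere 0 1" "\<eta> \<in> sphere 0 1"
  shows "zonal_kernel j \<theta> \<theta> = zonal_kernel j \<eta> \<eta>"
proof (induction j rule: nat_less_induct)
  case (1 j)
  define c where "c = monomial_coef (real DIM('a)) (\<lambda>j. LINT x|sphere_measure. (\<theta> \<bullet> x) ^ j)"
  have s: "(\<Sum>m\<le>j. (c m j)\<^sup>2 * zonal_kernel m \<zeta> \<zeta>) = (LINT x|sphere_measure. ((\<theta> \<bullet> x) ^ j)\<^sup>2)" if \<zeta>: "\<zeta> \<in> sphere 0 1" for \<zeta>
  proof -
    have "continuous_on (sphere 0 1) (\<lambda>x. (\<zeta> \<bullet> x) ^ j)" by (intro continuous_intros)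
    from parseval[OF this]
    have "(\<lambda>m. \<Sum>l=1..N m. (fourier_coeff (\<lambda>x. (\<zeta> \<bullet> x) ^ j) (m, l))\<^sup>2) sums (LINT x|sphere_measure. ((\<zeta> \<bullet> x) ^ j)\<^sup>2)" .
    moreover have "(\<Sum>l=1..N m. (fourier_coeff (\<lambda>x. (\<zeta> \<bullet> x) ^ j) (m, l))\<^sup>2) = (c m j)\<^sup>2 * zonal_kernel m \<zeta> \<zeta>" for m
    proof -
      have "fourier_coeff (\<lambda>x. (\<zeta> \<bullet> x) ^ j) (m, l) = c m j * Ypoly m l \<zeta>" if l: "l \<in> {1..N m}" for l
        using zonal_pairing_monomial[OF \<zeta> Ypoly(1)[OF l] assms(1)] dim3 fourier_coeff_zonal[OF l, of "\<lambda>t. t ^ j"] by (simp add: c_def)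
      then show ?thesis unfolding zonal_kernel_def sum_distrib_left
        by (intro sum.cong refl) (simp add: power2_eq_square mult_ac)
    qed
    ultimately have "(\<lambda>m. (c m j)\<^sup>2 * zonal_kernel m \<zeta> \<zeta>) sums (LINT x|sphere_measure. ((\<zeta> \<bullet> x) ^ j)\<^sup>2)" by simp
    moreover have "(\<lambda>m. (c m j)\<^sup>2 * zonal_kernel m \<zeta> \<zeta>) sums (\<Sum>m\<le>j. (c m j)\<^sup>2 * zonal_kernel m \<zeta> \<zeta>)"
      by (rule sums_finite) (auto simp: c_def monomial_coef_eq_0)
    ultimately have "(\<Sum>m\<le>j. (c m j)\<^sup>2 * zonal_kernel m \<zeta> \<zeta>) = (LINT x|sphere_measure. ((\<zeta> \<bullet> x) ^ j)\<^sup>2)" by (rule sums_unique2[symmetric])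
    also have "\<dots> = (LINT x|sphere_measure. ((\<theta> \<bullet> x) ^ j)\<^sup>2)"
      using zonal_integral_indep[OF \<zeta> assms(1), of "\<lambda>t. (t ^ j)\<^sup>2"] by simp
    finally show ?thesis .
  qed
  have c0: "c j j \<noteq> 0" unfolding c_def using dim3 by (intro monomial_coef_neq_0) auto
  have "(\<Sum>m<j. (c m j)\<^sup>2 * zonal_kernel m \<theta> \<theta>) = (\<Sum>m<j. (c m j)\<^sup>2 * zonal_kernel m \<eta> \<eta>)" using 1 by (intro sum.cong) auto
  then have "(c j j)\<^sup>2 * zonal_kernel j \<theta> \<theta> = (c j j)\<^sup>2 * zonal_kernel j \<eta> \<eta>"
    using s[OF assms(1)] s[OF assms(2)]
    unfolding lessThan_Suc_atMost[symmetric] sum.lessThan_Suc by linarith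
  then show ?case using c0 by simp
qed

lemma zonal_kernel_diagonal:
  assumes \<theta>: "\<theta> \<in> sphere 0 1"
  shows "(\<Sum>l=1..N m. (Ypoly m l x)\<^sup>2) = zonal_kernel m \<theta> \<theta> * (x \<bullet> x) ^ m"
proof -
  define u where "u = (if x = 0 then \<theta> else sgn x)"
  have u: "u \<in> sphere 0 1" "x = norm x *\<^sub>R u" using \<theta> by (auto simp: u_def norm_sgn sgn_div_norm)
  have "Ypoly m l x = norm x ^ m * Ypoly m l u" if "l \<in> {1..N m}" for l
    using solid_harmonicsD(2)[OF Ypoly(1)[OF that], of "norm x" u] u(2) by simp
  then have "(\<Sum>l=1..N m. (Ypoly m l x)\<^sup>2) = (norm x ^ m)\<^sup>2 * (\<Sum>l=1..N m. (Ypoly m l u)\<^sup>2)"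
    by (simp add: sum_distrib_left power_mult_distrib)
  also have "(\<Sum>l=1..N m. (Ypoly m l u)\<^sup>2) = zonal_kernel m \<theta> \<theta>"
    using zonal_kernel_diagonal_const[OF u(1) \<theta>, of m] by (simp add: zonal_kernel_def power2_eq_square)
  also have "(norm x ^ m)\<^sup>2 = (x \<bullet> x) ^ m" by (simp add: dot_square_norm power_mult[symmetric] mult.commute)
  finally show ?thesis by simp
qed

lemma zonal_kernel_diagonal_nonneg: "zonal_kernel m \<theta> \<theta> \<ge> 0"
  by (simp add: zonal_kernel_def sum_nonneg)

text \<open>
  Apply the Laplacian to the identity \<open>zonal_kernel_diagonal\<close>: as the polynomials are harmonic, only
  the squares of their first derivatives remain on the left.
\<close>

lemma gradient_sum:
  assumes \<theta>: "\<theta> \<in> sphere 0 1" and x: "norm x \<le> 1"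
  shows "(\<Sum>l=1..N m. \<Sum>b\<in>Basis. (dir_deriv b (Ypoly m l) x)\<^sup>2) \<le> zonal_kernel m \<theta> \<theta> * (real m)\<^sup>2 * real DIM('a)"
proof (cases m)
  case 0
  have "dir_deriv b (Ypoly m l) x = 0" if "l \<in> {1..N m}" for l b
  proof -
    have "Ypoly m l = (\<lambda>x. Ypoly m l 0)" using Ypoly(1)[OF that] 0 solid_harmonics_0_const by blast
    then show ?thesis by (metis dir_deriv_const)
  qed
  then show ?thesis using 0 by simp
next
  case (Suc n)
  let ?D = "zonal_kernel m \<theta> \<theta>"
  have pol: "real_polynomial_function (Ypoly m l)" "real_polynomial_function (dir_deriv b (Ypoly m l))" if "l \<in> {1..N m}" for l b
    using that Ypoly_polynomial by auto
  have F: "(\<lambda>x. \<Sum>l=1..N m. Ypoly m l x * Ypoly m l x) = (\<lambda>x. ?D * (x \<bullet> x) ^ m)"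
    using zonal_kernel_diagonal[OF \<theta>, of m] by (simp add: power2_eq_square)
  have 1: "dir_deriv b (\<lambda>x. \<Sum>l=1..N m. Ypoly m l x * Ypoly m l x) = (\<lambda>x. \<Sum>l=1..N m. 2 * (Ypoly m l x * dir_deriv b (Ypoly m l) x))" for b
    using pol by (intro ext) (subst dir_deriv_sum, auto simp: dir_deriv_mult intro!: poly_mult sum.cong)
  have 2: "dir_deriv b (\<lambda>x. \<Sum>l=1..N m. 2 * (Ypoly m l x * dir_deriv b (Ypoly m l) x)) x
      = (\<Sum>l=1..N m. 2 * (Ypoly m l x * dir_deriv b (dir_deriv b (Ypoly m l)) x + (dir_deriv b (Ypoly m l) x)\<^sup>2))" for b
  proof -
    have "dir_deriv b (\<lambda>x. 2 * (Ypoly m l x * dir_deriv b (Ypoly m l) x)) x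
       = 2 * (Ypoly m l x * dir_deriv b (dir_deriv b (Ypoly m l)) x + (dir_deriv b (Ypoly m l) x)\<^sup>2)" if l: "l \<in> {1..N m}" for l
      by (subst dir_deriv_cmult[OF poly_mult[OF pol[OF l]]], subst dir_deriv_mult[OF pol[OF l]]) (simp add: power2_eq_square)
    then show ?thesis using pol by (subst dir_deriv_sum) (auto intro!: poly_mult poly_const)
  qed
  have half: "S = R * (a * b * c)" if "2 * S = R * (2 * a * b * c)" for S R a b c :: real
    using that by simp
  have q: "real_polynomial_function (\<lambda>x::'a. (x \<bullet> x) ^ m)" by (intro poly_intros) auto
  have 3: "dir_deriv b (\<lambda>x. ?D * (x \<bullet> x) ^ m) = (\<lambda>x. ?D * dir_deriv b (\<lambda>x. (x \<bullet> x) ^ m) x)" for b :: 'a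
    by (rule ext) (rule dir_deriv_cmult[OF q])
  have 4: "dir_deriv b (\<lambda>x. ?D * dir_deriv b (\<lambda>x. (x \<bullet> x) ^ m) x) x = ?D * dir_deriv b (dir_deriv b (\<lambda>x. (x \<bullet> x) ^ m)) x" for b :: 'a
    by (rule dir_deriv_cmult[OF dir_deriv_polynomial[OF q]])
  have "(\<Sum>b\<in>Basis. dir_deriv b (dir_deriv b (\<lambda>x. \<Sum>l=1..N m. Ypoly m l x * Ypoly m l x)) x)
     = (\<Sum>b\<in>Basis. dir_deriv b (dir_deriv b (\<lambda>x. ?D * (x \<bullet> x) ^ m)) x)" unfolding F ..
  then have "(\<Sum>b\<in>Basis. \<Sum>l=1..N m. 2 * (Ypoly m l x * dir_deriv b (dir_deriv b (Ypoly m l)) x + (dir_deriv b (Ypoly m l) x)\<^sup>2))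
     = ?D * (\<Sum>b\<in>Basis. dir_deriv b (dir_deriv b (\<lambda>x. (x \<bullet> x) ^ m)) x)"
    unfolding 1 2 3 4 by (simp add: sum_distrib_left)
  also have "(\<Sum>b\<in>Basis. \<Sum>l=1..N m. 2 * (Ypoly m l x * dir_deriv b (dir_deriv b (Ypoly m l)) x + (dir_deriv b (Ypoly m l) x)\<^sup>2))
     = (\<Sum>l=1..N m. 2 * (Ypoly m l x * (\<Sum>b\<in>Basis. dir_deriv b (dir_deriv b (Ypoly m l)) x) + (\<Sum>b\<in>Basis. (dir_deriv b (Ypoly m l) x)\<^sup>2)))"
    by (subst sum.swap) (simp add: sum_distrib_left sum.distrib distrib_left)
  also have "\<dots> = 2 * (\<Sum>l=1..N m. \<Sum>b\<in>Basis. (dir_deriv b (Ypoly m l) x)\<^sup>2)"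
    by (subst sum_distrib_left, intro sum.cong refl) (simp add: solid_harmonicsD(3)[OF Ypoly(1)])
  finally have "(\<Sum>l=1..N m. \<Sum>b\<in>Basis. (dir_deriv b (Ypoly m l) x)\<^sup>2)
      = ?D * (real m * (real DIM('a) + 2 * real n) * (x \<bullet> x) ^ n)"
    unfolding Suc laplacian_inner_power by (rule half)
  also have "\<dots> \<le> ?D * (real m * (real m * real DIM('a)) * 1)"
  proof (intro mult_left_mono mult_mono zonal_kernel_diagonal_nonneg)
    have "2 * real n \<le> real DIM('a) * real n" using dim3 by (intro mult_right_mono) auto
    then show "real DIM('a) + 2 * real n \<le> real m * real DIM('a)" by (simp add: Suc algebra_simps)
    have "x \<bullet> x \<le> 1" using x by (simp add: dot_square_norm power_le_one)
    then show "(x \<bullet> x) ^ n \<le> 1" by (intro power_le_one) auto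
  qed auto
  finally show ?thesis by (simp add: power2_eq_square mult_ac)
qed

text \<open>
  By the Cauchy-Schwarz inequality and the bound for the gradients, \<open>zonal_kernel m \<theta>\<close> changes between \<open>\<theta>\<close>
  and \<open>x\<close> by at most \<open>norm (x - \<theta>) * m * sqrt N\<close> times its value at \<open>\<theta>\<close>.
\<close>

lemma zonal_kernel_near_diagonal:
  assumes \<theta>: "\<theta> \<in> sphere 0 1" and x: "x \<in> sphere 0 1" and near: "norm (x - \<theta>) * real m * sqrt (real DIM('a)) \<le> 1/2"
  shows "zonal_kernel m \<theta> x \<ge> zonal_kernel m \<theta> \<theta> / 2"
proof -
  define v where "v = x - \<theta>"
  let ?D = "zonal_kernel m \<theta> \<theta>"
  have der: "((\<lambda>t. zonal_kernel m \<theta> (\<theta> + t *\<^sub>R v)) has_real_derivative (\<Sum>l=1..N m. Ypoly m l \<theta> * dir_deriv v (Ypoly m l) (\<theta> + t *\<^sub>R v))) (at t)" for t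
    unfolding zonal_kernel_def by (intro DERIV_sum DERIV_cmult deriv_line Ypoly_polynomial) auto
  obtain t where t: "0 < t" "t < 1" and mvt: "zonal_kernel m \<theta> (\<theta> + 1 *\<^sub>R v) - zonal_kernel m \<theta> (\<theta> + 0 *\<^sub>R v)
      = (1 - 0) * (\<Sum>l=1..N m. Ypoly m l \<theta> * dir_deriv v (Ypoly m l) (\<theta> + t *\<^sub>R v))"
    using MVT2[of 0 1 "\<lambda>t. zonal_kernel m \<theta> (\<theta> + t *\<^sub>R v)", OF zero_less_one der] by blast
  define y where "y = \<theta> + t *\<^sub>R v"
  have "y = (1 - t) *\<^sub>R \<theta> + t *\<^sub>R x" by (simp add: y_def v_def algebra_simps)
  then have y: "norm y \<le> 1"
    using norm_triangle_ineq[of "(1 - t) *\<^sub>R \<theta>" "t *\<^sub>R x"] t \<theta> x by simp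
  have pdv: "(dir_deriv v (Ypoly m l) y)\<^sup>2 \<le> (norm v)\<^sup>2 * (\<Sum>b\<in>Basis. (dir_deriv b (Ypoly m l) y)\<^sup>2)" if l: "l \<in> {1..N m}" for l
  proof -
    have "(norm v)\<^sup>2 = (\<Sum>b\<in>Basis. (v \<bullet> b)\<^sup>2)" 
      by (subst dot_square_norm[symmetric], subst euclidean_inner) (simp add: power2_eq_square)
    then show ?thesis
      unfolding dir_deriv_basis_sum[OF Ypoly_polynomial[OF l], of v] by (simp add: Cauchy_Schwarz_ineq_sum)
  qed
  have "(zonal_kernel m \<theta> x - ?D)\<^sup>2 = (\<Sum>l=1..N m. Ypoly m l \<theta> * dir_deriv v (Ypoly m l) y)\<^sup>2"
    using mvt by (simp add: y_def v_def)
  also have "\<dots> \<le> (\<Sum>l=1..N m. (Ypoly m l \<theta>)\<^sup>2) * (\<Sum>l=1..N m. (dir_deriv v (Ypoly m l) y)\<^sup>2)"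
    by (rule Cauchy_Schwarz_ineq_sum)
  also have "(\<Sum>l=1..N m. (Ypoly m l \<theta>)\<^sup>2) = ?D" by (simp add: zonal_kernel_def power2_eq_square)
  also have "?D * (\<Sum>l=1..N m. (dir_deriv v (Ypoly m l) y)\<^sup>2) \<le> ?D * ((norm v)\<^sup>2 * (?D * (real m)\<^sup>2 * real DIM('a)))"
  proof (intro mult_left_mono zonal_kernel_diagonal_nonneg)
    have "(\<Sum>l=1..N m. (dir_deriv v (Ypoly m l) y)\<^sup>2) \<le> (norm v)\<^sup>2 * (\<Sum>l=1..N m. \<Sum>b\<in>Basis. (dir_deriv b (Ypoly m l) y)\<^sup>2)"
      unfolding sum_distrib_left[of "(norm v)\<^sup>2"] by (intro sum_mono order_trans[OF pdv]) (auto simp: sum_distrib_left)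
    also have "\<dots> \<le> (norm v)\<^sup>2 * (?D * (real m)\<^sup>2 * real DIM('a))"
      by (intro mult_left_mono gradient_sum[OF \<theta> y]) auto
    finally show "(\<Sum>l=1..N m. (dir_deriv v (Ypoly m l) y)\<^sup>2) \<le> (norm v)\<^sup>2 * (?D * (real m)\<^sup>2 * real DIM('a))" .
  qed
  also have "\<dots> = (?D * (norm v * real m * sqrt (real DIM('a))))\<^sup>2"
    by (simp add: power_mult_distrib power2_eq_square)
  finally have "\<bar>zonal_kernel m \<theta> x - ?D\<bar> \<le> ?D * (norm v * real m * sqrt (real DIM('a)))"
    unfolding abs_le_square_iff[symmetric] using zonal_kernel_diagonal_nonneg by (simp add: abs_mult)
  also have "\<dots> \<le> ?D * (1/2)" using near by (intro mult_left_mono zonal_kernel_diagonal_nonneg) (simp add: v_def)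
  finally show ?thesis by linarith
qed

end

section \<open>Spherical caps\<close>

lemma measure_sphere_cone:
  fixes A :: "'a::euclidean_space set"
  assumes "A \<in> sets borel" "A \<subseteq> sphere 0 1"
  shows "measure sphere_measure A = measure lborel (ball 0 1 \<inter> sgn -` A) / measure lborel (ball (0::'a) 1)"
proof -
  have fin: "emeasure lborel (ball (0::'a) 1) < \<infinity>" by (rule emeasure_lborel_ball_finite)
  have B: "ball 0 1 \<inter> sgn -` A \<in> sets borel" using assms measurable_sets[OF sgn_borel_measurable, of A] by auto
  have "emeasure lborel (ball 0 1 \<inter> sgn -` A) \<le> emeasure lborel (ball (0::'a) 1)"
    by (intro emeasure_mono) auto
  with fin have 1: "emeasure lborel (ball 0 1 \<inter> sgn -` A) = ennreal (measure lborel (ball 0 1 \<inter> sgn -` A))"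
    by (intro emeasure_eq_ennreal_measure) (auto simp: top_unique)
  have 2: "emeasure lborel (ball (0::'a) 1) = ennreal (measure lborel (ball (0::'a) 1))"
    using fin by (intro emeasure_eq_ennreal_measure) auto
  have "measure lborel (ball (0::'a) 1) > 0" using content_ball_pos[of 1 "0::'a"] by simp
  then have "emeasure sphere_measure A = ennreal (measure lborel (ball 0 1 \<inter> sgn -` A) / measure lborel (ball (0::'a) 1))"
    unfolding emeasure_sphere_measure[OF assms] 1 2 by (intro divide_ennreal) auto
  then show ?thesis by (simp add: measure_def)
qed

text \<open>
  The part of the cone over the cap inside the unit ball is covered by about \<open>1 / \<epsilon>\<close> balls of radius
  \<open>2 * \<epsilon>\<close> with centres on the axis.
\<close>

lemma cap_upper:
  fixes \<theta> :: "'a::euclidean_space"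
  assumes \<theta>: "\<theta> \<in> sphere 0 1" and \<epsilon>: "0 < \<epsilon>" "\<epsilon> \<le> 1"
  shows "measure sphere_measure {x \<in> sphere 0 1. norm (x - \<theta>) \<le> \<epsilon>} \<le> 2 * 2 ^ DIM('a) * \<epsilon> ^ (DIM('a) - 1)"
proof -
  define A where "A = {x \<in> sphere 0 1. norm (x - \<theta>) \<le> \<epsilon>}"
  have "A = sphere 0 1 \<inter> cball \<theta> \<epsilon>" by (auto simp: A_def dist_norm norm_minus_commute)
  then have A: "A \<in> sets borel" "A \<subseteq> sphere 0 1" by (auto intro!: borel_closed)
  define n where "n = nat \<lceil>1 / \<epsilon>\<rceil>"
  have "1 / \<epsilon> > 0" using \<epsilon> by simp
  then have n: "1 / \<epsilon> \<le> real n" "real n \<le> 1 / \<epsilon> + 1" unfolding n_def by linarith+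
  let ?c = "\<lambda>i::nat. cball ((real i * \<epsilon>) *\<^sub>R \<theta>) (2 * \<epsilon>)"
  have sub: "ball 0 1 \<inter> sgn -` A \<subseteq> (\<Union>i<n. ?c i)"
  proof
    fix x assume "x \<in> ball 0 1 \<inter> sgn -` A"
    then have x: "norm x < 1" "norm (sgn x) = 1" "norm (sgn x - \<theta>) \<le> \<epsilon>" by (auto simp: A_def)
    define i where "i = nat \<lfloor>norm x / \<epsilon>\<rfloor>"
    have "norm x / \<epsilon> \<ge> 0" using \<epsilon> by simp
    then have i: "real i \<le> norm x / \<epsilon>" "norm x / \<epsilon> < real i + 1" unfolding i_def by linarith+
    then have i': "real i * \<epsilon> \<le> norm x" "norm x < real i * \<epsilon> + \<epsilon>" using \<epsilon> by (auto simp: field_simps)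
    have "norm x / \<epsilon> < 1 / \<epsilon>" using x \<epsilon> by (simp add: divide_strict_right_mono)
    then have "i < n" using i n by linarith
    have xs: "x - norm x *\<^sub>R \<theta> = norm x *\<^sub>R (sgn x - \<theta>)"
      by (cases "x = 0") (simp_all add: sgn_div_norm scaleR_diff_right)
    have "norm (x - norm x *\<^sub>R \<theta>) \<le> 1 * \<epsilon>" unfolding xs norm_scaleR using x by (intro mult_mono) auto
    moreover have "norm (norm x *\<^sub>R \<theta> - (real i * \<epsilon>) *\<^sub>R \<theta>) \<le> \<epsilon>"
      using \<theta> i' unfolding scaleR_diff_left[symmetric] norm_scaleR by simp
    ultimately have "norm (x - (real i * \<epsilon>) *\<^sub>R \<theta>) \<le> 2 * \<epsilon>"
      using norm_triangle_ineq[of "x - norm x *\<^sub>R \<theta>" "norm x *\<^sub>R \<theta> - (real i * \<epsilon>) *\<^sub>R \<theta>"] by simp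
    then show "x \<in> (\<Union>i<n. ?c i)" using \<open>i < n\<close> by (auto simp: dist_norm norm_minus_commute)
  qed
  let ?V = "unit_ball_vol (real DIM('a))"
  have "measure lborel (ball 0 1 \<inter> sgn -` A) \<le> measure lborel (\<Union>i<n. ?c i)"
    using A measurable_sets[OF sgn_borel_measurable, of A] sub
    by (intro measure_mono_fmeasurable fmeasurable_compact compact_UN) auto
  also have "\<dots> \<le> (\<Sum>i<n. measure lborel (?c i))"
    by (intro measure_UNION_le) auto
  also have "\<dots> = real n * (?V * (2 * \<epsilon>) ^ DIM('a))" using \<epsilon> by (simp add: content_cball)
  also have "\<dots> \<le> (2 / \<epsilon>) * (?V * (2 * \<epsilon>) ^ DIM('a))"
  proof (intro mult_right_mono)
    have "1 \<le> 1 / \<epsilon>" using \<epsilon> by simp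
    then show "real n \<le> 2 / \<epsilon>" using n by simp
  qed (use \<epsilon> in auto)
  also have "\<dots> = ?V * (2 * 2 ^ DIM('a) * \<epsilon> ^ (DIM('a) - 1))"
  proof -
    have "\<epsilon> ^ DIM('a) = \<epsilon> * \<epsilon> ^ (DIM('a) - 1)" by (metis DIM_positive Suc_diff_1 power_Suc)
    then show ?thesis using \<epsilon> by (simp add: power_mult_distrib)
  qed
  finally have "measure lborel (ball 0 1 \<inter> sgn -` A) \<le> ?V * (2 * 2 ^ DIM('a) * \<epsilon> ^ (DIM('a) - 1))" .
  moreover have "measure lborel (ball (0::'a) 1) = ?V" by (simp add: content_ball)
  moreover have "?V > 0" by simp
  ultimately show ?thesis
    unfolding A_def[symmetric] measure_sphere_cone[OF A] by (simp add: divide_le_eq mult.commute)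
qed

text \<open>
  The cone over the cap contains about \<open>1 / \<epsilon>\<close> disjoint balls of radius \<open>\<epsilon> / 8\<close> with centres on the axis.
  These are spaced by \<open>\<epsilon> / 4\<close> and stay at distances between \<open>1/2\<close> and \<open>3/4\<close> from the origin.
\<close>

lemma cap_lower:
  fixes \<theta> :: "'a::euclidean_space"
  assumes \<theta>: "\<theta> \<in> sphere 0 1" and \<epsilon>: "0 < \<epsilon>" "\<epsilon> \<le> 1"
  shows "measure sphere_measure {x \<in> sphere 0 1. norm (x - \<theta>) < \<epsilon>} \<ge> (1/2) * (1/8) ^ DIM('a) * \<epsilon> ^ (DIM('a) - 1)"
proof -
  define A where "A = {x \<in> sphere 0 1. norm (x - \<theta>) < \<epsilon>}"
  have "A = sphere 0 1 \<inter> ball \<theta> \<epsilon>" by (auto simp: A_def dist_norm norm_minus_commute)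
  then have A: "A \<in> sets borel" "A \<subseteq> sphere 0 1" by auto
  define n where "n = nat \<lfloor>1 / \<epsilon>\<rfloor>"
  have e1: "1 / \<epsilon> \<ge> 1" using \<epsilon> by simp
  then have n: "real n \<le> 1 / \<epsilon>" "1 / (2 * \<epsilon>) \<le> real n"
  proof -
    show "real n \<le> 1 / \<epsilon>" unfolding n_def using e1 by linarith
    have "\<lfloor>1 / \<epsilon>\<rfloor> \<ge> 1" using e1 by (simp only: le_floor_iff of_int_1)
    then have "1 \<le> real n" "1 / \<epsilon> < real n + 1" unfolding n_def by linarith+
    then show "1 / (2 * \<epsilon>) \<le> real n" by simp
  qed
  define r where "r i = 1/2 + real i * \<epsilon> / 4" for i :: nat
  let ?c = "\<lambda>i::nat. ball (r i *\<^sub>R \<theta>) (\<epsilon> / 8)"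
  have sub: "(\<Union>i<n. ?c i) \<subseteq> ball 0 1 \<inter> sgn -` A"
  proof
    fix x assume "x \<in> (\<Union>i<n. ?c i)"
    then obtain i where i: "i < n" "norm (x - r i *\<^sub>R \<theta>) < \<epsilon> / 8" by (auto simp: dist_norm norm_minus_commute)
    have "real i * \<epsilon> \<le> 1"
    proof -
      have "real i \<le> 1 / \<epsilon>" using i n by linarith
      then show ?thesis using \<epsilon> by (simp add: field_simps)
    qed
    then have ri: "1/2 \<le> r i" "r i \<le> 3/4" using \<epsilon> by (auto simp: r_def)
    have nr: "norm (r i *\<^sub>R \<theta>) = r i" using \<theta> ri by simp
    have d: "\<bar>norm x - r i\<bar> < \<epsilon> / 8" using norm_triangle_ineq3[of x "r i *\<^sub>R \<theta>"] i nr by linarith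
    then have nx: "norm x < 1" "norm x > 3/8 - 1/1000" using ri \<epsilon> by linarith+
    have "norm (r i *\<^sub>R \<theta> - norm x *\<^sub>R \<theta>) < \<epsilon> / 8"
      using \<theta> d unfolding scaleR_diff_left[symmetric] norm_scaleR by (simp add: abs_minus_commute)
    then have "norm (x - norm x *\<^sub>R \<theta>) < \<epsilon> / 4"
      using norm_triangle_ineq[of "x - r i *\<^sub>R \<theta>" "r i *\<^sub>R \<theta> - norm x *\<^sub>R \<theta>"] i(2) by simp
    moreover have "x - norm x *\<^sub>R \<theta> = norm x *\<^sub>R (sgn x - \<theta>)"
      by (cases "x = 0") (simp_all add: sgn_div_norm scaleR_diff_right)
    ultimately have "norm x * norm (sgn x - \<theta>) < \<epsilon> / 4" by simp
    moreover have "1/4 * norm (sgn x - \<theta>) \<le> norm x * norm (sgn x - \<theta>)" using nx by (intro mult_right_mono) auto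
    ultimately have "norm (sgn x - \<theta>) < \<epsilon>" by simp
    moreover have "x \<noteq> 0" using nx by auto
    ultimately show "x \<in> ball 0 1 \<inter> sgn -` A" using nx by (simp add: A_def norm_sgn)
  qed
  have disj: "disjoint_family_on ?c {..<n}"
  proof (unfold disjoint_family_on_def, intro ballI impI)
    fix i j assume ij: "i \<in> {..<n}" "j \<in> {..<n}" "i \<noteq> j"
    have "dist (r i *\<^sub>R \<theta>) (r j *\<^sub>R \<theta>) = \<bar>r i - r j\<bar>"
      using \<theta> unfolding dist_norm scaleR_diff_left[symmetric] norm_scaleR by simp
    also have "\<bar>r i - r j\<bar> = \<bar>real i - real j\<bar> * (\<epsilon> / 4)"
    proof -
      have "r i - r j = (real i - real j) * (\<epsilon> / 4)" by (simp add: r_def field_simps)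
      then show ?thesis using \<epsilon> by (simp only: abs_mult)
    qed
    also have "\<dots> \<ge> 1 * (\<epsilon> / 4)" using ij \<epsilon> by (intro mult_right_mono) auto
    finally have "dist (r i *\<^sub>R \<theta>) (r j *\<^sub>R \<theta>) \<ge> \<epsilon> / 8 + \<epsilon> / 8" by simp
    then show "?c i \<inter> ?c j = {}" by (rule disjoint_ballI)
  qed
  let ?V = "unit_ball_vol (real DIM('a))"
  have "?V * ((1/2) * (1/8) ^ DIM('a) * \<epsilon> ^ (DIM('a) - 1)) = (1 / (2 * \<epsilon>)) * (?V * (\<epsilon> / 8) ^ DIM('a))"
  proof -
    have "\<epsilon> ^ DIM('a) = \<epsilon> * \<epsilon> ^ (DIM('a) - 1)" by (metis DIM_positive Suc_diff_1 power_Suc)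
    then show ?thesis using \<epsilon> by (simp add: power_divide)
  qed
  also have "\<dots> \<le> real n * (?V * (\<epsilon> / 8) ^ DIM('a))" using n \<epsilon> by (intro mult_right_mono) auto
  also have "\<dots> = (\<Sum>i<n. measure lborel (?c i))" using \<epsilon> by (simp add: content_ball)
  also have "\<dots> = measure lborel (\<Union>i<n. ?c i)"
    using disj emeasure_lborel_ball_finite by (intro measure_finite_Union[symmetric]) (auto simp: less_top[symmetric])
  also have "\<dots> \<le> measure lborel (ball 0 1 \<inter> sgn -` A)"
  proof (rule measure_mono_fmeasurable[OF sub])
    have "ball (0::'a) 1 \<in> fmeasurable lborel"
      by (rule fmeasurableI) (simp, rule emeasure_lborel_ball_finite)
    moreover have "ball 0 1 \<inter> sgn -` A \<in> sets lborel"
      using A measurable_sets[OF sgn_borel_measurable, of A] by auto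
    ultimately show "ball 0 1 \<inter> sgn -` A \<in> fmeasurable lborel"
      using fmeasurableI2[of "ball (0::'a) 1" lborel "ball 0 1 \<inter> sgn -` A"] by blast
    show "(\<Union>i<n. ?c i) \<in> sets lborel" by (intro sets.finite_UN) simp_all
  qed
  finally have "?V * ((1/2) * (1/8) ^ DIM('a) * \<epsilon> ^ (DIM('a) - 1)) \<le> measure lborel (ball 0 1 \<inter> sgn -` A)" .
  moreover have "measure lborel (ball (0::'a) 1) = ?V" by (simp add: content_ball)
  moreover have "?V > 0" by simp
  ultimately show ?thesis
    unfolding A_def[symmetric] measure_sphere_cone[OF A] by (simp add: le_divide_eq mult.commute)
qed

section \<open>Moments of caps\<close>

text \<open>
  The mean of \<open>(\<theta> \<bullet> x - \<tau>)\<^sub>+ ^ j\<close>, which is the same for all unit vectors \<open>\<theta>\<close>; for \<open>j = 0\<close> it is the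
  measure of the cap \<open>{x. \<tau> < \<theta> \<bullet> x}\<close>.
\<close>

definition cap_moment :: "'a::euclidean_space itself \<Rightarrow> real \<Rightarrow> nat \<Rightarrow> real" where
  "cap_moment _ \<tau> j = (LINT x|sphere_measure. relu_pow j ((SOME b::'a. b \<in> sphere 0 1) \<bullet> x - \<tau>))"

lemma cap_moment:
  fixes \<theta> :: "'a::euclidean_space"
  assumes \<theta>: "\<theta> \<in> sphere 0 1"
  shows "(LINT x|sphere_measure. relu_pow j (\<theta> \<bullet> x - \<tau>)) = cap_moment TYPE('a) \<tau> j"
  unfolding cap_moment_def
  by (rule zonal_integral_indep[OF \<theta> _, of _ "\<lambda>t. relu_pow j (t - \<tau>)"])
    (rule someI[of "\<lambda>b. b \<in> sphere 0 1", OF \<theta>], measurable)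

lemma sphere_nonempty_ex: "\<exists>b::'a::euclidean_space. b \<in> sphere 0 1"
  using SOME_Basis[where 'a='a] norm_Basis by (metis dist_0_norm mem_sphere)

lemma relu_zonal_integrable:
  assumes "0 \<le> \<tau>" "\<theta> \<in> sphere 0 1"
  shows "integrable sphere_measure (\<lambda>x. relu_pow j ((\<theta>::'a::euclidean_space) \<bullet> x - \<tau>))"
  using zonal_integrable[OF bounded_profile_relu_pow[OF assms(1)] assms(2)] .

lemma cap_moment_nonneg: "0 \<le> cap_moment TYPE('a::euclidean_space) \<tau> j"
  unfolding cap_moment_def by (intro integral_nonneg_AE AE_I2 relu_pow_nonneg)

lemma cap_moment_le:
  assumes \<tau>: "0 \<le> \<tau>" "\<tau> \<le> 1"
  shows "cap_moment TYPE('a::euclidean_space) \<tau> (i + j) \<le> (1 - \<tau>) ^ i * cap_moment TYPE('a) \<tau> j"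
proof -
  obtain b :: 'a where b: "b \<in> sphere 0 1" using sphere_nonempty_ex by blast
  have "(LINT x|sphere_measure. relu_pow (i + j) (b \<bullet> x - \<tau>)) \<le> (LINT x|sphere_measure. (1 - \<tau>) ^ i * relu_pow j (b \<bullet> x - \<tau>))"
  proof (intro sphere_integral_mono integrable_mult_right relu_zonal_integrable \<tau> b)
    fix x :: 'a assume "x \<in> sphere 0 1"
    then show "relu_pow (i + j) (b \<bullet> x - \<tau>) \<le> (1 - \<tau>) ^ i * relu_pow j (b \<bullet> x - \<tau>)"
      using inner_sphere_range[OF b, of x] \<tau> by (intro relu_pow_le) auto
  qed
  then show ?thesis by (simp add: cap_moment[OF b])
qed

text \<open>
  The Laplace-Beltrami operator on the sphere in dimension \<open>N\<close>, applied to the profile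
  \<open>(t - \<tau>)\<^sub>+ ^ (j + 2)\<close>.
\<close>

definition cap_laplacian :: "real \<Rightarrow> real \<Rightarrow> nat \<Rightarrow> real \<Rightarrow> real" where
  "cap_laplacian N \<tau> j t = real (Suc (Suc j)) * real (Suc j) * ((1 - t\<^sup>2) * relu_pow j (t - \<tau>))
     - (N - 1) * real (Suc (Suc j)) * (t * relu_pow (Suc j) (t - \<tau>))"

lemma cap_laplacian_expand:
  "cap_laplacian N \<tau> j t = real (Suc (Suc j)) * (real (Suc j) * (1 - \<tau>\<^sup>2) * relu_pow j (t - \<tau>)
     - (2 * real (Suc j) + N - 1) * \<tau> * relu_pow (Suc j) (t - \<tau>)
     - (real (Suc j) + N - 1) * relu_pow (Suc (Suc j)) (t - \<tau>))"
  unfolding cap_laplacian_def relu_pow_mult_t[symmetric] by (simp add: power2_eq_square algebra_simps)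

lemma bounded_profile_cap_laplacian:
  assumes "0 \<le> \<tau>"
  shows "cap_laplacian N \<tau> j \<in> bounded_profile"
  unfolding cap_laplacian_expand[abs_def]
  by (intro bounded_profile_mult bounded_profile_diff bounded_profile_const bounded_profile_relu_pow assms)

lemma cap_laplacian_eigenvalue:
  fixes \<theta> :: "'a::euclidean_space"
  assumes \<tau>: "0 \<le> \<tau>" "\<tau> < 1" and \<theta>: "\<theta> \<in> sphere 0 1" and p: "p \<in> solid_harmonics m"
  shows "zonal_pairing \<theta> (cap_laplacian (real DIM('a)) \<tau> j) p
     = - (real m * (real m + real DIM('a) - 2)) * zonal_pairing \<theta> (\<lambda>t. relu_pow (Suc (Suc j)) (t - \<tau>)) p"
proof -
  have "kinked \<tau> (\<lambda>t. real (Suc (Suc j)) * relu_pow (Suc j) (t - \<tau>)) (\<lambda>t. real (Suc (Suc j)) * (real (Suc j) * relu_pow j (t - \<tau>)))"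
    by (intro kinked_cmult kinked_relu_pow \<tau>)
  from zonal_laplacian_eigenvalue[OF kinked_relu_pow[OF \<tau>(1)] this \<tau> \<theta> p]
  show ?thesis unfolding cap_laplacian_def[abs_def] by (simp only: mult_ac)
qed

text \<open>
  A Laplacian has mean zero; for the profile \<open>(t - \<tau>)\<^sub>+ ^ (j + 2)\<close> this is a linear relation between three
  consecutive moments. Together with the trivial bound in the other direction, all the moments
  \<open>cap_moment TYPE('a) \<tau> j\<close> are comparable to \<open>(1 - \<tau>) ^ j\<close> times the measure of the cap.
\<close>

lemma cap_moment_step:
  assumes \<tau>: "0 \<le> \<tau>" "\<tau> < 1" and N: "DIM('a::euclidean_space) \<ge> 2"
  shows "(1 - \<tau>) * cap_moment TYPE('a) \<tau> j \<le> (1 + 2 * real DIM('a)) * cap_moment TYPE('a) \<tau> (Suc j)"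
proof -
  let ?M = "cap_moment TYPE('a) \<tau>" and ?N = "real DIM('a)"
  obtain b :: 'a where b: "b \<in> sphere 0 1" using sphere_nonempty_ex by blast
  have "zonal_pairing b (cap_laplacian ?N \<tau> j) (\<lambda>x. 1) = 0"
    using cap_laplacian_eigenvalue[OF \<tau> b solid_harmonics_const[of 1], of j] by simp
  moreover have "zonal_pairing b (cap_laplacian ?N \<tau> j) (\<lambda>x. 1) = real (Suc (Suc j)) * (real (Suc j) * (1 - \<tau>\<^sup>2) * ?M j
     - (2 * real (Suc j) + ?N - 1) * \<tau> * ?M (Suc j) - (real (Suc j) + ?N - 1) * ?M (Suc (Suc j)))"
    unfolding zonal_pairing_def cap_laplacian_expand
    using relu_zonal_integrable[OF \<tau>(1) b] by (simp add: cap_moment[OF b] del: of_nat_Suc)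
  ultimately have "real (Suc j) * (1 - \<tau>\<^sup>2) * ?M j
     = (2 * real (Suc j) + ?N - 1) * \<tau> * ?M (Suc j) + (real (Suc j) + ?N - 1) * ?M (Suc (Suc j))" by simp
  also have "\<dots> \<le> (2 * real (Suc j) + ?N - 1) * 1 * ?M (Suc j) + (real (Suc j) + ?N - 1) * ?M (Suc j)"
  proof -
    have "?M (1 + Suc j) \<le> (1 - \<tau>) ^ 1 * ?M (Suc j)" using \<tau> by (intro cap_moment_le) auto
    also have "\<dots> \<le> 1 * ?M (Suc j)" using \<tau> by (intro mult_right_mono cap_moment_nonneg) auto
    finally have "?M (Suc (Suc j)) \<le> ?M (Suc j)" by simp
    then show ?thesis using \<tau> N cap_moment_nonneg by (intro add_mono mult_left_mono mult_right_mono) auto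
  qed
  also have "\<dots> \<le> real (Suc j) * ((1 + 2 * ?N) * ?M (Suc j))"
  proof -
    have "0 \<le> real j * (2 * ?N - 2)" using N by (intro mult_nonneg_nonneg) auto
    then have "2 * real (Suc j) + ?N - 1 + (real (Suc j) + ?N - 1) \<le> real (Suc j) * (1 + 2 * ?N)"
      by (simp add: algebra_simps)
    from mult_right_mono[OF this cap_moment_nonneg[where 'a='a, of \<tau> "Suc j"]] show ?thesis by (simp add: algebra_simps)
  qed
  finally have "real (Suc j) * ((1 - \<tau>\<^sup>2) * ?M j) \<le> real (Suc j) * ((1 + 2 * ?N) * ?M (Suc j))" by (simp add: algebra_simps)
  then have 1: "(1 - \<tau>\<^sup>2) * ?M j \<le> (1 + 2 * ?N) * ?M (Suc j)" by (subst (asm) mult_le_cancel_left_pos) auto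
  have "\<tau> * \<tau> \<le> \<tau> * 1" using \<tau> by (intro mult_left_mono) auto
  then have "(1 - \<tau>) * ?M j \<le> (1 - \<tau>\<^sup>2) * ?M j"
    by (intro mult_right_mono cap_moment_nonneg) (simp add: power2_eq_square)
  with 1 show ?thesis by simp
qed

lemma cap_moment_lower:
  assumes \<tau>: "0 \<le> \<tau>" "\<tau> < 1" and N: "DIM('a::euclidean_space) \<ge> 2"
  shows "(1 - \<tau>) ^ j * cap_moment TYPE('a) \<tau> 0 \<le> (1 + 2 * real DIM('a)) ^ j * cap_moment TYPE('a) \<tau> j"
proof (induction j)
  case (Suc j)
  have "(1 - \<tau>) ^ Suc j * cap_moment TYPE('a) \<tau> 0 \<le> (1 - \<tau>) * ((1 + 2 * real DIM('a)) ^ j * cap_moment TYPE('a) \<tau> j)"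
    using mult_left_mono[OF Suc, of "1 - \<tau>"] \<tau> by simp
  also have "\<dots> = (1 + 2 * real DIM('a)) ^ j * ((1 - \<tau>) * cap_moment TYPE('a) \<tau> j)" by simp
  also have "\<dots> \<le> (1 + 2 * real DIM('a)) ^ j * ((1 + 2 * real DIM('a)) * cap_moment TYPE('a) \<tau> (Suc j))"
    by (intro mult_left_mono cap_moment_step assms) auto
  finally show ?case by (simp add: mult_ac)
qed simp

lemma cap_iff_norm:
  fixes \<theta> x :: "'a::euclidean_space"
  assumes "\<theta> \<in> sphere 0 1" "x \<in> sphere 0 1" "\<epsilon> > 0"
  shows "1 - \<epsilon>\<^sup>2 / 2 < \<theta> \<bullet> x \<longleftrightarrow> norm (x - \<theta>) < \<epsilon>"
proof -
  have "(norm (x - \<theta>))\<^sup>2 = 2 - 2 * (\<theta> \<bullet> x)"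
    using assms by (simp add: dot_norm_neg[of \<theta> x] norm_minus_commute field_simps)
  then have "1 - \<epsilon>\<^sup>2 / 2 < \<theta> \<bullet> x \<longleftrightarrow> (norm (x - \<theta>))\<^sup>2 < \<epsilon>\<^sup>2" by linarith
  also have "\<dots> \<longleftrightarrow> norm (x - \<theta>) < \<epsilon>"
    using assms(3) power2_less_imp_less[of "norm (x - \<theta>)" \<epsilon>] power_strict_mono[of "norm (x - \<theta>)" \<epsilon> 2] by auto
  finally show ?thesis .
qed

lemma cap_moment_0:
  fixes \<theta> :: "'a::euclidean_space"
  assumes \<theta>: "\<theta> \<in> sphere 0 1" and \<epsilon>: "\<epsilon> > 0"
  shows "cap_moment TYPE('a) (1 - \<epsilon>\<^sup>2 / 2) 0 = measure sphere_measure {x \<in> sphere 0 1. norm (x - \<theta>) < \<epsilon>}"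
proof -
  let ?A = "{x \<in> sphere 0 1. norm (x - \<theta>) < \<epsilon>}"
  have "?A = sphere 0 1 \<inter> ball \<theta> \<epsilon>" by (auto simp: dist_norm norm_minus_commute)
  then have "?A \<in> sets sphere_measure" by (auto simp: sets_sphere_measure sets_restrict_space)
  moreover have "(LINT x|sphere_measure. relu_pow 0 (\<theta> \<bullet> x - (1 - \<epsilon>\<^sup>2 / 2))) = (LINT x|sphere_measure. indicator ?A x)"
    by (intro Bochner_Integration.integral_cong refl)
      (use cap_iff_norm[OF \<theta> _ \<epsilon>] in \<open>auto simp: relu_pow_0 indicator_def\<close>)
  moreover have "?A \<inter> space sphere_measure = ?A" by auto
  ultimately show ?thesis using cap_moment[OF \<theta>] by simp
qed

section \<open>Ridge functions with disjoint supports and the upper estimate\<close>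

lemma disjoint_square_sum:
  fixes f :: "'i \<Rightarrow> real"
  assumes "finite J" "\<And>i j. i \<in> J \<Longrightarrow> j \<in> J \<Longrightarrow> i \<noteq> j \<Longrightarrow> f i * f j = 0"
  shows "(\<Sum>i\<in>J. f i)\<^sup>2 = (\<Sum>i\<in>J. (f i)\<^sup>2)"
  using assms
proof (induction J rule: finite_induct)
  case (insert i J)
  have "f i * (\<Sum>j\<in>J. f j) = 0"
    unfolding sum_distrib_left using insert by (intro sum.neutral) (metis insert_iff)
  then show ?case using insert by (simp add: power2_sum)
qed simp

lemma caps_disjoint:
  fixes \<theta> \<eta> x :: "'a::euclidean_space"
  assumes "\<theta> \<in> sphere 0 1" "\<eta> \<in> sphere 0 1" "x \<in> sphere 0 1" "\<epsilon> > 0" "2 * \<epsilon> \<le> norm (\<theta> - \<eta>)"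
  shows "\<theta> \<bullet> x \<le> 1 - \<epsilon>\<^sup>2 / 2 \<or> \<eta> \<bullet> x \<le> 1 - \<epsilon>\<^sup>2 / 2"
proof (rule ccontr)
  assume "\<not> ?thesis"
  then have "norm (x - \<theta>) < \<epsilon>" "norm (x - \<eta>) < \<epsilon>"
    using cap_iff_norm[OF assms(1,3,4)] cap_iff_norm[OF assms(2,3,4)] by auto
  then show False
    using norm_triangle_ineq4[of "x - \<eta>" "x - \<theta>"] assms(5) by simp
qed

lemma ridge_measurable:
  assumes "finite J" "G \<in> bounded_profile"
  shows "(\<lambda>x. \<Sum>i\<in>J. b i * G ((\<eta> i :: 'a::euclidean_space) \<bullet> x)) \<in> borel_measurable sphere_measure"
  by (intro borel_measurable_sum borel_measurable_times zonal_measurable bounded_profile_measurable assms) auto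

lemma ridge_L2:
  assumes "finite J" "G \<in> bounded_profile" "\<And>i. i \<in> J \<Longrightarrow> \<eta> i \<in> sphere (0::'a::euclidean_space) 1"
  shows "(\<lambda>x. \<Sum>i\<in>J. b i * G (\<eta> i \<bullet> x)) \<in> sphere_L2"
proof -
  obtain B where B: "B > 0" "\<And>t. t \<in> {-1..1} \<Longrightarrow> \<bar>G t\<bar> \<le> B" using bounded_profileE[OF assms(2)] by metis
  have bd: "\<bar>\<Sum>i\<in>J. b i * G (\<eta> i \<bullet> x)\<bar> \<le> (\<Sum>i\<in>J. \<bar>b i\<bar> * B)" if "x \<in> sphere 0 1" for x
    using B(2) inner_sphere_range[OF assms(3) that]
    by (intro order_trans[OF sum_abs] sum_mono) (auto simp: abs_mult intro!: mult_left_mono)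
  have "\<bar>(\<Sum>i\<in>J. b i * G (\<eta> i \<bullet> x))\<^sup>2\<bar> \<le> (\<Sum>i\<in>J. \<bar>b i\<bar> * B)\<^sup>2" if "x \<in> sphere 0 1" for x
    using power_mono[OF bd[OF that] abs_ge_zero, of 2] by simp
  then show ?thesis unfolding sphere_L2_def
    using ridge_measurable[OF assms(1,2), of b \<eta>] by (auto intro!: integrable_sphere_bounded borel_measurable_power)
qed

lemma ridge_square_integral:
  fixes \<eta> :: "'i \<Rightarrow> 'a::euclidean_space"
  assumes J: "finite J" and G: "G \<in> bounded_profile" and \<eta>: "\<And>i. i \<in> J \<Longrightarrow> \<eta> i \<in> sphere 0 1" and \<epsilon>: "\<epsilon> > 0"
    and supp: "\<And>t. t \<le> 1 - \<epsilon>\<^sup>2 / 2 \<Longrightarrow> G t = 0"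
    and sep: "\<And>i j. i \<in> J \<Longrightarrow> j \<in> J \<Longrightarrow> i \<noteq> j \<Longrightarrow> 2 * \<epsilon> \<le> norm (\<eta> i - \<eta> j)"
    and \<theta>: "\<theta> \<in> sphere (0::'a) 1"
  shows "(LINT x|sphere_measure. (\<Sum>i\<in>J. b i * G (\<eta> i \<bullet> x))\<^sup>2) = (\<Sum>i\<in>J. (b i)\<^sup>2) * (LINT x|sphere_measure. (G (\<theta> \<bullet> x))\<^sup>2)"
proof -
  have G2: "(\<lambda>t. (G t)\<^sup>2) \<in> bounded_profile" by (intro bounded_profile_power G)
  have "(LINT x|sphere_measure. (\<Sum>i\<in>J. b i * G (\<eta> i \<bullet> x))\<^sup>2) = (LINT x|sphere_measure. (\<Sum>i\<in>J. (b i)\<^sup>2 * (G (\<eta> i \<bullet> x))\<^sup>2))"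
  proof (intro Bochner_Integration.integral_cong refl)
    fix x :: 'a assume "x \<in> space sphere_measure"
    then have x: "x \<in> sphere 0 1" by simp
    have "(\<Sum>i\<in>J. b i * G (\<eta> i \<bullet> x))\<^sup>2 = (\<Sum>i\<in>J. (b i * G (\<eta> i \<bullet> x))\<^sup>2)"
    proof (rule disjoint_square_sum[OF J])
      fix i j assume ij: "i \<in> J" "j \<in> J" "i \<noteq> j"
      show "b i * G (\<eta> i \<bullet> x) * (b j * G (\<eta> j \<bullet> x)) = 0"
        using caps_disjoint[OF \<eta>[OF ij(1)] \<eta>[OF ij(2)] x \<epsilon> sep[OF ij]] supp by auto
    qed
    then show "(\<Sum>i\<in>J. b i * G (\<eta> i \<bullet> x))\<^sup>2 = (\<Sum>i\<in>J. (b i)\<^sup>2 * (G (\<eta> i \<bullet> x))\<^sup>2)"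
      by (simp add: power_mult_distrib)
  qed
  also have "\<dots> = (\<Sum>i\<in>J. (b i)\<^sup>2 * (LINT x|sphere_measure. (G (\<eta> i \<bullet> x))\<^sup>2))"
    using zonal_integrable[OF G2 \<eta>] by (subst Bochner_Integration.integral_sum) auto
  also have "\<dots> = (\<Sum>i\<in>J. (b i)\<^sup>2 * (LINT x|sphere_measure. (G (\<theta> \<bullet> x))\<^sup>2))"
    using zonal_integral_indep[OF \<eta> \<theta> bounded_profile_measurable[OF G2]] by (intro sum.cong) auto
  finally show ?thesis by (simp add: sum_distrib_right)
qed

context spherical_basis
begin

lemma fourier_coeff_ridge:
  assumes J: "finite J" and G: "G \<in> bounded_profile" and \<eta>: "\<And>i. i \<in> J \<Longrightarrow> \<eta> i \<in> sphere 0 1"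
    and FH: "\<And>\<theta> p. \<theta> \<in> sphere (0::'a) 1 \<Longrightarrow> p \<in> solid_harmonics m \<Longrightarrow> zonal_pairing \<theta> G p = \<mu> * p \<theta>" and l: "l \<in> {1..N m}"
  shows "fourier_coeff (\<lambda>x. \<Sum>i\<in>J. b i * G (\<eta> i \<bullet> x)) (m, l) = \<mu> * (\<Sum>i\<in>J. b i * Ypoly m l (\<eta> i))"
proof -
  have "fourier_coeff (\<lambda>x. \<Sum>i\<in>J. b i * G (\<eta> i \<bullet> x)) (m, l) = (LINT x|sphere_measure. (\<Sum>i\<in>J. b i * (G (\<eta> i \<bullet> x) * Ypoly m l x)))"
    by (simp add: fourier_coeff_def Yfun_def sum_distrib_right mult.assoc)
  also have "\<dots> = (\<Sum>i\<in>J. b i * zonal_pairing (\<eta> i) G (Ypoly m l))"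
    using zonal_pairing_integrable[OF G \<eta> Ypoly_polynomial[OF l]]
    by (subst Bochner_Integration.integral_sum) (auto simp: zonal_pairing_def)
  also have "\<dots> = (\<Sum>i\<in>J. b i * (\<mu> * Ypoly m l (\<eta> i)))"
    using FH[OF \<eta> Ypoly(1)[OF l]] by (intro sum.cong) auto
  finally show ?thesis by (simp add: sum_distrib_left mult_ac)
qed

text \<open>
  For \<open>f = (\<Sum>j=1..n. a j * G (\<theta> j \<bullet> x))\<close> this is the energy of \<open>f\<close> in degree \<open>m\<close>, except for the square
  of the Funk-Hecke multiplier of \<open>G\<close>.
\<close>

definition energy :: "(nat \<Rightarrow> real) \<Rightarrow> (nat \<Rightarrow> 'a) \<Rightarrow> nat \<Rightarrow> nat \<Rightarrow> real" where
  "energy a \<theta> n m = (\<Sum>l=1..N m. (\<Sum>j=1..n. a j * Ypoly m l (\<theta> j))\<^sup>2)"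

lemma energy_nonneg: "0 \<le> energy a \<theta> n m" by (simp add: energy_def sum_nonneg)

text \<open>
  Test with the profile \<open>(t - \<tau>)\<^sub>+\<close>. Its translates to the points \<open>\<theta> j\<close> have disjoint supports. In the
  degrees considered the kernel \<open>zonal_kernel m b\<close> is at least half of its maximum on the support, so
  the multiplier is at least half of the mean of the profile, and Bessel's inequality gives the
  estimate.
\<close>

lemma energy_upper:
  assumes \<theta>: "\<theta> ` {1..n} \<subseteq> sphere 0 1" and \<epsilon>: "0 < \<epsilon>" "\<epsilon> \<le> 1"
    and sep: "\<And>i j. i \<in> {1..n} \<Longrightarrow> j \<in> {1..n} \<Longrightarrow> i \<noteq> j \<Longrightarrow> 2 * \<epsilon> \<le> norm (\<theta> i - \<theta> j)"
    and M: "\<epsilon> * real M * sqrt (real DIM('a)) \<le> 1/2"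
  shows "(\<Sum>m\<le>M. energy a \<theta> n m) * cap_moment TYPE('a) (1 - \<epsilon>\<^sup>2 / 2) 0 \<le> 4 * (1 + 2 * real DIM('a)) * (\<Sum>j=1..n. (a j)\<^sup>2)"
proof -
  define \<tau> where "\<tau> = 1 - \<epsilon>\<^sup>2 / 2"
  have "\<epsilon>\<^sup>2 \<le> 1" using \<epsilon> by (simp add: power_le_one)
  then have \<tau>: "0 \<le> \<tau>" "\<tau> < 1" using \<epsilon> by (auto simp: \<tau>_def)
  define G where "G t = relu_pow (Suc 0) (t - \<tau>)" for t
  have Gb: "G \<in> bounded_profile" unfolding G_def using bounded_profile_relu_pow[OF \<tau>(1)] .
  have Gc: "continuous_on UNIV G" unfolding G_def[abs_def] by (rule relu_pow_continuous)
  let ?M = "cap_moment TYPE('a) \<tau>" and ?E = "1 + 2 * real DIM('a)" and ?A = "\<Sum>j=1..n. (a j)\<^sup>2"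
  obtain b :: 'a where b: "b \<in> sphere 0 1" using sphere_nonempty_ex by blast
  have th: "\<theta> j \<in> sphere 0 1" if "j \<in> {1..n}" for j using \<theta> that by (auto simp only: image_subset_iff)
  have "\<forall>m. \<exists>\<mu>. \<forall>\<theta>\<in>sphere (0::'a) 1. \<forall>p\<in>solid_harmonics m. zonal_pairing \<theta> G p = \<mu> * p \<theta>"
    using funk_hecke[where 'a='a, OF _ Gc] dim3 by (metis Suc_leD eval_nat_numeral(3))
  then obtain \<mu> where \<mu>: "\<And>m \<theta> p. \<theta> \<in> sphere (0::'a) 1 \<Longrightarrow> p \<in> solid_harmonics m \<Longrightarrow> zonal_pairing \<theta> G p = \<mu> m * p \<theta>" by metis
  have lower: "(?M 1 / 2)\<^sup>2 * energy a \<theta> n m \<le> (\<mu> m)\<^sup>2 * energy a \<theta> n m" if m: "m \<le> M" for m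
  proof (cases "zonal_kernel m b b = 0")
    case True
    have "Ypoly m l x = 0" if "l \<in> {1..N m}" "x \<in> sphere 0 1" for l x
    proof -
      have "(\<Sum>l=1..N m. (Ypoly m l x)\<^sup>2) = 0" using zonal_kernel_diagonal[OF b, of m x] True by simp
      then show ?thesis using that by (auto simp: sum_nonneg_eq_0_iff)
    qed
    then have "energy a \<theta> n m = 0" using th by (simp add: energy_def)
    then show ?thesis by simp
  next
    case False
    then have D: "zonal_kernel m b b > 0" using zonal_kernel_diagonal_nonneg[of m b] by simp
    have zh: "zonal_kernel m b \<in> solid_harmonics m" unfolding zonal_kernel_def[abs_def] using Ypoly(1) by (intro solid_harmonics_lincomb) auto
    note zp = solid_harmonicsD(1)[OF zh]
    have "(LINT x|sphere_measure. (zonal_kernel m b b / 2) * G (b \<bullet> x)) \<le> zonal_pairing b G (zonal_kernel m b)"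
      unfolding zonal_pairing_def
    proof (intro sphere_integral_mono integrable_mult_right zonal_integrable zonal_pairing_integrable Gb b zp)
      fix x :: 'a assume x: "x \<in> sphere 0 1"
      show "(zonal_kernel m b b / 2) * G (b \<bullet> x) \<le> G (b \<bullet> x) * zonal_kernel m b x"
      proof (cases "\<tau> < b \<bullet> x")
        case True
        then have "norm (x - b) < \<epsilon>" using cap_iff_norm[OF b x \<epsilon>(1)] by (simp add: \<tau>_def)
        then have "norm (x - b) * real m * sqrt (real DIM('a)) \<le> \<epsilon> * real M * sqrt (real DIM('a))"
          using m \<epsilon> by (intro mult_mono) auto
        then have "zonal_kernel m b b / 2 \<le> zonal_kernel m b x" using zonal_kernel_near_diagonal[OF b x order_trans[OF _ M]] by blast
        then have "(zonal_kernel m b b / 2) * G (b \<bullet> x) \<le> zonal_kernel m b x * G (b \<bullet> x)"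
          by (intro mult_right_mono) (simp_all add: G_def relu_pow_nonneg)
        then show ?thesis by (simp add: mult.commute)
      next
        case False
        then show ?thesis by (simp add: G_def relu_pow_nonpos)
      qed
    qed
    then have "zonal_kernel m b b * (?M 1 / 2) \<le> zonal_kernel m b b * \<mu> m"
      using \<mu>[OF b zh] cap_moment[OF b, of "Suc 0" \<tau>] by (simp add: G_def mult.commute)
    then have "?M 1 / 2 \<le> \<mu> m" using D by (subst (asm) mult_le_cancel_left_pos)
    then have "(?M 1 / 2)\<^sup>2 \<le> (\<mu> m)\<^sup>2" using cap_moment_nonneg by (intro power_mono) auto
    then show ?thesis using energy_nonneg by (intro mult_right_mono)
  qed
  let ?g = "\<lambda>x. \<Sum>j\<in>{1..n}. a j * G (\<theta> j \<bullet> x)"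
  have cfg: "fourier_coeff ?g (m, l) = \<mu> m * (\<Sum>j=1..n. a j * Ypoly m l (\<theta> j))" if "l \<in> {1..N m}" for m l
    using fourier_coeff_ridge[where J="{1..n}" and \<eta>=\<theta>, OF finite_atLeastAtMost Gb th \<mu> that] by simp
  have "(?M 1 / 2)\<^sup>2 * (\<Sum>m\<le>M. energy a \<theta> n m) \<le> (\<Sum>m\<le>M. (\<mu> m)\<^sup>2 * energy a \<theta> n m)"
    unfolding sum_distrib_left using lower by (intro sum_mono) auto
  also have "\<dots> = (\<Sum>m<Suc M. \<Sum>l=1..N m. (fourier_coeff ?g (m, l))\<^sup>2)"
    unfolding lessThan_Suc_atMost energy_def
    by (subst sum_distrib_left, intro sum.cong refl) (simp only: cfg power_mult_distrib)
  also have "\<dots> = (\<Sum>i\<in>degree_index (Suc M). (fourier_coeff ?g i)\<^sup>2)" by (simp add: sum_degree_index)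
  also have "\<dots> \<le> (LINT x|sphere_measure. (?g x)\<^sup>2)" by (intro bessel ridge_L2 Gb th) auto
  also have "\<dots> = ?A * (LINT x|sphere_measure. (G (b \<bullet> x))\<^sup>2)"
    by (rule ridge_square_integral[OF _ Gb th \<epsilon>(1) _ sep b]) (auto simp: G_def \<tau>_def relu_pow_nonpos)
  also have "(LINT x|sphere_measure. (G (b \<bullet> x))\<^sup>2) = ?M 2"
    unfolding cap_moment[OF b, symmetric] using relu_pow_add[of 1 1] by (simp add: G_def power2_eq_square numeral_2_eq_2)
  also have "?A * ?M 2 \<le> ?A * ((1 - \<tau>) * ?M 1)"
    using cap_moment_le[of \<tau> 1 1, where 'a='a] \<tau> by (intro mult_left_mono sum_nonneg) (auto simp: numeral_2_eq_2)
  finally have 1: "?M 1 * (?M 1 * (\<Sum>m\<le>M. energy a \<theta> n m)) \<le> ?M 1 * (4 * (1 - \<tau>) * ?A)"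
    by (simp add: power2_eq_square field_simps)
  have 2: "(1 - \<tau>) * ?M 0 \<le> ?E * ?M 1" using cap_moment_lower[OF \<tau>, of 1, where 'a='a] dim3 by simp
  have M0: "?M 0 > 0"
  proof -
    have "0 < (1/2) * (1/8) ^ DIM('a) * \<epsilon> ^ (DIM('a) - 1)" using \<epsilon> by simp
    also have "\<dots> \<le> ?M 0" using cap_lower[OF b \<epsilon>] cap_moment_0[OF b \<epsilon>(1)] by (simp add: \<tau>_def)
    finally show ?thesis .
  qed
  have M1: "?M 1 > 0"
  proof -
    have "0 < (1 - \<tau>) * ?M 0" using \<tau> M0 by simp
    with 2 have "0 < ?E * ?M 1" by linarith
    then show ?thesis by (simp add: zero_less_mult_iff)
  qed
  have "?M 1 * (\<Sum>m\<le>M. energy a \<theta> n m) \<le> 4 * (1 - \<tau>) * ?A" using 1 M1 by (subst (asm) mult_le_cancel_left_pos)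
  then have 3: "?E * ?M 1 * (\<Sum>m\<le>M. energy a \<theta> n m) \<le> ?E * (4 * (1 - \<tau>) * ?A)" by (simp only: mult.assoc) simp
  have "(1 - \<tau>) * (?M 0 * (\<Sum>m\<le>M. energy a \<theta> n m)) = (1 - \<tau>) * ?M 0 * (\<Sum>m\<le>M. energy a \<theta> n m)" by simp
  also have "\<dots> \<le> ?E * ?M 1 * (\<Sum>m\<le>M. energy a \<theta> n m)" using 2 by (intro mult_right_mono sum_nonneg energy_nonneg)
  also have "\<dots> \<le> ?E * (4 * (1 - \<tau>) * ?A)" by (rule 3)
  also have "\<dots> = (1 - \<tau>) * (4 * ?E * ?A)" by (simp only: mult_ac)
  finally have "(1 - \<tau>) * (?M 0 * (\<Sum>m\<le>M. energy a \<theta> n m)) \<le> (1 - \<tau>) * (4 * ?E * ?A)" .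
  then have "?M 0 * (\<Sum>m\<le>M. energy a \<theta> n m) \<le> 4 * ?E * ?A" using \<tau> by (subst (asm) mult_le_cancel_left_pos) auto
  then show ?thesis by (simp add: \<tau>_def mult.commute)
qed

end

section \<open>A profile that is a Laplacian\<close>

text \<open>
  The Laplacian of \<open>(t - \<tau>)\<^sub>+ ^ 4\<close>. The fourth power is the smallest one for which the profile is
  continuous and has a bounded Laplacian.
\<close>

definition bump :: "real \<Rightarrow> real \<Rightarrow> real \<Rightarrow> real" where
  "bump N \<tau> = cap_laplacian N \<tau> 2"

text \<open>
  The Laplacian of \<open>bump N \<tau>\<close>, obtained from the expansion of \<open>bump\<close> in powers of \<open>(t - \<tau>)\<^sub>+\<close>.
\<close>

definition bump_laplacian :: "real \<Rightarrow> real \<Rightarrow> real \<Rightarrow> real" where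
  "bump_laplacian N \<tau> t = 12 * (1 - \<tau>\<^sup>2) * cap_laplacian N \<tau> 0 t - 4 * (N + 5) * \<tau> * cap_laplacian N \<tau> 1 t
     - 4 * (N + 2) * cap_laplacian N \<tau> 2 t"

lemma bump_expand:
  "bump N \<tau> t = 12 * (1 - \<tau>\<^sup>2) * relu_pow 2 (t - \<tau>) - 4 * (N + 5) * \<tau> * relu_pow 3 (t - \<tau>) - 4 * (N + 2) * relu_pow 4 (t - \<tau>)"
  unfolding bump_def cap_laplacian_expand by (simp add: eval_nat_numeral algebra_simps)

lemma bounded_profile_bump: "0 \<le> \<tau> \<Longrightarrow> bump N \<tau> \<in> bounded_profile"
  unfolding bump_def by (rule bounded_profile_cap_laplacian)

lemma bounded_profile_bump_laplacian: "0 \<le> \<tau> \<Longrightarrow> bump_laplacian N \<tau> \<in> bounded_profile"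
  unfolding bump_laplacian_def[abs_def]
  by (intro bounded_profile_mult bounded_profile_diff bounded_profile_const bounded_profile_cap_laplacian)

lemma continuous_bump: "continuous_on UNIV (bump N \<tau>)"
  unfolding bump_expand[abs_def] eval_nat_numeral
  by (intro continuous_on_diff continuous_on_mult continuous_on_const relu_pow_continuous)

lemma cap_laplacian_supp: "t \<le> \<tau> \<Longrightarrow> cap_laplacian N \<tau> j t = 0"
  by (simp add: cap_laplacian_def relu_pow_nonpos)

lemma bump_supp: "t \<le> \<tau> \<Longrightarrow> bump N \<tau> t = 0" "t \<le> \<tau> \<Longrightarrow> bump_laplacian N \<tau> t = 0"
  by (simp_all add: bump_def bump_laplacian_def cap_laplacian_supp)

lemma bump_laplacian_eigenvalue:
  fixes \<theta> :: "'a::euclidean_space"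
  assumes \<tau>: "0 \<le> \<tau>" "\<tau> < 1" and \<theta>: "\<theta> \<in> sphere 0 1" and p: "p \<in> solid_harmonics m"
  shows "zonal_pairing \<theta> (bump (real DIM('a)) \<tau>) p = - (real m * (real m + real DIM('a) - 2)) * zonal_pairing \<theta> (\<lambda>t. relu_pow 4 (t - \<tau>)) p"
    "zonal_pairing \<theta> (bump_laplacian (real DIM('a)) \<tau>) p = - (real m * (real m + real DIM('a) - 2)) * zonal_pairing \<theta> (bump (real DIM('a)) \<tau>) p"
proof -
  let ?e = "- (real m * (real m + real DIM('a) - 2))" and ?N = "real DIM('a)"
  let ?u = "\<lambda>j. zonal_pairing \<theta> (\<lambda>t. relu_pow j (t - \<tau>)) p"
  have four: "Suc (Suc 2) = 4" "Suc (Suc 1) = 3" "Suc (Suc 0) = 2" by simp_all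
  note L = cap_laplacian_eigenvalue[OF \<tau> \<theta> p]
  note pp = solid_harmonicsD(1)[OF p]
  show "zonal_pairing \<theta> (bump ?N \<tau>) p = ?e * ?u 4"
    unfolding bump_def using L[of 2] by (simp only: four)
  have *: "zonal_pairing \<theta> (\<lambda>t. a * f t - b * g t - c * h t) p = a * zonal_pairing \<theta> f p - b * zonal_pairing \<theta> g p - c * zonal_pairing \<theta> h p"
    if "f \<in> bounded_profile" "g \<in> bounded_profile" "h \<in> bounded_profile" for a b c f g h
    using that \<theta> pp by (subst zonal_pairing_diff | intro bounded_profile_diff bounded_profile_mult bounded_profile_const | simp add: zonal_pairing_cmult)+
  have "zonal_pairing \<theta> (bump_laplacian ?N \<tau>) p = 12 * (1 - \<tau>\<^sup>2) * (?e * ?u 2) - 4 * (?N + 5) * \<tau> * (?e * ?u 3) - 4 * (?N + 2) * (?e * ?u 4)"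
    unfolding bump_laplacian_def[abs_def]
    by (subst *) (simp_all only: L four bounded_profile_cap_laplacian[OF \<tau>(1)])
  also have "\<dots> = ?e * (12 * (1 - \<tau>\<^sup>2) * ?u 2 - 4 * (?N + 5) * \<tau> * ?u 3 - 4 * (?N + 2) * ?u 4)"
    by (simp add: algebra_simps)
  also have "12 * (1 - \<tau>\<^sup>2) * ?u 2 - 4 * (?N + 5) * \<tau> * ?u 3 - 4 * (?N + 2) * ?u 4 = zonal_pairing \<theta> (bump ?N \<tau>) p"
    unfolding bump_expand[abs_def] by (rule *[symmetric]) (rule bounded_profile_relu_pow[OF \<tau>(1)])+
  finally show "zonal_pairing \<theta> (bump_laplacian ?N \<tau>) p = ?e * zonal_pairing \<theta> (bump ?N \<tau>) p" .
qed

lemma cap_laplacian_bound: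
  assumes \<tau>: "0 \<le> \<tau>" "\<tau> < 1" and t: "t \<in> {-1..1}" and N: "N \<ge> 1"
  shows "\<bar>cap_laplacian N \<tau> j t\<bar> \<le> real (Suc (Suc j)) * (2 * real (Suc j) + N - 1) * (1 - \<tau>) ^ Suc j"
proof (cases "\<tau> < t")
  case False
  then show ?thesis using \<tau> N by (simp add: cap_laplacian_supp)
next
  case True
  have "0 \<le> 1 - t\<^sup>2" "1 - t\<^sup>2 \<le> 2 * (1 - \<tau>)"
  proof -
    have "t\<^sup>2 \<le> 1\<^sup>2" using t by (intro abs_le_square_iff[THEN iffD1]) auto
    then show "0 \<le> 1 - t\<^sup>2" by simp
    have "1 - t\<^sup>2 = (1 - t) * (1 + t)" by (simp add: power2_eq_square algebra_simps)
    also have "\<dots> \<le> (1 - \<tau>) * 2" using True t by (intro mult_mono) auto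
    finally show "1 - t\<^sup>2 \<le> 2 * (1 - \<tau>)" by simp
  qed
  moreover have u: "0 \<le> relu_pow i (t - \<tau>)" "relu_pow i (t - \<tau>) \<le> (1 - \<tau>) ^ i" for i
    using True t by (auto simp: relu_pow_pos intro: power_mono)
  ultimately have 1: "0 \<le> (1 - t\<^sup>2) * relu_pow j (t - \<tau>)" "(1 - t\<^sup>2) * relu_pow j (t - \<tau>) \<le> 2 * (1 - \<tau>) * (1 - \<tau>) ^ j"
    using \<tau> by (auto intro!: mult_nonneg_nonneg mult_mono)
  have 2: "0 \<le> t * relu_pow (Suc j) (t - \<tau>)" "t * relu_pow (Suc j) (t - \<tau>) \<le> 1 * (1 - \<tau>) ^ Suc j"
    using True \<tau> t u[of "Suc j"] mult_mono[of t 1 "relu_pow (Suc j) (t - \<tau>)" "(1 - \<tau>) ^ Suc j"] by auto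
  have abs_le: "\<bar>c * y - d * z\<bar> \<le> c * y' + d * z'"
    if "0 \<le> c" "0 \<le> d" "0 \<le> y" "y \<le> y'" "0 \<le> z" "z \<le> z'" for c d y z y' z' :: real
  proof -
    have "0 \<le> c * y" "c * y \<le> c * y'" "0 \<le> d * z" "d * z \<le> d * z'"
      using that by (auto intro: mult_left_mono)
    then show ?thesis by linarith
  qed
  have "\<bar>cap_laplacian N \<tau> j t\<bar> \<le> real (Suc (Suc j)) * real (Suc j) * (2 * (1 - \<tau>) * (1 - \<tau>) ^ j) + (N - 1) * real (Suc (Suc j)) * (1 * (1 - \<tau>) ^ Suc j)"
    unfolding cap_laplacian_def using N by (intro abs_le 1 2) auto
  also have "\<dots> = real (Suc (Suc j)) * (2 * real (Suc j) + N - 1) * (1 - \<tau>) ^ Suc j"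
    by (simp add: algebra_simps)
  finally show ?thesis .
qed

definition bump_const :: "real \<Rightarrow> real" where
  "bump_const N = 48 * (N + 1) + 12 * (N + 5) * (N + 3) + 16 * (N + 2) * (N + 5)"

lemma bump_laplacian_bound:
  assumes \<tau>: "0 \<le> \<tau>" "\<tau> < 1" and t: "t \<in> {-1..1}" and N: "N \<ge> 1"
  shows "\<bar>bump_laplacian N \<tau> t\<bar> \<le> bump_const N * (1 - \<tau>)\<^sup>2 * relu_pow 0 (t - \<tau>)"
proof (cases "\<tau> < t")
  case False
  then show ?thesis by (simp add: bump_supp relu_pow_nonpos)
next
  case True
  define v where "v = 1 - \<tau>"
  have v: "0 < v" "v \<le> 1" using \<tau> by (auto simp: v_def)
  have v3: "v ^ 3 \<le> v\<^sup>2" using v by (intro power_decreasing) auto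
  note b = cap_laplacian_bound[OF \<tau> t N, folded v_def]
  have "1 - \<tau>\<^sup>2 = v * (1 + \<tau>)" by (simp add: v_def power2_eq_square algebra_simps)
  then have w: "0 \<le> 1 - \<tau>\<^sup>2" "1 - \<tau>\<^sup>2 \<le> v * 2" using \<tau> v by (auto intro!: mult_left_mono)
  have "\<bar>bump_laplacian N \<tau> t\<bar> \<le> \<bar>12 * (1 - \<tau>\<^sup>2) * cap_laplacian N \<tau> 0 t\<bar> + \<bar>4 * (N + 5) * \<tau> * cap_laplacian N \<tau> 1 t\<bar> + \<bar>4 * (N + 2) * cap_laplacian N \<tau> 2 t\<bar>"
    unfolding bump_laplacian_def by linarith
  also have "\<dots> = 12 * (1 - \<tau>\<^sup>2) * \<bar>cap_laplacian N \<tau> 0 t\<bar> + 4 * (N + 5) * \<tau> * \<bar>cap_laplacian N \<tau> 1 t\<bar> + 4 * (N + 2) * \<bar>cap_laplacian N \<tau> 2 t\<bar>"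
    using w \<tau> N by (simp add: abs_mult)
  also have "\<dots> \<le> 12 * (v * 2) * (2 * (N + 1) * v) + 4 * (N + 5) * 1 * (3 * (N + 3) * v\<^sup>2) + 4 * (N + 2) * (4 * (N + 5) * v ^ 3)"
    using b[of 0] b[of 1] b[of 2] w \<tau> N v
    by (intro add_mono mult_mono) (simp_all add: eval_nat_numeral algebra_simps)
  also have "\<dots> \<le> 12 * (v * 2) * (2 * (N + 1) * v) + 4 * (N + 5) * 1 * (3 * (N + 3) * v\<^sup>2) + 4 * (N + 2) * (4 * (N + 5) * v\<^sup>2)"
    using v3 N v by (intro add_mono mult_left_mono) auto
  also have "\<dots> = bump_const N * v\<^sup>2" by (simp add: bump_const_def power2_eq_square algebra_simps)
  finally show ?thesis using True by (simp add: v_def relu_pow_0)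
qed

context
  fixes \<tau> :: real and \<theta> :: "'a::euclidean_space"
  assumes \<tau>: "1/2 \<le> \<tau>" "\<tau> < 1" and \<theta>: "\<theta> \<in> sphere 0 1" and dim3: "DIM('a) \<ge> 3"
begin

private lemma \<tau>': "0 \<le> \<tau>" using \<tau> by simp

text \<open>
  Write \<open>u\<close> for \<open>(t - \<tau>)\<^sub>+ ^ 4\<close> and \<open>\<psi>\<close> for its Laplacian. Pairing with the harmonics \<open>1\<close> and \<open>\<theta> \<bullet> x\<close> shows
  that the mean of \<open>(1 - t) * \<psi>\<close> is \<open>N - 1\<close> times the mean of \<open>t * u\<close>; and \<open>0 \<le> 1 - t \<le> 1 - \<tau>\<close> on the
  cap.
\<close>

lemma bump_mass_lower:
  "cap_moment TYPE('a) \<tau> 4 \<le> (1 - \<tau>) * (LINT x|sphere_measure. \<bar>bump (real DIM('a)) \<tau> (\<theta> \<bullet> x)\<bar>)"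
proof -
  let ?N = "real DIM('a)" and ?u = "\<lambda>t. relu_pow 4 (t - \<tau>)"
  have ub: "?u \<in> bounded_profile" by (rule bounded_profile_relu_pow[OF \<tau>'])
  have pb: "bump (real DIM('a)) \<tau> \<in> bounded_profile" by (rule bounded_profile_bump[OF \<tau>'])
  note I = zonal_integrable[OF _ \<theta>]
  have z0: "(LINT x|sphere_measure. bump (real DIM('a)) \<tau> (\<theta> \<bullet> x)) = 0"
    using bump_laplacian_eigenvalue(1)[OF \<tau>' \<tau>(2) \<theta> solid_harmonics_const[of 1]] by (simp add: zonal_pairing_def)
  have z1: "(LINT x|sphere_measure. bump (real DIM('a)) \<tau> (\<theta> \<bullet> x) * (\<theta> \<bullet> x)) = - (?N - 1) * (LINT x|sphere_measure. ?u (\<theta> \<bullet> x) * (\<theta> \<bullet> x))"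
    using bump_laplacian_eigenvalue(1)[OF \<tau>' \<tau>(2) \<theta> solid_harmonics_inner[of \<theta>]] by (simp add: zonal_pairing_def)
  have i1: "integrable sphere_measure (\<lambda>x. bump (real DIM('a)) \<tau> (\<theta> \<bullet> x))" by (rule I[OF pb])
  have i2: "integrable sphere_measure (\<lambda>x. bump (real DIM('a)) \<tau> (\<theta> \<bullet> x) * (\<theta> \<bullet> x))"
    using I[of "\<lambda>t. bump (real DIM('a)) \<tau> t * t"] bounded_profile_mult[OF pb bounded_profile_id] by simp
  have i3: "integrable sphere_measure (\<lambda>x. ?u (\<theta> \<bullet> x) * (\<theta> \<bullet> x))"
    using I[of "\<lambda>t. ?u t * t"] bounded_profile_mult[OF ub bounded_profile_id] by simp
  have "cap_moment TYPE('a) \<tau> 4 \<le> (?N - 1) * (1/2) * cap_moment TYPE('a) \<tau> 4"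
    using dim3 mult_right_mono[OF _ cap_moment_nonneg[where 'a='a, of \<tau> 4], of 1 "(?N - 1) * (1/2)"] by simp
  also have "\<dots> = (?N - 1) * (LINT x|sphere_measure. (1/2) * ?u (\<theta> \<bullet> x))"
    using cap_moment[OF \<theta>, of 4 \<tau>] by simp
  also have "\<dots> \<le> (?N - 1) * (LINT x|sphere_measure. ?u (\<theta> \<bullet> x) * (\<theta> \<bullet> x))"
  proof (intro mult_left_mono sphere_integral_mono integrable_mult_right I[OF ub] i3)
    fix x :: 'a
    show "(1/2) * ?u (\<theta> \<bullet> x) \<le> ?u (\<theta> \<bullet> x) * (\<theta> \<bullet> x)"
    proof (cases "\<tau> < \<theta> \<bullet> x")
      case True
      then have "(1/2) * ?u (\<theta> \<bullet> x) \<le> (\<theta> \<bullet> x) * ?u (\<theta> \<bullet> x)" using \<tau> by (intro mult_right_mono relu_pow_nonneg) auto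
      then show ?thesis by (simp add: mult.commute)
    qed (simp add: relu_pow_nonpos)
  qed (use dim3 in auto)
  also have "\<dots> = (LINT x|sphere_measure. bump (real DIM('a)) \<tau> (\<theta> \<bullet> x) - bump (real DIM('a)) \<tau> (\<theta> \<bullet> x) * (\<theta> \<bullet> x))"
    using z0 z1 i1 i2 by (simp add: algebra_simps)
  also have "\<dots> \<le> (LINT x|sphere_measure. (1 - \<tau>) * \<bar>bump (real DIM('a)) \<tau> (\<theta> \<bullet> x)\<bar>)"
  proof (intro sphere_integral_mono Bochner_Integration.integrable_diff integrable_mult_right integrable_abs i1 i2)
    fix x :: 'a assume x: "x \<in> sphere 0 1"
    show "bump (real DIM('a)) \<tau> (\<theta> \<bullet> x) - bump (real DIM('a)) \<tau> (\<theta> \<bullet> x) * (\<theta> \<bullet> x) \<le> (1 - \<tau>) * \<bar>bump (real DIM('a)) \<tau> (\<theta> \<bullet> x)\<bar>"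
    proof (cases "\<tau> < \<theta> \<bullet> x")
      case True
      have t: "\<theta> \<bullet> x \<le> 1" using inner_sphere_range[OF \<theta> x] by simp
      have "bump (real DIM('a)) \<tau> (\<theta> \<bullet> x) - bump (real DIM('a)) \<tau> (\<theta> \<bullet> x) * (\<theta> \<bullet> x) = (1 - \<theta> \<bullet> x) * bump (real DIM('a)) \<tau> (\<theta> \<bullet> x)" by (simp add: algebra_simps)
      also have "\<dots> \<le> (1 - \<theta> \<bullet> x) * \<bar>bump (real DIM('a)) \<tau> (\<theta> \<bullet> x)\<bar>" using t by (intro mult_left_mono) auto
      also have "\<dots> \<le> (1 - \<tau>) * \<bar>bump (real DIM('a)) \<tau> (\<theta> \<bullet> x)\<bar>" using True by (intro mult_right_mono) auto
      finally show ?thesis .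
    qed (simp add: bump_supp)
  qed
  finally show ?thesis by simp
qed

lemma bump_Cauchy_Schwarz:
  assumes M0: "cap_moment TYPE('a) \<tau> 0 > 0"
  shows "(LINT x|sphere_measure. \<bar>bump (real DIM('a)) \<tau> (\<theta> \<bullet> x)\<bar>)\<^sup>2 \<le> cap_moment TYPE('a) \<tau> 0 * (LINT x|sphere_measure. (bump (real DIM('a)) \<tau> (\<theta> \<bullet> x))\<^sup>2)"
proof -
  let ?u = "\<lambda>t. relu_pow 0 (t - \<tau>)" and ?M = "cap_moment TYPE('a) \<tau> 0"
  let ?I = "LINT x|sphere_measure. \<bar>bump (real DIM('a)) \<tau> (\<theta> \<bullet> x)\<bar>"
  define c where "c = ?I / ?M"
  have pb: "bump (real DIM('a)) \<tau> \<in> bounded_profile" by (rule bounded_profile_bump[OF \<tau>'])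
  note I = zonal_integrable[OF _ \<theta>]
  have i: "integrable sphere_measure (\<lambda>x. \<bar>bump (real DIM('a)) \<tau> (\<theta> \<bullet> x)\<bar>)" "integrable sphere_measure (\<lambda>x. (bump (real DIM('a)) \<tau> (\<theta> \<bullet> x))\<^sup>2)"
    "integrable sphere_measure (\<lambda>x. ?u (\<theta> \<bullet> x))"
    using I[OF bounded_profile_abs[OF pb]] I[OF bounded_profile_power[OF pb]] I[OF bounded_profile_relu_pow[OF \<tau>']] by simp_all
  have "0 \<le> (LINT x|sphere_measure. (\<bar>bump (real DIM('a)) \<tau> (\<theta> \<bullet> x)\<bar> - c * ?u (\<theta> \<bullet> x))\<^sup>2)" by (intro integral_nonneg_AE) auto
  also have "\<dots> = (LINT x|sphere_measure. (bump (real DIM('a)) \<tau> (\<theta> \<bullet> x))\<^sup>2 - 2 * c * \<bar>bump (real DIM('a)) \<tau> (\<theta> \<bullet> x)\<bar> + c\<^sup>2 * ?u (\<theta> \<bullet> x))"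
  proof (intro Bochner_Integration.integral_cong refl)
    fix x :: 'a
    show "(\<bar>bump (real DIM('a)) \<tau> (\<theta> \<bullet> x)\<bar> - c * ?u (\<theta> \<bullet> x))\<^sup>2 = (bump (real DIM('a)) \<tau> (\<theta> \<bullet> x))\<^sup>2 - 2 * c * \<bar>bump (real DIM('a)) \<tau> (\<theta> \<bullet> x)\<bar> + c\<^sup>2 * ?u (\<theta> \<bullet> x)"
      by (cases "\<tau> < \<theta> \<bullet> x") (simp_all add: relu_pow_0 bump_supp power2_diff)
  qed
  also have "\<dots> = (LINT x|sphere_measure. (bump (real DIM('a)) \<tau> (\<theta> \<bullet> x))\<^sup>2) - 2 * c * ?I + c\<^sup>2 * ?M"
    using i cap_moment[OF \<theta>, of 0 \<tau>] by simp
  also have "\<dots> = (LINT x|sphere_measure. (bump (real DIM('a)) \<tau> (\<theta> \<bullet> x))\<^sup>2) - ?I\<^sup>2 / ?M"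
    using M0 by (simp add: c_def power2_eq_square)
  finally show ?thesis using M0 by (simp add: field_simps)
qed

text \<open>
  On the cap, whose radius squared is about \<open>1 - \<tau>\<close>, one more Laplacian costs no more than the factor
  \<open>1 / (1 - \<tau>)\<close>. The upper bound is pointwise; for the lower bound the \<open>L\<^sup>1\<close> norm of the preceding lemmas is
  compared with the measure of the cap.
\<close>

lemma bump_laplacian_norm:
  assumes M0: "cap_moment TYPE('a) \<tau> 0 > 0"
  shows "(1 - \<tau>)\<^sup>2 * (LINT x|sphere_measure. (bump_laplacian (real DIM('a)) \<tau> (\<theta> \<bullet> x))\<^sup>2)
    \<le> (bump_const (real DIM('a)))\<^sup>2 * (1 + 2 * real DIM('a)) ^ 8 * (LINT x|sphere_measure. (bump (real DIM('a)) \<tau> (\<theta> \<bullet> x))\<^sup>2)"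
    and "(LINT x|sphere_measure. (bump (real DIM('a)) \<tau> (\<theta> \<bullet> x))\<^sup>2) > 0"
proof -
  let ?N = "real DIM('a)" let ?E = "1 + 2 * ?N" let ?M = "cap_moment TYPE('a) \<tau>" let ?K = "bump_const ?N"
  let ?\<Psi> = "LINT x|sphere_measure. (bump (real DIM('a)) \<tau> (\<theta> \<bullet> x))\<^sup>2" and ?I = "LINT x|sphere_measure. \<bar>bump (real DIM('a)) \<tau> (\<theta> \<bullet> x)\<bar>"
  let ?L = "bump_laplacian ?N \<tau>"
  define v where "v = 1 - \<tau>"
  have v: "v > 0" using \<tau> by (simp add: v_def)
  have E: "?E > 0" by simp
  have "v ^ 4 * ?M 0 \<le> ?E ^ 4 * ?M 4"
    unfolding v_def using dim3 by (intro cap_moment_lower \<tau>' \<tau>) auto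
  also have "\<dots> \<le> ?E ^ 4 * (v * ?I)" unfolding v_def by (intro mult_left_mono bump_mass_lower) auto
  finally have "v * (v ^ 3 * ?M 0) \<le> v * (?E ^ 4 * ?I)" by (simp add: eval_nat_numeral mult_ac)
  then have "v ^ 3 * ?M 0 \<le> ?E ^ 4 * ?I" using v by (subst (asm) mult_le_cancel_left_pos)
  then have "(v ^ 3 * ?M 0)\<^sup>2 \<le> (?E ^ 4 * ?I)\<^sup>2" using v M0 by (intro power_mono) auto
  also have "\<dots> = ?E ^ 8 * ?I\<^sup>2" by (simp add: power_mult_distrib flip: power_mult)
  also have "\<dots> \<le> ?E ^ 8 * (?M 0 * ?\<Psi>)" by (intro mult_left_mono bump_Cauchy_Schwarz M0) auto
  finally have "?M 0 * (v ^ 6 * ?M 0) \<le> ?M 0 * (?E ^ 8 * ?\<Psi>)"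
    by (simp add: eval_nat_numeral mult_ac)
  then have *: "v ^ 6 * ?M 0 \<le> ?E ^ 8 * ?\<Psi>" using M0 by (subst (asm) mult_le_cancel_left_pos)
  show "?\<Psi> > 0"
  proof -
    have "0 < v ^ 6 * ?M 0" using v M0 by simp
    with * have "0 < ?E ^ 8 * ?\<Psi>" by linarith
    then show ?thesis using E by (simp add: zero_less_mult_iff)
  qed
  have "(LINT x|sphere_measure. (?L (\<theta> \<bullet> x))\<^sup>2) \<le> (LINT x|sphere_measure. ?K\<^sup>2 * v ^ 4 * relu_pow 0 (\<theta> \<bullet> x - \<tau>))"
  proof (intro sphere_integral_mono integrable_mult_right relu_zonal_integrable \<tau>' \<theta>)
    show "integrable sphere_measure (\<lambda>x. (?L (\<theta> \<bullet> x))\<^sup>2)"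
      using zonal_integrable[OF bounded_profile_power[OF bounded_profile_bump_laplacian[OF \<tau>']] \<theta>] by simp
    fix x :: 'a assume x: "x \<in> sphere 0 1"
    have "\<bar>?L (\<theta> \<bullet> x)\<bar> \<le> ?K * v\<^sup>2 * relu_pow 0 (\<theta> \<bullet> x - \<tau>)"
      unfolding v_def using dim3 by (intro bump_laplacian_bound \<tau>' \<tau> inner_sphere_range[OF \<theta> x]) auto
    then have "\<bar>?L (\<theta> \<bullet> x)\<bar>\<^sup>2 \<le> (?K * v\<^sup>2 * relu_pow 0 (\<theta> \<bullet> x - \<tau>))\<^sup>2" by (intro power_mono) auto
    then show "(?L (\<theta> \<bullet> x))\<^sup>2 \<le> ?K\<^sup>2 * v ^ 4 * relu_pow 0 (\<theta> \<bullet> x - \<tau>)"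
      by (simp add: power_mult_distrib relu_pow_0 flip: power_mult split: if_splits)
  qed
  also have "\<dots> = ?K\<^sup>2 * v ^ 4 * ?M 0" using cap_moment[OF \<theta>, of 0 \<tau>] by simp
  finally have "v\<^sup>2 * (LINT x|sphere_measure. (?L (\<theta> \<bullet> x))\<^sup>2) \<le> v\<^sup>2 * (?K\<^sup>2 * v ^ 4 * ?M 0)" by (intro mult_left_mono) auto
  also have "\<dots> = ?K\<^sup>2 * (v ^ 6 * ?M 0)" by (simp add: mult_ac flip: power_add)
  also have "\<dots> \<le> ?K\<^sup>2 * (?E ^ 8 * ?\<Psi>)" by (intro mult_left_mono *) auto
  finally show "(1 - \<tau>)\<^sup>2 * (LINT x|sphere_measure. (?L (\<theta> \<bullet> x))\<^sup>2) \<le> ?K\<^sup>2 * ?E ^ 8 * ?\<Psi>"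
    by (simp add: v_def mult.assoc)
qed

end

section \<open>The lower estimate for the energies\<close>

context spherical_basis
begin

text \<open>
  Parseval's identity for the test function with profile \<open>\<psi> = bump N \<tau>\<close>, made even or odd so that only the
  degrees with \<open>m + k\<close> odd contribute. The degrees above \<open>M\<close> carry at most a quarter of its energy, by
  Bessel's inequality for its Laplacian, and so do the degrees up to \<open>k\<close>, because there
  \<open>\<psi>\<close>, as a Laplacian, has small multipliers and \<open>energy_upper\<close> bounds the rest. In the remaining degrees the
  square of the multiplier is at most the square of the \<open>L\<^sup>1\<close> norm of \<open>\<psi>\<close>, hence at most the measure of the
  cap times the square of its \<open>L\<^sup>2\<close> norm.
\<close>

lemma energy_lower:
  fixes k n M :: nat and \<theta> :: "nat \<Rightarrow> 'a" and a :: "nat \<Rightarrow> real"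
  defines "E \<equiv> 1 + 2 * real DIM('a)"
  assumes \<theta>: "\<theta> ` {1..n} \<subseteq> sphere 0 1" and \<epsilon>: "0 < \<epsilon>" "\<epsilon> \<le> 1"
    and sep: "\<And>i j. i \<in> {1..n} \<Longrightarrow> j \<in> {1..n} \<Longrightarrow> i \<noteq> j \<Longrightarrow> 2 * \<epsilon> \<le> norm (\<theta> i - \<theta> j)"
    and asep: "\<And>i j. i \<in> {1..n} \<Longrightarrow> j \<in> {1..n} \<Longrightarrow> i \<noteq> j \<Longrightarrow> 2 * \<epsilon> \<le> norm (\<theta> i + \<theta> j)"
    and k1: "\<epsilon> * real k * sqrt (real DIM('a)) \<le> 1/2"
    and k2: "8 * E * (real k * (real k + real DIM('a) - 2))\<^sup>2 * \<epsilon> ^ 4 \<le> 1"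
    and M: "16 * ((bump_const (real DIM('a)))\<^sup>2 * E ^ 8) \<le> (\<epsilon> * real M) ^ 4" and kM: "k \<le> M"
  shows "(\<Sum>j=1..n. (a j)\<^sup>2) \<le> 4 * cap_moment TYPE('a) (1 - \<epsilon>\<^sup>2 / 2) 0 * (\<Sum>m | k < m \<and> m \<le> M \<and> odd (m + k). energy a \<theta> n m)"
proof -
  define \<tau> where "\<tau> = 1 - \<epsilon>\<^sup>2 / 2"
  have "\<epsilon>\<^sup>2 \<le> 1" using \<epsilon> by (simp add: power_le_one)
  then have \<tau>: "1/2 \<le> \<tau>" "\<tau> < 1" using \<epsilon> by (auto simp: \<tau>_def)
  then have \<tau>0: "0 \<le> \<tau>" by simp
  let ?N = "real DIM('a)"
  define \<psi> where "\<psi> = bump ?N \<tau>"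
  define \<phi> where "\<phi> = bump_laplacian ?N \<tau>"
  define ev where "ev m = real m * (real m + ?N - 2)" for m
  let ?M = "cap_moment TYPE('a) \<tau>" and ?A = "\<Sum>j=1..n. (a j)\<^sup>2"
  obtain b :: 'a where b: "b \<in> sphere 0 1" using sphere_nonempty_ex by blast
  have th: "\<theta> j \<in> sphere 0 1" if "j \<in> {1..n}" for j using \<theta> that by (auto simp only: image_subset_iff)
  have pb: "\<psi> \<in> bounded_profile" "\<phi> \<in> bounded_profile" unfolding \<psi>_def \<phi>_def by (rule bounded_profile_bump[OF \<tau>0], rule bounded_profile_bump_laplacian[OF \<tau>0])
  have M0: "?M 0 > 0"
  proof -
    have "0 < (1/2) * (1/8) ^ DIM('a) * \<epsilon> ^ (DIM('a) - 1)" using \<epsilon> by simp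
    also have "\<dots> \<le> ?M 0" using cap_lower[OF b \<epsilon>] cap_moment_0[OF b \<epsilon>(1)] by (simp add: \<tau>_def)
    finally show ?thesis .
  qed
  define \<Psi> where "\<Psi> = (LINT x|sphere_measure. (\<psi> (b \<bullet> x))\<^sup>2)"
  define X where "X = (LINT x|sphere_measure. (\<phi> (b \<bullet> x))\<^sup>2)"
  define I where "I = (LINT x|sphere_measure. \<bar>\<psi> (b \<bullet> x)\<bar>)"
  have \<Psi>: "\<Psi> > 0" "(1 - \<tau>)\<^sup>2 * X \<le> (bump_const ?N)\<^sup>2 * E ^ 8 * \<Psi>"
    using bump_laplacian_norm[OF \<tau> b dim3 M0] by (auto simp: \<Psi>_def X_def \<psi>_def \<phi>_def E_def)
  have I: "I\<^sup>2 \<le> ?M 0 * \<Psi>" "?M 4 \<le> (1 - \<tau>) * I"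
    using bump_Cauchy_Schwarz[OF \<tau> b dim3 M0] bump_mass_lower[OF \<tau> b dim3] by (auto simp: \<Psi>_def I_def \<psi>_def)
  have d2: "DIM('a) \<ge> 2" using dim3 by simp
  have "\<forall>m. \<exists>\<mu>. (\<forall>\<theta>\<in>sphere (0::'a) 1. \<forall>p\<in>solid_harmonics m. zonal_pairing \<theta> \<psi> p = \<mu> * p \<theta>) \<and> \<bar>\<mu>\<bar> \<le> I"
  proof
    fix m
    show "\<exists>\<mu>. (\<forall>\<theta>\<in>sphere (0::'a) 1. \<forall>p\<in>solid_harmonics m. zonal_pairing \<theta> \<psi> p = \<mu> * p \<theta>) \<and> \<bar>\<mu>\<bar> \<le> I"
      using funk_hecke[OF d2 continuous_bump[of "?N" \<tau>], of m] b unfolding \<psi>_def I_def by blast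
  qed
  then obtain \<mu> where \<mu>: "\<And>m \<theta> p. \<theta> \<in> sphere (0::'a) 1 \<Longrightarrow> p \<in> solid_harmonics m \<Longrightarrow> zonal_pairing \<theta> \<psi> p = \<mu> m * p \<theta>" "\<And>m. \<bar>\<mu> m\<bar> \<le> I" by metis
  have c4: "continuous_on UNIV (\<lambda>t. relu_pow 4 (t - \<tau>))" using relu_pow_continuous[of 3 \<tau>] by simp
  have "\<forall>m. \<exists>\<nu>. (\<forall>\<theta>\<in>sphere (0::'a) 1. \<forall>p\<in>solid_harmonics m. zonal_pairing \<theta> (\<lambda>t. relu_pow 4 (t - \<tau>)) p = \<nu> * p \<theta>) \<and> \<bar>\<nu>\<bar> \<le> ?M 4"
  proof
    fix m
    have "(LINT x|sphere_measure. \<bar>relu_pow 4 (b \<bullet> x - \<tau>)\<bar>) = ?M 4"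
      using cap_moment[OF b, of 4 \<tau>] by (simp add: relu_pow_nonneg)
    then show "\<exists>\<nu>. (\<forall>\<theta>\<in>sphere (0::'a) 1. \<forall>p\<in>solid_harmonics m. zonal_pairing \<theta> (\<lambda>t. relu_pow 4 (t - \<tau>)) p = \<nu> * p \<theta>) \<and> \<bar>\<nu>\<bar> \<le> ?M 4"
      using funk_hecke[OF d2 c4, of m] b by metis
  qed
  then obtain \<nu> where \<nu>: "\<And>m \<theta> p. \<theta> \<in> sphere (0::'a) 1 \<Longrightarrow> p \<in> solid_harmonics m \<Longrightarrow> zonal_pairing \<theta> (\<lambda>t. relu_pow 4 (t - \<tau>)) p = \<nu> m * p \<theta>"
      "\<And>m. \<bar>\<nu> m\<bar> \<le> ?M 4" by metis
  \<comment> \<open>The multiplier of \<open>\<psi>\<close> has two descriptions: \<open>\<mu>\<close>, which is bounded by the \<open>L\<^sup>1\<close> norm of \<open>\<psi>\<close>,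
    and \<open>- ev m * \<nu> m\<close>, which shows that it is small in low degrees.\<close>
  have \<psi>\<nu>: "zonal_pairing \<theta> \<psi> p = - (ev m * \<nu> m) * p \<theta>" if "\<theta> \<in> sphere (0::'a) 1" "p \<in> solid_harmonics m" for \<theta> p m
    using bump_laplacian_eigenvalue(1)[OF \<tau>0 \<tau>(2) that] \<nu>(1)[OF that] by (simp add: \<psi>_def ev_def)
  have \<phi>\<mu>: "zonal_pairing \<theta> \<phi> p = - (ev m * \<mu> m) * p \<theta>" if "\<theta> \<in> sphere (0::'a) 1" "p \<in> solid_harmonics m" for \<theta> p m
    using bump_laplacian_eigenvalue(2)[OF \<tau>0 \<tau>(2) that] \<mu>(1)[OF that] by (simp add: \<phi>_def \<psi>_def ev_def)
  define J where "J = {1..n} \<times> (UNIV :: bool set)"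
  define \<eta> where "\<eta> i = (if snd i then \<theta> (fst i) else - \<theta> (fst i))" for i :: "nat \<times> bool"
  \<comment> \<open>The sign with which the summands at \<open>- \<theta> j\<close> enter: it cancels the degrees \<open>m\<close> with \<open>m + k\<close> even
    and doubles the coefficients in the others.\<close>
  define s :: real where "s = (-1) ^ Suc k"
  define w where "w i = a (fst i) * (if snd i then 1 else s)" for i :: "nat \<times> bool"
  have J: "finite J" by (simp add: J_def)
  have sumJ: "(\<Sum>i\<in>J. f i) = (\<Sum>j=1..n. f (j, True) + f (j, False))" for f :: "nat \<times> bool \<Rightarrow> real"
    unfolding J_def by (subst sum.cartesian_product[symmetric, of "\<lambda>x y. f (x, y)", simplified]) (simp add: UNIV_bool add.commute)
  have \<eta>S: "\<eta> i \<in> sphere 0 1" if "i \<in> J" for i using th[of "fst i"] that by (auto simp: \<eta>_def J_def)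
  have \<eta>sep: "2 * \<epsilon> \<le> norm (\<eta> i - \<eta> j)" if ij: "i \<in> J" "j \<in> J" "i \<noteq> j" for i j
  proof (cases "fst i = fst j")
    case True
    then have "\<eta> i - \<eta> j = 2 *\<^sub>R \<eta> i" using ij(3) by (cases i; cases j) (auto simp: \<eta>_def scaleR_2)
    then show ?thesis using \<eta>S[OF ij(1)] \<epsilon> by simp
  next
    case False
    have f: "fst i \<in> {1..n}" "fst j \<in> {1..n}" using ij by (auto simp: J_def)
    have "- \<theta> (fst i) - \<theta> (fst j) = - (\<theta> (fst i) + \<theta> (fst j))" "- \<theta> (fst i) + \<theta> (fst j) = - (\<theta> (fst i) - \<theta> (fst j))" by simp_all
    then show ?thesis using sep[OF f False] asep[OF f False]
      unfolding \<eta>_def by (auto simp only: norm_minus_cancel diff_minus_eq_add split: if_split)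
  qed
  have w2: "(\<Sum>i\<in>J. (w i)\<^sup>2) = 2 * ?A"
    unfolding sumJ by (simp add: w_def s_def power_mult_distrib sum_distrib_left flip: power_mult)
  define c where "c m = (1 + s * (-1) ^ m)" for m :: nat
  have c: "(c m)\<^sup>2 = (if odd (m + k) then 4 else 0)" for m
    by (cases "even m"; cases "even k") (auto simp: c_def s_def)
  have wP: "(\<Sum>i\<in>J. w i * Ypoly m l (\<eta> i)) = c m * (\<Sum>j=1..n. a j * Ypoly m l (\<theta> j))" if l: "l \<in> {1..N m}" for m l
    unfolding sumJ sum_distrib_left
    by (intro sum.cong refl) (simp add: w_def \<eta>_def c_def solid_harmonics_odd_even[OF Ypoly(1)[OF l]] algebra_simps)
  define g where "g x = (\<Sum>i\<in>J. w i * \<psi> (\<eta> i \<bullet> x))" for x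
  define h where "h x = (\<Sum>i\<in>J. w i * \<phi> (\<eta> i \<bullet> x))" for x
  have cfg: "fourier_coeff g (m, l) = \<mu> m * (c m * (\<Sum>j=1..n. a j * Ypoly m l (\<theta> j)))" if l: "l \<in> {1..N m}" for m l
    unfolding g_def[abs_def] using fourier_coeff_ridge[OF J pb(1) \<eta>S \<mu>(1) l] wP[OF l] by simp
  have cfg': "fourier_coeff g (m, l) = - (ev m * \<nu> m) * (c m * (\<Sum>j=1..n. a j * Ypoly m l (\<theta> j)))" if l: "l \<in> {1..N m}" for m l
    unfolding g_def[abs_def] using fourier_coeff_ridge[OF J pb(1) \<eta>S \<psi>\<nu> l] wP[OF l] by simp
  have cfh: "fourier_coeff h (m, l) = - ev m * fourier_coeff g (m, l)" if l: "l \<in> {1..N m}" for m l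
    unfolding cfg[OF l] unfolding h_def[abs_def] using fourier_coeff_ridge[OF J pb(2) \<eta>S \<phi>\<mu> l] wP[OF l] by simp
  define T where "T m = (\<Sum>l=1..N m. (fourier_coeff g (m, l))\<^sup>2)" for m
  have T1: "T m = (\<mu> m)\<^sup>2 * (c m)\<^sup>2 * energy a \<theta> n m" for m
    unfolding T_def energy_def sum_distrib_left by (intro sum.cong refl) (simp add: cfg power_mult_distrib)
  have T2: "T m = (ev m)\<^sup>2 * (\<nu> m)\<^sup>2 * (c m)\<^sup>2 * energy a \<theta> n m" for m
    unfolding T_def energy_def sum_distrib_left by (intro sum.cong refl) (simp add: cfg' power_mult_distrib)
  have Tn: "0 \<le> T m" for m unfolding T_def by (intro sum_nonneg) auto
  have gc: "continuous_on (sphere 0 1) g"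
    unfolding g_def[abs_def] \<psi>_def
    by (intro continuous_on_sum continuous_on_mult continuous_on_const continuous_on_compose2[OF continuous_bump]
        continuous_on_inner continuous_on_id) auto
  have G: "(LINT x|sphere_measure. (g x)\<^sup>2) = 2 * ?A * \<Psi>"
    unfolding g_def \<Psi>_def w2[symmetric]
    by (rule ridge_square_integral[OF J pb(1) \<eta>S \<epsilon>(1) _ \<eta>sep b]) (simp_all add: \<psi>_def \<tau>_def bump_supp)
  have H: "(LINT x|sphere_measure. (h x)\<^sup>2) = 2 * ?A * X"
    unfolding h_def X_def w2[symmetric]
    by (rule ridge_square_integral[OF J pb(2) \<eta>S \<epsilon>(1) _ \<eta>sep b]) (simp_all add: \<phi>_def \<tau>_def bump_supp)
  have sumsT: "T sums (2 * ?A * \<Psi>)" using parseval[OF gc] unfolding G T_def[abs_def] .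
  have besselh: "(\<Sum>m<K. (ev m)\<^sup>2 * T m) \<le> 2 * ?A * X" for K
  proof -
    have "(\<Sum>m<K. (ev m)\<^sup>2 * T m) = (\<Sum>m<K. \<Sum>l=1..N m. (fourier_coeff h (m, l))\<^sup>2)"
      unfolding T_def sum_distrib_left by (intro sum.cong refl) (simp add: cfh power_mult_distrib)
    also have "\<dots> = (\<Sum>i\<in>degree_index K. (fourier_coeff h i)\<^sup>2)" by (simp add: sum_degree_index)
    also have "\<dots> \<le> (LINT x|sphere_measure. (h x)\<^sup>2)"
      unfolding h_def[abs_def] by (intro bessel ridge_L2 J pb \<eta>S)
    finally show ?thesis by (simp add: H)
  qed
  have A0: "0 \<le> ?A" by (intro sum_nonneg) auto
  \<comment> \<open>As \<open>1 - \<tau> = \<epsilon>\<^sup>2 / 2\<close>, the bound for \<open>X\<close> has the factor \<open>4 / \<epsilon> ^ 4\<close>, which \<open>(\<epsilon> * M) ^ 4\<close> absorbs.\<close>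
  have X: "X / real M ^ 4 \<le> \<Psi> / 4"
  proof -
    have MM: "0 < (\<epsilon> * real M) ^ 4"
    proof -
      have "bump_const ?N > 0" using dim3 by (auto simp: bump_const_def intro!: add_pos_pos)
      then have "0 < 16 * ((bump_const ?N)\<^sup>2 * E ^ 8)" by (simp add: E_def)
      then show ?thesis using M by linarith
    qed
    then have M1: "real M > 0" using \<epsilon> by (cases "M = 0") auto
    have "\<epsilon> ^ 4 * X = 4 * ((1 - \<tau>)\<^sup>2 * X)" by (simp add: \<tau>_def power2_eq_square eval_nat_numeral)
    also have "\<dots> \<le> 4 * ((bump_const ?N)\<^sup>2 * E ^ 8 * \<Psi>)" by (intro mult_left_mono \<Psi>) auto
    also have "\<dots> \<le> (\<epsilon> * real M) ^ 4 / 4 * \<Psi>" using mult_right_mono[OF M less_imp_le[OF \<Psi>(1)]] by simp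
    also have "\<dots> = \<epsilon> ^ 4 * (real M ^ 4 * \<Psi> / 4)" by (simp add: power_mult_distrib)
    finally have "X \<le> real M ^ 4 * \<Psi> / 4" using \<epsilon> by (subst (asm) mult_le_cancel_left_pos) auto
    then show ?thesis using M1 by (simp add: field_simps)
  qed
  have M1: "M > 0"
  proof (rule ccontr)
    assume "\<not> M > 0"
    then have "16 * ((bump_const ?N)\<^sup>2 * E ^ 8) \<le> 0" using M by simp
    moreover have "bump_const ?N > 0" using dim3 by (auto simp: bump_const_def intro!: add_pos_pos)
    then have "0 < 16 * ((bump_const ?N)\<^sup>2 * E ^ 8)" by (simp add: E_def)
    ultimately show False by linarith
  qed
  have "2 * ?A * \<Psi> \<le> (\<Sum>m\<le>M. T m) + 2 * ?A * (\<Psi> / 4)"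
  proof (rule LIMSEQ_le_const2[OF sumsT[unfolded sums_def]], intro exI[of _ 0] allI impI)
    fix K
    \<comment> \<open>For \<open>m > M\<close> the eigenvalue \<open>ev m\<close> is at least \<open>M\<^sup>2\<close>.\<close>
    have "T m \<le> (if m \<le> M then T m else 0) + (ev m)\<^sup>2 * T m / real M ^ 4" for m
    proof (cases "m \<le> M")
      case False
      have "real M * real M \<le> ev m" unfolding ev_def using False dim3 by (intro mult_mono) auto
      then have "(real M * real M)\<^sup>2 \<le> (ev m)\<^sup>2" by (intro power_mono) auto
      then have "real M ^ 4 * T m \<le> (ev m)\<^sup>2 * T m" using Tn by (intro mult_right_mono) (simp_all add: eval_nat_numeral)
      then show ?thesis using False M1 by (simp add: field_simps)
    qed (use Tn in simp)
    then have "(\<Sum>m<K. T m) \<le> (\<Sum>m<K. (if m \<le> M then T m else 0) + (ev m)\<^sup>2 * T m / real M ^ 4)" by (rule sum_mono)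
    also have "\<dots> = (\<Sum>m<K. if m \<le> M then T m else 0) + (\<Sum>m<K. (ev m)\<^sup>2 * T m) / real M ^ 4"
      by (simp add: sum.distrib sum_divide_distrib)
    finally have 1: "(\<Sum>m<K. T m) \<le> (\<Sum>m<K. if m \<le> M then T m else 0) + (\<Sum>m<K. (ev m)\<^sup>2 * T m) / real M ^ 4" .
    have 2: "(\<Sum>m<K. if m \<le> M then T m else 0) \<le> (\<Sum>m\<le>M. T m)"
    proof -
      have "(\<Sum>m<K. if m \<le> M then T m else 0) = (\<Sum>m\<in>{..<K} \<inter> {..M}. T m)"
        by (subst sum.inter_restrict) (auto intro: sum.cong)
      also have "\<dots> \<le> (\<Sum>m\<le>M. T m)" using Tn by (intro sum_mono2) auto
      finally show ?thesis .
    qed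
    have "(\<Sum>m<K. (ev m)\<^sup>2 * T m) / real M ^ 4 \<le> 2 * ?A * X / real M ^ 4" by (intro divide_right_mono besselh) auto
    also have "\<dots> \<le> 2 * ?A * (\<Psi> / 4)" using mult_left_mono[OF X, of "2 * ?A"] A0 by simp
    finally show "(\<Sum>m<K. T m) \<le> (\<Sum>m\<le>M. T m) + 2 * ?A * (\<Psi> / 4)" using 1 2 by linarith
  qed
  moreover have low: "(\<Sum>m\<le>k. T m) \<le> ?A * \<Psi> / 2"
  proof -
    have ub: "(\<Sum>m\<le>k. energy a \<theta> n m) * ?M 0 \<le> 4 * E * ?A"
      unfolding \<tau>_def E_def by (rule energy_upper[OF \<theta> \<epsilon> sep k1])
    have ek: "0 \<le> ev m" "ev m \<le> ev k" if "m \<le> k" for m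
      unfolding ev_def using that dim3 by (auto intro!: mult_mono mult_nonneg_nonneg)
    have tm: "T m \<le> 4 * (ev k)\<^sup>2 * (?M 4)\<^sup>2 * energy a \<theta> n m" if "m \<le> k" for m
    proof -
      have "(ev m)\<^sup>2 \<le> (ev k)\<^sup>2" using ek[OF that] by (intro power_mono)
      moreover have "(\<nu> m)\<^sup>2 \<le> (?M 4)\<^sup>2" using power_mono[OF \<nu>(2)[of m] abs_ge_zero, of 2] by simp
      moreover have "(c m)\<^sup>2 \<le> 4" by (simp add: c)
      ultimately have "(ev m)\<^sup>2 * (\<nu> m)\<^sup>2 * (c m)\<^sup>2 * energy a \<theta> n m \<le> (ev k)\<^sup>2 * (?M 4)\<^sup>2 * 4 * energy a \<theta> n m"
        using energy_nonneg by (intro mult_right_mono mult_mono) auto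
      then show ?thesis unfolding T2 by (simp add: mult_ac)
    qed
    have "(?M 4)\<^sup>2 \<le> ((1 - \<tau>) * I)\<^sup>2" by (intro power_mono I cap_moment_nonneg)
    also have "\<dots> \<le> (1 - \<tau>)\<^sup>2 * (?M 0 * \<Psi>)" unfolding power_mult_distrib by (intro mult_left_mono I) auto
    finally have m4: "(?M 4)\<^sup>2 \<le> (1 - \<tau>)\<^sup>2 * (?M 0 * \<Psi>)" .
    have "(\<Sum>m\<le>k. T m) \<le> 4 * (ev k)\<^sup>2 * (?M 4)\<^sup>2 * (\<Sum>m\<le>k. energy a \<theta> n m)"
      unfolding sum_distrib_left using tm by (intro sum_mono) auto
    also have "\<dots> \<le> 4 * (ev k)\<^sup>2 * ((1 - \<tau>)\<^sup>2 * (?M 0 * \<Psi>)) * (\<Sum>m\<le>k. energy a \<theta> n m)"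
      using m4 by (intro mult_right_mono mult_left_mono sum_nonneg energy_nonneg) auto
    also have "\<dots> = 4 * (ev k)\<^sup>2 * (1 - \<tau>)\<^sup>2 * \<Psi> * ((\<Sum>m\<le>k. energy a \<theta> n m) * ?M 0)" by (simp only: mult_ac)
    also have "\<dots> \<le> 4 * (ev k)\<^sup>2 * (1 - \<tau>)\<^sup>2 * \<Psi> * (4 * E * ?A)"
      using \<Psi> by (intro mult_left_mono ub) auto
    also have "\<dots> = (8 * E * (ev k)\<^sup>2 * \<epsilon> ^ 4) * (?A * \<Psi> / 2)"
      by (simp add: \<tau>_def power2_eq_square eval_nat_numeral)
    also have "\<dots> \<le> 1 * (?A * \<Psi> / 2)"
      using k2 A0 \<Psi> unfolding ev_def by (intro mult_right_mono) auto
    finally show ?thesis by simp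
  qed
  moreover have "(\<Sum>m\<le>M. T m) \<le> (\<Sum>m\<le>k. T m) + 4 * (?M 0 * \<Psi>) * (\<Sum>m | k < m \<and> m \<le> M \<and> odd (m + k). energy a \<theta> n m)"
  proof -
    have 1: "(\<Sum>m\<le>M. T m) = (\<Sum>m\<le>k. T m) + (\<Sum>m\<in>{k<..M}. T m)"
      using kM by (subst sum.union_disjoint[symmetric]) (auto intro: sum.cong)
    have "(\<Sum>m\<in>{k<..M}. T m) = (\<Sum>m | k < m \<and> m \<le> M \<and> odd (m + k). T m)"
    proof (rule sum.mono_neutral_right)
      show "\<forall>m\<in>{k<..M} - {m. k < m \<and> m \<le> M \<and> odd (m + k)}. T m = 0"
        unfolding T1 by (auto simp: c)
    qed auto
    also have "\<dots> \<le> (\<Sum>m | k < m \<and> m \<le> M \<and> odd (m + k). 4 * (?M 0 * \<Psi>) * energy a \<theta> n m)"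
    proof (intro sum_mono)
      fix m
      have "(\<mu> m)\<^sup>2 \<le> I\<^sup>2" using power_mono[OF \<mu>(2)[of m] abs_ge_zero, of 2] by simp
      also have "\<dots> \<le> ?M 0 * \<Psi>" by (rule I)
      finally have "(\<mu> m)\<^sup>2 * (c m)\<^sup>2 \<le> (?M 0 * \<Psi>) * 4" using M0 \<Psi> by (intro mult_mono) (auto simp: c)
      then have "(\<mu> m)\<^sup>2 * (c m)\<^sup>2 * energy a \<theta> n m \<le> (?M 0 * \<Psi>) * 4 * energy a \<theta> n m" by (intro mult_right_mono energy_nonneg)
      then show "T m \<le> 4 * (?M 0 * \<Psi>) * energy a \<theta> n m" unfolding T1 by (simp add: mult_ac)
    qed
    finally show ?thesis unfolding 1 by (simp only: sum_distrib_left add_le_cancel_left)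
  qed
  moreover have "2 * ?A * \<Psi> = 2 * (?A * \<Psi>)" "2 * ?A * (\<Psi> / 4) = ?A * \<Psi> / 2" by simp_all
  ultimately have "?A * \<Psi> \<le> 4 * (?M 0 * \<Psi>) * (\<Sum>m | k < m \<and> m \<le> M \<and> odd (m + k). energy a \<theta> n m)" by linarith
  then have "\<Psi> * ?A \<le> \<Psi> * (4 * ?M 0 * (\<Sum>m | k < m \<and> m \<le> M \<and> odd (m + k). energy a \<theta> n m))" by (simp only: mult_ac)
  then have "?A \<le> 4 * ?M 0 * (\<Sum>m | k < m \<and> m \<le> M \<and> odd (m + k). energy a \<theta> n m)"
    using \<Psi>(1) by (subst (asm) mult_le_cancel_left_pos)
  then show ?thesis by (simp add: \<tau>_def)
qed

end

section \<open>Dyadic summation\<close>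

text \<open>
  On each dyadic block \<open>{K<..2 * K}\<close> the weight is at most \<open>K powr (- (D + \<gamma>))\<close> and the sum of \<open>q\<close> is at
  most \<open>B * (2 * K) powr D\<close>. The blocks form a geometric series with ratio \<open>2 powr (- \<gamma>)\<close>.
\<close>

lemma dyadic_sum_bound:
  fixes q :: "nat \<Rightarrow> real" and M :: nat
  assumes q: "\<And>m. 0 \<le> q m" and M: "M \<ge> 1" and \<gamma>: "\<gamma> > 0" and D: "D \<ge> 0" and B: "B \<ge> 0"
    and up: "\<And>K. K \<ge> M \<Longrightarrow> (\<Sum>m\<le>K. q m) \<le> B * real K powr D"
  shows "(\<Sum>m\<in>{M<..2 ^ J * M}. real m powr (- (D + \<gamma>)) * q m)
    \<le> B * 2 powr D * real M powr (- \<gamma>) / (1 - 2 powr (- \<gamma>))"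
proof -
  define x where "x = 2 powr (- \<gamma>)"
  have x: "0 < x" "x < 1" using \<gamma> by (auto simp: x_def powr_less_one)
  have "(\<Sum>m\<in>{M<..2 ^ J * M}. real m powr (- (D + \<gamma>)) * q m) \<le> B * 2 powr D * real M powr (- \<gamma>) * (\<Sum>j<J. x ^ j)"
  proof (induction J)
    case (Suc J)
    let ?K = "2 ^ J * M"
    have K: "M \<le> ?K" "real ?K > 0" using M by auto
    have "{M<..2 * L} = {M<..L} \<union> {L<..2 * L}" if "M \<le> L" for L using that by auto
    from this[OF K(1)] have "{M<..2 ^ Suc J * M} = {M<..?K} \<union> {?K<..2 * ?K}" by (simp only: power_Suc mult.assoc)
    then have "(\<Sum>m\<in>{M<..2 ^ Suc J * M}. real m powr (- (D + \<gamma>)) * q m)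
      = (\<Sum>m\<in>{M<..?K}. real m powr (- (D + \<gamma>)) * q m) + (\<Sum>m\<in>{?K<..2 * ?K}. real m powr (- (D + \<gamma>)) * q m)"
      by (simp only:) (rule sum.union_disjoint, auto)
    also have "\<dots> \<le> B * 2 powr D * real M powr (- \<gamma>) * (\<Sum>j<J. x ^ j) + B * 2 powr D * real M powr (- \<gamma>) * x ^ J"
    proof (rule add_mono[OF Suc])
      have "(\<Sum>m\<in>{?K<..2 * ?K}. real m powr (- (D + \<gamma>)) * q m) \<le> (\<Sum>m\<in>{?K<..2 * ?K}. real ?K powr (- (D + \<gamma>)) * q m)"
      proof (intro sum_mono mult_right_mono q)
        fix m assume "m \<in> {?K<..2 * ?K}"
        then have "real ?K \<le> real m" by (intro of_nat_mono) simp
        then show "real m powr (- (D + \<gamma>)) \<le> real ?K powr (- (D + \<gamma>))" using K D \<gamma> by (intro powr_mono2') auto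
      qed
      also have "\<dots> \<le> real ?K powr (- (D + \<gamma>)) * (\<Sum>m\<le>2 * ?K. q m)"
        unfolding sum_distrib_left[symmetric] using q by (intro mult_left_mono sum_mono2) auto
      also have "\<dots> \<le> real ?K powr (- (D + \<gamma>)) * (B * real (2 * ?K) powr D)"
        using K by (intro mult_left_mono up) auto
      also have "real (2 * ?K) powr D = 2 powr D * real ?K powr D"
        using K by (simp add: powr_mult)
      also have "real ?K powr (- (D + \<gamma>)) * (B * (2 powr D * real ?K powr D)) = B * 2 powr D * (real ?K powr (- (D + \<gamma>)) * real ?K powr D)"
        by (simp only: mult_ac)
      also have "real ?K powr (- (D + \<gamma>)) * real ?K powr D = real ?K powr (- \<gamma>)" by (simp add: powr_add[symmetric])
      also have "real ?K powr (- \<gamma>) = real M powr (- \<gamma>) * x ^ J"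
      proof -
        have "real ?K powr (- \<gamma>) = (2 ^ J) powr (- \<gamma>) * real M powr (- \<gamma>)" by (simp add: powr_mult)
        also have "(2 ^ J) powr (- \<gamma>) = x ^ J"
          by (simp add: x_def powr_realpow[symmetric] powr_powr mult.commute)
        finally show ?thesis by simp
      qed
      finally show "(\<Sum>m\<in>{?K<..2 * ?K}. real m powr (- (D + \<gamma>)) * q m) \<le> B * 2 powr D * real M powr (- \<gamma>) * x ^ J"
        by (simp only: mult.assoc)
    qed
    also have "\<dots> = B * 2 powr D * real M powr (- \<gamma>) * (\<Sum>j<Suc J. x ^ j)" by (simp only: sum.lessThan_Suc distrib_left)
    finally show ?case .
  qed simp
  also have "\<dots> \<le> B * 2 powr D * real M powr (- \<gamma>) * (1 / (1 - x))"
  proof (intro mult_left_mono)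
    have "(\<Sum>j<J. x ^ j) = (1 - x ^ J) / (1 - x)" using x by (simp add: sum_gp_strict)
    also have "\<dots> \<le> 1 / (1 - x)" using x by (intro divide_right_mono) auto
    finally show "(\<Sum>j<J. x ^ j) \<le> 1 / (1 - x)" .
  qed (use B in auto)
  finally show ?thesis by (simp add: x_def)
qed

text \<open>
  Here \<open>q m\<close> stands for the energy in degree \<open>m\<close>, \<open>w m\<close> for the square of the multiplier, \<open>A\<close> for the
  sum of the squares of the \<open>a j\<close>, and \<open>M\<close> for the degree that separates low from high. The high degrees
  are bounded by \<open>A\<close> through the dyadic sum, and \<open>A\<close> is bounded by the low degrees.
\<close>

lemma inverse_inequality_sequences:
  fixes D \<alpha> r s CU cL C1 c1 :: real and k :: nat
  assumes D: "0 \<le> D" and s: "0 \<le> s" and sr: "s < r" and \<alpha>: "D + 2 * r < \<alpha>"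
    and C: "CU > 0" "cL > 0" "C1 > 0" "c1 > 0"
  shows "\<exists>C>0. \<forall>(q :: nat \<Rightarrow> real) w A M. (\<forall>m. 0 \<le> q m) \<longrightarrow> (\<forall>m. 0 \<le> w m) \<longrightarrow> 0 \<le> A \<longrightarrow> M \<ge> 1 \<longrightarrow>
     (\<forall>K\<ge>M. (\<Sum>m\<le>K. q m) \<le> CU * A * real K powr D) \<longrightarrow>
     A * real M powr D \<le> cL * (\<Sum>m | k < m \<and> m \<le> M \<and> odd (m + k). q m) \<longrightarrow>
     (\<forall>m>M. w m \<le> C1 * real m powr (- \<alpha>)) \<longrightarrow>
     (\<forall>m. k < m \<and> m \<le> M \<and> odd (m + k) \<longrightarrow> c1 * real m powr (- \<alpha>) \<le> w m) \<longrightarrow>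
     summable (\<lambda>m. (1 + real m powr (2 * r)) * (w m * q m)) \<and>
     (\<Sum>m. (1 + real m powr (2 * r)) * (w m * q m))
       \<le> C * real M powr (2 * (r - s)) * (\<Sum>m\<le>M. (1 + real m powr (2 * s)) * (w m * q m))"
proof -
  define \<gamma> where "\<gamma> = \<alpha> - D - 2 * r"
  have \<gamma>: "\<gamma> > 0" using \<alpha> by (simp add: \<gamma>_def)
  define S where "S = 2 powr D / (1 - 2 powr (- \<gamma>))"
  have S: "S > 0" unfolding S_def using \<gamma> by (intro divide_pos_pos) (auto simp: powr_less_one)
  define C where "C = 1 + 2 * C1 * CU * S * cL / c1"
  have C0: "C > 0" using C S by (auto simp: C_def intro!: add_pos_nonneg)
  show ?thesis
  proof (intro exI[of _ C] conjI allI impI C0)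
    fix q w :: "nat \<Rightarrow> real" and A :: real and M :: nat
    assume q: "\<forall>m. 0 \<le> q m" and w: "\<forall>m. 0 \<le> w m" and A: "0 \<le> A" and M: "M \<ge> 1"
      and up: "\<forall>K\<ge>M. (\<Sum>m\<le>K. q m) \<le> CU * A * real K powr D"
      and lo: "A * real M powr D \<le> cL * (\<Sum>m | k < m \<and> m \<le> M \<and> odd (m + k). q m)"
      and wu: "\<forall>m>M. w m \<le> C1 * real m powr (- \<alpha>)"
      and wl: "\<forall>m. k < m \<and> m \<le> M \<and> odd (m + k) \<longrightarrow> c1 * real m powr (- \<alpha>) \<le> w m"
    let ?f = "\<lambda>m. (1 + real m powr (2 * r)) * (w m * q m)"
    let ?D = "\<Sum>m\<le>M. (1 + real m powr (2 * s)) * (w m * q m)"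
    have wq: "0 \<le> w m * q m" for m using q w by simp
    have f0: "0 \<le> ?f m" for m by (intro mult_nonneg_nonneg[OF _ wq]) auto
    have M1: "real M powr (2 * (r - s)) \<ge> 1" using M sr by (intro ge_one_powr_ge_zero) auto
    have low: "(\<Sum>m\<le>M. ?f m) \<le> real M powr (2 * (r - s)) * ?D"
      unfolding sum_distrib_left
    proof (rule sum_mono)
      fix m assume m: "m \<in> {..M}"
      have "1 + real m powr (2 * r) \<le> real M powr (2 * (r - s)) * (1 + real m powr (2 * s))"
      proof (cases "m = 0")
        case False
        have "real m powr (2 * r) = real m powr (2 * (r - s)) * real m powr (2 * s)"
          by (simp add: powr_add[symmetric] algebra_simps)
        also have "\<dots> \<le> real M powr (2 * (r - s)) * real m powr (2 * s)"
          using m sr False by (intro mult_right_mono powr_mono2) auto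
        finally show ?thesis using M1 by (simp add: distrib_left)
      qed (use M1 in simp)
      from mult_right_mono[OF this wq[of m]]
      show "?f m \<le> real M powr (2 * (r - s)) * ((1 + real m powr (2 * s)) * (w m * q m))" by (simp only: mult.assoc)
    qed
    have Abound: "A * real M powr (- \<gamma>) \<le> cL / c1 * real M powr (2 * (r - s)) * ?D"
    proof -
      let ?O = "{m. k < m \<and> m \<le> M \<and> odd (m + k)}"
      have finO: "finite ?O" by (rule finite_subset[of _ "{..M}"]) auto
      have "c1 * (\<Sum>m\<in>?O. q m) \<le> real M powr (\<alpha> - 2 * s) * ?D"
      proof -
        have "c1 * (\<Sum>m\<in>?O. q m) \<le> (\<Sum>m\<in>?O. real M powr (\<alpha> - 2 * s) * ((1 + real m powr (2 * s)) * (w m * q m)))"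
          unfolding sum_distrib_left
        proof (rule sum_mono)
          fix m assume m: "m \<in> ?O"
          have "c1 = c1 * real m powr (- \<alpha>) * real m powr \<alpha>" using m by (simp add: powr_minus)
          also have "\<dots> \<le> w m * real m powr \<alpha>" using wl m by (intro mult_right_mono) auto
          also have "real m powr \<alpha> = real m powr (\<alpha> - 2 * s) * real m powr (2 * s)" by (simp add: powr_add[symmetric])
          also have "w m * (real m powr (\<alpha> - 2 * s) * real m powr (2 * s)) \<le> w m * (real M powr (\<alpha> - 2 * s) * (1 + real m powr (2 * s)))"
            using m w D sr s \<alpha> by (intro mult_left_mono mult_mono powr_mono2) auto
          finally have "c1 * q m \<le> w m * (real M powr (\<alpha> - 2 * s) * (1 + real m powr (2 * s))) * q m"
            using q by (intro mult_right_mono) auto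
          then show "c1 * q m \<le> real M powr (\<alpha> - 2 * s) * ((1 + real m powr (2 * s)) * (w m * q m))" by (simp only: mult_ac)
        qed
        also have "\<dots> \<le> (\<Sum>m\<le>M. real M powr (\<alpha> - 2 * s) * ((1 + real m powr (2 * s)) * (w m * q m)))"
          using wq by (intro sum_mono2) (auto intro!: mult_nonneg_nonneg)
        finally show ?thesis by (simp add: sum_distrib_left)
      qed
      then have O: "(\<Sum>m\<in>?O. q m) \<le> real M powr (\<alpha> - 2 * s) * ?D / c1" using C by (simp add: field_simps)
      have "A * real M powr (- \<gamma>) = A * real M powr D * real M powr (- \<gamma> - D)"
        using M by (simp add: powr_add[symmetric])
      also have "\<dots> \<le> cL * (\<Sum>m\<in>?O. q m) * real M powr (- \<gamma> - D)" by (intro mult_right_mono lo) auto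
      also have "\<dots> \<le> cL * (real M powr (\<alpha> - 2 * s) * ?D / c1) * real M powr (- \<gamma> - D)"
        using C by (intro mult_right_mono mult_left_mono O) auto
      also have "\<dots> = cL / c1 * (real M powr (\<alpha> - 2 * s) * real M powr (- \<gamma> - D)) * ?D" by simp
      also have "real M powr (\<alpha> - 2 * s) * real M powr (- \<gamma> - D) = real M powr (2 * (r - s))"
        unfolding powr_add[symmetric] by (simp add: \<gamma>_def algebra_simps)
      finally show ?thesis .
    qed
    have part: "(\<Sum>m<K. ?f m) \<le> C * real M powr (2 * (r - s)) * ?D" for K
    proof -
      have "K \<le> 2 ^ K * M"
      proof -
        have "K \<le> 2 ^ K * 1" using less_exp[of K] by simp
        also have "\<dots> \<le> 2 ^ K * M" using M by (intro mult_left_mono) auto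
        finally show ?thesis .
      qed
      then have "{..<K} \<subseteq> {..M} \<union> {M<..2 ^ K * M}" by auto
      then have "(\<Sum>m<K. ?f m) \<le> (\<Sum>m\<in>{..M} \<union> {M<..2 ^ K * M}. ?f m)" using f0 by (intro sum_mono2) auto
      also have "\<dots> = (\<Sum>m\<le>M. ?f m) + (\<Sum>m\<in>{M<..2 ^ K * M}. ?f m)" by (intro sum.union_disjoint) auto
      finally have 1: "(\<Sum>m<K. ?f m) \<le> (\<Sum>m\<le>M. ?f m) + (\<Sum>m\<in>{M<..2 ^ K * M}. ?f m)" .
      have "(\<Sum>m\<in>{M<..2 ^ K * M}. ?f m) \<le> (\<Sum>m\<in>{M<..2 ^ K * M}. 2 * C1 * (real m powr (- (D + \<gamma>)) * q m))"
      proof (rule sum_mono)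
        fix m assume m: "m \<in> {M<..2 ^ K * M}"
        have "1 \<le> real m powr (2 * r)" using m sr s by (intro ge_one_powr_ge_zero) auto
        then have "1 + real m powr (2 * r) \<le> 2 * real m powr (2 * r)" by simp
        then have "(1 + real m powr (2 * r)) * w m \<le> (2 * real m powr (2 * r)) * (C1 * real m powr (- \<alpha>))"
          using m w wu by (intro mult_mono) auto
        also have "\<dots> = 2 * C1 * (real m powr (2 * r) * real m powr (- \<alpha>))" by simp
        also have "real m powr (2 * r) * real m powr (- \<alpha>) = real m powr (- (D + \<gamma>))"
          unfolding powr_add[symmetric] by (simp add: \<gamma>_def)
        finally have "(1 + real m powr (2 * r)) * w m * q m \<le> 2 * C1 * real m powr (- (D + \<gamma>)) * q m"
          using q by (intro mult_right_mono) auto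
        then show "?f m \<le> 2 * C1 * (real m powr (- (D + \<gamma>)) * q m)" by (simp only: mult.assoc)
      qed
      also have "\<dots> = 2 * C1 * (\<Sum>m\<in>{M<..2 ^ K * M}. real m powr (- (D + \<gamma>)) * q m)" by (simp add: sum_distrib_left)
      also have "\<dots> \<le> 2 * C1 * (CU * A * 2 powr D * real M powr (- \<gamma>) / (1 - 2 powr (- \<gamma>)))"
        using q up A C by (intro mult_left_mono dyadic_sum_bound M \<gamma> D) auto
      also have "\<dots> = 2 * C1 * CU * S * (A * real M powr (- \<gamma>))" by (simp add: S_def)
      also have "\<dots> \<le> 2 * C1 * CU * S * (cL / c1 * real M powr (2 * (r - s)) * ?D)"
        using C S by (intro mult_left_mono Abound) auto
      finally have 2: "(\<Sum>m\<in>{M<..2 ^ K * M}. ?f m) \<le> 2 * C1 * CU * S * (cL / c1 * real M powr (2 * (r - s)) * ?D)" .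
      have "C * real M powr (2 * (r - s)) * ?D = real M powr (2 * (r - s)) * ?D + 2 * C1 * CU * S * (cL / c1 * real M powr (2 * (r - s)) * ?D)"
        by (simp add: C_def distrib_right)
      then show ?thesis using 1 2 low by linarith
    qed
    show sm: "summable ?f" by (rule summableI_nonneg_bounded[OF f0 part])
    show "(\<Sum>m. ?f m) \<le> C * real M powr (2 * (r - s)) * ?D" by (rule suminf_le_const[OF sm part])
  qed
qed

section \<open>Geodesic and Euclidean distances\<close>

text \<open>
  On \<open>{0..pi / 3}\<close> the derivative \<open>cos\<close> is at least \<open>1/2\<close>; after that \<open>sin x\<close> is at least \<open>sqrt 3 / 2\<close>,
  which exceeds \<open>2/3\<close>, whereas \<open>pi / 6 < 2/3\<close>.
\<close>

lemma sin_ge_third: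
  assumes "0 \<le> x" "x \<le> pi / 2"
  shows "x / 3 \<le> sin x"
proof (cases "x \<le> pi / 3")
  case True
  have "sin 0 - 0 / 3 \<le> sin x - x / 3"
  proof (rule DERIV_nonneg_imp_nondecreasing[OF assms(1), of "\<lambda>x. sin x - x / 3"])
    fix y assume y: "0 \<le> y" "y \<le> x"
    have "cos (pi / 3) \<le> cos y" using y True pi_gt_zero by (intro cos_monotone_0_pi_le) auto
    then show "\<exists>z. ((\<lambda>x. sin x - x / 3) has_real_derivative z) (at y) \<and> 0 \<le> z"
      by (intro exI[of _ "cos y - 1 / 3"]) (auto intro!: derivative_eq_intros simp: cos_60)
  qed
  then show ?thesis by simp
next
  case False
  have "x / 3 \<le> 2 / 3" using assms pi_less_4 by simp
  also have "\<dots> \<le> sqrt 3 / 2"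
    using real_le_rsqrt[of "4/3" 3] by (simp add: power2_eq_square)
  also have "sqrt 3 / 2 = sin (pi / 3)" by (simp add: sin_60)
  also have "\<dots> \<le> sin x" using False assms by (intro sin_monotone_2pi_le) auto
  finally show ?thesis .
qed

lemma norm_diff_geod:
  fixes x y :: "'a::euclidean_space"
  assumes "x \<in> sphere 0 1" "y \<in> sphere 0 1"
  shows "norm (x - y) = 2 * sin (geod_dist x y / 2)" "0 \<le> geod_dist x y" "geod_dist x y \<le> pi"
proof -
  let ?g = "geod_dist x y"
  have xy: "-1 \<le> x \<bullet> y" "x \<bullet> y \<le> 1" using inner_sphere_range[OF assms] by auto
  show g: "0 \<le> ?g" "?g \<le> pi" unfolding geod_dist_def using xy by (auto intro: arccos_lbound arccos_ubound)
  have "(norm (x - y))\<^sup>2 = 2 - 2 * (x \<bullet> y)"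
    using assms by (simp add: dot_norm_neg[of x y] field_simps)
  moreover have "x \<bullet> y = 1 - 2 * (sin (?g / 2))\<^sup>2"
    using xy cos_double_sin[of "?g / 2"] by (simp add: geod_dist_def)
  ultimately have "(norm (x - y))\<^sup>2 = (2 * sin (?g / 2))\<^sup>2" by (simp add: power_mult_distrib)
  moreover have "0 \<le> 2 * sin (?g / 2)"
    using sin_ge_zero[of "?g / 2"] g by simp
  ultimately show "norm (x - y) = 2 * sin (?g / 2)"
    by (rule power2_eq_imp_eq[OF _ norm_ge_zero])
qed

lemma norm_diff_ge_geod:
  fixes x y :: "'a::euclidean_space"
  assumes "x \<in> sphere 0 1" "y \<in> sphere 0 1"
  shows "geod_dist x y / 3 \<le> norm (x - y)"
  using sin_ge_third[of "geod_dist x y / 2"] norm_diff_geod[OF assms] by simp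

lemma norm_diff_le_geod:
  fixes x y :: "'a::euclidean_space"
  assumes "x \<in> sphere 0 1" "y \<in> sphere 0 1"
  shows "norm (x - y) \<le> geod_dist x y"
  using sin_x_le_x[of "geod_dist x y / 2"] norm_diff_geod[OF assms] by simp

lemma antipodal_sep_le:
  assumes ij: "i \<in> {1..n}" "j \<in> {1..n}" "i \<noteq> j"
  shows "antipodal_sep n \<theta> \<le> geod_dist (\<theta> i) (\<theta> j)" "antipodal_sep n \<theta> \<le> geod_dist (- \<theta> i) (\<theta> j)"
proof -
  have fin: "finite {f i j | i j. i \<in> {1..n} \<and> j \<in> {1..n} \<and> i \<noteq> j}" for f :: "nat \<Rightarrow> nat \<Rightarrow> real"
    by (rule finite_subset[of _ "(\<lambda>(i, j). f i j) ` ({1..n} \<times> {1..n})"]) auto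
  have "Min {geod_dist (\<theta> i) (\<theta> j) | i j. i \<in> {1..n} \<and> j \<in> {1..n} \<and> i \<noteq> j} \<le> geod_dist (\<theta> i) (\<theta> j)"
    using ij by (intro Min_le fin) blast
  moreover have "Min {geod_dist (- \<theta> i) (\<theta> j) | i j. i \<in> {1..n} \<and> j \<in> {1..n} \<and> i \<noteq> j} \<le> geod_dist (- \<theta> i) (\<theta> j)"
    using ij by (intro Min_le fin) blast
  ultimately show "antipodal_sep n \<theta> \<le> geod_dist (\<theta> i) (\<theta> j)" "antipodal_sep n \<theta> \<le> geod_dist (- \<theta> i) (\<theta> j)"
    by (auto simp: antipodal_sep_def)
qed

lemma antipodal_sep_nonneg:
  fixes \<theta> :: "nat \<Rightarrow> 'a::euclidean_space"
  assumes n: "n \<ge> 2" and \<theta>: "\<theta> ` {1..n} \<subseteq> sphere 0 1"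
  shows "0 \<le> antipodal_sep n \<theta>"
proof -
  have fin: "finite {f i j | i j. i \<in> {1..n} \<and> j \<in> {1..n} \<and> i \<noteq> j}" for f :: "nat \<Rightarrow> nat \<Rightarrow> real"
    by (rule finite_subset[of _ "(\<lambda>(i, j). f i j) ` ({1..n} \<times> {1..n})"]) auto
  have ne: "{f i j | i j. i \<in> {1..n} \<and> j \<in> {1..n} \<and> i \<noteq> j} \<noteq> {}" for f :: "nat \<Rightarrow> nat \<Rightarrow> real"
  proof -
    have "f 1 2 \<in> {f i j | i j. i \<in> {1..n} \<and> j \<in> {1..n} \<and> i \<noteq> j}"
      unfolding mem_Collect_eq by (intro exI[of _ 1] exI[of _ 2]) (use n in auto)
    then show ?thesis by blast
  qed
  have th: "\<theta> j \<in> sphere 0 1" "- \<theta> j \<in> sphere 0 1" if "j \<in> {1..n}" for j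
    using \<theta> that by (auto simp: image_subset_iff)
  have "0 \<le> Min {geod_dist (\<theta> i) (\<theta> j) | i j. i \<in> {1..n} \<and> j \<in> {1..n} \<and> i \<noteq> j}"
    using norm_diff_geod(2)[OF th(1) th(1)] by (subst Min_ge_iff[OF fin ne]) blast
  moreover have "0 \<le> Min {geod_dist (- \<theta> i) (\<theta> j) | i j. i \<in> {1..n} \<and> j \<in> {1..n} \<and> i \<noteq> j}"
    using norm_diff_geod(2)[OF th(2) th(1)] by (subst Min_ge_iff[OF fin ne]) blast
  ultimately show ?thesis by (simp add: antipodal_sep_def)
qed

text \<open>
  The caps of radius \<open>mesh_norm n \<theta>\<close> around the points cover the sphere. If the radius were smaller than
  claimed, their total measure would be at most \<open>1/2\<close>.
\<close>

lemma mesh_norm_lower: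
  fixes \<theta> :: "nat \<Rightarrow> 'a::euclidean_space"
  assumes n: "n \<ge> 1" and \<theta>: "\<theta> ` {1..n} \<subseteq> sphere 0 1" and d: "d = DIM('a) - 1" "d \<ge> 1"
  shows "(4 * 2 ^ DIM('a)) powr (- 1 / real d) * real n powr (- 1 / real d) \<le> mesh_norm n \<theta>"
proof (rule ccontr)
  assume "\<not> ?thesis"
  define \<rho> where "\<rho> = (4 * 2 ^ DIM('a) * real n) powr (- 1 / real d)"
  have "\<rho> = (4 * 2 ^ DIM('a)) powr (- 1 / real d) * real n powr (- 1 / real d)"
    unfolding \<rho>_def by (rule powr_mult)
  with \<open>\<not> ?thesis\<close> have small: "mesh_norm n \<theta> < \<rho>" by simp
  have base: "1 \<le> 4 * 2 ^ DIM('a) * real n"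
    using n mult_mono[of 1 "4 * 2 ^ DIM('a)" 1 "real n"] by (simp add: one_le_power order_trans[of 1 4])
  have \<rho>0: "0 < \<rho>" unfolding \<rho>_def using n by simp
  have "\<rho> \<le> (4 * 2 ^ DIM('a) * real n) powr 0" unfolding \<rho>_def using base by (intro powr_mono) auto
  then have \<rho>1: "\<rho> \<le> 1" using base by (simp split: if_splits)
  have \<rho>d: "\<rho> ^ d = 1 / (4 * 2 ^ DIM('a) * real n)"
  proof -
    have "\<rho> ^ d = \<rho> powr real d" using \<rho>0 by (simp add: powr_realpow)
    also have "\<dots> = (4 * 2 ^ DIM('a) * real n) powr (- 1)" unfolding \<rho>_def powr_powr using d by simp
    finally show ?thesis using base by (simp add: powr_minus_divide)
  qed
  have th: "\<theta> j \<in> sphere 0 1" if "j \<in> {1..n}" for j using \<theta> that by (auto simp: image_subset_iff)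
  define A where "A j = {x \<in> sphere 0 1. norm (x - \<theta> j) \<le> \<rho>}" for j
  have "A j = sphere 0 1 \<inter> cball (\<theta> j) \<rho>" for j by (auto simp: A_def dist_norm norm_minus_commute)
  then have sA: "A j \<in> sets sphere_measure" for j
    by (auto simp: sets_sphere_measure sets_restrict_space intro: borel_closed)
  have cover: "sphere 0 1 \<subseteq> (\<Union>j\<in>{1..n}. A j)"
  proof
    fix \<eta> :: 'a assume \<eta>: "\<eta> \<in> sphere 0 1"
    let ?G = "\<lambda>\<eta>. (\<lambda>j. geod_dist \<eta> (\<theta> j)) ` {1..n}"
    have ne: "finite (?G \<zeta>)" "?G \<zeta> \<noteq> {}" for \<zeta> using n by auto
    have "bdd_above ((\<lambda>\<eta>. Min (?G \<eta>)) ` sphere 0 1)"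
    proof (rule bdd_aboveI2)
      fix \<zeta> :: 'a assume \<zeta>: "\<zeta> \<in> sphere 0 1"
      have "Min (?G \<zeta>) \<le> geod_dist \<zeta> (\<theta> 1)" using n by (intro Min_le) auto
      also have "\<dots> \<le> pi" using n by (intro norm_diff_geod \<zeta> th) auto
      finally show "Min (?G \<zeta>) \<le> pi" .
    qed
    then have "Min (?G \<eta>) \<le> mesh_norm n \<theta>" unfolding mesh_norm_def by (rule cSUP_upper[OF \<eta>])
    moreover obtain j where j: "j \<in> {1..n}" "Min (?G \<eta>) = geod_dist \<eta> (\<theta> j)"
      using Min_in[OF ne(1) ne(2), of \<eta>] by blast
    ultimately have "norm (\<eta> - \<theta> j) \<le> \<rho>"
      using norm_diff_le_geod[OF \<eta> th[OF j(1)]] small by linarith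
    then show "\<eta> \<in> (\<Union>j\<in>{1..n}. A j)" using j(1) \<eta> by (auto simp: A_def)
  qed
  have "1 = measure (sphere_measure :: 'a measure) (sphere 0 1)" by simp
  also have "\<dots> \<le> measure sphere_measure (\<Union>j\<in>{1..n}. A j)"
    using sA by (intro sphere_measure.finite_measure_mono cover) auto
  also have "\<dots> \<le> (\<Sum>j\<in>{1..n}. measure sphere_measure (A j))"
    using sA by (intro sphere_measure.finite_measure_subadditive_finite) auto
  also have "\<dots> \<le> (\<Sum>j\<in>{1..n}. 2 * 2 ^ DIM('a) * \<rho> ^ d)"
    unfolding A_def d by (intro sum_mono cap_upper th \<rho>0 \<rho>1)
  also have "\<dots> = 1 / 2" using n by (simp add: \<rho>d)
  finally show False by simp
qed

section \<open>The inverse inequality and its consequences\<close>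

lemma (in spherical_basis) network_coefficient:
  fixes \<theta> :: "nat \<Rightarrow> 'a"
  assumes f: "f \<in> network k n \<theta>" and \<theta>: "\<theta> ` {1..n} \<subseteq> sphere 0 1"
  shows "\<exists>a. \<forall>m. \<forall>l\<in>{1..N m}. sphere_inner f (Y m l)
     = relu_coef (real DIM('a)) k (relu_moment TYPE('a) k) (relu_moment TYPE('a) (Suc k)) m * (\<Sum>j=1..n. a j * Ypoly m l (\<theta> j))"
proof -
  obtain a where fL: "f \<in> sphere_L2" and a: "AE \<eta> in sphere_measure. f \<eta> = (\<Sum>j=1..n. a j * relu_pow k (\<theta> j \<bullet> \<eta>))"
    using f by (auto simp: network_def)
  have th: "\<theta> j \<in> sphere 0 1" if "j \<in> {1..n}" for j using \<theta> that by (auto simp: image_subset_iff)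
  have bp: "relu_pow k \<in> bounded_profile" using bounded_profile_relu_pow[of 0 k] by simp
  have "sphere_inner f (Y m l)
     = relu_coef (real DIM('a)) k (relu_moment TYPE('a) k) (relu_moment TYPE('a) (Suc k)) m * (\<Sum>j=1..n. a j * Ypoly m l (\<theta> j))"
    if l: "l \<in> {1..N m}" for m l
  proof -
    have "sphere_inner f (Y m l) = fourier_coeff f (m, l)" by (rule fourier_coeff_sphere_inner[OF l])
    also have "\<dots> = fourier_coeff (\<lambda>x. \<Sum>j\<in>{1..n}. a j * relu_pow k (\<theta> j \<bullet> x)) (m, l)"
      unfolding fourier_coeff_def
    proof (rule integral_cong_AE)
      have e: "Yfun (m, l) \<in> borel_measurable sphere_measure"
        using Ypoly_polynomial[OF l] by (simp add: Yfun_def borel_measurable_polynomial)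
      show "(\<lambda>x. f x * Yfun (m, l) x) \<in> borel_measurable sphere_measure"
        using fL e by (auto simp: sphere_L2_def)
      show "(\<lambda>x. (\<Sum>j\<in>{1..n}. a j * relu_pow k (\<theta> j \<bullet> x)) * Yfun (m, l) x) \<in> borel_measurable sphere_measure"
        by (intro borel_measurable_times e ridge_measurable bp) auto
      show "AE x in sphere_measure. f x * Yfun (m, l) x = (\<Sum>j\<in>{1..n}. a j * relu_pow k (\<theta> j \<bullet> x)) * Yfun (m, l) x"
        using a by eventually_elim simp
    qed
    also have "\<dots> = relu_coef (real DIM('a)) k (relu_moment TYPE('a) k) (relu_moment TYPE('a) (Suc k)) m * (\<Sum>j\<in>{1..n}. a j * Ypoly m l (\<theta> j))"
      using dim3 by (intro fourier_coeff_ridge bp th l zonal_pairing_relu) auto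
    finally show ?thesis .
  qed
  then show ?thesis by blast
qed


lemma sobolev_norm_nonneg:
  assumes "f \<in> sobolev Y N s"
  shows "0 \<le> sobolev_norm Y N s f"
proof (cases "s = 0")
  case True
  have "0 \<le> (LINT x|sphere_measure. f x * f x)" by (intro integral_nonneg_AE) auto
  then show ?thesis using True by (simp add: sobolev_norm_def L2_norm_def sphere_inner_def)
next
  case False
  have "0 \<le> sobolev_term Y N s f m" for m by (simp add: sobolev_term_def sum_nonneg)
  then show ?thesis using False assms by (simp add: sobolev_norm_def sobolev_def suminf_nonneg)
qed

text \<open>
  All parts of the theorem are instances of this statement, in which \<open>v\<close> has the coefficients of a network
  multiplied by an elliptic symbol. The test functions live on the scale \<open>\<epsilon> = c0 * h\<close> and the
  degrees are split at \<open>M\<close>, the least integer with \<open>K \<le> \<epsilon> * M\<close>; the constants \<open>c0\<close> and \<open>K\<close> are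
  chosen such that the hypotheses of \<open>energy_lower\<close> hold.
\<close>

lemma inverse_inequality:
  fixes \<beta> cL CL r s :: real and k :: nat
  assumes dim3: "DIM('a::euclidean_space) \<ge> 3" and \<beta>: "0 \<le> \<beta>" and cL: "0 < cL" "cL \<le> CL"
    and s: "0 \<le> s" and sr: "s < r" and r: "r < real k + 1/2 - \<beta>"
  shows "\<exists>C>0. \<forall>(Y :: nat \<Rightarrow> nat \<Rightarrow> 'a \<Rightarrow> real) N ell. harmonic_onb Y N \<longrightarrow> elliptic_symbol \<beta> cL CL ell \<longrightarrow>
    (\<forall>n\<ge>2. \<forall>\<theta>. \<theta> ` {1..n} \<subseteq> sphere 0 1 \<longrightarrow> antipodal_sep n \<theta> > 0 \<longrightarrow>
      (\<forall>f\<in>network k n \<theta>. \<forall>v\<in>sphere_L2. (\<forall>m. \<forall>l\<in>{1..N m}. sphere_inner v (Y m l) = ell m * sphere_inner f (Y m l)) \<longrightarrow>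
        v \<in> sobolev Y N r \<and>
        sobolev_norm Y N r v \<le> C * antipodal_sep n \<theta> powr (- (r - s)) * sobolev_norm Y N s v))"
proof -
  let ?N = "real DIM('a)"
  define D where "D = ?N - 1"
  define E where "E = 1 + 2 * ?N"
  define \<alpha> where "\<alpha> = real k + ?N / 2"
  define \<alpha>2 where "\<alpha>2 = 2 * \<alpha> - 2 * \<beta>"
  define ek where "ek = real k * (real k + ?N - 2)"
  define K where "K = 1 + real k + 16 * ((bump_const ?N)\<^sup>2 * E ^ 8)"
  \<comment> \<open>The summand \<open>6\<close> makes \<open>2 * \<epsilon> \<le> h / 3\<close>, a lower bound for the Euclidean distances; the other two give
    the smallness conditions on \<open>\<epsilon>\<close>, because \<open>\<epsilon> \<le> 4 * c0\<close>.\<close>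
  define c0 where "c0 = 1 / (6 + 8 * real k * sqrt ?N + 32 * E * ek\<^sup>2)"
  define mom0 where "mom0 = relu_moment TYPE('a) k"
  define mom1 where "mom1 = relu_moment TYPE('a) (Suc k)"
  let ?lam = "relu_coef ?N k mom0 mom1"
  have N3: "?N \<ge> 3" using dim3 by simp
  have E: "E > 0" by (simp add: E_def)
  have K1: "K \<ge> 1" "K \<ge> real k" "K \<ge> 16 * ((bump_const ?N)\<^sup>2 * E ^ 8)" using E by (auto simp: K_def)
  have c00: "0 < c0" "c0 \<le> 1/6"
  proof -
    have "6 \<le> 6 + 8 * real k * sqrt ?N + 32 * E * ek\<^sup>2" using E by simp
    then show "0 < c0" "c0 \<le> 1/6" unfolding c0_def by (auto intro: divide_left_mono[of 6 _ 1, simplified])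
  qed
  have c0k: "c0 * (8 * real k * sqrt ?N) \<le> 1" "c0 * (32 * E * ek\<^sup>2) \<le> 1"
  proof -
    let ?x = "8 * real k * sqrt ?N" and ?y = "32 * E * ek\<^sup>2"
    have "0 \<le> ?x" "0 \<le> ?y" using E by auto
    then have "?x / (6 + ?x + ?y) \<le> 1" "?y / (6 + ?x + ?y) \<le> 1" by (auto simp only: divide_le_eq_1)
    then show "c0 * ?x \<le> 1" "c0 * ?y \<le> 1" by (simp_all add: c0_def)
  qed
  have sq1: "sqrt ?N \<ge> 1" using N3 by simp
  have mom: "mom0 > 0" "mom1 > 0" by (simp_all add: mom0_def mom1_def relu_moment_pos)
  obtain Cu where Cu: "Cu > 0" "\<And>m. m \<ge> k \<Longrightarrow> m \<ge> 1 \<Longrightarrow> \<bar>?lam m\<bar> \<le> Cu * real m powr (- \<alpha>)"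
    using relu_coef_upper[of ?N \<alpha> k mom0 mom1] N3 by (auto simp: \<alpha>_def)
  obtain Cl where Cl: "Cl > 0" "\<And>m. m > k \<Longrightarrow> odd (m + k) \<Longrightarrow> Cl * real m powr (- \<alpha>) \<le> \<bar>?lam m\<bar>"
    using relu_coef_lower[of ?N \<alpha> k mom0 mom1] N3 mom by (auto simp: \<alpha>_def)
  define CU where "CU = 4 * E * (2 * 8 ^ DIM('a) * (2 * sqrt ?N) powr D)"
  define CS where "CS = 8 * 2 ^ DIM('a) * (K + 1) powr D"
  define C1 where "C1 = (CL * 2 powr \<beta> * Cu)\<^sup>2"
  define C2 where "C2 = (cL * Cl)\<^sup>2"
  have CL: "CL > 0" using cL by simp
  have pos: "CU > 0" "CS > 0" "C1 > 0" "C2 > 0"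
    using E N3 K1 CL cL Cu(1) Cl(1) by (auto simp: CU_def CS_def C1_def C2_def)
  have "D + 2 * r < \<alpha>2" using r by (simp add: D_def \<alpha>2_def \<alpha>_def)
  then obtain C where C: "C > 0" and seq: "\<And>(q :: nat \<Rightarrow> real) w A M. (\<forall>m. 0 \<le> q m) \<Longrightarrow> (\<forall>m. 0 \<le> w m) \<Longrightarrow> 0 \<le> A \<Longrightarrow> M \<ge> 1 \<Longrightarrow>
     (\<forall>K\<ge>M. (\<Sum>m\<le>K. q m) \<le> CU * A * real K powr D) \<Longrightarrow>
     A * real M powr D \<le> CS * (\<Sum>m | k < m \<and> m \<le> M \<and> odd (m + k). q m) \<Longrightarrow>
     (\<forall>m>M. w m \<le> C1 * real m powr (- \<alpha>2)) \<Longrightarrow>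
     (\<forall>m. k < m \<and> m \<le> M \<and> odd (m + k) \<longrightarrow> C2 * real m powr (- \<alpha>2) \<le> w m) \<Longrightarrow>
     summable (\<lambda>m. (1 + real m powr (2 * r)) * (w m * q m)) \<and>
     (\<Sum>m. (1 + real m powr (2 * r)) * (w m * q m))
       \<le> C * real M powr (2 * (r - s)) * (\<Sum>m\<le>M. (1 + real m powr (2 * s)) * (w m * q m))"
    using inverse_inequality_sequences[of D s r \<alpha>2 CU CS C1 C2 k] s sr pos N3 by (auto simp: D_def)
  define CC where "CC = sqrt (2 * C) * ((K + 1) / c0) powr (r - s)"
  have CC: "CC > 0" using C K1 c00 by (simp add: CC_def)
  show ?thesis
  proof (intro exI[of _ CC] conjI CC allI impI ballI)
    fix Y :: "nat \<Rightarrow> nat \<Rightarrow> 'a \<Rightarrow> real" and N ell n and \<theta> :: "nat \<Rightarrow> 'a" and f v :: "'a \<Rightarrow> real"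
    assume onb: "harmonic_onb Y N" and ell: "elliptic_symbol \<beta> cL CL ell" and n: "n \<ge> 2" and \<theta>: "\<theta> ` {1..n} \<subseteq> sphere 0 1"
      and sep: "antipodal_sep n \<theta> > 0" and f: "f \<in> network k n \<theta>" and v: "v \<in> sphere_L2"
      and vf: "\<forall>m. \<forall>l\<in>{1..N m}. sphere_inner v (Y m l) = ell m * sphere_inner f (Y m l)"
    interpret spherical_basis Y N by unfold_locales (use onb dim3 in auto)
    define h where "h = antipodal_sep n \<theta>"
    define \<epsilon> where "\<epsilon> = c0 * h"
    have h: "h > 0" using sep by (simp add: h_def)
    have th: "\<theta> j \<in> sphere 0 1" "- \<theta> j \<in> sphere 0 1" if "j \<in> {1..n}" for j using \<theta> that by (auto simp: image_subset_iff)
    have h4: "h \<le> 4"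
    proof -
      have "h \<le> geod_dist (\<theta> 1) (\<theta> 2)" unfolding h_def using n by (intro antipodal_sep_le) auto
      also have "\<dots> \<le> pi" using n by (intro norm_diff_geod th) auto
      finally show ?thesis using pi_less_4 by linarith
    qed
    have sep1: "2 * \<epsilon> \<le> norm (\<theta> i - \<theta> j)" "2 * \<epsilon> \<le> norm (\<theta> i + \<theta> j)" if ij: "i \<in> {1..n}" "j \<in> {1..n}" "i \<noteq> j" for i j
    proof -
      have "2 * \<epsilon> \<le> h / 3" using c00 h by (simp add: \<epsilon>_def)
      moreover have "h \<le> geod_dist (\<theta> i) (\<theta> j)" "h \<le> geod_dist (- \<theta> i) (\<theta> j)"
        unfolding h_def by (intro antipodal_sep_le ij)+
      moreover have "norm (- \<theta> i - \<theta> j) = norm (\<theta> i + \<theta> j)" by (metis minus_add_distrib norm_minus_cancel uminus_add_conv_diff add.commute)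
      ultimately show "2 * \<epsilon> \<le> norm (\<theta> i - \<theta> j)" "2 * \<epsilon> \<le> norm (\<theta> i + \<theta> j)"
        using norm_diff_ge_geod[OF th(1)[OF ij(1)] th(1)[OF ij(2)]] norm_diff_ge_geod[OF th(2)[OF ij(1)] th(1)[OF ij(2)]]
        by linarith+
    qed
    have \<epsilon>4: "\<epsilon> \<le> 4 * c0" using mult_left_mono[OF h4, of c0] c00 by (simp add: \<epsilon>_def)
    have \<epsilon>: "0 < \<epsilon>" "\<epsilon> \<le> 1"
    proof -
      show "0 < \<epsilon>" using c00 h by (simp add: \<epsilon>_def)
      show "\<epsilon> \<le> 1" using \<epsilon>4 c00 by linarith
    qed
    have k1: "\<epsilon> * real k * sqrt ?N \<le> 1/2"
    proof -
      have "\<epsilon> * (real k * sqrt ?N) \<le> 4 * c0 * (real k * sqrt ?N)" using \<epsilon>4 by (intro mult_right_mono) auto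
      then show ?thesis using c0k(1) by simp
    qed
    have k2: "8 * E * ek\<^sup>2 * \<epsilon> ^ 4 \<le> 1"
    proof -
      have "\<epsilon> ^ 4 \<le> \<epsilon> ^ 1" using \<epsilon> by (intro power_decreasing) auto
      then have "\<epsilon> ^ 4 \<le> 4 * c0" using \<epsilon>4 by simp
      then have "8 * E * ek\<^sup>2 * \<epsilon> ^ 4 \<le> 8 * E * ek\<^sup>2 * (4 * c0)" using E by (intro mult_left_mono) auto
      then show ?thesis using c0k(2) by (simp add: mult_ac)
    qed
    define M where "M = nat \<lceil>K / \<epsilon>\<rceil>"
    have Ke: "K / \<epsilon> \<ge> K" "K / \<epsilon> > 0" using \<epsilon> K1 by (auto simp: field_simps)
    then have M: "K / \<epsilon> \<le> real M" "real M \<le> K / \<epsilon> + 1" unfolding M_def by linarith+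
    have M1: "M \<ge> 1" "k \<le> M" using M Ke K1 by linarith+
    have eM: "K \<le> \<epsilon> * real M" "\<epsilon> * real M \<le> K + 1" using M \<epsilon> by (auto simp: field_simps)
    obtain a where a: "\<And>m l. l \<in> {1..N m} \<Longrightarrow> sphere_inner f (Y m l) = ?lam m * (\<Sum>j=1..n. a j * Ypoly m l (\<theta> j))"
      using network_coefficient[OF f \<theta>] unfolding mom0_def mom1_def by blast
    let ?A = "\<Sum>j=1..n. (a j)\<^sup>2"
    define q where "q = energy a \<theta> n"
    define w where "w m = (ell m * ?lam m)\<^sup>2" for m
    obtain b :: 'a where b: "b \<in> sphere 0 1" using sphere_nonempty_ex by blast
    have cap: "cap_moment TYPE('a) (1 - \<delta>\<^sup>2 / 2) 0 \<ge> (1/2) * (1/8) ^ DIM('a) * \<delta> powr D"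
      "cap_moment TYPE('a) (1 - \<delta>\<^sup>2 / 2) 0 \<le> 2 * 2 ^ DIM('a) * \<delta> powr D" if \<delta>: "0 < \<delta>" "\<delta> \<le> 1" for \<delta>
    proof -
      have DD: "\<delta> powr D = \<delta> ^ (DIM('a) - 1)" using dim3 \<delta> by (simp add: D_def powr_realpow[symmetric] of_nat_diff)
      show "cap_moment TYPE('a) (1 - \<delta>\<^sup>2 / 2) 0 \<ge> (1/2) * (1/8) ^ DIM('a) * \<delta> powr D"
        unfolding cap_moment_0[OF b \<delta>(1)] DD by (rule cap_lower[OF b \<delta>])
      have "{x \<in> sphere 0 1. norm (x - b) \<le> \<delta>} = sphere 0 1 \<inter> cball b \<delta>" by (auto simp: dist_norm norm_minus_commute)
      then have "{x \<in> sphere 0 1. norm (x - b) \<le> \<delta>} \<in> sets sphere_measure"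
        by (auto simp: sets_sphere_measure sets_restrict_space intro: borel_closed)
      then have "measure sphere_measure {x \<in> sphere 0 1. norm (x - b) < \<delta>} \<le> measure sphere_measure {x \<in> sphere 0 1. norm (x - b) \<le> \<delta>}"
        by (intro sphere_measure.finite_measure_mono) auto
      also have "\<dots> \<le> 2 * 2 ^ DIM('a) * \<delta> ^ (DIM('a) - 1)" by (rule cap_upper[OF b \<delta>])
      finally show "cap_moment TYPE('a) (1 - \<delta>\<^sup>2 / 2) 0 \<le> 2 * 2 ^ DIM('a) * \<delta> powr D"
        unfolding cap_moment_0[OF b \<delta>(1)] DD .
    qed
    have up: "\<forall>K\<ge>M. (\<Sum>m\<le>K. q m) \<le> CU * ?A * real K powr D"
    proof (intro allI impI)
      fix L assume L: "M \<le> L"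
      \<comment> \<open>The largest radius for which the upper estimate reaches degree \<open>L\<close>.\<close>
      define \<delta> where "\<delta> = 1 / (2 * sqrt ?N * real L)"
      have L1: "real L \<ge> 1" using L M1 by simp
      have \<delta>: "0 < \<delta>" "\<delta> \<le> \<epsilon>"
      proof -
        show "0 < \<delta>" using L1 N3 by (simp add: \<delta>_def)
        have "1 \<le> \<epsilon> * real M" using eM K1 by linarith
        also have "\<dots> \<le> \<epsilon> * (2 * sqrt ?N * real L)"
        proof (intro mult_left_mono)
          have "1 \<le> 2 * sqrt ?N" using sq1 by linarith
          from mult_mono[OF this, of "real M" "real L"] L
          have "1 * real M \<le> (2 * sqrt ?N) * real L" by simp
          then show "real M \<le> 2 * sqrt ?N * real L" by simp
        qed (use \<epsilon> in auto)
        finally show "\<delta> \<le> \<epsilon>" using L1 sq1 by (simp add: \<delta>_def divide_le_eq)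
      qed
      have "(\<Sum>m\<le>L. q m) * cap_moment TYPE('a) (1 - \<delta>\<^sup>2 / 2) 0 \<le> 4 * (1 + 2 * ?N) * ?A"
        unfolding q_def
      proof (rule energy_upper[OF \<theta> \<delta>(1)])
        show "\<delta> \<le> 1" using \<delta> \<epsilon> by simp
        show "2 * \<delta> \<le> norm (\<theta> i - \<theta> j)" if "i \<in> {1..n}" "j \<in> {1..n}" "i \<noteq> j" for i j
          using sep1(1)[OF that] \<delta> by simp
        show "\<delta> * real L * sqrt ?N \<le> 1/2" using L1 sq1 by (simp add: \<delta>_def)
      qed
      moreover have "(\<Sum>m\<le>L. q m) * ((1/2) * (1/8) ^ DIM('a) * \<delta> powr D) \<le> (\<Sum>m\<le>L. q m) * cap_moment TYPE('a) (1 - \<delta>\<^sup>2 / 2) 0"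
        using \<delta> \<epsilon> by (intro mult_left_mono cap sum_nonneg) (auto simp: q_def energy_nonneg)
      ultimately have "(\<Sum>m\<le>L. q m) * ((1/2) * (1/8) ^ DIM('a) * \<delta> powr D) \<le> 4 * E * ?A" by (simp add: E_def)
      note ub = this
      let ?X = "(2 * sqrt ?N) powr D * real L powr D"
      have \<delta>D: "\<delta> powr D = 1 / ?X"
        using L1 sq1 by (simp add: \<delta>_def powr_divide powr_mult)
      have X: "?X > 0" using L1 sq1 by simp
      have gen: "S = S * ((1/2) * (1/8) ^ j * (1 / x)) * (2 * 8 ^ j * x)" if "x > 0" for S x :: real and j :: nat
        using that by (simp add: power_one_over)
      have "(\<Sum>m\<le>L. q m) = (\<Sum>m\<le>L. q m) * ((1/2) * (1/8) ^ DIM('a) * \<delta> powr D) * (2 * 8 ^ DIM('a) * ?X)"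
        unfolding \<delta>D by (rule gen[OF X])
      also have "\<dots> \<le> 4 * E * ?A * (2 * 8 ^ DIM('a) * ?X)"
        using X by (intro mult_right_mono ub) auto
      finally show "(\<Sum>m\<le>L. q m) \<le> CU * ?A * real L powr D"
        by (simp only: CU_def mult_ac)
    qed
    have lo: "?A * real M powr D \<le> CS * (\<Sum>m | k < m \<and> m \<le> M \<and> odd (m + k). q m)"
    proof -
      let ?S = "\<Sum>m | k < m \<and> m \<le> M \<and> odd (m + k). q m"
      have S0: "0 \<le> ?S" by (intro sum_nonneg) (simp add: q_def energy_nonneg)
      have "16 * ((bump_const ?N)\<^sup>2 * E ^ 8) \<le> (\<epsilon> * real M) ^ 1" using K1(3) eM by simp
      also have "\<dots> \<le> (\<epsilon> * real M) ^ 4" using eM K1 by (intro power_increasing) auto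
      finally have "?A \<le> 4 * cap_moment TYPE('a) (1 - \<epsilon>\<^sup>2 / 2) 0 * ?S"
        unfolding q_def using energy_lower[OF \<theta> \<epsilon> sep1(1) sep1(2) k1 _ _ M1(2), of a] k2 by (simp add: E_def ek_def)
      also have "\<dots> \<le> 4 * (2 * 2 ^ DIM('a) * \<epsilon> powr D) * ?S"
        using S0 \<epsilon> by (intro mult_right_mono mult_left_mono cap) auto
      finally have "?A * real M powr D \<le> 4 * (2 * 2 ^ DIM('a) * \<epsilon> powr D) * ?S * real M powr D" by (intro mult_right_mono) auto
      also have "\<dots> = 8 * 2 ^ DIM('a) * (\<epsilon> * real M) powr D * ?S" using \<epsilon> by (simp add: powr_mult)
      also have "\<dots> \<le> 8 * 2 ^ DIM('a) * (K + 1) powr D * ?S"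
        using eM \<epsilon> N3 S0 by (intro mult_right_mono mult_left_mono powr_mono2) (auto simp: D_def)
      finally show ?thesis by (simp add: CS_def)
    qed
    have w: "\<forall>m. 0 \<le> w m" by (simp add: w_def)
    have q: "\<forall>m. 0 \<le> q m" by (simp add: q_def energy_nonneg)
    have ellb: "cL * (1 + real m) powr \<beta> \<le> ell m" "ell m \<le> CL * (1 + real m) powr \<beta>" for m
      using ell by (auto simp: elliptic_symbol_def)
    have pw: "(real m powr (- \<alpha>) * real m powr \<beta>)\<^sup>2 = real m powr (- \<alpha>2)" for m
      by (simp add: powr_add[symmetric] power2_eq_square \<alpha>2_def)
    have wu: "\<forall>m>M. w m \<le> C1 * real m powr (- \<alpha>2)"
    proof (intro allI impI)
      fix m assume m: "m > M"
      then have m1: "m \<ge> 1" "m \<ge> k" using M1 by auto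
      have "0 \<le> ell m" using ellb(1)[of m] cL by (smt (verit) mult_nonneg_nonneg powr_ge_zero)
      moreover have "ell m \<le> CL * (2 powr \<beta> * real m powr \<beta>)"
      proof -
        have "(1 + real m) powr \<beta> \<le> (2 * real m) powr \<beta>" using m1 \<beta> by (intro powr_mono2) auto
        then have "CL * (1 + real m) powr \<beta> \<le> CL * (2 powr \<beta> * real m powr \<beta>)"
          using CL by (intro mult_left_mono) (simp_all add: powr_mult)
        then show ?thesis using ellb(2)[of m] by linarith
      qed
      ultimately have "\<bar>ell m * ?lam m\<bar> \<le> CL * (2 powr \<beta> * real m powr \<beta>) * (Cu * real m powr (- \<alpha>))"
        using Cu(2)[OF m1(2,1)] CL unfolding abs_mult by (intro mult_mono) auto
      then have "\<bar>ell m * ?lam m\<bar>\<^sup>2 \<le> (CL * 2 powr \<beta> * Cu * (real m powr (- \<alpha>) * real m powr \<beta>))\<^sup>2"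
        by (intro power_mono) (auto simp: mult_ac)
      then show "w m \<le> C1 * real m powr (- \<alpha>2)" by (simp only: power2_abs w_def power_mult_distrib[of _ "real m powr (- \<alpha>) * real m powr \<beta>"] pw C1_def)
    qed
    have wl: "\<forall>m. k < m \<and> m \<le> M \<and> odd (m + k) \<longrightarrow> C2 * real m powr (- \<alpha>2) \<le> w m"
    proof (intro allI impI)
      fix m assume m: "k < m \<and> m \<le> M \<and> odd (m + k)"
      have "cL * real m powr \<beta> \<le> cL * (1 + real m) powr \<beta>" using cL \<beta> by (intro mult_left_mono powr_mono2) auto
      then have "cL * real m powr \<beta> \<le> \<bar>ell m\<bar>" using ellb(1)[of m] by linarith
      moreover have "Cl * real m powr (- \<alpha>) \<le> \<bar>?lam m\<bar>" using Cl(2) m by blast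
      ultimately have "(cL * real m powr \<beta>) * (Cl * real m powr (- \<alpha>)) \<le> \<bar>ell m * ?lam m\<bar>"
        unfolding abs_mult using cL Cl by (intro mult_mono) auto
      then have "(cL * Cl * (real m powr (- \<alpha>) * real m powr \<beta>))\<^sup>2 \<le> \<bar>ell m * ?lam m\<bar>\<^sup>2"
        using cL Cl by (intro power_mono) (auto simp: mult_ac)
      then show "C2 * real m powr (- \<alpha>2) \<le> w m" by (simp only: power2_abs w_def power_mult_distrib[of _ "real m powr (- \<alpha>) * real m powr \<beta>"] pw C2_def)
    qed
    have A0: "0 \<le> ?A" by (intro sum_nonneg) auto
    note concl = seq[OF q w A0 M1(1) up lo wu wl]
    have coef: "(\<Sum>l=1..N m. (sphere_inner v (Y m l))\<^sup>2) = w m * q m" for m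
      unfolding w_def q_def energy_def sum_distrib_left
      by (intro sum.cong refl) (use vf a in \<open>simp add: power_mult_distrib mult.assoc\<close>)
    have sobolev_term_eq: "sobolev_term Y N t v = (\<lambda>m. (1 + real m powr (2 * t)) * (w m * q m))" for t
      by (rule ext) (simp only: sobolev_term_def sum_distrib_left[symmetric] coef)
    have r0: "r > 0" using s sr by simp
    have wq: "0 \<le> w m * q m" for m using w q by simp
    show "v \<in> sobolev Y N r"
      using v r0 concl by (simp add: sobolev_def sobolev_term_eq)
    let ?g = "\<lambda>m. (1 + real m powr (2 * s)) * (w m * q m)"
    have g0: "0 \<le> ?g m" for m by (intro mult_nonneg_nonneg wq) auto
    have sm: "summable ?g"
    proof (rule summable_comparison_test[OF _ conjunct1[OF concl]], intro exI[of _ 0] allI impI)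
      fix m
      have "real m powr (2 * s) \<le> real m powr (2 * r)"
        by (cases "m = 0") (use sr in \<open>auto intro: powr_mono\<close>)
      then show "norm (?g m) \<le> (1 + real m powr (2 * r)) * (w m * q m)"
        using g0[of m] by (simp only: real_norm_def abs_of_nonneg) (intro mult_right_mono wq, simp)
    qed
    \<comment> \<open>The factor \<open>2\<close> is for \<open>s = 0\<close>: the weight is then \<open>2\<close>, except in degree \<open>0\<close>, whereas the norm is that
      of \<open>L\<^sup>2\<close>.\<close>
    have bound: "(\<Sum>m\<le>M. (1 + real m powr (2 * s)) * (w m * q m)) \<le> 2 * (sobolev_norm Y N s v)\<^sup>2"
    proof (cases "s = 0")
      case True
      have "(\<Sum>m\<le>M. (1 + real m powr (2 * s)) * (w m * q m)) \<le> (\<Sum>m\<le>M. 2 * (w m * q m))"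
        using True by (intro sum_mono mult_right_mono wq) auto
      also have "\<dots> = 2 * (\<Sum>m<Suc M. \<Sum>l=1..N m. (fourier_coeff v (m, l))\<^sup>2)"
        unfolding sum_distrib_left[symmetric] lessThan_Suc_atMost coef[symmetric]
        by (simp add: fourier_coeff_sphere_inner)
      also have "\<dots> \<le> 2 * (LINT x|sphere_measure. (v x)\<^sup>2)"
        using bessel[OF v, of "Suc M"] by (simp only: sum_degree_index)
      also have "\<dots> = 2 * (sobolev_norm Y N s v)\<^sup>2"
      proof -
        have "0 \<le> (LINT x|sphere_measure. (v x)\<^sup>2)" by (intro integral_nonneg_AE) auto
        then show ?thesis using True by (simp add: sobolev_norm_def L2_norm_def sphere_inner_def power2_eq_square)
      qed
      finally show ?thesis .
    next
      case False
      have "(\<Sum>m\<le>M. ?g m) \<le> (\<Sum>m. ?g m)" using g0 by (intro sum_le_suminf sm) auto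
      also have "\<dots> = (sobolev_norm Y N s v)\<^sup>2"
        using False suminf_nonneg[OF sm g0] by (simp add: sobolev_norm_def sobolev_term_eq)
      finally show ?thesis using zero_le_power2[of "sobolev_norm Y N s v"] by linarith
    qed
    have s0: "0 \<le> sobolev_norm Y N s v"
      using v sm by (intro sobolev_norm_nonneg) (simp add: sobolev_def sobolev_term_eq)
    have "sobolev_norm Y N r v = sqrt (\<Sum>m. (1 + real m powr (2 * r)) * (w m * q m))"
      using r0 by (simp add: sobolev_norm_def sobolev_term_eq)
    also have "\<dots> \<le> sqrt (C * real M powr (2 * (r - s)) * (2 * (sobolev_norm Y N s v)\<^sup>2))"
      using order_trans[OF conjunct2[OF concl] mult_left_mono[OF bound, of "C * real M powr (2 * (r - s))"]] C
      by (intro real_sqrt_le_mono) simp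
    also have "\<dots> = sqrt ((2 * C) * ((real M powr (r - s)) * sobolev_norm Y N s v)\<^sup>2)"
    proof -
      have "real M powr (2 * (r - s)) = (real M powr (r - s))\<^sup>2"
        unfolding power2_eq_square powr_add[symmetric] by simp
      then show ?thesis by (simp add: power_mult_distrib mult_ac)
    qed
    also have "\<dots> = sqrt (2 * C) * (real M powr (r - s) * sobolev_norm Y N s v)"
      using s0 by (simp add: real_sqrt_mult)
    also have "\<dots> \<le> sqrt (2 * C) * ((((K + 1) / c0) powr (r - s) * h powr (- (r - s))) * sobolev_norm Y N s v)"
    proof (intro mult_left_mono mult_right_mono s0)
      have "real M \<le> (K + 1) / \<epsilon>" using eM \<epsilon> by (simp add: field_simps)
      then have "real M powr (r - s) \<le> ((K + 1) / c0 / h) powr (r - s)"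
        using sr by (intro powr_mono2) (auto simp: \<epsilon>_def)
      also have "\<dots> = ((K + 1) / c0) powr (r - s) * h powr (- (r - s))"
        using powr_minus_divide[of h "r - s"] by (simp add: powr_divide powr_mult)
      finally show "real M powr (r - s) \<le> ((K + 1) / c0) powr (r - s) * h powr (- (r - s))" .
    qed (use C in auto)
    finally show "sobolev_norm Y N r v \<le> CC * antipodal_sep n \<theta> powr (- (r - s)) * sobolev_norm Y N s v"
      by (simp add: CC_def h_def mult.assoc)
  qed
qed

theorem theorem1:
  fixes d k :: nat and r s :: real
  assumes dim: "CARD('n::finite) = d + 1" and d: "d \<ge> 2"
    and s: "0 \<le> s" and sr: "s < r" and r: "r < real k + 1/2"
  shows
    "(\<exists>C>0. \<forall>Y N. harmonic_onb Y N \<longrightarrow>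
        (\<forall>n\<ge>2. \<forall>\<theta> :: nat \<Rightarrow> real^'n. \<theta> ` {1..n} \<subseteq> sphere 0 1 \<longrightarrow> antipodal_sep n \<theta> > 0 \<longrightarrow>
          (\<forall>f\<in>network k n \<theta>. f \<in> sobolev Y N r \<and>
             sobolev_norm Y N r f \<le> C * antipodal_sep n \<theta> powr (- (r - s)) * sobolev_norm Y N s f)))
     \<and>
     (\<forall>\<kappa>. \<exists>C'>0. \<forall>Y N. harmonic_onb Y N \<longrightarrow>
        (\<forall>\<Theta> :: nat \<Rightarrow> nat \<Rightarrow> real^'n. antipodally_quasi_uniform \<kappa> \<Theta> \<longrightarrow>
          (\<forall>n\<ge>2. \<forall>f\<in>network k n (\<Theta> n). f \<in> sobolev Y N r \<and>
             sobolev_norm Y N r f \<le> C' * real n powr ((r - s) / real d) * sobolev_norm Y N s f)))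
     \<and>
     (\<forall>\<beta> c\<^sub>L C\<^sub>L. 0 \<le> \<beta> \<longrightarrow> 0 < c\<^sub>L \<longrightarrow> c\<^sub>L \<le> C\<^sub>L \<longrightarrow> r < real k + 1/2 - \<beta> \<longrightarrow>
        (\<exists>C''>0. \<forall>Y N ell. harmonic_onb Y N \<longrightarrow> elliptic_symbol \<beta> c\<^sub>L C\<^sub>L ell \<longrightarrow>
          (\<forall>n\<ge>2. \<forall>\<theta> :: nat \<Rightarrow> real^'n. \<theta> ` {1..n} \<subseteq> sphere 0 1 \<longrightarrow> antipodal_sep n \<theta> > 0 \<longrightarrow>
            network k n \<theta> \<subseteq> sobolev Y N \<beta> \<and>
            (\<forall>v\<in>multiplier_image ell (network k n \<theta>). v \<in> sobolev Y N r \<and>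
               sobolev_norm Y N r v
                 \<le> C'' * antipodal_sep n \<theta> powr (- (r - s)) * sobolev_norm Y N s v))))"
proof -
  have dim3: "DIM(real^'n) \<ge> 3" and DN: "DIM(real^'n) = d + 1" using dim d by simp_all
  have r0: "0 < r" using s sr by simp
  have one: "elliptic_symbol 0 1 1 (\<lambda>m. 1)" by (simp add: elliptic_symbol_def)
  have network_L2: "f \<in> sphere_L2" if "f \<in> network k n \<theta>" for f n and \<theta> :: "nat \<Rightarrow> real^'n"
    using that by (simp add: network_def)
  have part1: "\<exists>C>0. \<forall>Y N. harmonic_onb Y N \<longrightarrow>
        (\<forall>n\<ge>2. \<forall>\<theta> :: nat \<Rightarrow> real^'n. \<theta> ` {1..n} \<subseteq> sphere 0 1 \<longrightarrow> antipodal_sep n \<theta> > 0 \<longrightarrow>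
          (\<forall>f\<in>network k n \<theta>. f \<in> sobolev Y N \<rho> \<and>
             sobolev_norm Y N \<rho> f \<le> C * antipodal_sep n \<theta> powr (- (\<rho> - \<sigma>)) * sobolev_norm Y N \<sigma> f))"
    if \<rho>: "0 \<le> \<sigma>" "\<sigma> < \<rho>" "\<rho> < real k + 1/2" for \<rho> \<sigma>
  proof -
    obtain C where C: "C > 0" and main: "\<And>(Y :: nat \<Rightarrow> nat \<Rightarrow> real^'n \<Rightarrow> real) N ell n \<theta> f v.
        harmonic_onb Y N \<Longrightarrow> elliptic_symbol 0 1 1 ell \<Longrightarrow> n \<ge> 2 \<Longrightarrow> \<theta> ` {1..n} \<subseteq> sphere 0 1 \<Longrightarrow> antipodal_sep n \<theta> > 0 \<Longrightarrow>
        f \<in> network k n \<theta> \<Longrightarrow> v \<in> sphere_L2 \<Longrightarrow>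
        (\<forall>m. \<forall>l\<in>{1..N m}. sphere_inner v (Y m l) = ell m * sphere_inner f (Y m l)) \<Longrightarrow>
        v \<in> sobolev Y N \<rho> \<and> sobolev_norm Y N \<rho> v \<le> C * antipodal_sep n \<theta> powr (- (\<rho> - \<sigma>)) * sobolev_norm Y N \<sigma> v"
      using inverse_inequality[OF dim3, of 0 1 1 \<sigma> \<rho> k] \<rho> by auto
    show ?thesis
      by (intro exI[of _ C] conjI[OF C] allI impI ballI main[OF _ one _ _ _ _ network_L2]) simp_all
  qed
  have part2: "\<exists>C'>0. \<forall>Y N. harmonic_onb Y N \<longrightarrow>
        (\<forall>\<Theta> :: nat \<Rightarrow> nat \<Rightarrow> real^'n. antipodally_quasi_uniform \<kappa> \<Theta> \<longrightarrow>
          (\<forall>n\<ge>2. \<forall>f\<in>network k n (\<Theta> n). f \<in> sobolev Y N r \<and>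
             sobolev_norm Y N r f \<le> C' * real n powr ((r - s) / real d) * sobolev_norm Y N s f))" for \<kappa>
  proof -
    obtain C where C: "C > 0" and main: "\<And>Y N n (\<theta> :: nat \<Rightarrow> real^'n) f. harmonic_onb Y N \<Longrightarrow> n \<ge> 2 \<Longrightarrow>
        \<theta> ` {1..n} \<subseteq> sphere 0 1 \<Longrightarrow> antipodal_sep n \<theta> > 0 \<Longrightarrow> f \<in> network k n \<theta> \<Longrightarrow>
        f \<in> sobolev Y N r \<and> sobolev_norm Y N r f \<le> C * antipodal_sep n \<theta> powr (- (r - s)) * sobolev_norm Y N s f"
      using part1[OF s sr r] by blast
    define c where "c = (4 * 2 ^ (d + 1)) powr (- 1 / real d)"
    \<comment> \<open>A positive bound for \<open>\<kappa>\<close>, by which one can divide.\<close>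
    define \<kappa>' where "\<kappa>' = max \<kappa> 1"
    have c: "c > 0" by (simp add: c_def)
    have \<kappa>': "\<kappa>' > 0" by (simp add: \<kappa>'_def)
    define C' where "C' = C * (c / \<kappa>') powr (- (r - s))"
    have C': "C' > 0" using C c \<kappa>' by (simp add: C'_def)
    show ?thesis
    proof (intro exI[of _ C'] conjI[OF C'] allI impI ballI)
      fix Y :: "nat \<Rightarrow> nat \<Rightarrow> real^'n \<Rightarrow> real" and N and \<Theta> :: "nat \<Rightarrow> nat \<Rightarrow> real^'n" and n f
      assume onb: "harmonic_onb Y N" and qu: "antipodally_quasi_uniform \<kappa> \<Theta>" and n: "n \<ge> 2" and f: "f \<in> network k n (\<Theta> n)"
      interpret spherical_basis Y N by unfold_locales (use onb dim3 in auto)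
      let ?h = "antipodal_sep n (\<Theta> n)"
      have \<Theta>: "\<Theta> n ` {1..n} \<subseteq> sphere 0 1" "mesh_norm n (\<Theta> n) \<le> \<kappa> * ?h"
        using qu n by (auto simp: antipodally_quasi_uniform_def)
      have "c * real n powr (- 1 / real d) \<le> mesh_norm n (\<Theta> n)"
        unfolding c_def DN[symmetric] using n d by (intro mesh_norm_lower \<Theta>) (simp_all add: dim)
      also have "\<dots> \<le> \<kappa>' * ?h"
        using \<Theta>(2) mult_right_mono[of \<kappa> \<kappa>' ?h] antipodal_sep_nonneg[OF n \<Theta>(1)] by (simp add: \<kappa>'_def)
      finally have lower: "c / \<kappa>' * real n powr (- 1 / real d) \<le> ?h" using \<kappa>' by (simp add: field_simps)
      have base: "0 < c / \<kappa>' * real n powr (- 1 / real d)" using c \<kappa>' n by simp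
      then have h: "?h > 0" using lower by linarith
      note m = main[OF onb n \<Theta>(1) h f]
      have s0: "0 \<le> sobolev_norm Y N s f"
      proof (rule sobolev_norm_nonneg)
        show "f \<in> sobolev Y N s"
        proof (cases "s = 0")
          case True
          then show ?thesis using network_L2[OF f] by (simp add: sobolev_def)
        next
          case False
          then have "0 < s" "s < real k + 1/2" using s sr r by auto
          from part1[OF order_refl this] show ?thesis using onb n \<Theta>(1) h f by blast
        qed
      qed
      have "?h powr (- (r - s)) \<le> (c / \<kappa>' * real n powr (- 1 / real d)) powr (- (r - s))"
        using lower base sr by (intro powr_mono2') auto
      also have "\<dots> = (c / \<kappa>') powr (- (r - s)) * real n powr ((r - s) / real d)"
      proof -
        have "(real n powr (- 1 / real d)) powr (- (r - s)) = real n powr ((r - s) / real d)"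
          unfolding powr_powr by (rule arg_cong[where f="\<lambda>t. real n powr t"]) (simp add: diff_divide_distrib)
        then show ?thesis by (simp only: powr_mult)
      qed
      finally have "C * ?h powr (- (r - s)) * sobolev_norm Y N s f
          \<le> C * ((c / \<kappa>') powr (- (r - s)) * real n powr ((r - s) / real d)) * sobolev_norm Y N s f"
        using C s0 by (intro mult_right_mono mult_left_mono) auto
      also have "\<dots> = C' * real n powr ((r - s) / real d) * sobolev_norm Y N s f"
        by (simp add: C'_def mult.assoc)
      finally show "f \<in> sobolev Y N r \<and> sobolev_norm Y N r f \<le> C' * real n powr ((r - s) / real d) * sobolev_norm Y N s f"
        using m order_trans by blast
    qed
  qed
  have part3: "\<exists>C''>0. \<forall>Y N ell. harmonic_onb Y N \<longrightarrow> elliptic_symbol \<beta> c\<^sub>L C\<^sub>L ell \<longrightarrow>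
          (\<forall>n\<ge>2. \<forall>\<theta> :: nat \<Rightarrow> real^'n. \<theta> ` {1..n} \<subseteq> sphere 0 1 \<longrightarrow> antipodal_sep n \<theta> > 0 \<longrightarrow>
            network k n \<theta> \<subseteq> sobolev Y N \<beta> \<and>
            (\<forall>v\<in>multiplier_image ell (network k n \<theta>). v \<in> sobolev Y N r \<and>
               sobolev_norm Y N r v
                 \<le> C'' * antipodal_sep n \<theta> powr (- (r - s)) * sobolev_norm Y N s v))"
    if \<beta>: "0 \<le> \<beta>" "0 < c\<^sub>L" "c\<^sub>L \<le> C\<^sub>L" "r < real k + 1/2 - \<beta>" for \<beta> c\<^sub>L C\<^sub>L
  proof -
    obtain C where C: "C > 0" and main: "\<And>(Y :: nat \<Rightarrow> nat \<Rightarrow> real^'n \<Rightarrow> real) N ell n \<theta> f v.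
        harmonic_onb Y N \<Longrightarrow> elliptic_symbol \<beta> c\<^sub>L C\<^sub>L ell \<Longrightarrow> n \<ge> 2 \<Longrightarrow> \<theta> ` {1..n} \<subseteq> sphere 0 1 \<Longrightarrow> antipodal_sep n \<theta> > 0 \<Longrightarrow>
        f \<in> network k n \<theta> \<Longrightarrow> v \<in> sphere_L2 \<Longrightarrow>
        (\<forall>m. \<forall>l\<in>{1..N m}. sphere_inner v (Y m l) = ell m * sphere_inner f (Y m l)) \<Longrightarrow>
        v \<in> sobolev Y N r \<and> sobolev_norm Y N r v \<le> C * antipodal_sep n \<theta> powr (- (r - s)) * sobolev_norm Y N s v"
      using inverse_inequality[OF dim3 \<beta>(1,2,3) s sr \<beta>(4)] by auto
    show ?thesis
    proof (intro exI[of _ C] conjI[OF C] allI impI conjI ballI)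
      fix Y :: "nat \<Rightarrow> nat \<Rightarrow> real^'n \<Rightarrow> real" and N ell n and \<theta> :: "nat \<Rightarrow> real^'n"
      assume onb: "harmonic_onb Y N" and ell: "elliptic_symbol \<beta> c\<^sub>L C\<^sub>L ell" and n: "n \<ge> 2"
        and \<theta>: "\<theta> ` {1..n} \<subseteq> sphere 0 1" and sep: "antipodal_sep n \<theta> > 0"
      interpret spherical_basis Y N by unfold_locales (use onb dim3 in auto)
      show "network k n \<theta> \<subseteq> sobolev Y N \<beta>"
      proof (cases "\<beta> = 0")
        case True
        then show ?thesis using network_L2 by (auto simp: sobolev_def)
      next
        case False
        then have "0 < \<beta>" "\<beta> < real k + 1/2" using \<beta> r0 by auto
        from part1[OF order_refl this] show ?thesis using onb n \<theta> sep by blast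
      qed
      fix v assume "v \<in> multiplier_image ell (network k n \<theta>)"
      then obtain g where g: "g \<in> network k n \<theta>" "is_multiplier_value ell g v" by (auto simp: multiplier_image_def)
      have v: "v \<in> sphere_L2" using g(2) by (simp add: is_multiplier_value_def)
      have "\<forall>m. \<forall>l\<in>{1..N m}. sphere_inner v (Y m l) = ell m * sphere_inner g (Y m l)"
        using multiplier_coefficient[OF network_L2[OF g(1)] g(2)] by (simp add: fourier_coeff_sphere_inner)
      from main[OF onb ell n \<theta> sep g(1) v this]
      show "v \<in> sobolev Y N r" "sobolev_norm Y N r v \<le> C * antipodal_sep n \<theta> powr (- (r - s)) * sobolev_norm Y N s v"
        by auto
    qed
  qed
  show ?thesis using part1[OF s sr r] part2 part3 by blast
qed

end
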